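(* Let $n\ge 2$, let $\Omega\subset\mathbb{R}^n$ be a bounded open Lipschitz domain, and let $T>0$, $\nu>0$ and $\alpha\in(1/2,1)$. For every $f\in L^2(0,T;V')$ and every $u_0\in H$ there exists a unique weak solution $u$ of the fractional unsteady Stokes problem $$cD_t^\alpha u-\nu\Delta u+\nabla p=f,\quad \operatorname{div}u=0 \ \text{ in }(0,T)\times\Omega,\qquad u=0\ \text{ on }[0,T]\times\partial\Omega,\qquad u(0,\cdot)=u_0\ \text{ in }\Omega,$$ where "weak solution" is as defined in the context.
   Context: Let $\mathcal{V}=\{v\in [C_c^\infty(\Omega)]^n:\operatorname{div}v=0\}$, let $H$ be the closure of $\mathcal{V}$ in $[L^2(\Omega)]^n$ with the inner product $(\cdot,\cdot)_H$ of $[L^2(\Omega)]^n$, and let $V$ be the closure of $\mathcal{V}$ in $[H_0^1(\Omega)]^n$ with the inner product $(u,v)_V=\int_\Omega\nabla u:\nabla v\,dx$. $V'$ is the dual of $V$, $\langle\cdot,\cdot\rangle_{V',V}$ is the duality pairing, and $V\hookrightarrow H\equiv H'\hookrightarrow V'$ by the usual identification of $H$ with its dual. For a Banach space $X$, $\beta>0$ and $v\in L^1(0,T;X)$, the Riemann-Liouville fractional integral is $J_t^\beta v(t)=\frac{1}{\Gamma(\beta)}\int_0^t(t-s)^{\beta-1}v(s)\,ds$ for a.e. $t\in[0,T]$. For $\alpha\in(0,1)$ and $v\in L^1(0,T;X)$ with $J_t^{1-\alpha}v\in W^{1,1}(0,T;X)$, the Riemann-Liouville derivative is $D_t^\alpha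 v(t)=\frac{d}{dt}[J_t^{1-\alpha}v(t)]$, and the Caputo derivative (for $v$ continuous) is $cD_t^\alpha v(t)=D_t^\alpha[v(t)-v(0)]$. For $\beta\in(0,1]$, $p\in[1,\infty)$, $L^p_\beta(0,T;X)$ is the space of (classes of) Bochner measurable $v:[0,T]\to X$ with $\int_0^T\frac{(T-s)^{\beta-1}}{\Gamma(\beta)}\|v(s)\|_X^p\,ds<\infty$. Weak solution: a function $u\in L^2_{1-\alpha}(0,T;H)\cap L^2(0,T;V)$ with $J_t^{1-\alpha}\|u(\cdot)-u_0\|_H^2\in L^\infty(0,T)$ such that, for all $\eta\in V$, $J_t^{1-\alpha}(u(\cdot)-u_0,\eta)_H\in W^{1,1}(0,T)$ and $$D_t^\alpha(u(t)-u_0,\eta)_H+\nu(u(t),\eta)_V=\langle f(t),\eta\rangle_{V',V}\quad\text{for a.e. }t\in[0,T],$$ and $u(0)=u_0$. The last condition is understood as: $u$ has a representative in $C([0,T];V')$ whose value at $0$ is $u_0$ (regarded as an element of $V'$). Uniqueness is up to equality for almost every $t$. *)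

theory Defs
  imports "HOL-Analysis.Analysis"
begin

text \<open>
  Elements of the function spaces over a set \<open>\<Omega>\<close> are represented by functions on the whole
  Euclidean space; only their values on \<open>\<Omega>\<close> matter, and equality in these spaces is equality
  almost everywhere on \<open>\<Omega>\<close>. A normed space is rendered by a carrier \<open>X\<close> together with a
  (semi)norm \<open>N\<close> on it.
\<close>

subsection \<open>Test functions\<close>

primrec Ck :: "nat \<Rightarrow> ('a::euclidean_space \<Rightarrow> 'b::real_normed_vector) \<Rightarrow> bool" where
  "Ck 0 f \<longleftrightarrow> continuous_on UNIV f"
| "Ck (Suc k) f \<longleftrightarrow> (\<forall>x. f differentiable (at x)) \<and>
     (\<forall>b\<in>Basis. Ck k (\<lambda>x. frechet_derivative f (at x) b))"

definition test_functions :: "'a::euclidean_space set \<Rightarrow> ('a \<Rightarrow> 'b::real_normed_vector) set" where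
  "test_functions \<Omega> = {\<phi>. (\<forall>k. Ck k \<phi>) \<and> compact (closure {x. \<phi> x \<noteq> 0})
     \<and> closure {x. \<phi> x \<noteq> 0} \<subseteq> \<Omega>}"

definition partial :: "'n \<Rightarrow> (real^'n::finite \<Rightarrow> 'b::real_normed_vector) \<Rightarrow> real^'n \<Rightarrow> 'b" where
  "partial j f x = frechet_derivative f (at x) (axis j 1)"

definition divergence :: "(real^'n \<Rightarrow> real^'n) \<Rightarrow> real^'n::finite \<Rightarrow> real" where
  "divergence v x = (\<Sum>j\<in>UNIV. partial j v x $ j)"

definition solenoidal_test :: "(real^'n::finite) set \<Rightarrow> (real^'n \<Rightarrow> real^'n) set" where
  "solenoidal_test \<Omega> = {v \<in> test_functions \<Omega>. \<forall>x. divergence v x = 0}"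

subsection \<open>Lipschitz domains\<close>

text \<open>
  Near each boundary point, \<open>\<Omega>\<close> is the strict epigraph of a Lipschitz function after a change of
  orthonormal coordinates. The unit vector \<open>e\<close> is the last coordinate axis, the hyperplane
  orthogonal to \<open>e\<close> carries the remaining coordinates.
\<close>

definition lipschitz_boundary :: "'a::euclidean_space set \<Rightarrow> bool" where
  "lipschitz_boundary \<Omega> \<longleftrightarrow> (\<forall>x\<in>frontier \<Omega>. \<exists>r>0. \<exists>e \<gamma> L. norm e = 1 \<and>
     L-lipschitz_on {z. z \<bullet> e = 0} \<gamma> \<and>
     \<Omega> \<inter> ball x r = {y \<in> ball x r. y \<bullet> e > \<gamma> (y - (y \<bullet> e) *\<^sub>R e)})"

definition bounded_lipschitz_domain :: "'a::euclidean_space set \<Rightarrow> bool" where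
  "bounded_lipschitz_domain \<Omega> \<longleftrightarrow>
     open \<Omega> \<and> connected \<Omega> \<and> \<Omega> \<noteq> {} \<and> bounded \<Omega> \<and> lipschitz_boundary \<Omega>"

subsection \<open>Lebesgue and Sobolev spaces on \<open>\<Omega>\<close>\<close>

definition L2_space :: "'a::euclidean_space set \<Rightarrow> ('a \<Rightarrow> 'b::euclidean_space) set" where
  "L2_space \<Omega> = {v. v \<in> borel_measurable (lebesgue_on \<Omega>) \<and>
     integrable (lebesgue_on \<Omega>) (\<lambda>x. (norm (v x))\<^sup>2)}"

definition inner_L2 ::
  "'a::euclidean_space set \<Rightarrow> ('a \<Rightarrow> 'b::euclidean_space) \<Rightarrow> ('a \<Rightarrow> 'b) \<Rightarrow> real" where
  "inner_L2 \<Omega> u v = (LINT x|lebesgue_on \<Omega>. u x \<bullet> v x)"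

definition norm_L2 :: "'a::euclidean_space set \<Rightarrow> ('a \<Rightarrow> 'b::euclidean_space) \<Rightarrow> real" where
  "norm_L2 \<Omega> u = sqrt (inner_L2 \<Omega> u u)"

text \<open>The entry \<open>G x $ i $ j\<close> is the weak partial derivative of \<open>u\<^sub>i\<close> in direction \<open>j\<close>.\<close>

definition is_weak_gradient ::
  "(real^'n::finite) set \<Rightarrow> (real^'n \<Rightarrow> real^'n) \<Rightarrow> (real^'n \<Rightarrow> real^'n^'n) \<Rightarrow> bool" where
  "is_weak_gradient \<Omega> u G \<longleftrightarrow> (\<forall>\<phi>\<in>test_functions \<Omega>. \<forall>i j.
     (LINT x|lebesgue_on \<Omega>. u x $ i * partial j \<phi> x) = - (LINT x|lebesgue_on \<Omega>. G x $ i $ j * \<phi> x))"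

definition H1_space :: "(real^'n::finite) set \<Rightarrow> (real^'n \<Rightarrow> real^'n) set" where
  "H1_space \<Omega> = {u \<in> L2_space \<Omega>. \<exists>G\<in>L2_space \<Omega>. is_weak_gradient \<Omega> u G}"

text \<open>The weak gradient is unique up to a null set; some representative is chosen.\<close>

definition weak_grad ::
  "(real^'n::finite) set \<Rightarrow> (real^'n \<Rightarrow> real^'n) \<Rightarrow> real^'n \<Rightarrow> real^'n^'n" where
  "weak_grad \<Omega> u = (SOME G. G \<in> L2_space \<Omega> \<and> is_weak_gradient \<Omega> u G)"

definition norm_H1 :: "(real^'n::finite) set \<Rightarrow> (real^'n \<Rightarrow> real^'n) \<Rightarrow> real" where
  "norm_H1 \<Omega> u = sqrt ((norm_L2 \<Omega> u)\<^sup>2 + (norm_L2 \<Omega> (weak_grad \<Omega> u))\<^sup>2)"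

definition closure_in :: "'v set \<Rightarrow> ('v::minus \<Rightarrow> real) \<Rightarrow> 'v set \<Rightarrow> 'v set" where
  "closure_in X N S = {u \<in> X. \<forall>\<epsilon>>0. \<exists>\<phi>\<in>S. N (u - \<phi>) < \<epsilon>}"

definition H01_space :: "(real^'n::finite) set \<Rightarrow> (real^'n \<Rightarrow> real^'n) set" where
  "H01_space \<Omega> = closure_in (H1_space \<Omega>) (norm_H1 \<Omega>) (test_functions \<Omega>)"

definition H_space :: "(real^'n::finite) set \<Rightarrow> (real^'n \<Rightarrow> real^'n) set" where
  "H_space \<Omega> = closure_in (L2_space \<Omega>) (norm_L2 \<Omega>) (solenoidal_test \<Omega>)"

definition V_space :: "(real^'n::finite) set \<Rightarrow> (real^'n \<Rightarrow> real^'n) set" where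
  "V_space \<Omega> = closure_in (H01_space \<Omega>) (norm_H1 \<Omega>) (solenoidal_test \<Omega>)"

text \<open>The inner product of \<^typ>\<open>real^'n^'n\<close> is the Frobenius product of matrices.\<close>

definition inner_V ::
  "(real^'n::finite) set \<Rightarrow> (real^'n \<Rightarrow> real^'n) \<Rightarrow> (real^'n \<Rightarrow> real^'n) \<Rightarrow> real" where
  "inner_V \<Omega> u v = inner_L2 \<Omega> (weak_grad \<Omega> u) (weak_grad \<Omega> v)"

definition norm_V :: "(real^'n::finite) set \<Rightarrow> (real^'n \<Rightarrow> real^'n) \<Rightarrow> real" where
  "norm_V \<Omega> u = sqrt (inner_V \<Omega> u u)"

text \<open>
  Bounded linear functionals on \<open>V\<close>. Their values outside of \<open>V\<close> are irrelevant. The pairing of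
  \<open>F\<close> with \<open>\<eta>\<close> is the application \<open>F \<eta>\<close>.
\<close>

definition V_dual :: "(real^'n::finite) set \<Rightarrow> ((real^'n \<Rightarrow> real^'n) \<Rightarrow> real) set" where
  "V_dual \<Omega> = {F.
     (\<forall>u\<in>V_space \<Omega>. \<forall>v\<in>V_space \<Omega>. \<forall>a b. F (\<lambda>x. a *\<^sub>R u x + b *\<^sub>R v x) = a * F u + b * F v) \<and>
     (\<exists>C. \<forall>v\<in>V_space \<Omega>. \<bar>F v\<bar> \<le> C * norm_V \<Omega> v)}"

definition norm_V_dual :: "(real^'n::finite) set \<Rightarrow> ((real^'n \<Rightarrow> real^'n) \<Rightarrow> real) \<Rightarrow> real" where
  "norm_V_dual \<Omega> F = Sup {\<bar>F v\<bar> | v. v \<in> V_space \<Omega> \<and> norm_V \<Omega> v \<le> 1}"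

subsection \<open>Bochner spaces on \<open>(0,T)\<close>\<close>

text \<open>
  Strong measurability: almost everywhere limit of simple functions with values in \<open>X\<close>. The value
  \<open>v t\<close> is required to lie in \<open>X\<close> only for almost every \<open>t\<close>.
\<close>

definition bochner_measurable ::
  "'v::minus set \<Rightarrow> ('v \<Rightarrow> real) \<Rightarrow> real \<Rightarrow> (real \<Rightarrow> 'v) \<Rightarrow> bool" where
  "bochner_measurable X N T v \<longleftrightarrow>
     (AE t in lebesgue_on {0..T}. v t \<in> X) \<and>
     (\<exists>s :: nat \<Rightarrow> real \<Rightarrow> 'v.
        (\<forall>k. simple_function (lebesgue_on {0..T}) (s k) \<and> s k ` {0..T} \<subseteq> X) \<and>
        (AE t in lebesgue_on {0..T}. (\<lambda>k. N (v t - s k t)) \<longlonglongrightarrow> 0))"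

definition Lp_bochner ::
  "real \<Rightarrow> 'v::minus set \<Rightarrow> ('v \<Rightarrow> real) \<Rightarrow> real \<Rightarrow> (real \<Rightarrow> 'v) set" where
  "Lp_bochner p X N T = {v. bochner_measurable X N T v \<and>
     (\<integral>\<^sup>+ s. ennreal (N (v s) powr p) \<partial>lebesgue_on {0..T}) < \<infinity>}"

definition Lp_bochner_weighted ::
  "real \<Rightarrow> real \<Rightarrow> 'v::minus set \<Rightarrow> ('v \<Rightarrow> real) \<Rightarrow> real \<Rightarrow> (real \<Rightarrow> 'v) set" where
  "Lp_bochner_weighted p \<beta> X N T = {v. bochner_measurable X N T v \<and>
     (\<integral>\<^sup>+ s. ennreal ((T - s) powr (\<beta> - 1) / Gamma \<beta> * N (v s) powr p) \<partial>lebesgue_on {0..T}) < \<infinity>}"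

definition Linfty :: "real \<Rightarrow> (real \<Rightarrow> real) set" where
  "Linfty T = {g. g \<in> borel_measurable (lebesgue_on {0..T}) \<and>
     (\<exists>C. AE t in lebesgue_on {0..T}. \<bar>g t\<bar> \<le> C)}"

definition is_weak_deriv :: "real \<Rightarrow> (real \<Rightarrow> real) \<Rightarrow> (real \<Rightarrow> real) \<Rightarrow> bool" where
  "is_weak_deriv T v g \<longleftrightarrow> (\<forall>\<phi>\<in>test_functions {0<..<T}.
     (LINT t|lebesgue_on {0..T}. v t * deriv \<phi> t) = - (LINT t|lebesgue_on {0..T}. g t * \<phi> t))"

definition W11 :: "real \<Rightarrow> (real \<Rightarrow> real) set" where
  "W11 T = {v. integrable (lebesgue_on {0..T}) v \<and>
     (\<exists>g. integrable (lebesgue_on {0..T}) g \<and> is_weak_deriv T v g)}"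

text \<open>The weak derivative is unique up to a null set; some representative is chosen.\<close>

definition weak_deriv :: "real \<Rightarrow> (real \<Rightarrow> real) \<Rightarrow> real \<Rightarrow> real" where
  "weak_deriv T v = (SOME g. integrable (lebesgue_on {0..T}) g \<and> is_weak_deriv T v g)"

definition is_continuous_rep ::
  "('v::minus \<Rightarrow> real) \<Rightarrow> real \<Rightarrow> (real \<Rightarrow> 'v) \<Rightarrow> bool" where
  "is_continuous_rep N T w \<longleftrightarrow>
     (\<forall>t\<in>{0..T}. ((\<lambda>s. N (w s - w t)) \<longlongrightarrow> 0) (at t within {0..T}))"

subsection \<open>Fractional integral and derivative\<close>

text \<open>
  For integrable \<open>v\<close> the integral exists for almost every \<open>t\<close>; on the exceptional null set the
  Bochner integral of the library has the value \<open>0\<close>. Only scalar functions are needed.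
\<close>

definition RL_integral :: "real \<Rightarrow> (real \<Rightarrow> real) \<Rightarrow> real \<Rightarrow> real" where
  "RL_integral \<beta> v t =
     (1 / Gamma \<beta>) * (LINT s|lebesgue_on {0..t}. (t - s) powr (\<beta> - 1) * v s)"

definition RL_deriv :: "real \<Rightarrow> real \<Rightarrow> (real \<Rightarrow> real) \<Rightarrow> real \<Rightarrow> real" where
  "RL_deriv T \<alpha> v = weak_deriv T (RL_integral (1 - \<alpha>) v)"

subsection \<open>Weak solutions of the fractional Stokes problem\<close>

definition attains_initial_value ::
  "(real^'n::finite) set \<Rightarrow> real \<Rightarrow> (real \<Rightarrow> real^'n \<Rightarrow> real^'n) \<Rightarrow> (real^'n \<Rightarrow> real^'n) \<Rightarrow> bool" where
  "attains_initial_value \<Omega> T u u0 \<longleftrightarrow> (\<exists>w.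
     (\<forall>t\<in>{0..T}. w t \<in> V_dual \<Omega>) \<and>
     is_continuous_rep (norm_V_dual \<Omega>) T w \<and>
     (AE t in lebesgue_on {0..T}. \<forall>\<eta>\<in>V_space \<Omega>. w t \<eta> = inner_L2 \<Omega> (u t) \<eta>) \<and>
     (\<forall>\<eta>\<in>V_space \<Omega>. w 0 \<eta> = inner_L2 \<Omega> u0 \<eta>))"

definition weak_solution ::
  "(real^'n::finite) set \<Rightarrow> real \<Rightarrow> real \<Rightarrow> real \<Rightarrow> (real \<Rightarrow> (real^'n \<Rightarrow> real^'n) \<Rightarrow> real) \<Rightarrow>
   (real^'n \<Rightarrow> real^'n) \<Rightarrow> (real \<Rightarrow> real^'n \<Rightarrow> real^'n) \<Rightarrow> bool" where
  "weak_solution \<Omega> T \<nu> \<alpha> f u0 u \<longleftrightarrow>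
     u \<in> Lp_bochner_weighted 2 (1 - \<alpha>) (H_space \<Omega>) (norm_L2 \<Omega>) T \<and>
     u \<in> Lp_bochner 2 (V_space \<Omega>) (norm_V \<Omega>) T \<and>
     RL_integral (1 - \<alpha>) (\<lambda>t. (norm_L2 \<Omega> (u t - u0))\<^sup>2) \<in> Linfty T \<and>
     (\<forall>\<eta>\<in>V_space \<Omega>.
        RL_integral (1 - \<alpha>) (\<lambda>t. inner_L2 \<Omega> (u t - u0) \<eta>) \<in> W11 T \<and>
        (AE t in lebesgue_on {0..T}.
           RL_deriv T \<alpha> (\<lambda>t. inner_L2 \<Omega> (u t - u0) \<eta>) t + \<nu> * inner_V \<Omega> (u t) \<eta> = f t \<eta>)) \<and>
     attains_initial_value \<Omega> T u u0"

end

theory Submission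
  imports Defs "HOL-Library.Diagonal_Subsequence" "HOL-Library.Function_Algebras"
begin

text \<open>
  The idea is spectral. The embedding of \<open>V\<close> into \<open>H\<close> is compact, so there are functions \<open>e\<^sub>k \<in> V\<close>,
  orthonormal in \<open>H\<close>, with \<open>(e\<^sub>k, \<eta>)\<^sub>V = \<lambda>\<^sub>k (e\<^sub>k, \<eta>)\<^sub>H\<close>, in which elements of \<open>H\<close> and of \<open>V\<close> can be expanded.
  The \<open>k\<close>-th coefficient of a weak solution solves the scalar equation
  \<open>c = c(0) + J\<^sup>\<alpha> (f\<^sub>k - \<mu> c)\<close> with \<open>\<mu> = \<nu> \<lambda>\<^sub>k\<close>. Its solution is written with the resolvent \<open>r\<close> of
  \<open>\<kappa> = t\<^sup>\<alpha>\<^sup>-\<^sup>1 / \<Gamma>(\<alpha>)\<close>, that is \<open>r + \<mu> \<kappa> * r = \<kappa>\<close>, which is nonnegative because \<open>\<kappa>\<close> is logarithmically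
  convex. Nonnegativity gives bounds in terms of \<open>c(0)\<^sup>2\<close> and \<open>\<integral> f\<^sub>k\<^sup>2 / \<lambda>\<^sub>k\<close> that can be summed over \<open>k\<close>,
  and \<open>\<alpha> > 1/2\<close> makes \<open>\<kappa>\<close> square integrable, whence the continuity in \<open>V'\<close>. Uniqueness is
  uniqueness for each coefficient.
\<close>

section \<open>Semi-inner product spaces\<close>

text \<open>What decides whether the series is a weak solution is how the scalar bounds depend on
  the eigenvalue. Nonnegativity of \<open>r\<close> gives it an integral of at most 1/\<mu>.
  Cauchy-Schwarz with weight \<open>r\<close> then bounds the squared L2 norm of r * F by that of F
  divided by \<mu>^2, and the response to the initial value, which has values in [0,1], has an
  integral of order 1/\<mu>. With \<mu> = \<nu> lambda_k this makes the squared coefficients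
  summable after multiplication by lambda_k (solution in L2 with values in V), and the squared
  fractional derivatives summable after division by lambda_k (derivative in L2 with values in V').
  No compactness in time enters. In the uniqueness part the tested equation determines
  J^{1-\<alpha>} z + \<mu> J^1 z only up to an additive constant; the initial condition in V' is
  what forces this constant to vanish. Functions stand for classes modulo null sets. The Hilbert
  space arguments are therefore made for seminorms on carrier sets, and limits are determined only
  up to vectors of norm zero.\<close>

locale semi_inner =
  fixes V :: "'v::real_vector set" and a :: "'v \<Rightarrow> 'v \<Rightarrow> real"
  assumes sub: "subspace V"
    and add_left: "\<lbrakk>u \<in> V; v \<in> V; w \<in> V\<rbrakk> \<Longrightarrow> a (u + v) w = a u w + a v w"
    and scale_left: "\<lbrakk>u \<in> V; w \<in> V\<rbrakk> \<Longrightarrow> a (c *\<^sub>R u) w = c * a u w"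
    and sym: "\<lbrakk>u \<in> V; v \<in> V\<rbrakk> \<Longrightarrow> a u v = a v u"
    and nonneg: "u \<in> V \<Longrightarrow> a u u \<ge> 0"
begin

lemmas mem_add = subspace_add[OF sub] and mem_diff = subspace_diff[OF sub]
  and mem_scale = subspace_mul[OF sub] and mem_zero = subspace_0[OF sub]
  and mem_sum = subspace_sum[OF sub]

definition nrm :: "'v \<Rightarrow> real" where "nrm u = sqrt (a u u)"

lemma add_right: "\<lbrakk>u \<in> V; v \<in> V; w \<in> V\<rbrakk> \<Longrightarrow> a u (v + w) = a u v + a u w" by (metis add_left mem_add sym)

lemma scale_right: "\<lbrakk>u \<in> V; w \<in> V\<rbrakk> \<Longrightarrow> a u (c *\<^sub>R w) = c * a u w" by (metis scale_left mem_scale sym)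

lemma zero_left [simp]: "w \<in> V \<Longrightarrow> a 0 w = 0" using scale_left[of 0 w 0] mem_zero by simp

lemma zero_right [simp]: "w \<in> V \<Longrightarrow> a w 0 = 0" using scale_right[of w 0 0] mem_zero by simp

lemma diff_left: "\<lbrakk>u \<in> V; v \<in> V; w \<in> V\<rbrakk> \<Longrightarrow> a (u - v) w = a u w - a v w"
  using add_left[of "u - v" v w] mem_diff by simp

lemma diff_right: "\<lbrakk>u \<in> V; v \<in> V; w \<in> V\<rbrakk> \<Longrightarrow> a u (v - w) = a u v - a u w" by (metis diff_left mem_diff sym)

lemma sum_left: "\<lbrakk>\<And>i. i \<in> I \<Longrightarrow> f i \<in> V; w \<in> V\<rbrakk> \<Longrightarrow> a (sum f I) w = (\<Sum>i\<in>I. a (f i) w)"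
  by (induction I rule: infinite_finite_induct) (auto simp: add_left mem_sum)

lemma sum_right: "\<lbrakk>\<And>i. i \<in> I \<Longrightarrow> f i \<in> V; w \<in> V\<rbrakk> \<Longrightarrow> a w (sum f I) = (\<Sum>i\<in>I. a w (f i))"
  by (induction I rule: infinite_finite_induct) (auto simp: add_right mem_sum)

lemma sq_diff: "\<lbrakk>u \<in> V; v \<in> V\<rbrakk> \<Longrightarrow> a (u - v) (u - v) = a u u - 2 * a u v + a v v"
  using sym[of u v] by (simp add: diff_left diff_right mem_diff)

lemma sq_add: "\<lbrakk>u \<in> V; v \<in> V\<rbrakk> \<Longrightarrow> a (u + v) (u + v) = a u u + 2 * a u v + a v v"
  using sym[of u v] by (simp add: add_left add_right mem_add)

text \<open>Only semidefiniteness is available, so a vanishing \<open>a v v\<close> needs its own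
  argument: an affine function of \<open>t\<close> that stays nonnegative has slope zero. Otherwise
  the quadratic is evaluated at its minimum.\<close>

lemma cauchy_schwarz_sq:
  assumes "u \<in> V" "v \<in> V" shows "(a u v)\<^sup>2 \<le> a u u * a v v"
proof -
  have q: "0 \<le> a u u - 2 * t * a u v + t\<^sup>2 * a v v" for t
    using nonneg[of "u - t *\<^sub>R v"] assms sq_diff[of u "t *\<^sub>R v"]
    by (simp add: mem_diff mem_scale scale_left scale_right power2_eq_square mult.assoc)
  show ?thesis
  proof (cases "a v v = 0")
    case True
    have "a u v = 0"
    proof (rule ccontr)
      assume "a u v \<noteq> 0"
      \<comment> \<open>At this value of \<open>t\<close> the affine lower bound equals -1.\<close>
      with q[of "(a u u + 1) / (2 * a u v)"] True show False by simp
    qed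
    then show ?thesis using nonneg assms by simp
  next
    case False
    then have pos: "a v v > 0" using nonneg[OF assms(2)] by simp
    have "0 \<le> a u u - (a u v)\<^sup>2 / a v v"
      using q[of "a u v / a v v"] pos by (simp add: power2_eq_square field_simps)
    then show ?thesis using pos by (simp add: field_simps)
  qed
qed

lemma nrm_nonneg [simp]: "u \<in> V \<Longrightarrow> 0 \<le> nrm u" by (simp add: nrm_def nonneg)

lemma nrm_sq: "u \<in> V \<Longrightarrow> (nrm u)\<^sup>2 = a u u" by (simp add: nrm_def nonneg)

lemma cauchy_schwarz: "\<lbrakk>u \<in> V; v \<in> V\<rbrakk> \<Longrightarrow> \<bar>a u v\<bar> \<le> nrm u * nrm v"
  using real_sqrt_le_mono[OF cauchy_schwarz_sq[of u v]] by (simp add: nrm_def real_sqrt_mult)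

lemma nrm_triangle:
  assumes "u \<in> V" "v \<in> V" shows "nrm (u + v) \<le> nrm u + nrm v"
proof (rule power2_le_imp_le)
  show "(nrm (u + v))\<^sup>2 \<le> (nrm u + nrm v)\<^sup>2"
    using cauchy_schwarz[OF assms] assms by (simp add: nrm_sq mem_add sq_add power2_sum)
qed (use assms in simp)

lemma nrm_scale: "u \<in> V \<Longrightarrow> nrm (c *\<^sub>R u) = \<bar>c\<bar> * nrm u"
  by (simp add: nrm_def scale_left scale_right mem_scale real_sqrt_mult
      flip: mult.assoc power2_eq_square)

lemma nrm_minus_commute: "\<lbrakk>u \<in> V; v \<in> V\<rbrakk> \<Longrightarrow> nrm (u - v) = nrm (v - u)"
  using nrm_scale[of "u - v" "-1"] by (simp add: mem_diff)

lemma nrm_triangle_diff: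
  assumes "u \<in> V" "v \<in> V" "w \<in> V" shows "nrm (u - w) \<le> nrm (u - v) + nrm (v - w)"
  using nrm_triangle[of "u - v" "v - w"] assms by (simp add: mem_diff)

lemma nrm_diff_abs:
  assumes "u \<in> V" "v \<in> V" shows "\<bar>nrm u - nrm v\<bar> \<le> nrm (u - v)"
  using nrm_triangle[of "u - v" v] nrm_triangle[of "v - u" u] nrm_minus_commute[OF assms] assms
  by (simp add: mem_diff)

lemma nrm_sum_le:
  "\<lbrakk>\<And>i. i \<in> I \<Longrightarrow> f i \<in> V\<rbrakk> \<Longrightarrow> nrm (sum f I) \<le> (\<Sum>i\<in>I. nrm (f i))"
proof (induction I rule: infinite_finite_induct)
  case (insert x F)
  then have "nrm (f x + sum f F) \<le> nrm (f x) + nrm (sum f F)" by (intro nrm_triangle mem_sum) auto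
  then show ?case using insert by simp
qed (simp_all add: nrm_def mem_zero)

lemma tendsto_inner:
  assumes "(\<lambda>n. nrm (X n - u)) \<longlonglongrightarrow> 0" "\<And>n. X n \<in> V" "u \<in> V" "v \<in> V"
  shows "(\<lambda>n. a (X n) v) \<longlonglongrightarrow> a u v"
proof -
  have "(\<lambda>n. a (X n) v - a u v) \<longlonglongrightarrow> 0"
  proof (rule Lim_null_comparison)
    show "\<forall>\<^sub>F n in sequentially. norm (a (X n) v - a u v) \<le> nrm (X n - u) * nrm v"
      using cauchy_schwarz[of "X _ - u" v] assms by (simp add: diff_left mem_diff)
    show "(\<lambda>n. nrm (X n - u) * nrm v) \<longlonglongrightarrow> 0" using tendsto_mult_left_zero[OF assms(1)] by simp
  qed
  then show ?thesis by (simp add: LIM_zero_iff)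
qed

lemma tendsto_nrm:
  assumes "(\<lambda>n. nrm (X n - u)) \<longlonglongrightarrow> 0" "\<And>n. X n \<in> V" "u \<in> V"
  shows "(\<lambda>n. nrm (X n)) \<longlonglongrightarrow> nrm u"
proof -
  have "(\<lambda>n. nrm (X n) - nrm u) \<longlonglongrightarrow> 0"
    by (rule Lim_null_comparison[OF _ assms(1)]) (use nrm_diff_abs assms in auto)
  then show ?thesis by (simp add: LIM_zero_iff)
qed

definition Cauchy_seq :: "(nat \<Rightarrow> 'v) \<Rightarrow> bool" where
  "Cauchy_seq X \<longleftrightarrow> (\<forall>eps>0. \<exists>N. \<forall>m\<ge>N. \<forall>n\<ge>N. nrm (X m - X n) < eps)"

text \<open>Completeness for a seminorm: the limit lies in the carrier but is unique only up to
  vectors of norm zero.\<close>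

definition complete :: bool where
  "complete \<longleftrightarrow> (\<forall>X. (\<forall>n. X n \<in> V) \<longrightarrow> Cauchy_seq X \<longrightarrow> (\<exists>u\<in>V. (\<lambda>n. nrm (X n - u)) \<longlonglongrightarrow> 0))"

end

section \<open>Orthonormal systems\<close>

text \<open>Zero vectors are admitted in an orthonormal system, so that finite-dimensional spaces also
  have systems indexed by the natural numbers.\<close>

locale orthonormal = semi_inner +
  fixes e :: "nat \<Rightarrow> 'a"
  assumes mem: "e n \<in> V"
    and orth: "m \<noteq> n \<Longrightarrow> a (e m) (e n) = 0"
    and unit: "a (e n) (e n) = 1 \<or> e n = 0"
begin

definition psum :: "nat \<Rightarrow> 'a \<Rightarrow> 'a" where
  "psum n u = (\<Sum>k<n. a u (e k) *\<^sub>R e k)"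

lemma psum_mem: "psum n u \<in> V" unfolding psum_def by (intro mem_sum mem_scale mem)

lemma inner_combination:
  assumes "finite I"
  shows "a (\<Sum>k\<in>I. c k *\<^sub>R e k) (e j) = (if j \<in> I then c j * a (e j) (e j) else 0)"
proof -
  have "a (\<Sum>k\<in>I. c k *\<^sub>R e k) (e j) = (\<Sum>k\<in>I. c k * a (e k) (e j))"
    by (simp add: sum_left mem mem_scale scale_left)
  also have "... = (\<Sum>k\<in>I. if k = j then c j * a (e j) (e j) else 0)" by (intro sum.cong) (auto simp: orth)
  finally show ?thesis using assms by simp
qed

text \<open>The factor \<open>a (e j) (e j)\<close> is 1 unless \<open>e j\<close> is zero, and then
  the coefficient is zero as well. This is how zero members of the system are absorbed
  throughout.\<close>

lemma coeff_unit: "u \<in> V \<Longrightarrow> a u (e j) * a (e j) (e j) = a u (e j)" using unit[of j] by auto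

lemma combination_sq_le:
  assumes "finite I"
  shows "a (\<Sum>k\<in>I. c k *\<^sub>R e k) (\<Sum>k\<in>I. c k *\<^sub>R e k) \<le> (\<Sum>k\<in>I. (c k)\<^sup>2)"
proof -
  have "a (\<Sum>k\<in>I. c k *\<^sub>R e k) (\<Sum>k\<in>I. c k *\<^sub>R e k) = (\<Sum>j\<in>I. c j * (c j * a (e j) (e j)))"
    by (subst sum_right) (auto simp: mem mem_scale mem_sum scale_right inner_combination assms)
  also have "... \<le> (\<Sum>k\<in>I. (c k)\<^sup>2)"
  proof (intro sum_mono)
    fix j
    show "c j * (c j * a (e j) (e j)) \<le> (c j)\<^sup>2" using unit[of j] mem_zero by (auto simp: power2_eq_square)
  qed
  finally show ?thesis .
qed

lemma residual_orth:
  assumes "u \<in> V" "k < n" shows "a (u - psum n u) (e k) = 0"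
  using assms inner_combination[of "{..<n}" "\<lambda>k. a u (e k)" k]
  by (simp add: diff_left psum_mem mem coeff_unit flip: psum_def)

lemma inner_psum: "u \<in> V \<Longrightarrow> v \<in> V \<Longrightarrow> a (psum n u) v = (\<Sum>k<n. a u (e k) * a v (e k))"
  using sym[OF mem, of v] unfolding psum_def by (simp add: sum_left mem mem_scale scale_left)

lemma residual_sq:
  assumes "u \<in> V"
  shows "a (u - psum n u) (u - psum n u) = a u u - (\<Sum>k<n. (a u (e k))\<^sup>2)"
proof -
  have "a (u - psum n u) (psum n u) = 0" unfolding psum_def by (subst sum_right) (use assms residual_orth in
        \<open>auto simp: mem mem_scale mem_diff mem_sum scale_right psum_def intro!: sum.neutral\<close>)
  then have "a (u - psum n u) (u - psum n u) = a (u - psum n u) u"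
    using assms by (simp add: diff_right mem_diff psum_mem)
  then show ?thesis using assms by (simp add: diff_left psum_mem inner_psum power2_eq_square)
qed

lemma bessel_partial: "u \<in> V \<Longrightarrow> (\<Sum>k<n. (a u (e k))\<^sup>2) \<le> a u u"
  using residual_sq[of u n] nonneg[of "u - psum n u"] by (simp add: mem_diff psum_mem)

lemma bessel: "u \<in> V \<Longrightarrow> summable (\<lambda>k. (a u (e k))\<^sup>2)"
  by (rule summableI_nonneg_bounded[where x = "a u u"]) (auto simp: bessel_partial)

lemma residual_nrm_le: "u \<in> V \<Longrightarrow> nrm (u - psum n u) \<le> nrm u"
  unfolding nrm_def using residual_sq[of u n] by (simp add: sum_nonneg)

lemma parseval:
  assumes "u \<in> V" "v \<in> V" "(\<lambda>n. nrm (u - psum n u)) \<longlonglongrightarrow> 0"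
  shows "(\<lambda>k. a u (e k) * a v (e k)) sums a u v"
proof -
  have "(\<lambda>n. nrm (psum n u - u)) \<longlonglongrightarrow> 0" using assms(3) nrm_minus_commute[OF assms(1) psum_mem] by simp
  from tendsto_inner[OF this psum_mem assms(1,2)] show ?thesis by (simp add: inner_psum assms sums_def)
qed

text \<open>The partial sums are Cauchy because their increments are tails of a convergent series of
  squares. A prescribed coefficient at a zero vector cannot be attained, hence the factor
  \<open>a (e k) (e k)\<close> in the conclusion.\<close>

lemma riesz_fischer:
  assumes "complete" "summable (\<lambda>k. (c k)\<^sup>2)"
  shows "\<exists>u\<in>V. (\<lambda>n. nrm ((\<Sum>k<n. c k *\<^sub>R e k) - u)) \<longlonglongrightarrow> 0 \<and> (\<forall>k. a u (e k) = c k * a (e k) (e k))"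
proof -
  define X where "X n = (\<Sum>k<n. c k *\<^sub>R e k)" for n
  have XV: "X n \<in> V" for n unfolding X_def by (intro mem_sum mem_scale mem)
  have tail: "(nrm (X n - X m))\<^sup>2 \<le> (\<Sum>k=m..<n. (c k)\<^sup>2)" if "m \<le> n" for m n
  proof -
    have "X n - X m = (\<Sum>k=m..<n. c k *\<^sub>R e k)"
      using that by (simp add: X_def sum_diff_nat_ivl lessThan_atLeast0)
    then show ?thesis using combination_sq_le[of "{m..<n}" c]
        nrm_sq[OF mem_diff[OF XV XV], of n m] by simp
  qed
  have "Cauchy_seq X" unfolding Cauchy_seq_def
  proof (intro allI impI)
    fix eps :: real assume "eps > 0"
    then obtain N where N: "\<And>m n. m \<ge> N \<Longrightarrow> norm (\<Sum>k=m..<n. (c k)\<^sup>2) < eps\<^sup>2"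
      using assms(2) unfolding summable_Cauchy by (meson zero_less_power)
    have *: "nrm (X n - X m) < eps" if "m \<ge> N" "m \<le> n" for m n
    proof -
      have "(nrm (X n - X m))\<^sup>2 < eps\<^sup>2" using tail[OF that(2)] N[OF that(1), of n] by auto
      then show ?thesis using \<open>eps > 0\<close> by (simp add: power2_less_imp_less)
    qed
    have "nrm (X m - X n) < eps" if "m \<ge> N" "n \<ge> N" for m n
      using *[of m n] *[of n m] that nrm_minus_commute[OF XV XV, of m n] by (cases "m \<le> n") auto
    then show "\<exists>N. \<forall>m\<ge>N. \<forall>n\<ge>N. nrm (X m - X n) < eps" by blast
  qed
  then obtain u where u: "u \<in> V" "(\<lambda>n. nrm (X n - u)) \<longlonglongrightarrow> 0" using assms(1) XV unfolding complete_def by blast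
  have "a u (e k) = c k * a (e k) (e k)" for k
  proof (rule LIMSEQ_unique)
    show "(\<lambda>n. a (X n) (e k)) \<longlonglongrightarrow> a u (e k)" by (rule tendsto_inner[OF u(2) XV u(1) mem])
    show "(\<lambda>n. a (X n) (e k)) \<longlonglongrightarrow> c k * a (e k) (e k)"
    proof (rule tendsto_eventually)
      show "\<forall>\<^sub>F n in sequentially. a (X n) (e k) = c k * a (e k) (e k)" using eventually_gt_at_top[of k]
        by eventually_elim (simp add: X_def inner_combination)
    qed
  qed
  with u show ?thesis unfolding X_def by blast
qed

end

section \<open>Simultaneous diagonalisation of two forms\<close>

text \<open>The model is the Dirichlet form for \<open>a\<close> and the L2 product for
  \<open>b\<close>. Compactness is expressed by Cauchy subsequences in the \<open>b\<close>
  seminorm, since the carrier is not complete in it. The assumption \<open>definite\<close> says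
  that null vectors of \<open>b\<close> are null vectors of \<open>a\<close>, which identifies
  limits taken in the two seminorms.\<close>

locale compact_pair = A: semi_inner V a + B: semi_inner V b for V :: "'v::real_vector set" and a b +
  fixes C :: real
  assumes C_pos: "C > 0"
    and a_bounds_b: "u \<in> V \<Longrightarrow> b u u \<le> C * a u u"
    and definite: "u \<in> V \<Longrightarrow> b u u = 0 \<Longrightarrow> a u u = 0"
    and A_complete: "A.complete"
    and rellich: "\<lbrakk>\<And>n. X n \<in> V; \<And>n. a (X n) (X n) \<le> K\<rbrakk>
      \<Longrightarrow> \<exists>r::nat \<Rightarrow> nat. strict_mono r \<and> B.Cauchy_seq (X \<circ> r)"
begin

lemmas V_mem = A.mem_add A.mem_diff A.mem_scale A.mem_zero A.mem_sum

lemma B_le_A: "u \<in> V \<Longrightarrow> B.nrm u \<le> sqrt C * A.nrm u"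
  unfolding A.nrm_def B.nrm_def using a_bounds_b[of u] C_pos by (simp flip: real_sqrt_mult)

lemma A_limit_imp_B_limit:
  assumes "(\<lambda>n. A.nrm (X n - u)) \<longlonglongrightarrow> 0" "\<And>n. X n \<in> V" "u \<in> V"
  shows "(\<lambda>n. B.nrm (X n - u)) \<longlonglongrightarrow> 0"
proof (rule Lim_null_comparison)
  show "\<forall>\<^sub>F n in sequentially. norm (B.nrm (X n - u)) \<le> sqrt C * A.nrm (X n - u)"
    using B_le_A assms by (auto simp: V_mem)
  show "(\<lambda>n. sqrt C * A.nrm (X n - u)) \<longlonglongrightarrow> 0" using tendsto_mult_right_zero[OF assms(1)] by simp
qed

definition orth_compl :: "'v set \<Rightarrow> 'v set" where
  "orth_compl S = {u \<in> V. \<forall>s\<in>S. a u s = 0}"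

text \<open>Either a normalised minimiser of the Rayleigh quotient on the complement, or the zero
  vector once \<open>b\<close> vanishes there, which is how a finite-dimensional carrier is
  handled.\<close>

definition rayleigh_min :: "'v set \<Rightarrow> 'v \<Rightarrow> bool" where
  "rayleigh_min S x \<longleftrightarrow> x \<in> orth_compl S \<and>
     (b x x = 1 \<and> (\<forall>u\<in>orth_compl S. a x x * b u u \<le> a u u) \<or>
      x = 0 \<and> (\<forall>u\<in>orth_compl S. b u u = 0))"

lemma orth_compl_subspace: "S \<subseteq> V \<Longrightarrow> subspace (orth_compl S)" unfolding orth_compl_def subspace_def
  by (auto simp: V_mem A.add_left A.scale_left subset_iff)

lemma orth_compl_closed:
  assumes "(\<lambda>n. A.nrm (X n - u)) \<longlonglongrightarrow> 0" "\<And>n. X n \<in> orth_compl S" "u \<in> V" "S \<subseteq> V"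
  shows "u \<in> orth_compl S"
proof -
  have XV: "X n \<in> V" for n using assms(2) by (simp add: orth_compl_def)
  have "a u s = 0" if "s \<in> S" for s
  proof (rule LIMSEQ_unique)
    show "(\<lambda>n. a (X n) s) \<longlonglongrightarrow> a u s" using A.tendsto_inner[OF assms(1) XV assms(3)] that assms(4) by auto
    show "(\<lambda>n. a (X n) s) \<longlonglongrightarrow> 0" using assms(2) that by (simp add: orth_compl_def)
  qed
  then show ?thesis using assms(3) by (simp add: orth_compl_def)
qed

text \<open>The parallelogram identity for \<open>a\<close>, with the infimum \<open>m\<close> of the quotients as a lower
  bound for \<open>a\<close> at the sum, turns a minimising sequence that is Cauchy for \<open>b\<close> into one that is
  Cauchy for \<open>a\<close>; weak limits are not needed.\<close>

lemma rayleigh_min_ex: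
  assumes "S \<subseteq> V" shows "\<exists>x. rayleigh_min S x"
proof (cases "\<forall>u\<in>orth_compl S. b u u = 0")
  case True
  have "0 \<in> orth_compl S" using subspace_0[OF orth_compl_subspace[OF assms]] .
  with True show ?thesis unfolding rayleigh_min_def by blast
next
  case False
  let ?W = "orth_compl S"
  note W = orth_compl_subspace[OF assms]
  have WV: "u \<in> V" if "u \<in> ?W" for u using that by (simp add: orth_compl_def)
  define m where "m = Inf {a u u | u. u \<in> ?W \<and> b u u = 1}"
  have bdd: "bdd_below {a u u | u. u \<in> ?W \<and> b u u = 1}" by (rule bdd_belowI[of _ 0]) (auto simp: WV A.nonneg)
  from False obtain u0 where u0: "u0 \<in> ?W" "b u0 u0 \<noteq> 0" by blast
  have normalise: "b (u /\<^sub>R sqrt (b u u)) (u /\<^sub>R sqrt (b u u)) = 1"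
    "a (u /\<^sub>R sqrt (b u u)) (u /\<^sub>R sqrt (b u u)) = a u u / b u u"
    "u /\<^sub>R sqrt (b u u) \<in> ?W" if u: "u \<in> ?W" "b u u > 0" for u
  proof -
    have s: "inverse (sqrt (b u u)) * inverse (sqrt (b u u)) = 1 / b u u"
      using u(2) by (metis inverse_eq_divide inverse_mult_distrib less_imp_le real_sqrt_mult_self abs_of_nonneg)
    show "b (u /\<^sub>R sqrt (b u u)) (u /\<^sub>R sqrt (b u u)) = 1"
      using u s by (simp add: WV B.scale_left B.scale_right V_mem flip: mult.assoc)
    show "a (u /\<^sub>R sqrt (b u u)) (u /\<^sub>R sqrt (b u u)) = a u u / b u u"
      using u s by (simp add: WV A.scale_left A.scale_right V_mem flip: mult.assoc)
    show "u /\<^sub>R sqrt (b u u) \<in> ?W" using subspace_mul[OF W] u(1) .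
  qed
  from u0 have b0: "b u0 u0 > 0" using B.nonneg[OF WV] by (simp add: order_less_le)
  have ne: "{a u u | u. u \<in> ?W \<and> b u u = 1} \<noteq> {}" using normalise[OF u0(1) b0] by blast
  have m_le: "m * b u u \<le> a u u" if "u \<in> ?W" for u
  proof (cases "b u u = 0")
    case True then show ?thesis using A.nonneg WV that by simp
  next
    case False
    then have pos: "b u u > 0" using B.nonneg[OF WV[OF that]] by simp
    have "m \<le> a u u / b u u"
      unfolding m_def using normalise[OF that pos] by (intro cInf_lower bdd) (auto intro!: exI)
    then show ?thesis using pos by (simp add: field_simps)
  qed
  have "\<exists>u. u \<in> ?W \<and> b u u = 1 \<and> a u u < m + 1 / real (Suc n)" for n
    using cInf_lessD[OF ne, of "m + 1 / real (Suc n)"] unfolding m_def by auto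
  then obtain X where X: "\<And>n. X n \<in> ?W" "\<And>n. b (X n) (X n) = 1"
    "\<And>n. a (X n) (X n) < m + 1 / real (Suc n)" by metis
  have XV: "X n \<in> V" for n using X(1) WV by blast
  have "a (X n) (X n) \<le> m + 1" for n
  proof -
    have "1 / real (Suc n) \<le> 1" by simp
    then show ?thesis using X(3)[of n] by linarith
  qed
  from rellich[of X, OF XV this] obtain r where r: "strict_mono r" "B.Cauchy_seq (X \<circ> r)" by blast
  define Y where "Y = X \<circ> r"
  have Y: "Y n \<in> ?W" "Y n \<in> V" "b (Y n) (Y n) = 1" for n using X XV by (auto simp: Y_def)
  have Ym: "a (Y n) (Y n) < m + 1 / real (Suc n)" for n
  proof -
    have "1 / real (Suc (r n)) \<le> 1 / real (Suc n)"
      using seq_suble[OF r(1), of n] by (intro divide_left_mono) auto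
    then show ?thesis using X(3)[of "r n"] by (simp add: Y_def)
  qed
  have m_ge: "m \<le> a (Y n) (Y n)" for n using m_le[OF Y(1), of n] Y(3) by simp
  have par: "a (Y i - Y j) (Y i - Y j) \<le> 2 / real (Suc i) + 2 / real (Suc j) + m * b (Y i - Y j) (Y i - Y j)" for i j
  proof -
    have "m * b (Y i + Y j) (Y i + Y j) \<le> a (Y i + Y j) (Y i + Y j)" by (intro m_le subspace_add[OF W] Y)
    moreover have "b (Y i + Y j) (Y i + Y j) = 4 - b (Y i - Y j) (Y i - Y j)"
      using Y by (simp add: B.sq_add B.sq_diff)
    moreover have "a (Y i - Y j) (Y i - Y j) = 2 * a (Y i) (Y i) + 2 * a (Y j) (Y j) - a (Y i + Y j) (Y i + Y j)"
      using Y by (simp add: A.sq_add A.sq_diff)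
    ultimately show ?thesis using Ym[of i] Ym[of j] by (simp add: algebra_simps)
  qed
  have "m \<ge> 0" unfolding m_def using ne by (intro cInf_greatest) (auto simp: WV A.nonneg)
  have "A.Cauchy_seq Y" unfolding A.Cauchy_seq_def
  proof (intro allI impI)
    fix eps :: real assume eps: "eps > 0"
    \<comment> \<open>In \<open>par\<close> the term with factor m may use up eps^2/2, and the two
      reciprocal terms together the other half. The constant m + 1 stands in the denominator because
      only m \<ge> 0 is at hand.\<close>
    have "eps / sqrt (2 * (m + 1)) > 0" using eps \<open>m \<ge> 0\<close> by simp
    then obtain N1 where N1: "\<And>i j. i \<ge> N1 \<Longrightarrow> j \<ge> N1 \<Longrightarrow> B.nrm (Y i - Y j) < eps / sqrt (2 * (m + 1))"
      using r(2) unfolding B.Cauchy_seq_def Y_def by blast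
    obtain N2 where N2: "inverse (real (Suc N2)) < eps\<^sup>2 / 8" using reals_Archimedean[of "eps\<^sup>2 / 8"] eps by auto
    have "A.nrm (Y i - Y j) < eps" if "i \<ge> max N1 N2" "j \<ge> max N1 N2" for i j
    proof -
      have "1 / real (Suc i) \<le> inverse (real (Suc N2))" "1 / real (Suc j) \<le> inverse (real (Suc N2))"
        using that by (auto simp: divide_simps)
      moreover have "b (Y i - Y j) (Y i - Y j) < eps\<^sup>2 / (2 * (m + 1))"
      proof -
        have "(B.nrm (Y i - Y j))\<^sup>2 < (eps / sqrt (2 * (m + 1)))\<^sup>2"
          using N1[of i j] that Y by (intro power_strict_mono) (auto simp: V_mem)
        then show ?thesis using Y \<open>m \<ge> 0\<close> by (simp add: B.nrm_sq V_mem power_divide)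
      qed
      then have "m * b (Y i - Y j) (Y i - Y j) \<le> eps\<^sup>2 / 2"
      proof -
        assume l: "b (Y i - Y j) (Y i - Y j) < eps\<^sup>2 / (2 * (m + 1))"
        have "m * b (Y i - Y j) (Y i - Y j) \<le> (m + 1) * b (Y i - Y j) (Y i - Y j)"
          using B.nonneg[of "Y i - Y j"] Y by (simp add: V_mem mult_right_mono)
        also have "... \<le> (m + 1) * (eps\<^sup>2 / (2 * (m + 1)))" using l \<open>m \<ge> 0\<close> by (intro mult_left_mono) auto
        also have "... = eps\<^sup>2 / 2" using \<open>m \<ge> 0\<close> by (simp add: field_simps add_nonneg_eq_0_iff)
        finally show ?thesis .
      qed
      ultimately have "a (Y i - Y j) (Y i - Y j) < eps\<^sup>2" using par[of i j] N2 by simp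
      then have "(A.nrm (Y i - Y j))\<^sup>2 < eps\<^sup>2" using Y by (simp add: A.nrm_sq V_mem)
      then show ?thesis using eps by (simp add: power2_less_imp_less)
    qed
    then show "\<exists>N. \<forall>i\<ge>N. \<forall>j\<ge>N. A.nrm (Y i - Y j) < eps" by blast
  qed
  then obtain x where x: "x \<in> V" "(\<lambda>n. A.nrm (Y n - x)) \<longlonglongrightarrow> 0"
    using A_complete Y(2) unfolding A.complete_def by blast
  have xW: "x \<in> ?W" using orth_compl_closed[OF x(2) Y(1) x(1) assms] .
  have "(\<lambda>n. (A.nrm (Y n))\<^sup>2) \<longlonglongrightarrow> (A.nrm x)\<^sup>2" by (intro tendsto_power A.tendsto_nrm x Y)
  then have l1: "(\<lambda>n. a (Y n) (Y n)) \<longlonglongrightarrow> a x x" using Y x by (simp add: A.nrm_sq)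
  have l2: "(\<lambda>n. a (Y n) (Y n)) \<longlonglongrightarrow> m"
  proof (rule tendsto_sandwich)
    show "\<forall>\<^sub>F n in sequentially. m \<le> a (Y n) (Y n)" using m_ge by simp
    show "\<forall>\<^sub>F n in sequentially. a (Y n) (Y n) \<le> m + inverse (real (Suc n))"
      using Ym by (simp add: less_imp_le inverse_eq_divide)
    show "(\<lambda>n. m + inverse (real (Suc n))) \<longlonglongrightarrow> m" by (rule LIMSEQ_inverse_real_of_nat_add)
  qed simp
  have "a x x = m" using LIMSEQ_unique[OF l1 l2] .
  moreover have "b x x = 1"
  proof -
    have "(\<lambda>n. (B.nrm (Y n))\<^sup>2) \<longlonglongrightarrow> (B.nrm x)\<^sup>2" by (intro tendsto_power B.tendsto_nrm x Y A_limit_imp_B_limit)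
    then have "(\<lambda>n. 1) \<longlonglongrightarrow> b x x" using Y x by (simp add: B.nrm_sq)
    then show ?thesis by (simp add: LIMSEQ_const_iff)
  qed
  ultimately show ?thesis using xW m_le unfolding rayleigh_min_def by auto
qed

text \<open>Each new vector depends on all earlier ones. Recursion on the set of vectors found so
  far keeps this a primitive recursion.\<close>

primrec eig_set :: "nat \<Rightarrow> 'v set" where
  "eig_set 0 = {}"
| "eig_set (Suc n) = insert (SOME x. rayleigh_min (eig_set n) x) (eig_set n)"

definition eig :: "nat \<Rightarrow> 'v" where "eig n = (SOME x. rayleigh_min (eig_set n) x)"

text \<open>The value 1 at a null vector keeps all eigenvalues positive, so that division by them
  and by their roots is always legitimate.\<close>

definition eigval :: "nat \<Rightarrow> real" where
  "eigval n = (if b (eig n) (eig n) = 0 then 1 else a (eig n) (eig n))"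

lemma eig_set_eq: "eig_set n = eig ` {..<n}" by (induction n) (simp_all add: eig_def lessThan_Suc)

lemma eig_set_subset: "eig_set n \<subseteq> V"
proof (induction n)
  case (Suc n)
  have "rayleigh_min (eig_set n) (eig n)" unfolding eig_def using rayleigh_min_ex[OF Suc] by (rule someI_ex)
  then have "eig n \<in> V" by (simp add: rayleigh_min_def orth_compl_def)
  with Suc show ?case by (simp add: eig_def)
qed simp

lemma eig_min: "rayleigh_min (eig ` {..<n}) (eig n)"
  using someI_ex[OF rayleigh_min_ex[OF eig_set_subset[of n]]]
  by (simp only: eig_def[symmetric] eig_set_eq[symmetric])

lemma eig_mem: "eig n \<in> V" using eig_min[of n] by (simp add: rayleigh_min_def orth_compl_def)

lemma eig_orth_A: "k < n \<Longrightarrow> a (eig n) (eig k) = 0"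
  using eig_min[of n] by (auto simp: rayleigh_min_def orth_compl_def)

lemma eig_unit: "b (eig n) (eig n) = 1 \<or> eig n = 0" using eig_min[of n] by (auto simp: rayleigh_min_def)

lemma eigval_pos: "eigval n > 0"
proof (cases "b (eig n) (eig n) = 0")
  case False
  then have "b (eig n) (eig n) = 1" using eig_unit[of n] eig_mem[of n] B.mem_zero by auto
  then have "1 \<le> C * a (eig n) (eig n)" using a_bounds_b[OF eig_mem[of n]] by simp
  then have "0 < C * a (eig n) (eig n)" by linarith
  then show ?thesis using False C_pos by (simp add: eigval_def zero_less_mult_iff)
qed (simp add: eigval_def)

lemma eig_sq: "a (eig n) (eig n) = eigval n * b (eig n) (eig n)"
  using eig_unit[of n] B.mem_zero by (auto simp: eigval_def)

text \<open>Cauchy--Schwarz for the nonnegative form \<open>a - \<lambda> b\<close>, which vanishes at the minimiser, is the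
  Euler--Lagrange equation.\<close>

lemma eig_eq_compl:
  assumes "\<eta> \<in> orth_compl (eig ` {..<n})"
  shows "a (eig n) \<eta> = eigval n * b (eig n) \<eta>"
proof -
  let ?W = "orth_compl (eig ` {..<n})"
  have WV: "u \<in> V" if "u \<in> ?W" for u using that by (simp add: orth_compl_def)
  have en: "eig n \<in> ?W" using eig_min[of n] by (simp add: rayleigh_min_def)
  have ge: "eigval n * b u u \<le> a u u" if "u \<in> ?W" for u
    using eig_min[of n] that A.nonneg[OF WV[OF that]] B.mem_zero by (auto simp: rayleigh_min_def eigval_def)
  interpret Q: semi_inner ?W "\<lambda>u v. a u v - eigval n * b u v"
  proof
    show "subspace ?W" by (rule orth_compl_subspace) (use eig_mem in auto)
  qed (auto simp: WV A.add_left B.add_left A.scale_left B.scale_left right_diff_distrib mult.left_commute ge A.sym B.sym distrib_left)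
  have "(a (eig n) \<eta> - eigval n * b (eig n) \<eta>)\<^sup>2 \<le> 0"
    using Q.cauchy_schwarz_sq[OF en assms] by (simp add: eig_sq)
  then show ?thesis by simp
qed

text \<open>The Euler-Lagrange equation holds for test vectors in the complement of the earlier
  vectors. A general \<eta> is its \<open>a\<close>-projection \<open>p\<close> onto their span plus
  a vector of the complement, and \<open>p\<close> contributes to neither side: \<open>eig n\<close>
  is orthogonal to the earlier vectors for \<open>a\<close> by construction and for \<open>b\<close>
  by the induction hypothesis.\<close>

lemma eig_eq: "\<eta> \<in> V \<Longrightarrow> a (eig n) \<eta> = eigval n * b (eig n) \<eta>"
proof (induction n arbitrary: \<eta> rule: less_induct)
  case (less n)
  have b0: "b (eig n) (eig k) = 0" if "k < n" for k
    using less.IH[OF that eig_mem[of n]] eig_orth_A[OF that] eigval_pos[of k]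
      A.sym[OF eig_mem eig_mem, of n k] B.sym[OF eig_mem eig_mem, of n k] by simp
  have ak: "a (eig j) (eig k) = 0" if "j \<noteq> k" for j k
    using that eig_orth_A A.sym[OF eig_mem eig_mem, of j k] by (metis linorder_neq_iff)
  \<comment> \<open>If \<open>a (eig k) (eig k)\<close> is 0, the quotient is 0 by convention; then
    \<open>a \<eta> (eig k)\<close> vanishes too by Cauchy-Schwarz, so the coefficient is still the
    right one.\<close>
  define c where "c k = a \<eta> (eig k) / a (eig k) (eig k)" for k
  define p where "p = (\<Sum>k<n. c k *\<^sub>R eig k)"
  have pV: "p \<in> V" unfolding p_def by (intro A.mem_sum A.mem_scale eig_mem)
  have "a p (eig j) = a \<eta> (eig j)" if "j < n" for j
  proof -
    have "a p (eig j) = (\<Sum>k<n. c k * a (eig k) (eig j))"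
      unfolding p_def by (simp add: A.sum_left A.scale_left eig_mem A.mem_scale)
    also have "... = (\<Sum>k<n. if k = j then c j * a (eig j) (eig j) else 0)" by (intro sum.cong) (auto simp: ak)
    also have "... = c j * a (eig j) (eig j)" using that by simp
    also have "... = a \<eta> (eig j)" using A.cauchy_schwarz_sq[OF less.prems eig_mem[of j]] by (auto simp: c_def)
    finally show ?thesis .
  qed
  then have "\<eta> - p \<in> orth_compl (eig ` {..<n})"
    using less.prems pV by (auto simp: orth_compl_def V_mem A.diff_left eig_mem)
  from eig_eq_compl[OF this]
  have "a (eig n) \<eta> - a (eig n) p = eigval n * (b (eig n) \<eta> - b (eig n) p)"
    using less.prems pV by (simp add: A.diff_right B.diff_right eig_mem)
  moreover have "a (eig n) p = 0" "b (eig n) p = 0"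
    unfolding p_def by (simp_all add: A.sum_right A.scale_right B.sum_right B.scale_right
        eig_mem A.mem_scale ak b0)
  ultimately show ?case by simp
qed

lemma eig_orth_B: "j \<noteq> k \<Longrightarrow> b (eig j) (eig k) = 0"
proof -
  assume "j \<noteq> k"
  then have "a (eig j) (eig k) = 0"
    using eig_orth_A A.sym[OF eig_mem eig_mem, of j k] by (metis linorder_neq_iff)
  then show ?thesis using eig_eq[OF eig_mem, of j k] eigval_pos[of j] by simp
qed

sublocale onB: orthonormal V b eig by unfold_locales (auto simp: eig_mem eig_orth_B eig_unit)

text \<open>The eigenvalue is the squared \<open>a\<close>-length of a nonzero eigenvector, so this
  rescaling is the normalisation for \<open>a\<close>.\<close>

definition sc_eig :: "nat \<Rightarrow> 'v" where "sc_eig n = eig n /\<^sub>R sqrt (eigval n)"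

sublocale onA: orthonormal V a sc_eig
proof
  show "a (sc_eig m) (sc_eig n) = 0" if "m \<noteq> n" for m n
    using that eig_eq[OF eig_mem, of m n] eig_orth_B[OF that]
    by (simp add: sc_eig_def A.scale_left A.scale_right A.mem_scale eig_mem)
  show "a (sc_eig n) (sc_eig n) = 1 \<or> sc_eig n = 0" for n
    using eig_unit[of n] eig_eq[OF eig_mem, of n n] eigval_pos[of n]
    by (auto simp: sc_eig_def A.scale_left A.scale_right A.mem_scale eig_mem divide_simps
        simp flip: power2_eq_square mult.assoc)
qed (simp add: sc_eig_def A.mem_scale eig_mem)

lemma coeff_A: "u \<in> V \<Longrightarrow> a u (sc_eig k) = sqrt (eigval k) * b u (eig k)"
  using eig_eq[of u k] eigval_pos[of k] A.sym[OF eig_mem, of u k] B.sym[OF eig_mem, of u k]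
  by (simp add: sc_eig_def A.scale_right eig_mem field_simps)

text \<open>The roots of the eigenvalue cancel between coefficient and vector. Convergence in the
  \<open>a\<close> and in the \<open>b\<close> seminorm thus concerns one and the same
  sequence.\<close>

lemma psum_A_eq: "u \<in> V \<Longrightarrow> onA.psum n u = onB.psum n u" unfolding onA.psum_def onB.psum_def
proof (rule sum.cong[OF refl])
  fix k assume "u \<in> V"
  have "sqrt (eigval k) \<noteq> 0" using eigval_pos[of k] by simp
  then show "a u (sc_eig k) *\<^sub>R sc_eig k = b u (eig k) *\<^sub>R eig k"
    by (subst coeff_A[OF \<open>u \<in> V\<close>]) (simp add: sc_eig_def)
qed

text \<open>Orthonormal vectors have squared \<open>b\<close>-distance 2, so no subsequence of them
  is Cauchy; by compactness they cannot be bounded for \<open>a\<close>.\<close>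

lemma eigval_unbounded:
  assumes "\<And>n. b (eig n) (eig n) = 1" shows "\<exists>n. eigval n > K"
proof (rule ccontr)
  assume *: "\<nexists>n. eigval n > K"
  have "a (eig n) (eig n) \<le> K" for n using * eig_sq[of n] assms by (simp add: not_less)
  from rellich[of eig, OF eig_mem this] obtain r where r: "strict_mono r" "B.Cauchy_seq (eig \<circ> r)" by blast
  then obtain N where N: "\<And>m n. m \<ge> N \<Longrightarrow> n \<ge> N \<Longrightarrow> B.nrm ((eig \<circ> r) m - (eig \<circ> r) n) < 1"
    unfolding B.Cauchy_seq_def by (meson zero_less_one)
  have "r (Suc N) \<noteq> r N" using strict_monoD[OF r(1), of N "Suc N"] by simp
  then have "b (eig (r (Suc N)) - eig (r N)) (eig (r (Suc N)) - eig (r N)) = 2"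
    by (simp add: B.sq_diff eig_mem assms eig_orth_B)
  moreover have "B.nrm (eig (r (Suc N)) - eig (r N)) < 1" using N[of "Suc N" N] by simp
  ultimately show False by (simp add: B.nrm_def)
qed

lemma residual_compl:
  assumes "u \<in> V" shows "u - onB.psum n u \<in> orth_compl (eig ` {..<n})"
proof -
  have "a (u - onB.psum n u) (eig k) = 0" if "k < n" for k
    using eig_eq[OF A.mem_diff[OF assms onB.psum_mem], of k n] onB.residual_orth[OF assms that]
      A.sym[OF eig_mem A.mem_diff[OF assms onB.psum_mem], of k n]
      B.sym[OF eig_mem A.mem_diff[OF assms onB.psum_mem], of k n] by simp
  then show ?thesis using assms by (auto simp: orth_compl_def onB.psum_mem V_mem)
qed

lemma residual_nrm_antimono:
  assumes "u \<in> V" "m \<le> n" shows "B.nrm (u - onB.psum n u) \<le> B.nrm (u - onB.psum m u)"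
proof -
  have "(\<Sum>k<m. (b u (eig k))\<^sup>2) \<le> (\<Sum>k<n. (b u (eig k))\<^sup>2)" using assms(2) by (intro sum_mono2) auto
  then show ?thesis unfolding B.nrm_def using assms(1) by (simp add: onB.residual_sq)
qed

text \<open>On the complement of the first n vectors the Rayleigh quotient is at least
  \<open>eigval n\<close>, while the residual of u never exceeds u in the \<open>a\<close> seminorm;
  so its \<open>b\<close> seminorm is at most that of order 1 / sqrt (\<open>eigval n\<close>), and
  the eigenvalues are unbounded. If some \<open>eig n\<close> is zero, \<open>b\<close> vanishes on
  that complement and the residual is a null vector.\<close>

theorem eig_complete:
  assumes "u \<in> V" shows "(\<lambda>n. B.nrm (u - onB.psum n u)) \<longlonglongrightarrow> 0"
proof (rule LIMSEQ_I)
  fix eps :: real assume eps: "eps > 0"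
  have "\<exists>n. B.nrm (u - onB.psum n u) < eps"
  proof (cases "\<forall>n. b (eig n) (eig n) = 1")
    case True
    then obtain n where n: "eigval n > (a u u + 1) / eps\<^sup>2" using eigval_unbounded by blast
    let ?r = "u - onB.psum n u"
    have rV: "?r \<in> V" using assms by (simp add: V_mem onB.psum_mem)
    have "eigval n * b ?r ?r \<le> a ?r ?r" using eig_min[of n] residual_compl[OF assms] True B.mem_zero
      by (fastforce simp: rayleigh_min_def eigval_def A.nonneg[OF rV])
    also have "... \<le> a u u"
      using onA.residual_nrm_le[OF assms, of n] psum_A_eq[OF assms, of n] by (simp add: A.nrm_def)
    also have "... < eigval n * eps\<^sup>2" using n eps by (simp add: field_simps)
    finally have "(B.nrm ?r)\<^sup>2 < eps\<^sup>2" using eigval_pos[of n] rV by (simp add: B.nrm_sq)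
    then show ?thesis using eps by (auto intro!: exI[of _ n] power2_less_imp_less)
  next
    case False
    then obtain n where "b (eig n) (eig n) \<noteq> 1" by blast
    then have "b (u - onB.psum n u) (u - onB.psum n u) = 0"
      using eig_min[of n] residual_compl[OF assms] by (auto simp: rayleigh_min_def)
    then show ?thesis using eps by (auto simp: B.nrm_def intro!: exI[of _ n])
  qed
  then obtain N where N: "B.nrm (u - onB.psum N u) < eps" by blast
  have "norm (B.nrm (u - onB.psum n u) - 0) < eps" if "n \<ge> N" for n
  proof -
    have "B.nrm (u - onB.psum n u) < eps" using residual_nrm_antimono[OF assms that] N by linarith
    moreover have "0 \<le> B.nrm (u - onB.psum n u)" by (simp add: V_mem assms onB.psum_mem)
    ultimately show ?thesis by simp
  qed
  then show "\<exists>no. \<forall>n\<ge>no. norm (B.nrm (u - onB.psum n u) - 0) < eps" by blast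
qed

text \<open>Bessel and completeness give some limit \<open>w\<close> of the partial sums in the
  \<open>a\<close> seminorm. Convergence to u for \<open>b\<close> shows that u - w is null for
  \<open>b\<close>, hence by \<open>definite\<close> also for \<open>a\<close>.\<close>

theorem eig_complete_A:
  assumes "u \<in> V" shows "(\<lambda>n. A.nrm (u - onA.psum n u)) \<longlonglongrightarrow> 0"
proof -
  obtain w where w: "w \<in> V" "(\<lambda>n. A.nrm (onA.psum n u - w)) \<longlonglongrightarrow> 0"
    using onA.riesz_fischer[OF A_complete onA.bessel[OF assms]] unfolding onA.psum_def by blast
  have "(\<lambda>n. B.nrm (onB.psum n u - w)) \<longlonglongrightarrow> 0"
    using A_limit_imp_B_limit[OF w(2) onA.psum_mem w(1)] by (simp add: psum_A_eq assms)
  from tendsto_add[OF eig_complete[OF assms] this]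
  have "(\<lambda>n. B.nrm (u - onB.psum n u) + B.nrm (onB.psum n u - w)) \<longlonglongrightarrow> 0" by simp
  moreover have "B.nrm (u - w) \<le> B.nrm (u - onB.psum n u) + B.nrm (onB.psum n u - w)" for n
    by (intro B.nrm_triangle_diff assms w onB.psum_mem)
  ultimately have "B.nrm (u - w) \<le> 0" by (intro LIMSEQ_le_const) auto
  then have "b (u - w) (u - w) = 0" using B.nonneg[of "u - w"] assms w by (simp add: B.nrm_def V_mem)
  then have 0: "A.nrm (u - w) = 0" using definite assms w by (simp add: A.nrm_def V_mem)
  show ?thesis
  proof (rule Lim_null_comparison[OF _ w(2)])
    show "\<forall>\<^sub>F n in sequentially. norm (A.nrm (u - onA.psum n u)) \<le> A.nrm (onA.psum n u - w)"
      using A.nrm_triangle_diff[OF assms w(1) onA.psum_mem] A.nrm_minus_commute[OF w(1) onA.psum_mem] 0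
      by (auto simp: V_mem assms onA.psum_mem)
  qed
qed

end

section \<open>Smooth functions\<close>

lemma Ck_Suc_imp_Ck: "Ck (Suc k) f \<Longrightarrow> Ck k f"
proof (induction k arbitrary: f)
  case 0
  then show ?case by (auto intro!: continuous_at_imp_continuous_on differentiable_imp_continuous_within)
qed auto

lemma frechet_derivative_eqI: "(f has_derivative D) (at x) \<Longrightarrow> frechet_derivative f (at x) = D"
  by (rule frechet_derivative_at[symmetric])

lemma Ck_SucI:
  assumes "\<And>x. (f has_derivative D x) (at x)" "\<And>b. b \<in> Basis \<Longrightarrow> Ck k (\<lambda>x. D x b)"
  shows "Ck (Suc k) f" using assms frechet_derivative_eqI[OF assms(1)] by (auto simp: differentiable_def)

lemma Ck_Suc_has_derivative:
  "Ck (Suc k) f \<Longrightarrow> (f has_derivative frechet_derivative f (at x)) (at x)"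
  by (simp add: frechet_derivative_works[symmetric])

lemma Ck_const [simp]: "Ck k (\<lambda>x. c)" by (induction k arbitrary: c) auto

lemma Ck_add: "Ck k f \<Longrightarrow> Ck k g \<Longrightarrow> Ck k (\<lambda>x. f x + g x)"
proof (induction k arbitrary: f g)
  case 0 then show ?case by (auto intro: continuous_intros)
next
  case (Suc k)
  show ?case
  proof (rule Ck_SucI)
    show "((\<lambda>x. f x + g x) has_derivative (\<lambda>b. frechet_derivative f (at x) b + frechet_derivative g (at x) b)) (at x)" for x
      using Suc.prems by (intro has_derivative_add Ck_Suc_has_derivative)
  qed (use Suc in auto)
qed

lemma Ck_linear:
  assumes "bounded_linear L" shows "Ck k f \<Longrightarrow> Ck k (\<lambda>x. L (f x))"
proof (induction k arbitrary: f)
  case 0 then show ?case using bounded_linear.continuous_on[OF assms] by auto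
next
  case (Suc k)
  show ?case
  proof (rule Ck_SucI)
    show "((\<lambda>x. L (f x)) has_derivative (\<lambda>b. L (frechet_derivative f (at x) b))) (at x)" for x
      using Suc.prems by (intro bounded_linear.has_derivative[OF assms] Ck_Suc_has_derivative)
  qed (use Suc in auto)
qed

lemma Ck_mult:
  fixes f g :: "'a::euclidean_space \<Rightarrow> real"
  shows "Ck k f \<Longrightarrow> Ck k g \<Longrightarrow> Ck k (\<lambda>x. f x * g x)"
proof (induction k arbitrary: f g)
  case 0 then show ?case by (auto intro: continuous_intros)
next
  case (Suc k)
  show ?case
  proof (rule Ck_SucI)
    show "((\<lambda>x. f x * g x) has_derivative (\<lambda>b. f x * frechet_derivative g (at x) b + frechet_derivative f (at x) b * g x)) (at x)" for x
      using Suc.prems by (intro has_derivative_mult Ck_Suc_has_derivative)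
    show "Ck k (\<lambda>x. f x * frechet_derivative g (at x) b + frechet_derivative f (at x) b * g x)"
      if "b \<in> Basis" for b using Suc.prems that Ck_Suc_imp_Ck[OF Suc.prems(1)] Ck_Suc_imp_Ck[OF Suc.prems(2)]
      by (intro Ck_add Suc.IH) auto
  qed
qed

lemma Ck_prod:
  fixes f :: "'i \<Rightarrow> 'a::euclidean_space \<Rightarrow> real"
  shows "(\<And>i. i \<in> I \<Longrightarrow> Ck k (f i)) \<Longrightarrow> Ck k (\<lambda>x. \<Prod>i\<in>I. f i x)"
  by (induction I rule: infinite_finite_induct) (auto intro!: Ck_mult)

definition flat :: "real \<Rightarrow> nat \<Rightarrow> real \<Rightarrow> real" where
  "flat \<delta> m s = (if s > 0 then exp (- \<delta> / s) / s ^ m else 0)"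

lemma power_div_fact_le_exp:
  fixes y :: real assumes "y \<ge> 0" shows "y ^ n / fact n \<le> exp y"
proof -
  have "(\<Sum>i\<in>{n}. inverse (fact i) * y ^ i) \<le> (\<Sum>i. inverse (fact i) * y ^ i)"
    using assms by (intro sum_le_suminf summable_exp) auto
  then show ?thesis by (simp add: exp_def divide_inverse mult.commute scaleR_conv_of_real)
qed

text \<open>A single term of the exponential series, of order m + 2, bounds exp(\<delta>/s) from
  below; the two extra powers leave s^2. A quadratic bound is what yields derivative 0 at the
  origin.\<close>

lemma flat_le_square:
  assumes "\<delta> > 0"
  shows "\<bar>flat \<delta> m s\<bar> \<le> fact (m + 2) / \<delta> ^ (m + 2) * s\<^sup>2"
proof (cases "s > 0")
  case True
  have "(\<delta> / s) ^ (m + 2) / fact (m + 2) \<le> exp (\<delta> / s)" using True assms by (intro power_div_fact_le_exp) auto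
  moreover have "0 < (\<delta> / s) ^ (m + 2) / fact (m + 2)" using True assms by (intro divide_pos_pos zero_less_power) auto
  ultimately have "inverse (exp (\<delta> / s)) \<le> inverse ((\<delta> / s) ^ (m + 2) / fact (m + 2))"
    by (rule le_imp_inverse_le)
  also have "... = fact (m + 2) / \<delta> ^ (m + 2) * s ^ (m + 2)"
    using True assms by (simp add: power_divide field_simps)
  finally have "exp (- \<delta> / s) \<le> fact (m + 2) / \<delta> ^ (m + 2) * s ^ (m + 2)" by (simp add: exp_minus)
  then have "exp (- \<delta> / s) / s ^ m \<le> fact (m + 2) / \<delta> ^ (m + 2) * s ^ (m + 2) / s ^ m"
    using True by (intro divide_right_mono) auto
  also have "... = fact (m + 2) / \<delta> ^ (m + 2) * s\<^sup>2" using True by (simp add: power_add power2_eq_square)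
  finally show ?thesis using True by (simp add: flat_def)
qed (use assms in \<open>simp add: flat_def\<close>)

lemma flat_deriv:
  assumes "\<delta> > 0"
  shows "(flat \<delta> m has_real_derivative \<delta> * flat \<delta> (m + 2) s - real m * flat \<delta> (m + 1) s) (at s)"
proof -
  consider "s > 0" | "s < 0" | "s = 0" by linarith
  then show ?thesis
  proof cases
    case 1
    have "((\<lambda>s. exp (- \<delta> / s) / s ^ m) has_real_derivative \<delta> * flat \<delta> (m + 2) s - real m * flat \<delta> (m + 1) s) (at s)"
    proof (cases m)
      case 0 then show ?thesis using 1 by (auto intro!: derivative_eq_intros simp: flat_def power2_eq_square)
    next
      case (Suc k) then show ?thesis using 1
        by (auto intro!: derivative_eq_intros simp: flat_def power2_eq_square field_simps)
          (use power_minus_mult[of k s] in \<open>auto simp: mult.commute\<close>)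
    qed
    then show ?thesis
      by (rule has_field_derivative_transform_within_open[where S = "{0<..}"]) (use 1 in \<open>auto simp: flat_def\<close>)
  next
    case 2
    have "((\<lambda>s. 0) has_real_derivative \<delta> * flat \<delta> (m + 2) s - real m * flat \<delta> (m + 1) s) (at s)"
      using 2 by (auto simp: flat_def)
    then show ?thesis
      by (rule has_field_derivative_transform_within_open[where S = "{..<0}"]) (use 2 in \<open>auto simp: flat_def\<close>)
  next
    case 3
    define K where "K = fact (m + 2) / \<delta> ^ (m + 2)"
    have "(\<lambda>h. (flat \<delta> m (0 + h) - flat \<delta> m 0) / h) \<midarrow>0\<rightarrow> 0"
    proof (rule Lim_null_comparison)
      show "\<forall>\<^sub>F h in at 0. norm ((flat \<delta> m (0 + h) - flat \<delta> m 0) / h) \<le> K * \<bar>h\<bar>"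
      proof (intro always_eventually allI)
        fix h :: real
        have "\<bar>flat \<delta> m h\<bar> \<le> K * \<bar>h\<bar> * \<bar>h\<bar>"
          using flat_le_square[OF assms, of m h] by (simp add: K_def power2_eq_square mult.assoc)
        then show "norm ((flat \<delta> m (0 + h) - flat \<delta> m 0) / h) \<le> K * \<bar>h\<bar>"
          using assms by (cases "h = 0") (auto simp: flat_def[of _ _ 0] K_def divide_le_eq)
      qed
      show "((\<lambda>h. K * \<bar>h\<bar>) \<longlongrightarrow> 0) (at 0)" by (auto intro!: tendsto_eq_intros)
    qed
    then show ?thesis using 3 by (simp add: DERIV_def flat_def[of _ _ 0])
  qed
qed

lemma Ck_flat:
  fixes L :: "'a::euclidean_space \<Rightarrow> real"
  assumes "\<delta> > 0" "bounded_linear L" shows "Ck k (\<lambda>x. flat \<delta> m (L x + d))"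
proof (induction k arbitrary: m)
  case 0
  have "isCont (flat \<delta> m) s" for s using flat_deriv[OF assms(1)] by (rule DERIV_isCont)
  then have "continuous_on UNIV (flat \<delta> m)" by (simp add: continuous_at_imp_continuous_on)
  moreover have "continuous_on UNIV (\<lambda>x. L x + d)"
    by (intro continuous_intros bounded_linear.continuous_on[OF assms(2)])
  ultimately show ?case using continuous_on_compose2[of UNIV "flat \<delta> m" UNIV "\<lambda>x. L x + d"] by auto
next
  case (Suc k)
  let ?D = "\<lambda>x. \<delta> * flat \<delta> (m + 2) (L x + d) + (- real m) * flat \<delta> (m + 1) (L x + d)"
  show ?case
  proof (rule Ck_SucI)
    fix x
    have "((\<lambda>x. L x + d) has_derivative L) (at x)"
      using has_derivative_add_const[OF bounded_linear.has_derivative[OF assms(2) has_derivative_ident]] .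
    from has_derivative_compose[OF this, of "flat \<delta> m"] flat_deriv[OF assms(1), of m "L x + d"]
    show "((\<lambda>x. flat \<delta> m (L x + d)) has_derivative (\<lambda>b. ?D x * L b)) (at x)"
      by (simp add: has_field_derivative_def)
    show "Ck k (\<lambda>x. ?D x * L b)" for b by (intro Ck_mult Ck_add Suc.IH Ck_const)
  qed
qed

section \<open>Test functions\<close>

lemma test_functionsD:
  assumes "\<phi> \<in> test_functions U"
  shows "Ck k \<phi>" "compact (closure {x. \<phi> x \<noteq> 0})" "closure {x. \<phi> x \<noteq> 0} \<subseteq> U"
    "\<phi> x \<noteq> 0 \<Longrightarrow> x \<in> U" using assms closure_subset[of "{x. \<phi> x \<noteq> 0}"] by (auto simp: test_functions_def)

lemma test_functions_subset_support:
  assumes "\<And>k. Ck k \<phi>" "{x. \<phi> x \<noteq> 0} \<subseteq> K" "compact K" "K \<subseteq> U"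
  shows "\<phi> \<in> test_functions U"
proof -
  have "closure {x. \<phi> x \<noteq> 0} \<subseteq> K" using assms by (intro closure_minimal compact_imp_closed)
  moreover from this have "compact (closure {x. \<phi> x \<noteq> 0})"
    using assms(3) by (metis closed_closure compact_Int_closed inf.absorb2)
  ultimately show ?thesis using assms unfolding test_functions_def by blast
qed

definition bump_seq :: "'a::euclidean_space set \<Rightarrow> 'a \<Rightarrow> 'a \<Rightarrow> (nat \<Rightarrow> 'a \<Rightarrow> real) \<Rightarrow> bool" where
  "bump_seq U a c \<phi> \<longleftrightarrow> (\<forall>n. \<phi> n \<in> test_functions U) \<and> (\<forall>n x. 0 \<le> \<phi> n x \<and> \<phi> n x \<le> 1) \<and>
     (\<forall>n. \<forall>x\<in>box a c. \<phi> n x > 0) \<and> (\<forall>x. (\<lambda>n. \<phi> n x) \<longlonglongrightarrow> indicator (box a c) x)"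

text \<open>The product over all coordinates of flat functions of the distances to the two faces,
  with \<delta> = 1/(n+1), so that the values inside the box increase to 1.\<close>

lemma bump_seq_ex:
  fixes a c :: "'a::euclidean_space"
  assumes "cbox a c \<subseteq> U"
  shows "\<exists>\<phi>. bump_seq U a c \<phi>"
proof -
  define f where "f n x i = flat (1 / real (Suc n)) 0 (x \<bullet> i + - (a \<bullet> i)) *
    flat (1 / real (Suc n)) 0 (x \<bullet> (- i) + (c \<bullet> i))" for n and x i :: 'a
  define \<phi> where "\<phi> n x = (\<Prod>i\<in>Basis. f n x i)" for n x
  have fl: "0 \<le> flat (1 / real (Suc n)) 0 s" "flat (1 / real (Suc n)) 0 s \<le> 1" for n s
    by (auto simp: flat_def)
  have f: "0 \<le> f n x i" "f n x i \<le> 1" for n x i unfolding f_def using fl by (auto intro: mult_le_one)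
  have out: "\<phi> n x = 0" if x: "x \<notin> box a c" for n x
  proof -
    obtain i where i: "i \<in> Basis" "\<not> (a \<bullet> i < x \<bullet> i \<and> x \<bullet> i < c \<bullet> i)" using x by (auto simp: mem_box)
    then have "f n x i = 0" by (auto simp: f_def flat_def)
    then show ?thesis unfolding \<phi>_def using i(1) by (auto intro: prod_zero)
  qed
  have pos: "\<phi> n x > 0" if "x \<in> box a c" for n x
    unfolding \<phi>_def using that by (intro prod_pos) (auto simp: box_def f_def flat_def)
  have lim: "(\<lambda>n. flat (1 / real (Suc n)) 0 s) \<longlonglongrightarrow> 1" if "s > 0" for s
  proof -
    have "(\<lambda>n. - (1 / real (Suc n)) / s) \<longlonglongrightarrow> - 0 / s"
      using LIMSEQ_Suc[OF lim_1_over_n] that by (intro tendsto_intros) auto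
    then have "(\<lambda>n. exp (- (1 / real (Suc n)) / s)) \<longlonglongrightarrow> exp (- 0 / s)" by (rule tendsto_exp)
    then show ?thesis using that by (simp add: flat_def)
  qed
  have "bump_seq U a c \<phi>" unfolding bump_seq_def
  proof (intro conjI allI ballI)
    show "\<phi> n \<in> test_functions U" for n
    proof (rule test_functions_subset_support[OF _ _ compact_cbox assms])
      show "Ck k (\<phi> n)" for k unfolding \<phi>_def f_def
        by (intro Ck_prod Ck_mult Ck_flat bounded_linear_inner_left) auto
      show "{x. \<phi> n x \<noteq> 0} \<subseteq> cbox a c" using out box_subset_cbox by blast
    qed
    show "0 \<le> \<phi> n x" "\<phi> n x \<le> 1" for n x unfolding \<phi>_def using f by (auto intro: prod_nonneg prod_le_1)
    show "(\<lambda>n. \<phi> n x) \<longlonglongrightarrow> indicator (box a c) x" for x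
    proof (cases "x \<in> box a c")
      case True
      have "(\<lambda>n. f n x i) \<longlonglongrightarrow> 1 * 1" if "i \<in> Basis" for i
        unfolding f_def using True that by (intro tendsto_mult lim) (auto simp: box_def)
      then have "(\<lambda>n. \<phi> n x) \<longlonglongrightarrow> (\<Prod>i\<in>(Basis::'a set). 1)" unfolding \<phi>_def by (intro tendsto_prod) auto
      then show ?thesis using True by simp
    qed (simp add: out)
  qed (use pos in auto)
  then show ?thesis by blast
qed

lemma integrable_mult_bounded:
  fixes g h :: "'a \<Rightarrow> real"
  assumes "integrable M g" "h \<in> borel_measurable M" "\<And>x. x \<in> space M \<Longrightarrow> \<bar>h x\<bar> \<le> B"
  shows "integrable M (\<lambda>x. g x * h x)"
proof (rule Bochner_Integration.integrable_bound)
  show "integrable M (\<lambda>x. B * norm (g x))" using assms(1) by simp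
  show "(\<lambda>x. g x * h x) \<in> borel_measurable M" using assms by measurable
  show "AE x in M. norm (g x * h x) \<le> norm (B * norm (g x))"
  proof (intro AE_I2)
    fix x assume x: "x \<in> space M"
    have "B \<ge> 0" using assms(3)[OF x] by linarith
    moreover have "\<bar>g x\<bar> * \<bar>h x\<bar> \<le> \<bar>g x\<bar> * B" using assms(3)[OF x] by (intro mult_left_mono) auto
    ultimately show "norm (g x * h x) \<le> norm (B * norm (g x))" by (simp add: abs_mult mult.commute)
  qed
qed

lemma continuous_imp_lebesgue_on:
  fixes \<phi> :: "'a::euclidean_space \<Rightarrow> 'b::euclidean_space"
  shows "continuous_on UNIV \<phi> \<Longrightarrow> \<phi> \<in> borel_measurable (lebesgue_on S)"
  by (intro measurable_restrict_space1 measurable_completion) (simp add: borel_measurable_continuous_onI)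

text \<open>Testing with bumps and dominated convergence gives integral zero over every open box
  whose closure lies in \<open>U\<close>. Inside one closed box these open boxes form an
  intersection-stable generator of the Borel sets, so all Borel integrals vanish there. Finally
  \<open>U\<close> is a countable union of closed boxes.\<close>

theorem fundamental_lemma:
  fixes g :: "'a::euclidean_space \<Rightarrow> real"
  assumes "open U" "integrable (lebesgue_on U) g"
    and zero: "\<And>\<phi>. \<phi> \<in> test_functions U \<Longrightarrow> (LINT x|lebesgue_on U. g x * \<phi> x) = 0"
  shows "AE x in lebesgue_on U. g x = 0"
proof -
  have U: "U \<in> sets lebesgue" using assms(1) by simp
  have G: "integrable lebesgue (\<lambda>x. indicator U x * g x)"
    using assms(2) U by (subst (asm) integrable_restrict_space) auto
  have box0: "(LINT x|lebesgue. indicator (box a c) x * g x) = 0" if that': "cbox a c \<subseteq> U" for a c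
  proof -
    obtain \<phi> where "bump_seq U a c \<phi>" using bump_seq_ex[OF that'] by blast
    then have \<phi>: "\<phi> n \<in> test_functions U" "0 \<le> \<phi> n x" "\<phi> n x \<le> 1"
      "(\<lambda>n. \<phi> n x) \<longlonglongrightarrow> indicator (box a c) x" for n x unfolding bump_seq_def by blast+
    have "(\<lambda>n. LINT x|lebesgue_on U. g x * \<phi> n x) \<longlonglongrightarrow> (LINT x|lebesgue_on U. g x * indicator (box a c) x)"
    proof (rule integral_dominated_convergence)
      show "integrable (lebesgue_on U) (\<lambda>x. norm (g x))" using assms(2) by simp
      show "AE x in lebesgue_on U. (\<lambda>n. g x * \<phi> n x) \<longlonglongrightarrow> g x * indicator (box a c) x"
        using \<phi>(4) by (intro AE_I2 tendsto_mult_left)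
      show "AE x in lebesgue_on U. norm (g x * \<phi> n x) \<le> norm (g x)" for n
      proof (intro AE_I2)
        fix x
        show "norm (g x * \<phi> n x) \<le> norm (g x)"
          using mult_left_mono[OF \<phi>(3), of "\<bar>g x\<bar>" n x] \<phi>(2)[of n x] by (simp add: abs_mult)
      qed
      have m: "g \<in> borel_measurable (lebesgue_on U)" using assms(2) by simp
      have "\<phi> n \<in> borel_measurable (lebesgue_on U)" for n
        using test_functionsD(1)[OF \<phi>(1), of 0 n] by (intro continuous_imp_lebesgue_on) simp
      with m show "(\<lambda>x. g x * \<phi> n x) \<in> borel_measurable (lebesgue_on U)" for n
        by (intro borel_measurable_times)
      have "(indicator (box a c) :: 'a \<Rightarrow> real) \<in> borel_measurable (lebesgue_on U)"
        by (intro measurable_restrict_space1 measurable_completion borel_measurable_indicator) simp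
      with m show "(\<lambda>x. g x * indicator (box a c) x) \<in> borel_measurable (lebesgue_on U)"
        by (intro borel_measurable_times)
    qed
    then have "(LINT x|lebesgue_on U. g x * indicator (box a c) x) = 0"
      using zero[OF \<phi>(1)] by (simp add: LIMSEQ_const_iff)
    then have "(LINT x|lebesgue. indicator U x *\<^sub>R (g x * indicator (box a c) x)) = 0"
      using U by (subst (asm) integral_restrict_space) auto
    moreover have "(LINT x|lebesgue. indicator (box a c) x * g x)
        = (LINT x|lebesgue. indicator U x *\<^sub>R (g x * indicator (box a c) x))"
    proof (rule Bochner_Integration.integral_cong[OF refl])
      fix x
      show "indicator (box a c) x * g x = indicator U x *\<^sub>R (g x * indicator (box a c) x)"
        using that' box_subset_cbox[of a c] by (auto simp: indicator_def)
    qed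
    ultimately show ?thesis by (rule trans[rotated])
  qed
  have cbox_null: "AE x in lebesgue. x \<in> cbox a c \<longrightarrow> g x = 0" if ac: "cbox a c \<subseteq> U" for a c
  proof -
    let ?h = "\<lambda>x. indicator (box a c) x * g x"
    have hG: "?h = (\<lambda>x. indicator (box a c) x *\<^sub>R (indicator U x * g x))"
      using ac box_subset_cbox[of a c] by (auto simp: indicator_def fun_eq_iff)
    have h: "integrable lebesgue ?h" unfolding hG by (rule integrable_mult_indicator[OF _ G]) simp
    \<comment> \<open>The induction over the generated sigma-algebra reaches only Borel sets, while
      g is merely Lebesgue measurable; hence a Borel version.\<close>
    then obtain h' where h': "h' \<in> borel_measurable lborel" "AE x in lborel. ?h x = h' x"
      using completion_ex_borel_measurable_real[of ?h lborel] by blast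
    have AEl: "AE x in lebesgue. ?h x = h' x" using h'(2) by (rule AE_completion)
    have h'c: "h' \<in> borel_measurable lebesgue" using h'(1) by (rule measurable_completion)
    have ilh': "integrable lebesgue h'" using integrable_cong_AE[OF _ h'c AEl] h by auto
    then have ih': "integrable lborel h'" using integrable_completion[OF h'(1)] by simp
    have ihA: "integrable lborel (\<lambda>x. indicator A x *\<^sub>R h' x)" if "A \<in> sets borel" for A
      using that by (intro integrable_mult_indicator ih') simp
    have "(LINT x:A|lborel. h' x) = 0" if "A \<in> sets borel" for A
    proof -
      have stable: "Int_stable (range (\<lambda>(a, b). box a b :: 'a set))"
      proof (rule Int_stableI)
        fix X Y :: "'a set" assume "X \<in> range (\<lambda>(a, b). box a b)" "Y \<in> range (\<lambda>(a, b). box a b)"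
        then obtain p q p' q' where "X = box p q" "Y = box p' q'" by auto
        then show "X \<inter> Y \<in> range (\<lambda>(a, b). box a b)"
          by (simp only: box_Int_box) (rule range_eqI[of _ _ "(_, _)"], simp only: split)
      qed
      have "A \<in> sigma_sets UNIV (range (\<lambda>(a, b). box a b))" using that unfolding borel_eq_box by simp
      then show ?thesis
      proof (induction rule: sigma_sets_induct_disjoint[OF stable Pow_UNIV[THEN equalityD2, THEN subset_trans[OF subset_UNIV]], consumes 1, case_names basic empty compl union])
        case (basic A)
        then obtain p q where A: "A = box p q" by auto
        have "(LINT x:A|lborel. h' x) = (LINT x|lebesgue. indicator A x *\<^sub>R h' x)"
          unfolding set_lebesgue_integral_def using A h'(1) by (intro integral_completion[symmetric]) auto
        also have "... = (LINT x|lebesgue. indicator A x *\<^sub>R ?h x)"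
        proof (rule integral_cong_AE)
          have A': "A \<in> sets lebesgue" using A by simp
          show "(\<lambda>x. indicator A x *\<^sub>R h' x) \<in> borel_measurable lebesgue"
            using integrable_mult_indicator[OF A' ilh'] by (rule borel_measurable_integrable)
          show "(\<lambda>x. indicator A x *\<^sub>R ?h x) \<in> borel_measurable lebesgue"
            using integrable_mult_indicator[OF A' h] by (rule borel_measurable_integrable)
          show "AE x in lebesgue. indicator A x *\<^sub>R h' x = indicator A x *\<^sub>R ?h x"
            using AEl by eventually_elim (simp only:)
        qed
        also have "... = (LINT x|lebesgue. indicator (box p q \<inter> box a c) x * g x)"
          by (intro Bochner_Integration.integral_cong) (auto simp: A indicator_def)
        also have "... = 0"
        proof -
          obtain p' q' where pq: "box p q \<inter> box a c = box p' q'" by (rule that, rule box_Int_box)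
          show ?thesis
          \<comment> \<open>An empty open box may belong to a nonempty degenerate closed box, about
            whose position nothing is known. For a nonempty one the closed box is the closure, and
            so lies in \<open>cbox a c\<close>.\<close>
          proof (cases "box p' q' = {}")
            case False
            then have "cbox p' q' = closure (box p' q')" by (simp add: closure_box)
            also have "... \<subseteq> cbox a c" using pq box_subset_cbox[of a c] by (intro closure_minimal) auto
            finally show ?thesis using ac unfolding pq by (intro box0) auto
          qed (simp add: pq)
        qed
        finally show ?case .
      next
        case (compl A)
        have Am: "A \<in> sets borel" using compl(1) unfolding borel_eq_box by simp
        have tot: "(LINT x|lborel. h' x) = 0"
        proof -
          have "(LINT x|lborel. h' x) = (LINT x|lebesgue. ?h x)"
            using AEl h h'c by (subst integral_completion[symmetric, OF h'(1)], intro integral_cong_AE) auto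
          then show ?thesis using box0[OF ac] by simp
        qed
        have "(LINT x:UNIV - A|lborel. h' x) = (LINT x|lborel. h' x - indicator A x *\<^sub>R h' x)"
          unfolding set_lebesgue_integral_def by (intro Bochner_Integration.integral_cong) (auto simp: indicator_def)
        also have "... = 0" using compl(2) tot Am by (subst Bochner_Integration.integral_diff)
            (use ih' ihA[OF Am] in \<open>auto simp: set_lebesgue_integral_def\<close>)
        finally show ?case .
      next
        case (union A)
        have Am: "A i \<in> sets borel" for i using union(2) unfolding borel_eq_box by auto
        then have "(LINT x:(\<Union>i. A i)|lborel. h' x) = (\<Sum>i. LINT x:A i|lborel. h' x)"
          using union(1) unfolding disjoint_family_on_def
          by (intro lebesgue_integral_countable_add) (use ihA[of "\<Union>i. A i"] in \<open>auto simp: set_integrable_def\<close>)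
        then show ?case using union(3) by simp
      qed (auto simp: set_lebesgue_integral_def)
    qed
    then have "AE x in lborel. h' x = 0"
      using ih' by (intro density_unique_real) (auto simp: set_lebesgue_integral_def)
    then have "AE x in lebesgue. h' x = 0" by (rule AE_completion)
    moreover have "AE x in lebesgue. x \<notin> cbox a c - box a c"
    proof (rule AE_not_in)
      have "negligible (cbox a c - box a c)" by (rule negligible_frontier_interval)
      then show "cbox a c - box a c \<in> null_sets lebesgue" by (simp add: negligible_iff_null_sets)
    qed
    ultimately show ?thesis using AEl by eventually_elim (auto simp: indicator_def)
  qed
  obtain D where D: "countable D" "D \<subseteq> Pow U" "\<And>X. X \<in> D \<Longrightarrow> \<exists>a b. X = cbox a b" "\<Union>D = U"
    using open_countable_Union_open_cbox[OF assms(1)] by metis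
  have "AE x in lebesgue. \<forall>X\<in>D. x \<in> X \<longrightarrow> g x = 0"
    unfolding AE_ball_countable[OF D(1)] using D(2,3) cbox_null by (metis PowD subsetD)
  then have "AE x in lebesgue. x \<in> U \<longrightarrow> g x = 0" by eventually_elim (use D(4) in auto)
  then show ?thesis using U by (subst AE_restrict_space_iff) auto
qed

section \<open>Compactly supported differentiable functions\<close>

definition dd :: "('a::euclidean_space \<Rightarrow> real) \<Rightarrow> 'a \<Rightarrow> 'a \<Rightarrow> real" where
  "dd \<phi> z x = frechet_derivative \<phi> (at x) z"

definition C1c :: "('a::euclidean_space \<Rightarrow> real) \<Rightarrow> bool" where
  "C1c \<phi> \<longleftrightarrow> Ck (Suc 0) \<phi> \<and> compact (closure {x. \<phi> x \<noteq> 0})"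

lemma test_function_C1c: "\<phi> \<in> test_functions U \<Longrightarrow> C1c \<phi>"
  unfolding C1c_def by (intro conjI test_functionsD(1) test_functionsD(2))

lemma integral_translation:
  fixes f :: "'a::euclidean_space \<Rightarrow> real"
  assumes "f \<in> borel_measurable borel"
  shows "(LINT x|lborel. f (x + c)) = (LINT x|lborel. f x)"
proof -
  have "(LINT x|lborel. f x) = (LINT x|distr lborel borel ((+) c). f x)" by (simp add: lborel_distr_plus)
  also have "... = (LINT x|lborel. f (c + x))" using assms by (subst integral_distr) auto
  finally show ?thesis by (simp add: add.commute)
qed

lemma integrable_translation:
  fixes f :: "'a::euclidean_space \<Rightarrow> real"
  assumes "integrable lborel f" shows "integrable lborel (\<lambda>x. f (x + c))"
proof -
  have "integrable (distr lborel borel ((+) c)) f" using assms by (simp add: lborel_distr_plus)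
  from integrable_distr[OF _ this] show ?thesis by (simp add: add.commute)
qed

lemma nn_integral_translation:
  fixes f :: "'a::euclidean_space \<Rightarrow> ennreal"
  assumes "f \<in> borel_measurable borel"
  shows "(\<integral>\<^sup>+x. f (x + c) \<partial>lborel) = (\<integral>\<^sup>+x. f x \<partial>lborel)"
proof -
  have "(\<integral>\<^sup>+x. f x \<partial>lborel) = (\<integral>\<^sup>+x. f x \<partial>distr lborel borel ((+) c))" by (simp add: lborel_distr_plus)
  also have "... = (\<integral>\<^sup>+x. f (c + x) \<partial>lborel)" using assms by (subst nn_integral_distr) auto
  finally show ?thesis by (simp add: add.commute)
qed

lemma integrable_continuous_support:
  fixes f :: "'a::euclidean_space \<Rightarrow> real"
  assumes "continuous_on UNIV f" "bounded {x. f x \<noteq> 0}"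
  shows "integrable lborel f"
proof -
  have K: "compact (closure {x. f x \<noteq> 0})" using assms(2) by (simp add: compact_closure)
  have "integrable lborel (\<lambda>x. indicator (closure {x. f x \<noteq> 0}) x *\<^sub>R f x)"
    by (rule borel_integrable_compact[OF K continuous_on_subset[OF assms(1) subset_UNIV]])
  moreover have "(\<lambda>x. indicator (closure {x. f x \<noteq> 0}) x *\<^sub>R f x) = f"
  proof
    fix x
    have "f x = 0" if "x \<notin> closure {x. f x \<noteq> 0}"
      using that subsetD[OF closure_subset, of x "{x. f x \<noteq> 0}"] by (cases "f x = 0") simp_all
    then show "indicator (closure {x. f x \<noteq> 0}) x *\<^sub>R f x = f x"
      by (cases "x \<in> closure {x. f x \<noteq> 0}") simp_all
  qed
  ultimately show ?thesis by simp
qed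

context
  fixes \<phi> :: "'a::euclidean_space \<Rightarrow> real"
  assumes C: "C1c \<phi>"
begin

lemma C1c_has_derivative: "(\<phi> has_derivative (\<lambda>z. dd \<phi> z x)) (at x)"
  using C Ck_Suc_has_derivative[of 0 \<phi> x] by (simp add: C1c_def dd_def del: Ck.simps)

lemma C1c_dd_linear: "linear (\<lambda>z. dd \<phi> z x)" using C1c_has_derivative by (rule has_derivative_linear)

lemma C1c_dd_scale: "dd \<phi> (c *\<^sub>R z) x = c * dd \<phi> z x"
  using linear_scale[OF C1c_dd_linear[of x], of c z] by simp

lemma C1c_continuous: "continuous_on UNIV \<phi>"
  using C1c_has_derivative by (intro continuous_at_imp_continuous_on) (auto intro: has_derivative_continuous)

lemma C1c_measurable: "\<phi> \<in> borel_measurable borel"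
  using C1c_continuous by (rule borel_measurable_continuous_onI)

lemma C1c_support: "bounded {x. \<phi> x \<noteq> 0}"
  using C bounded_subset[OF compact_imp_bounded closure_subset] unfolding C1c_def by simp

lemma C1c_dd_outside: "x \<notin> closure {x. \<phi> x \<noteq> 0} \<Longrightarrow> dd \<phi> z x = 0"
proof -
  assume x: "x \<notin> closure {x. \<phi> x \<noteq> 0}"
  have out: "0 = \<phi> y" if "y \<in> - closure {x. \<phi> x \<noteq> 0}" for y
    using that subsetD[OF closure_subset, of y "{x. \<phi> x \<noteq> 0}"] by (cases "\<phi> y = 0") simp_all
  have "(\<phi> has_derivative (\<lambda>z. 0)) (at x)"
  proof (rule has_derivative_transform_within_open[where f = "\<lambda>x. 0" and s = "- closure {x. \<phi> x \<noteq> 0}"])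
    show "((\<lambda>x. 0 :: real) has_derivative (\<lambda>z. 0)) (at x)" by (rule has_derivative_const)
    show "open (- closure {x. \<phi> x \<noteq> 0})" by (rule open_Compl[OF closed_closure])
    show "x \<in> - closure {x. \<phi> x \<noteq> 0}" using x by simp
  qed (rule out)
  from has_derivative_unique[OF C1c_has_derivative this] show ?thesis by (rule fun_cong)
qed

lemma C1c_dd_expand: "dd \<phi> z x = (\<Sum>b\<in>Basis. (z \<bullet> b) * dd \<phi> b x)"
proof -
  interpret linear "\<lambda>z. dd \<phi> z x" by (rule C1c_dd_linear)
  have "dd \<phi> (\<Sum>b\<in>Basis. (z \<bullet> b) *\<^sub>R b) x = (\<Sum>b\<in>Basis. (z \<bullet> b) * dd \<phi> b x)" by (simp add: sum scaleR)
  then show ?thesis by (simp add: euclidean_representation)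
qed

lemma C1c_dd_continuous: "continuous_on UNIV (dd \<phi> z)"
proof -
  have "continuous_on UNIV (dd \<phi> b)" if "b \<in> Basis" for b using C that by (auto simp: C1c_def dd_def[abs_def])
  then have "continuous_on UNIV (\<lambda>x. \<Sum>b\<in>Basis. (z \<bullet> b) * dd \<phi> b x)" by (intro continuous_intros) auto
  then show ?thesis by (simp add: C1c_dd_expand[symmetric])
qed

lemma C1c_dd_support: "bounded {x. dd \<phi> z x \<noteq> 0}"
proof (rule bounded_subset)
  show "bounded (closure {x. \<phi> x \<noteq> 0})" using C1c_support by (rule bounded_closure)
  show "{x. dd \<phi> z x \<noteq> 0} \<subseteq> closure {x. \<phi> x \<noteq> 0}"
  proof
    fix x assume "x \<in> {x. dd \<phi> z x \<noteq> 0}"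
    then show "x \<in> closure {x. \<phi> x \<noteq> 0}" using C1c_dd_outside[of x z] by (cases "x \<in> closure {x. \<phi> x \<noteq> 0}") simp_all
  qed
qed

lemma C1c_dd_bounded: "\<exists>M\<ge>0. \<forall>x. \<bar>dd \<phi> z x\<bar> \<le> M"
proof -
  let ?K = "closure {x. \<phi> x \<noteq> 0}"
  have "compact ?K" using C by (simp add: C1c_def)
  then have "compact (dd \<phi> z ` ?K)"
    by (rule compact_continuous_image[OF continuous_on_subset[OF C1c_dd_continuous subset_UNIV]])
  then obtain M where M: "\<And>x. x \<in> ?K \<Longrightarrow> \<bar>dd \<phi> z x\<bar> \<le> M"
    using compact_imp_bounded[of "dd \<phi> z ` ?K"] unfolding bounded_iff real_norm_def by blast
  have "\<bar>dd \<phi> z x\<bar> \<le> max M 0" for x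
  proof (cases "x \<in> ?K")
    case True then show ?thesis using M[of x] by linarith
  next
    case False then show ?thesis using C1c_dd_outside[of x z] by simp
  qed
  then show ?thesis by (intro exI[of _ "max M 0"] conjI allI) simp_all
qed

lemma C1c_mvt: "\<exists>y. \<phi> (x + z) - \<phi> x = dd \<phi> z y"
proof -
  have "((\<lambda>t. \<phi> (x + t *\<^sub>R z)) has_derivative (\<lambda>s. dd \<phi> (s *\<^sub>R z) (x + t *\<^sub>R z))) (at t within {0..1})" for t
  proof -
    have "((\<lambda>t. x + t *\<^sub>R z) has_derivative (\<lambda>s. s *\<^sub>R z)) (at t within {0..1})"
      by (auto intro!: derivative_eq_intros)
    from has_derivative_compose[OF this C1c_has_derivative] show ?thesis .
  qed
  from mvt_simple[of 0 1 "\<lambda>t. \<phi> (x + t *\<^sub>R z)", OF _ this] show ?thesis by auto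
qed

definition dquot :: "'a \<Rightarrow> nat \<Rightarrow> 'a \<Rightarrow> real" where
  "dquot z n x = real (Suc n) * (\<phi> (x + z /\<^sub>R real (Suc n)) - \<phi> x)"

lemma dquot_tendsto: "(\<lambda>n. dquot z n x) \<longlonglongrightarrow> dd \<phi> z x"
proof -
  have "((\<lambda>t. \<phi> (x + t *\<^sub>R z)) has_derivative (\<lambda>s. dd \<phi> (s *\<^sub>R z) (x + 0 *\<^sub>R z))) (at 0)"
  proof -
    have "((\<lambda>t. x + t *\<^sub>R z) has_derivative (\<lambda>s. s *\<^sub>R z)) (at 0)" by (auto intro!: derivative_eq_intros)
    from has_derivative_compose[OF this C1c_has_derivative] show ?thesis .
  qed
  moreover have "(\<lambda>s. dd \<phi> (s *\<^sub>R z) (x + 0 *\<^sub>R z)) = (*) (dd \<phi> z x)" by (simp add: C1c_dd_scale fun_eq_iff)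
  ultimately have "((\<lambda>t. \<phi> (x + t *\<^sub>R z)) has_real_derivative dd \<phi> z x) (at 0)"
    by (simp only: has_field_derivative_def)
  note this[unfolded DERIV_def]
  moreover have "filterlim (\<lambda>n. inverse (real (Suc n))) (at 0) sequentially"
    using LIMSEQ_inverse_real_of_nat by (simp add: filterlim_at)
  ultimately have "(\<lambda>n. (\<phi> (x + (0 + inverse (real (Suc n))) *\<^sub>R z) - \<phi> (x + 0 *\<^sub>R z)) / inverse (real (Suc n))) \<longlonglongrightarrow> dd \<phi> z x"
    by (rule filterlim_compose)
  then show ?thesis by (simp add: dquot_def divide_inverse mult.commute)
qed

text \<open>A common majorant for dominated convergence. The mean value theorem bounds the
  quotients, and outside the ball of radius R0 + norm z both function values vanish since the
  increment is never longer than z.\<close>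

lemma dquot_bound:
  obtains M R where "M \<ge> 0" "\<And>n x. \<bar>dquot z n x\<bar> \<le> M * indicator (cball 0 R) x"
proof -
  obtain R0 where R0: "\<And>x. \<phi> x \<noteq> 0 \<Longrightarrow> norm x \<le> R0" using C1c_support unfolding bounded_iff by blast
  obtain M where M: "M \<ge> 0" "\<And>x. \<bar>dd \<phi> z x\<bar> \<le> M" using C1c_dd_bounded by blast
  have "\<bar>dquot z n x\<bar> \<le> M * indicator (cball 0 (R0 + norm z)) x" for n x
  proof (cases "x \<in> cball 0 (R0 + norm z)")
    case True
    obtain y where "\<phi> (x + z /\<^sub>R real (Suc n)) - \<phi> x = dd \<phi> (z /\<^sub>R real (Suc n)) y" using C1c_mvt by blast
    also have "... = inverse (real (Suc n)) * dd \<phi> z y" by (rule C1c_dd_scale)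
    finally have "dquot z n x = dd \<phi> z y" by (simp add: dquot_def)
    then show ?thesis using True M by simp
  next
    case False
    have "norm (z /\<^sub>R real (Suc n)) \<le> norm z"
      using mult_right_mono[of "inverse (real (Suc n))" 1 "norm z"] by (simp add: field_simps)
    then have "R0 < norm (x + z /\<^sub>R real (Suc n))" "R0 < norm x"
      using False norm_triangle_ineq2[of x "- (z /\<^sub>R real (Suc n))"] norm_ge_zero[of z]
      by (auto simp del: norm_ge_zero)
    then have "\<phi> (x + z /\<^sub>R real (Suc n)) = 0" "\<phi> x = 0" using R0 by fastforce+
    then show ?thesis using False by (simp add: dquot_def)
  qed
  then show ?thesis using that M(1) by blast
qed

lemma dquot_measurable [measurable]: "dquot z n \<in> borel_measurable borel"
  unfolding dquot_def using C1c_measurable by simp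

lemma dd_measurable [measurable]: "dd \<phi> z \<in> borel_measurable borel"
  using C1c_dd_continuous by (rule borel_measurable_continuous_onI)

text \<open>Difference quotients have integral zero by translation invariance. Applied to a product,
  the limit is the integration by parts formula.\<close>

lemma integral_dd_zero: "(LINT x|lborel. dd \<phi> z x) = 0"
proof -
  note [measurable] = C1c_measurable
  obtain M R where MR: "M \<ge> 0" "\<And>n x. \<bar>dquot z n x\<bar> \<le> M * indicator (cball 0 R) x" using dquot_bound by metis
  have i\<phi>: "integrable lborel \<phi>" by (rule integrable_continuous_support[OF C1c_continuous C1c_support])
  have "(\<lambda>n. LINT x|lborel. dquot z n x) \<longlonglongrightarrow> (LINT x|lborel. dd \<phi> z x)"
  proof (rule integral_dominated_convergence)
    show "integrable lborel (\<lambda>x. M * indicator (cball (0::'a) R) x :: real)"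
      by (intro integrable_mult_right integrable_real_indicator) (use emeasure_lborel_cball_finite[of "0::'a" R] in simp_all)
    show "AE x in lborel. (\<lambda>n. dquot z n x) \<longlonglongrightarrow> dd \<phi> z x" by (intro AE_I2 dquot_tendsto)
    show "AE x in lborel. norm (dquot z n x) \<le> M * indicator (cball 0 R) x" for n
      unfolding real_norm_def by (intro AE_I2 MR(2))
  qed (measurable, measurable)
  moreover have "(LINT x|lborel. dquot z n x) = 0" for n
  proof -
    note integrable_translation[OF i\<phi>, of "z /\<^sub>R real (Suc n)"]
    then show ?thesis unfolding dquot_def using i\<phi> integral_translation[of \<phi> "z /\<^sub>R real (Suc n)"] by simp
  qed
  ultimately show ?thesis by (simp add: LIMSEQ_const_iff)
qed

lemma C1c_dd_sq_integrable: "integrable lborel (\<lambda>x. (dd \<phi> z x)\<^sup>2)"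
  by (rule integrable_continuous_support) (use C1c_dd_support C1c_dd_continuous in \<open>auto intro: continuous_intros\<close>)

lemma C1c_diff_sq_integrable: "integrable lborel (\<lambda>x. (\<phi> (x + z) - \<phi> (x + y))\<^sup>2)"
proof (rule integrable_continuous_support)
  show "continuous_on UNIV (\<lambda>x. (\<phi> (x + z) - \<phi> (x + y))\<^sup>2)"
    by (intro continuous_intros continuous_on_compose2[OF C1c_continuous]) auto
  obtain R where R: "\<And>x. \<phi> x \<noteq> 0 \<Longrightarrow> norm x \<le> R" using C1c_support unfolding bounded_iff by blast
  have "norm x \<le> R + norm z + norm y" if "\<phi> (x + z) - \<phi> (x + y) \<noteq> 0" for x
  proof -
    have "\<phi> (x + z) \<noteq> 0 \<or> \<phi> (x + y) \<noteq> 0" using that by auto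
    then have "norm (x + z) \<le> R \<or> norm (x + y) \<le> R" using R by blast
    moreover have "norm x \<le> norm (x + z) + norm z" "norm x \<le> norm (x + y) + norm y"
      using norm_triangle_ineq4[of "x + z" z] norm_triangle_ineq4[of "x + y" y] by simp_all
    ultimately show ?thesis using norm_ge_zero[of y] norm_ge_zero[of z] by linarith
  qed
  then show "bounded {x. (\<phi> (x + z) - \<phi> (x + y))\<^sup>2 \<noteq> 0}" unfolding bounded_iff by auto
qed

text \<open>The increment over \<open>z\<close> is a sum of \<open>n\<close> increments over \<open>z / n\<close>, which have equal norms by
  translation invariance; then \<open>n \<rightarrow> \<infinity>\<close>.\<close>

lemma integral_increment_le: "(LINT x|lborel. (\<phi> (x + z) - \<phi> x)\<^sup>2) \<le> (LINT x|lborel. (dd \<phi> z x)\<^sup>2)"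
proof -
  note [measurable] = C1c_measurable
  obtain M R where MR: "M \<ge> 0" "\<And>n x. \<bar>dquot z n x\<bar> \<le> M * indicator (cball 0 R) x" using dquot_bound by metis
  have "(\<lambda>n. LINT x|lborel. (dquot z n x)\<^sup>2) \<longlonglongrightarrow> (LINT x|lborel. (dd \<phi> z x)\<^sup>2)"
  proof (rule integral_dominated_convergence)
    show "integrable lborel (\<lambda>x. M\<^sup>2 * indicator (cball (0::'a) R) x :: real)"
      by (intro integrable_mult_right integrable_real_indicator) (use emeasure_lborel_cball_finite[of "0::'a" R] in simp_all)
    show "AE x in lborel. (\<lambda>n. (dquot z n x)\<^sup>2) \<longlonglongrightarrow> (dd \<phi> z x)\<^sup>2"
      using dquot_tendsto by (intro AE_I2 tendsto_power)
    show "AE x in lborel. norm ((dquot z n x)\<^sup>2) \<le> M\<^sup>2 * indicator (cball 0 R) x" for n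
    proof (intro AE_I2)
      fix x show "norm ((dquot z n x)\<^sup>2) \<le> M\<^sup>2 * indicator (cball 0 R) x"
      proof -
        have "\<bar>dquot z n x\<bar>\<^sup>2 \<le> (M * indicator (cball 0 R) x)\<^sup>2" by (rule power_mono[OF MR(2) abs_ge_zero])
        then show ?thesis by (cases "x \<in> cball 0 R") simp_all
      qed
    qed
  qed simp_all
  moreover have "(LINT x|lborel. (\<phi> (x + z) - \<phi> x)\<^sup>2) \<le> (LINT x|lborel. (dquot z n x)\<^sup>2)" for n
  proof -
    let ?w = "z /\<^sub>R real (Suc n)"
    let ?\<delta> = "\<lambda>j x. \<phi> (x + real (Suc j) *\<^sub>R ?w) - \<phi> (x + real j *\<^sub>R ?w)"
    have tele: "\<phi> (x + z) - \<phi> x = (\<Sum>j<Suc n. ?\<delta> j x)" for x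
      using sum_lessThan_telescope[of "\<lambda>j. \<phi> (x + real j *\<^sub>R ?w)" "Suc n"] by simp
    have int: "integrable lborel (\<lambda>x. (?\<delta> j x)\<^sup>2)" for j by (rule C1c_diff_sq_integrable)
    have "(LINT x|lborel. (\<phi> (x + z) - \<phi> x)\<^sup>2) \<le> (LINT x|lborel. (\<Sum>j<Suc n. (?\<delta> j x)\<^sup>2) * real (Suc n))"
    proof (rule integral_mono)
      show "integrable lborel (\<lambda>x. (\<phi> (x + z) - \<phi> x)\<^sup>2)" using C1c_diff_sq_integrable[of z 0] by simp
      show "integrable lborel (\<lambda>x. (\<Sum>j<Suc n. (?\<delta> j x)\<^sup>2) * real (Suc n))"
        by (intro integrable_mult_left Bochner_Integration.integrable_sum int)
      show "(\<phi> (x + z) - \<phi> x)\<^sup>2 \<le> (\<Sum>j<Suc n. (?\<delta> j x)\<^sup>2) * real (Suc n)" for x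
        unfolding tele using sum_squared_le_sum_of_squares[of "\<lambda>j. ?\<delta> j x" "{..<Suc n}"] by simp
    qed
    also have "... = (\<Sum>j<Suc n. LINT x|lborel. (?\<delta> j x)\<^sup>2) * real (Suc n)"
      by (subst integral_mult_left_zero, subst Bochner_Integration.integral_sum) (use int in auto)
    also have "... = (\<Sum>j<Suc n. LINT x|lborel. (\<phi> (x + ?w) - \<phi> x)\<^sup>2) * real (Suc n)"
    proof -
      have "(LINT x|lborel. (?\<delta> j x)\<^sup>2) = (LINT x|lborel. (\<phi> (x + ?w) - \<phi> x)\<^sup>2)" for j
      proof -
        have "(\<lambda>x. (?\<delta> j x)\<^sup>2) = (\<lambda>x. (\<phi> ((x + real j *\<^sub>R ?w) + ?w) - \<phi> (x + real j *\<^sub>R ?w))\<^sup>2)"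
          by (simp add: algebra_simps)
        then show ?thesis using integral_translation[of "\<lambda>x. (\<phi> (x + ?w) - \<phi> x)\<^sup>2" "real j *\<^sub>R ?w"] by simp
      qed
      then show ?thesis by simp
    qed
    also have "... = (LINT x|lborel. (dquot z n x)\<^sup>2)"
    proof -
      have "(dquot z n x)\<^sup>2 = (real (Suc n))\<^sup>2 * (\<phi> (x + ?w) - \<phi> x)\<^sup>2" for x
        by (simp only: dquot_def power_mult_distrib)
      then show ?thesis
        by (simp only: integral_mult_right_zero sum_constant card_lessThan) (simp add: power2_eq_square)
    qed
    finally show ?thesis .
  qed
  ultimately show ?thesis by (intro LIMSEQ_le_const) auto
qed

definition energy :: real where "energy = (\<Sum>b\<in>Basis. LINT x|lborel. (dd \<phi> b x)\<^sup>2)"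

lemma energy_nonneg: "energy \<ge> 0" unfolding energy_def by (intro sum_nonneg integral_nonneg_AE) auto

lemma integral_dd_le: "(LINT x|lborel. (dd \<phi> z x)\<^sup>2) \<le> (norm z)\<^sup>2 * energy"
proof -
  have "(LINT x|lborel. (dd \<phi> z x)\<^sup>2) \<le> (LINT x|lborel. (norm z)\<^sup>2 * (\<Sum>b\<in>Basis. (dd \<phi> b x)\<^sup>2))"
  proof (rule integral_mono)
    show "integrable lborel (\<lambda>x. (norm z)\<^sup>2 * (\<Sum>b\<in>Basis. (dd \<phi> b x)\<^sup>2))"
      by (intro integrable_mult_right Bochner_Integration.integrable_sum C1c_dd_sq_integrable)
    show "(dd \<phi> z x)\<^sup>2 \<le> (norm z)\<^sup>2 * (\<Sum>b\<in>Basis. (dd \<phi> b x)\<^sup>2)" for x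
    proof -
      have "(norm z)\<^sup>2 = (\<Sum>b\<in>Basis. (z \<bullet> b)\<^sup>2)"
        unfolding power2_norm_eq_inner using euclidean_inner[of z z] by (simp add: power2_eq_square)
      then show ?thesis unfolding C1c_dd_expand[of z]
        using Cauchy_Schwarz_ineq_sum[of "\<lambda>b. z \<bullet> b" "\<lambda>b. dd \<phi> b x" Basis] by simp
    qed
  qed (rule C1c_dd_sq_integrable)
  also have "... = (norm z)\<^sup>2 * energy"
    unfolding energy_def by (subst integral_mult_right_zero, subst Bochner_Integration.integral_sum) (use C1c_dd_sq_integrable in auto)
  finally show ?thesis .
qed

lemma C1c_sq_integrable: "integrable lborel (\<lambda>x. (\<phi> x)\<^sup>2)"
  by (rule integrable_continuous_support) (use C1c_support C1c_continuous in \<open>auto intro: continuous_intros\<close>)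

text \<open>A translation by more than the diameter makes the supports disjoint.\<close>

lemma poincare:
  assumes "R > 0" "\<And>x. \<phi> x \<noteq> 0 \<Longrightarrow> norm x < R"
  shows "(LINT x|lborel. (\<phi> x)\<^sup>2) \<le> 2 * R\<^sup>2 * energy"
proof -
  note [measurable] = C1c_measurable
  obtain b :: 'a where b: "b \<in> Basis" using nonempty_Basis by blast
  let ?z = "(2 * R) *\<^sub>R b"
  have eq: "(\<phi> (x + ?z) - \<phi> x)\<^sup>2 = (\<phi> (x + ?z))\<^sup>2 + (\<phi> x)\<^sup>2" for x
  proof -
    have "\<phi> (x + ?z) = 0 \<or> \<phi> x = 0"
    proof (rule ccontr)
      assume "\<not> ?thesis"
      then have "norm (x + ?z) < R" "norm x < R" using assms(2) by auto
      moreover have "norm ?z \<le> norm (x + ?z) + norm x" using norm_triangle_ineq4[of "x + ?z" x] by simp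
      moreover have "norm ?z = 2 * R" using b assms(1) by simp
      ultimately show False by linarith
    qed
    then show ?thesis by auto
  qed
  note t = integrable_translation[OF C1c_sq_integrable, of ?z]
  have "2 * (LINT x|lborel. (\<phi> x)\<^sup>2) = (LINT x|lborel. (\<phi> (x + ?z) - \<phi> x)\<^sup>2)"
    unfolding eq using t C1c_sq_integrable integral_translation[of "\<lambda>x. (\<phi> x)\<^sup>2" ?z] by simp
  also have "... \<le> (norm ?z)\<^sup>2 * energy" using integral_increment_le integral_dd_le by (rule order_trans)
  also have "... = 4 * R\<^sup>2 * energy" using b by (simp add: power_mult_distrib)
  finally show ?thesis by (simp add: ac_simps)
qed

end

section \<open>Compactness\<close>

text \<open>The floor function makes the cubes of side h half-open, so that they partition the space
  without exceptional faces.\<close>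

definition cube :: "real \<Rightarrow> ('a::euclidean_space \<Rightarrow> int) \<Rightarrow> 'a set" where
  "cube h k = {x. \<forall>b\<in>Basis. \<lfloor>(x \<bullet> b) / h\<rfloor> = k b}"

lemma cube_measurable [measurable]: "cube h k \<in> sets borel"
proof -
  have "cube h k = (\<Inter>b\<in>Basis. {x \<in> space borel. \<lfloor>(x \<bullet> b) / h\<rfloor> = k b})" by (auto simp: cube_def)
  moreover have "{x \<in> space borel. \<lfloor>((x::'a) \<bullet> b) / h\<rfloor> = k b} \<in> sets borel" for b by measurable
  ultimately show ?thesis by (auto intro!: sets.finite_INT)
qed

lemma emeasure_cube:
  fixes k :: "'a::euclidean_space \<Rightarrow> int"
  assumes "h > 0" shows "emeasure lborel (cube h k) = ennreal (h ^ DIM('a))"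
proof -
  define l :: 'a where "l = (\<Sum>b\<in>Basis. (h * k b) *\<^sub>R b)"
  define u :: 'a where "u = (\<Sum>b\<in>Basis. (h * (k b + 1)) *\<^sub>R b)"
  have lu: "l \<bullet> b = h * k b" "u \<bullet> b = h * (k b + 1)" if "b \<in> Basis" for b
    using that by (simp_all add: l_def u_def)
  have fl: "\<lfloor>(x \<bullet> b) / h\<rfloor> = k b \<longleftrightarrow> l \<bullet> b \<le> x \<bullet> b \<and> x \<bullet> b < u \<bullet> b" if "b \<in> Basis" for b and x :: 'a
    using assms by (simp add: lu that floor_eq_iff pos_le_divide_eq pos_divide_less_eq mult.commute)
  have sub: "box l u \<subseteq> cube h k" "cube h k \<subseteq> cbox l u" by (auto simp: cube_def mem_box fl less_imp_le)
  have le: "\<forall>b\<in>Basis. l \<bullet> b \<le> u \<bullet> b" using assms by (simp add: lu algebra_simps)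
  have vol: "(\<Prod>b\<in>Basis. (u - l) \<bullet> b) = h ^ DIM('a)" by (simp add: inner_diff_left lu algebra_simps)
  have "emeasure lborel (box l u) \<le> emeasure lborel (cube h k)"
    "emeasure lborel (cube h k) \<le> emeasure lborel (cbox l u)" using sub by (auto intro!: emeasure_mono)
  then show ?thesis using le vol by (simp add: emeasure_lborel_box_eq emeasure_lborel_cbox_eq)
qed

lemma same_cube_diff:
  assumes "x \<in> cube h k" "y \<in> cube h k" "h > 0"
  shows "y - x \<in> cbox (- (h *\<^sub>R One)) (h *\<^sub>R One)"
proof -
  have "\<bar>(y - x) \<bullet> b\<bar> \<le> h" if "b \<in> Basis" for b
  proof -
    have "\<bar>(y \<bullet> b) / h - (x \<bullet> b) / h\<bar> < 1"
    proof -
      have "\<lfloor>(x \<bullet> b) / h\<rfloor> = k b" "\<lfloor>(y \<bullet> b) / h\<rfloor> = k b" using assms(1,2) that by (auto simp: cube_def)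
      then show ?thesis unfolding floor_eq_iff by linarith
    qed
    then have "\<bar>(y \<bullet> b - x \<bullet> b) / h\<bar> < 1" by (simp add: diff_divide_distrib)
    then show ?thesis using assms(3) by (simp add: inner_diff_left abs_divide)
  qed
  then show ?thesis by (fastforce simp: mem_box abs_le_iff)
qed

text \<open>Expanding the square and integrating twice. On a cell this trades the mean square for
  the average plus increments, and increments are controlled by the gradient.\<close>

lemma variance_identity:
  fixes \<phi> :: "'a::euclidean_space \<Rightarrow> real"
  assumes C: "C1c \<phi>" and Q [measurable]: "Q \<in> sets borel" and q: "emeasure lborel Q = ennreal q" "q \<ge> 0"
  shows "(\<integral>\<^sup>+x. \<integral>\<^sup>+y. ennreal (indicator Q x * (indicator Q y * (\<phi> x - \<phi> y)\<^sup>2)) \<partial>lborel \<partial>lborel)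
    = ennreal (2 * q * (LINT x|lborel. indicator Q x * (\<phi> x)\<^sup>2) - 2 * (LINT x|lborel. indicator Q x * \<phi> x)\<^sup>2)"
proof -
  have [measurable]: "\<phi> \<in> borel_measurable borel"
    using C1c_continuous[OF C] by (rule borel_measurable_continuous_onI)
  define I where "I = (LINT x|lborel. indicator Q x * \<phi> x)"
  define J where "J = (LINT x|lborel. indicator Q x * (\<phi> x)\<^sup>2)"
  have i0: "integrable lborel (indicator Q :: 'a \<Rightarrow> real)" using q by (intro integrable_real_indicator) auto
  have m0: "measure lborel Q = q" using q by (simp add: measure_def)
  have i1: "integrable lborel (\<lambda>x. indicator Q x * \<phi> x)"
    using integrable_mult_indicator[of Q lborel \<phi>] integrable_continuous_support[OF C1c_continuous[OF C] C1c_support[OF C]] by simp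
  have i2: "integrable lborel (\<lambda>x. indicator Q x * (\<phi> x)\<^sup>2)"
    using integrable_mult_indicator[of Q lborel "\<lambda>x. (\<phi> x)\<^sup>2"] C1c_sq_integrable[OF C] by simp
  have expand: "indicator Q y * (\<phi> x - \<phi> y)\<^sup>2 = (\<phi> x)\<^sup>2 * indicator Q y - 2 * \<phi> x * (indicator Q y * \<phi> y) + indicator Q y * (\<phi> y)\<^sup>2" for x y
    by (simp add: power2_diff algebra_simps)
  have inner: "(\<integral>\<^sup>+y. ennreal (indicator Q x * (indicator Q y * (\<phi> x - \<phi> y)\<^sup>2)) \<partial>lborel)
      = ennreal (indicator Q x * (q * (\<phi> x)\<^sup>2 - 2 * \<phi> x * I + J))" for x
  proof -
    have int: "integrable lborel (\<lambda>y. indicator Q y * (\<phi> x - \<phi> y)\<^sup>2)" unfolding expand using i0 i1 i2 by simp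
    have "(LINT y|lborel. indicator Q y * (\<phi> x - \<phi> y)\<^sup>2) = q * (\<phi> x)\<^sup>2 - 2 * \<phi> x * I + J"
      unfolding expand using i0 i1 i2 by (simp add: m0 I_def J_def)
    then show ?thesis using int by (subst nn_integral_eq_integral) auto
  qed
  have exp2: "indicator Q x * (q * (\<phi> x)\<^sup>2 - 2 * \<phi> x * I + J) =
    q * (indicator Q x * (\<phi> x)\<^sup>2) - 2 * I * (indicator Q x * \<phi> x) + J * indicator Q x" for x
    by (simp add: algebra_simps)
  have nonneg: "0 \<le> indicator Q x * (q * (\<phi> x)\<^sup>2 - 2 * \<phi> x * I + J)" for x
  proof -
    have "0 \<le> (LINT y|lborel. indicator Q y * (\<phi> x - \<phi> y)\<^sup>2)" by (intro integral_nonneg_AE) auto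
    also have "... = q * (\<phi> x)\<^sup>2 - 2 * \<phi> x * I + J"
      unfolding expand using i0 i1 i2 by (simp add: m0 I_def J_def)
    finally show ?thesis by simp
  qed
  have int: "integrable lborel (\<lambda>x. indicator Q x * (q * (\<phi> x)\<^sup>2 - 2 * \<phi> x * I + J))"
    unfolding exp2 using i0 i1 i2 by simp
  have "(LINT x|lborel. indicator Q x * (q * (\<phi> x)\<^sup>2 - 2 * \<phi> x * I + J)) = 2 * q * J - 2 * I\<^sup>2"
    unfolding exp2 using i0 i1 i2 m0
    by (simp add: I_def[symmetric] J_def[symmetric]) (simp add: power2_eq_square)
  then show ?thesis unfolding inner I_def[symmetric] J_def[symmetric]
    using int nonneg by (subst nn_integral_eq_integral) auto
qed

text \<open>The index functions are extensional, so that there are finitely many of them and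
  different ones label disjoint cubes.\<close>

definition cubes :: "real \<Rightarrow> real \<Rightarrow> ('a::euclidean_space \<Rightarrow> int) set" where
  "cubes R h = (\<Pi>\<^sub>E b\<in>Basis. {-\<lceil>R / h\<rceil> - 1..\<lceil>R / h\<rceil>})"

lemma finite_cubes: "finite (cubes R h)" unfolding cubes_def by (intro finite_PiE) auto

lemma cubes_cover:
  assumes "norm x \<le> R" "h > 0"
  shows "\<exists>k\<in>cubes R h. x \<in> cube h k"
proof -
  have "\<lfloor>(x \<bullet> b) / h\<rfloor> \<in> {-\<lceil>R / h\<rceil> - 1..\<lceil>R / h\<rceil>}" if "b \<in> Basis" for b
  proof -
    have "\<bar>x \<bullet> b\<bar> \<le> R" using Basis_le_norm[OF that, of x] assms(1) by linarith
    then have "\<bar>(x \<bullet> b) / h\<bar> \<le> R / h" using assms(2) by (simp add: divide_right_mono)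
    then have v: "- (R / h) \<le> (x \<bullet> b) / h" "(x \<bullet> b) / h \<le> R / h" by (auto simp only: abs_le_iff minus_le_iff)
    have "\<lfloor>(x \<bullet> b) / h\<rfloor> \<le> \<lceil>R / h\<rceil>" using floor_mono[OF v(2)] floor_le_ceiling[of "R / h"] by (rule order_trans)
    moreover have "-\<lceil>R / h\<rceil> - 1 \<le> \<lfloor>(x \<bullet> b) / h\<rfloor>"
    proof -
      have "real_of_int (-\<lceil>R / h\<rceil> - 1) \<le> (x \<bullet> b) / h"
        unfolding of_int_diff of_int_minus using v(1) le_of_int_ceiling[of "R / h"] by linarith
      then show ?thesis by (simp only: le_floor_iff)
    qed
    ultimately show ?thesis by simp
  qed
  then have "restrict (\<lambda>b. \<lfloor>(x \<bullet> b) / h\<rfloor>) Basis \<in> cubes R h" unfolding cubes_def by auto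
  moreover have "x \<in> cube h (restrict (\<lambda>b. \<lfloor>(x \<bullet> b) / h\<rfloor>) Basis)" by (simp add: cube_def)
  ultimately show ?thesis by blast
qed

lemma cubes_disjoint:
  assumes "k \<in> cubes R h" "l \<in> cubes R h" "x \<in> cube h k" "x \<in> cube h l" shows "k = l"
proof (rule PiE_ext)
  show "k \<in> (\<Pi>\<^sub>E b\<in>Basis. {-\<lceil>R / h\<rceil> - 1..\<lceil>R / h\<rceil>})" "l \<in> (\<Pi>\<^sub>E b\<in>Basis. {-\<lceil>R / h\<rceil> - 1..\<lceil>R / h\<rceil>})"
    using assms unfolding cubes_def by auto
qed (use assms in \<open>auto simp: cube_def\<close>)

lemma sum_cubes_eq:
  fixes c :: "('a::euclidean_space \<Rightarrow> int) \<Rightarrow> real"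
  assumes "k \<in> cubes R h" "x \<in> cube h k"
  shows "(\<Sum>j\<in>cubes R h. indicator (cube h j) x * c j) = c k"
proof -
  have "(\<Sum>j\<in>cubes R h. indicator (cube h j) x * c j) = (\<Sum>j\<in>cubes R h. if j = k then c j else 0)"
  proof (rule sum.cong[OF refl])
    fix j :: "'a \<Rightarrow> int" assume j: "j \<in> cubes R h"
    show "indicator (cube h j) x * c j = (if j = k then c j else 0)"
    proof (cases "j = k")
      case False
      then have "x \<notin> cube h j" using cubes_disjoint[OF j assms(1) _ assms(2)] by argo
      then show ?thesis using False by simp
    qed (use assms in simp)
  qed
  then show ?thesis using assms(1) by (simp add: sum.delta finite_cubes)
qed

lemma sum_cubes_le:
  fixes c :: "('a::euclidean_space \<Rightarrow> int) \<Rightarrow> real"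
  assumes "\<And>k. k \<in> cubes R h \<Longrightarrow> x \<in> cube h k \<Longrightarrow> c k \<le> B" "B \<ge> 0"
  shows "(\<Sum>k\<in>cubes R h. indicator (cube h k) x * c k) \<le> B"
proof (cases "\<exists>k\<in>cubes R h. x \<in> cube h k")
  case True
  then obtain k where k: "k \<in> cubes R h" "x \<in> cube h k" by blast
  show ?thesis unfolding sum_cubes_eq[OF k] using assms(1)[OF k] .
next
  case False
  then have "(\<Sum>k\<in>cubes R h. indicator (cube h k) x * c k) = 0"
    by (intro sum.neutral) (auto simp: indicator_def)
  then show ?thesis using assms(2) by simp
qed

text \<open>The variance identity is summed over the cubes. Two points of one cube differ by a
  vector z with coordinates at most h in modulus, so the double integrals are bounded by the squared
  increments over z, integrated over such z. Each of these is at most norm z squared times the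
  energy, and norm z squared is at most the dimension times h^2; the volume (2h)^d of the set of z
  divided by the cell volume h^d leaves 2^d. Thus finitely many averages control the L2 norm up to a
  small multiple of the energy, which is the source of compactness.\<close>

theorem ehrling:
  fixes \<phi> :: "'a::euclidean_space \<Rightarrow> real"
  assumes C: "C1c \<phi>" and supp: "\<And>x. \<phi> x \<noteq> 0 \<Longrightarrow> norm x \<le> R" and h: "h > 0"
  shows "(LINT x|lborel. (\<phi> x)\<^sup>2) \<le>
    (\<Sum>k\<in>cubes R h. (LINT x|lborel. indicator (cube h k) x * \<phi> x)\<^sup>2 / h ^ DIM('a))
      + 2 ^ DIM('a) * real DIM('a) * h\<^sup>2 * energy \<phi>"
proof -
  let ?K = "cubes R h :: ('a \<Rightarrow> int) set" and ?q = "h ^ DIM('a)"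
  let ?I = "\<lambda>k. LINT x|lborel. indicator (cube h k) x * \<phi> x"
  let ?J = "\<lambda>k. LINT x|lborel. indicator (cube h k) x * (\<phi> x)\<^sup>2"
  let ?B = "cbox (- (h *\<^sub>R One)) (h *\<^sub>R One) :: 'a set"
  have [measurable]: "\<phi> \<in> borel_measurable borel"
    using C1c_continuous[OF C] by (rule borel_measurable_continuous_onI)
  have q: "?q > 0" using h by simp
  have i2: "integrable lborel (\<lambda>x. indicator (cube h k) x * (\<phi> x)\<^sup>2)" for k
    using integrable_mult_indicator[of "cube h k" lborel "\<lambda>x. (\<phi> x)\<^sup>2"] C1c_sq_integrable[OF C] by simp
  have tot: "(LINT x|lborel. (\<phi> x)\<^sup>2) = (\<Sum>k\<in>?K. ?J k)"
  proof -
    have "(\<phi> x)\<^sup>2 = (\<Sum>k\<in>?K. indicator (cube h k) x * (\<phi> x)\<^sup>2)" for x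
    proof (cases "\<phi> x = 0")
      case False
      then obtain k where k: "k \<in> ?K" "x \<in> cube h k" using cubes_cover[OF supp h] by blast
      show ?thesis by (rule sum_cubes_eq[OF k, symmetric])
    qed simp
    then have "(LINT x|lborel. (\<phi> x)\<^sup>2) = (LINT x|lborel. (\<Sum>k\<in>?K. indicator (cube h k) x * (\<phi> x)\<^sup>2))"
      by (intro Bochner_Integration.integral_cong) auto
    also have "... = (\<Sum>k\<in>?K. ?J k)" by (intro Bochner_Integration.integral_sum i2)
    finally show ?thesis .
  qed
  \<comment> \<open>Cauchy-Schwarz on a cell. The sign matters because the sum passes through
    \<open>ennreal\<close>, which would truncate negative terms.\<close>
  have nn: "0 \<le> 2 * ?q * ?J k - 2 * (?I k)\<^sup>2" for k
  proof -
    have "(?I k)\<^sup>2 \<le> ?q * ?J k"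
    proof -
      have i0: "integrable lborel (indicator (cube h k) :: 'a \<Rightarrow> real)"
        by (intro integrable_real_indicator) (auto simp: emeasure_cube[OF h])
      have i1: "integrable lborel (\<lambda>x. indicator (cube h k) x * \<phi> x)"
        using integrable_mult_indicator[of "cube h k" lborel \<phi>] integrable_continuous_support[OF C1c_continuous[OF C] C1c_support[OF C]] by simp
      have m0: "measure lborel (cube h k) = ?q" using h by (simp add: measure_def emeasure_cube[OF h])
      have "0 \<le> (LINT x|lborel. indicator (cube h k) x * (?q * \<phi> x - ?I k)\<^sup>2)" by (intro integral_nonneg_AE) auto
      also have "... = (LINT x|lborel. ?q\<^sup>2 * (indicator (cube h k) x * (\<phi> x)\<^sup>2) - 2 * ?q * ?I k * (indicator (cube h k) x * \<phi> x) + (?I k)\<^sup>2 * indicator (cube h k) x)"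
        by (intro Bochner_Integration.integral_cong) (auto simp: power2_eq_square algebra_simps)
      also have "... = ?q\<^sup>2 * ?J k - 2 * ?q * ?I k * ?I k + (?I k)\<^sup>2 * ?q" using i0 i1 i2[of k] m0 by simp
      also have "... = ?q * (?q * ?J k - (?I k)\<^sup>2)" by (simp add: power2_eq_square algebra_simps)
      finally show ?thesis using q by (simp add: zero_le_mult_iff)
    qed
    then show ?thesis by (simp add: algebra_simps)
  qed
  have "ennreal (\<Sum>k\<in>?K. 2 * ?q * ?J k - 2 * (?I k)\<^sup>2) = (\<Sum>k\<in>?K. ennreal (2 * ?q * ?J k - 2 * (?I k)\<^sup>2))"
    using nn by (intro sum_ennreal[symmetric])
  also have "... = (\<Sum>k\<in>?K. (\<integral>\<^sup>+x. (\<integral>\<^sup>+y. ennreal (indicator (cube h k) x * (indicator (cube h k) y * (\<phi> x - \<phi> y)\<^sup>2)) \<partial>lborel) \<partial>lborel))"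
    using h by (intro sum.cong refl variance_identity[OF C, symmetric] emeasure_cube) auto
  also have "... = (\<integral>\<^sup>+x. (\<Sum>k\<in>?K. (\<integral>\<^sup>+y. ennreal (indicator (cube h k) x * (indicator (cube h k) y * (\<phi> x - \<phi> y)\<^sup>2)) \<partial>lborel)) \<partial>lborel)"
    by (intro nn_integral_sum[symmetric]) measurable
  also have "... = (\<integral>\<^sup>+x. (\<integral>\<^sup>+y. (\<Sum>k\<in>?K. ennreal (indicator (cube h k) x * (indicator (cube h k) y * (\<phi> x - \<phi> y)\<^sup>2))) \<partial>lborel) \<partial>lborel)"
    by (intro nn_integral_cong nn_integral_sum[symmetric]) measurable
  \<comment> \<open>For fixed x at most one summand is nonzero, since the cubes are disjoint; so the
    whole sum obeys the bound of a single cube.\<close>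
  also have "... \<le> (\<integral>\<^sup>+x. \<integral>\<^sup>+y. ennreal (indicator ?B (y - x) * (\<phi> x - \<phi> y)\<^sup>2) \<partial>lborel \<partial>lborel)"
  proof (intro nn_integral_mono)
    fix x y
    have "(\<Sum>k\<in>?K. ennreal (indicator (cube h k) x * (indicator (cube h k) y * (\<phi> x - \<phi> y)\<^sup>2)))
      = ennreal (\<Sum>k\<in>?K. indicator (cube h k) x * (indicator (cube h k) y * (\<phi> x - \<phi> y)\<^sup>2))"
      by (intro sum_ennreal) auto
    also have "... \<le> ennreal (indicator ?B (y - x) * (\<phi> x - \<phi> y)\<^sup>2)"
    proof (intro ennreal_leI sum_cubes_le)
      fix k assume "x \<in> cube h k"
      then show "indicator (cube h k) y * (\<phi> x - \<phi> y)\<^sup>2 \<le> indicator ?B (y - x) * (\<phi> x - \<phi> y)\<^sup>2"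
        using same_cube_diff[of x h k y] h by (cases "y \<in> cube h k") auto
    qed simp
    finally show "(\<Sum>k\<in>?K. ennreal (indicator (cube h k) x * (indicator (cube h k) y * (\<phi> x - \<phi> y)\<^sup>2)))
      \<le> ennreal (indicator ?B (y - x) * (\<phi> x - \<phi> y)\<^sup>2)" .
  qed
  also have "... = (\<integral>\<^sup>+x. \<integral>\<^sup>+z. ennreal (indicator ?B z * (\<phi> x - \<phi> (x + z))\<^sup>2) \<partial>lborel \<partial>lborel)"
  proof (rule nn_integral_cong)
    fix x
    have m: "(\<lambda>y. ennreal (indicator ?B (y - x) * (\<phi> x - \<phi> y)\<^sup>2)) \<in> borel_measurable borel" by measurable
    show "(\<integral>\<^sup>+y. ennreal (indicator ?B (y - x) * (\<phi> x - \<phi> y)\<^sup>2) \<partial>lborel)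
       = (\<integral>\<^sup>+z. ennreal (indicator ?B z * (\<phi> x - \<phi> (x + z))\<^sup>2) \<partial>lborel)"
      using nn_integral_translation[OF m, of x] by (simp add: add.commute)
  qed
  also have "... = (\<integral>\<^sup>+z. \<integral>\<^sup>+x. ennreal (indicator ?B z * (\<phi> x - \<phi> (x + z))\<^sup>2) \<partial>lborel \<partial>lborel)"
    by (rule lborel_pair.Fubini') measurable
  also have "... \<le> (\<integral>\<^sup>+z. ennreal (real DIM('a) * h\<^sup>2 * energy \<phi>) * indicator ?B z \<partial>lborel)"
  proof (intro nn_integral_mono)
    fix z
    show "(\<integral>\<^sup>+x. ennreal (indicator ?B z * (\<phi> x - \<phi> (x + z))\<^sup>2) \<partial>lborel) \<le> ennreal (real DIM('a) * h\<^sup>2 * energy \<phi>) * indicator ?B z"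
    proof (cases "z \<in> ?B")
      case True
      have "(norm z)\<^sup>2 \<le> real DIM('a) * h\<^sup>2"
      proof -
        have "\<bar>z \<bullet> b\<bar> \<le> h" if "b \<in> Basis" for b using True that by (auto simp: mem_box abs_le_iff)
        then have "(z \<bullet> b)\<^sup>2 \<le> h\<^sup>2" if "b \<in> Basis" for b using that h by (metis abs_le_square_iff abs_of_pos)
        then have "(\<Sum>b\<in>Basis. (z \<bullet> b)\<^sup>2) \<le> (\<Sum>b\<in>(Basis::'a set). h\<^sup>2)" by (intro sum_mono)
        then show ?thesis unfolding power2_norm_eq_inner using euclidean_inner[of z z] by (simp add: power2_eq_square)
      qed
      then have "(norm z)\<^sup>2 * energy \<phi> \<le> real DIM('a) * h\<^sup>2 * energy \<phi>"
        by (rule mult_right_mono[OF _ energy_nonneg[OF C]])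
      then have "(LINT x|lborel. (\<phi> (x + z) - \<phi> x)\<^sup>2) \<le> real DIM('a) * h\<^sup>2 * energy \<phi>"
        using integral_increment_le[OF C, of z] integral_dd_le[OF C, of z] by linarith
      moreover have "(\<integral>\<^sup>+x. ennreal ((\<phi> (x + z) - \<phi> x)\<^sup>2) \<partial>lborel) = ennreal (LINT x|lborel. (\<phi> (x + z) - \<phi> x)\<^sup>2)"
        using C1c_diff_sq_integrable[OF C, of z 0] by (intro nn_integral_eq_integral) auto
      moreover have "(\<phi> x - \<phi> (x + z))\<^sup>2 = (\<phi> (x + z) - \<phi> x)\<^sup>2" for x by (rule power2_commute)
      ultimately show ?thesis using True by (simp add: ennreal_leI)
    qed simp
  qed
  also have "... = ennreal (real DIM('a) * h\<^sup>2 * energy \<phi>) * emeasure lborel ?B" by (simp add: nn_integral_cmult_indicator)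
  also have "... = ennreal (real DIM('a) * h\<^sup>2 * energy \<phi> * (2 * h) ^ DIM('a))"
  proof -
    have "(\<Prod>b\<in>(Basis::'a set). (h *\<^sub>R One - - (h *\<^sub>R One)) \<bullet> b) = (\<Prod>b\<in>(Basis::'a set). 2 * h)"
      by (rule prod.cong[OF refl]) (simp add: inner_add_left)
    then have vol: "emeasure lborel ?B = ennreal ((2 * h) ^ DIM('a))"
      using h by (simp only: emeasure_lborel_cbox_eq) simp
    show ?thesis unfolding vol
      using h energy_nonneg[OF C] by (intro ennreal_mult[symmetric] mult_nonneg_nonneg zero_le_power) auto
  qed
  finally have le: "(\<Sum>k\<in>?K. 2 * ?q * ?J k - 2 * (?I k)\<^sup>2) \<le> real DIM('a) * h\<^sup>2 * energy \<phi> * (2 * h) ^ DIM('a)"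
    using h energy_nonneg[OF C] by (subst (asm) ennreal_le_iff) auto
  have ar: "J \<le> I / p + E / 2" if "p > 0" "2 * p * J \<le> 2 * I + p * E" for p J I E :: real
    using that by (simp add: field_simps)
  from le have "2 * ?q * (\<Sum>k\<in>?K. ?J k) \<le> 2 * (\<Sum>k\<in>?K. (?I k)\<^sup>2) + ?q * (2 ^ DIM('a) * real DIM('a) * h\<^sup>2 * energy \<phi>)"
    by (simp add: sum_subtractf sum_distrib_left power_mult_distrib algebra_simps)
  then have "(\<Sum>k\<in>?K. ?J k) \<le> (\<Sum>k\<in>?K. (?I k)\<^sup>2) / ?q + (2 ^ DIM('a) * real DIM('a) * h\<^sup>2 * energy \<phi>) / 2"
    by (rule ar[OF q])
  also have "... \<le> (\<Sum>k\<in>?K. (?I k)\<^sup>2) / ?q + 2 ^ DIM('a) * real DIM('a) * h\<^sup>2 * energy \<phi>"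
    using energy_nonneg[OF C] by simp
  finally show ?thesis unfolding tot by (simp add: sum_divide_distrib)
qed

text \<open>Bolzano-Weierstrass for each q, followed by a diagonal sequence.\<close>

lemma bounded_family_convergent_subseq:
  fixes F :: "nat \<Rightarrow> nat \<Rightarrow> real"
  assumes "\<And>q j. \<bar>F q j\<bar> \<le> B q"
  shows "\<exists>r :: nat \<Rightarrow> nat. strict_mono r \<and> (\<forall>q. convergent (\<lambda>j. F q (r j)))"
proof -
  interpret subseqs "\<lambda>q r. convergent (\<lambda>j. F q (r j))"
  proof
    fix n :: nat and s :: "nat \<Rightarrow> nat" assume "strict_mono s"
    have "bounded (range (\<lambda>j. F n (s j)))" unfolding bounded_iff using assms by auto
    then obtain l r where "strict_mono r" "((\<lambda>j. F n (s j)) \<circ> r) \<longlonglongrightarrow> l"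
      using bounded_imp_convergent_subsequence by blast
    then show "\<exists>r'. strict_mono r' \<and> convergent (\<lambda>j. F n ((s \<circ> r') j))" by (auto simp: o_def convergent_def)
  qed
  have "convergent (\<lambda>j. F q (diagseq j))" for q
  proof -
    have "convergent (\<lambda>j. F q ((diagseq \<circ> ((+) (Suc q))) j))"
    proof (rule diagseq_holds)
      show "convergent (\<lambda>j. F x ((s \<circ> r) j))" if "strict_mono r" "convergent (\<lambda>j. F x (s j))" for x r s
        using convergent_subseq_convergent[OF that(2,1)] by (simp add: o_def)
    qed
    then have "convergent (\<lambda>j. F q (diagseq (j + Suc q)))" by (simp add: o_def add.commute)
    then show ?thesis using convergent_ignore_initial_segment[of "\<lambda>j. F q (diagseq j)" "Suc q"] by simp
  qed
  then show ?thesis using subseq_diagseq by blast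
qed

section \<open>Square integrable functions\<close>

text \<open>Turns the function spaces into subspaces of a real vector space, so that they can serve
  as carriers of \<open>semi_inner\<close>.\<close>

instantiation "fun" :: (type, real_vector) real_vector
begin

definition scaleR_fun :: "real \<Rightarrow> ('a \<Rightarrow> 'b) \<Rightarrow> 'a \<Rightarrow> 'b" where
  "scaleR_fun c f = (\<lambda>x. c *\<^sub>R f x)"

instance by standard (simp_all add: scaleR_fun_def fun_eq_iff scaleR_add_right scaleR_add_left)

end

lemma scaleR_fun_apply [simp]: "(c *\<^sub>R f) x = c *\<^sub>R f x" by (simp add: scaleR_fun_def)

lemma borel_measurable_plus_fun:
  fixes u v :: "'a \<Rightarrow> 'b::euclidean_space"
  shows "u \<in> borel_measurable M \<Longrightarrow> v \<in> borel_measurable M \<Longrightarrow> u + v \<in> borel_measurable M"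
  by (simp add: plus_fun_def)

lemma borel_measurable_scaleR_fun:
  fixes u :: "'a \<Rightarrow> 'b::euclidean_space"
  shows "u \<in> borel_measurable M \<Longrightarrow> c *\<^sub>R u \<in> borel_measurable M" by (simp add: scaleR_fun_def)

lemma inner_le_sq: "\<bar>x \<bullet> y\<bar> \<le> (norm x)\<^sup>2 + (norm y)\<^sup>2"
proof -
  have "\<bar>x \<bullet> y\<bar> \<le> norm x * norm y" by (rule Cauchy_Schwarz_ineq2)
  also have "... \<le> (norm x)\<^sup>2 + (norm y)\<^sup>2"
  proof -
    have "0 \<le> norm x * norm y" by simp
    moreover have "2 * (norm x * norm y) \<le> (norm x)\<^sup>2 + (norm y)\<^sup>2"
      using sum_squares_bound[of "norm x" "norm y"] by (simp only: mult.assoc)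
    ultimately show ?thesis by linarith
  qed
  finally show ?thesis .
qed

lemma L2_inner_integrable:
  assumes "u \<in> L2_space U" "v \<in> L2_space U"
  shows "integrable (lebesgue_on U) (\<lambda>x. u x \<bullet> v x)"
proof (rule Bochner_Integration.integrable_bound)
  show "integrable (lebesgue_on U) (\<lambda>x. (norm (u x))\<^sup>2 + (norm (v x))\<^sup>2)"
    using assms by (intro Bochner_Integration.integrable_add) (auto simp: L2_space_def)
  show "(\<lambda>x. u x \<bullet> v x) \<in> borel_measurable (lebesgue_on U)"
    using assms by (intro borel_measurable_inner) (auto simp: L2_space_def)
  show "AE x in lebesgue_on U. norm (u x \<bullet> v x) \<le> norm ((norm (u x))\<^sup>2 + (norm (v x))\<^sup>2)"
    using inner_le_sq by (intro AE_I2) simp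
qed

lemma L2_add:
  assumes "u \<in> L2_space U" "v \<in> L2_space U" shows "u + v \<in> L2_space U"
proof -
  have "integrable (lebesgue_on U) (\<lambda>x. (norm (u x))\<^sup>2 + 2 * (u x \<bullet> v x) + (norm (v x))\<^sup>2)"
    using assms L2_inner_integrable[OF assms]
    by (intro Bochner_Integration.integrable_add integrable_mult_right) (auto simp: L2_space_def)
  moreover have "(norm (u x))\<^sup>2 + 2 * (u x \<bullet> v x) + (norm (v x))\<^sup>2 = (norm ((u + v) x))\<^sup>2" for x
    by (simp add: power2_norm_eq_inner inner_add_left inner_add_right inner_commute)
  ultimately have "integrable (lebesgue_on U) (\<lambda>x. (norm ((u + v) x))\<^sup>2)" by (simp only:)
  then show ?thesis using assms borel_measurable_plus_fun[of u "lebesgue_on U" v] by (simp add: L2_space_def)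
qed

lemma L2_scale:
  assumes "u \<in> L2_space U" shows "c *\<^sub>R u \<in> L2_space U"
proof -
  have "integrable (lebesgue_on U) (\<lambda>x. c\<^sup>2 * (norm (u x))\<^sup>2)"
    using assms by (intro integrable_mult_right) (auto simp: L2_space_def)
  moreover have "c\<^sup>2 * (norm (u x))\<^sup>2 = (norm ((c *\<^sub>R u) x))\<^sup>2" for x by (simp add: power_mult_distrib)
  ultimately have "integrable (lebesgue_on U) (\<lambda>x. (norm ((c *\<^sub>R u) x))\<^sup>2)" by (simp only:)
  then show ?thesis
    using assms borel_measurable_scaleR_fun[of u "lebesgue_on U" c] by (simp add: L2_space_def)
qed

lemma L2_zero: "0 \<in> L2_space U" by (simp add: L2_space_def zero_fun_def)

lemma L2_semi_inner: "semi_inner (L2_space U) (inner_L2 U)"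
proof
  show "subspace (L2_space U)" by (simp add: subspace_def L2_add L2_scale L2_zero)
next
  fix u v w :: "'a \<Rightarrow> 'b" assume "u \<in> L2_space U" "v \<in> L2_space U" "w \<in> L2_space U"
  then show "inner_L2 U (u + v) w = inner_L2 U u w + inner_L2 U v w"
    by (simp add: inner_L2_def inner_add_left L2_inner_integrable)
next
  fix u v :: "'a \<Rightarrow> 'b" show "inner_L2 U u v = inner_L2 U v u" by (simp add: inner_L2_def inner_commute)
next
  fix u :: "'a \<Rightarrow> 'b" show "0 \<le> inner_L2 U u u" by (simp add: inner_L2_def)
qed (simp add: inner_L2_def)

interpretation L2: semi_inner "L2_space U" "inner_L2 U" for U by (rule L2_semi_inner)

lemma norm_L2_eq_nrm: "norm_L2 U u = L2.nrm U u" by (simp add: norm_L2_def L2.nrm_def)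

lemma L2_inner_cong_AE:
  assumes "AE x in lebesgue_on U. u x = u' x" "u \<in> L2_space U" "u' \<in> L2_space U" "v \<in> L2_space U"
  shows "inner_L2 U u v = inner_L2 U u' v" unfolding inner_L2_def
proof (rule integral_cong_AE)
  show "AE x in lebesgue_on U. u x \<bullet> v x = u' x \<bullet> v x" using assms(1) by eventually_elim simp
qed (use assms in \<open>auto simp: L2_space_def intro!: borel_measurable_inner\<close>)

lemma L2_zero_imp_AE:
  assumes "u \<in> L2_space U" "inner_L2 U u u = 0" shows "AE x in lebesgue_on U. u x = 0"
proof -
  have "AE x in lebesgue_on U. u x \<bullet> u x = 0" using assms L2_inner_integrable[OF assms(1,1)]
    by (subst integral_nonneg_eq_0_iff_AE[symmetric]) (auto simp: inner_L2_def)
  then show ?thesis by simp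
qed

lemma L2_nn_integral:
  assumes "u \<in> L2_space U"
  shows "(\<integral>\<^sup>+x. ennreal ((norm (u x))\<^sup>2) \<partial>lebesgue_on U) = ennreal (inner_L2 U u u)"
  unfolding inner_L2_def power2_norm_eq_inner[symmetric]
  using assms by (intro nn_integral_eq_integral) (auto simp: L2_space_def)

lemma L2_memI:
  assumes "u \<in> borel_measurable (lebesgue_on U)"
    "(\<integral>\<^sup>+x. ennreal ((norm (u x))\<^sup>2) \<partial>lebesgue_on U) \<le> ennreal B" "B \<ge> 0"
  shows "u \<in> L2_space U" "inner_L2 U u u \<le> B"
proof -
  have "integrable (lebesgue_on U) (\<lambda>x. (norm (u x))\<^sup>2)" unfolding integrable_iff_bounded using assms(1,2)
    by (auto intro: le_less_trans)
  with assms(1) show u: "u \<in> L2_space U" by (simp add: L2_space_def)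
  show "inner_L2 U u u \<le> B" using assms(2,3) unfolding L2_nn_integral[OF u] by simp
qed

text \<open>Adding up all thresholds so far, and k itself, yields indices that are strictly
  increasing and lie beyond every threshold reached.\<close>

lemma geometric_subsequence:
  assumes "\<And>k::nat. \<exists>N::nat. \<forall>m\<ge>N. \<forall>n\<ge>N. P k m n"
  shows "\<exists>r :: nat \<Rightarrow> nat. strict_mono r \<and> (\<forall>k. P k (r (Suc k)) (r k))"
proof -
  from assms obtain N where N: "\<And>k m n. m \<ge> N k \<Longrightarrow> n \<ge> N k \<Longrightarrow> P k m n" by metis
  define r where "r k = k + (\<Sum>j\<le>k. N j)" for k
  have "strict_mono r" unfolding strict_mono_Suc_iff r_def by simp
  moreover have "N k \<le> r k" for k unfolding r_def by (simp add: trans_le_add2 member_le_sum)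
  moreover have "r k \<le> r (Suc k)" for k unfolding r_def by simp
  ultimately show ?thesis using N by (meson le_trans)
qed

text \<open>Along a subsequence with increments of norm at most \<open>2\<^sup>-\<^sup>k\<close>, the series
  \<open>\<Sum>k. 2\<^sup>k \<bar>X\<^sub>k\<^sub>+\<^sub>1 - X\<^sub>k\<bar>\<^sup>2\<close> has a finite integral, so the increments decay geometrically almost
  everywhere.\<close>

theorem L2_complete:
  fixes X :: "nat \<Rightarrow> 'a::euclidean_space \<Rightarrow> 'b::euclidean_space"
  assumes X: "\<And>n. X n \<in> L2_space U" and cau: "L2.Cauchy_seq U X"
  shows "\<exists>u\<in>L2_space U. (\<lambda>n. L2.nrm U (X n - u)) \<longlonglongrightarrow> 0"
proof -
  let ?M = "lebesgue_on U"
  have Xm [measurable]: "X n \<in> borel_measurable ?M" for n using X by (auto simp: L2_space_def)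
  have D: "X m - X n \<in> L2_space U" for m n using X by (intro L2.mem_diff)
  have "\<exists>N. \<forall>m\<ge>N. \<forall>n\<ge>N. L2.nrm U (X m - X n) < (1/2) ^ k" for k using cau unfolding L2.Cauchy_seq_def by simp
  then obtain r where r: "strict_mono r" "\<And>k. L2.nrm U (X (r (Suc k)) - X (r k)) < (1/2) ^ k"
    using geometric_subsequence[of "\<lambda>k m n. L2.nrm U (X m - X n) < (1/2) ^ k"] by auto
  define g where "g k x = (norm (X (r (Suc k)) x - X (r k) x))\<^sup>2" for k x
  have gm [measurable]: "g k \<in> borel_measurable ?M" for k unfolding g_def by measurable
  have g_int: "(\<integral>\<^sup>+x. ennreal (2 ^ k * g k x) \<partial>?M) \<le> ennreal ((1/2) ^ k)" for k
  proof -
    have "(\<integral>\<^sup>+x. ennreal (2 ^ k * g k x) \<partial>?M) = ennreal (2 ^ k) * (\<integral>\<^sup>+x. ennreal (g k x) \<partial>?M)"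
      using gm by (simp add: ennreal_mult' nn_integral_cmult)
    also have "(\<integral>\<^sup>+x. ennreal (g k x) \<partial>?M) = ennreal ((L2.nrm U (X (r (Suc k)) - X (r k)))\<^sup>2)"
      using L2_nn_integral[OF D] by (simp add: g_def L2.nrm_sq[OF D])
    also have "... \<le> ennreal (((1/2) ^ k)\<^sup>2)"
      using r(2)[of k] by (intro ennreal_leI power_mono[OF less_imp_le] L2.nrm_nonneg[OF D])
    also have "ennreal (2 ^ k) * ennreal (((1/2) ^ k)\<^sup>2) = ennreal ((1/2) ^ k)"
      by (simp add: ennreal_mult'[symmetric] power2_eq_square power_mult_distrib[symmetric] flip: mult.assoc)
    finally show ?thesis by (simp add: mult_left_mono)
  qed
  have "(\<integral>\<^sup>+x. (\<Sum>k. ennreal (2 ^ k * g k x)) \<partial>?M) = (\<Sum>k. \<integral>\<^sup>+x. ennreal (2 ^ k * g k x) \<partial>?M)"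
    by (intro nn_integral_suminf) measurable
  also have "... \<le> (\<Sum>k. ennreal ((1/2) ^ k))" by (intro suminf_le g_int) auto
  also have "... < \<infinity>" by (simp add: suminf_ennreal2 summable_geometric)
  finally have "(\<integral>\<^sup>+x. (\<Sum>k. ennreal (2 ^ k * g k x)) \<partial>?M) \<noteq> \<infinity>" by simp
  moreover have "(\<lambda>x. \<Sum>k. ennreal (2 ^ k * g k x)) \<in> borel_measurable ?M" by measurable
  ultimately have "AE x in ?M. (\<Sum>k. ennreal (2 ^ k * g k x)) \<noteq> \<infinity>" by (rule nn_integral_PInf_AE[rotated])
  then have conv: "AE x in ?M. convergent (\<lambda>k. X (r k) x)"
  proof eventually_elim
    fix x assume fin: "(\<Sum>k. ennreal (2 ^ k * g k x)) \<noteq> \<infinity>"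
    then have "summable (\<lambda>k. 2 ^ k * g k x)" by (intro summable_suminf_not_top) (auto simp: g_def)
    then have "(\<lambda>k. 2 ^ k * g k x) \<longlonglongrightarrow> 0" by (rule summable_LIMSEQ_zero)
    then have "Bseq (\<lambda>k. 2 ^ k * g k x)" by (intro convergent_imp_Bseq convergentI)
    then obtain K where K: "K > 0" "\<And>k. norm (2 ^ k * g k x) \<le> K" by (auto elim: BseqE)
    have "norm (X (r (Suc k)) x - X (r k) x) \<le> sqrt K * (1 / sqrt 2) ^ k" for k
    proof (rule power2_le_imp_le)
      have "2 ^ k * g k x \<le> K" using K(2)[of k] by (simp add: g_def)
      then have "g k x \<le> K * (1/2) ^ k" by (simp add: field_simps power_one_over)
      also have "... = (sqrt K * (1 / sqrt 2) ^ k)\<^sup>2"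
      proof -
        have "((1 / sqrt 2) ^ k)\<^sup>2 = ((1 / sqrt 2)\<^sup>2) ^ k" by (simp only: power_mult[symmetric] mult.commute)
        then show ?thesis using K(1) by (simp add: power_mult_distrib power_divide)
      qed
      finally show "(norm (X (r (Suc k)) x - X (r k) x))\<^sup>2 \<le> (sqrt K * (1 / sqrt 2) ^ k)\<^sup>2" by (simp add: g_def)
    qed (use K in simp)
    then have le: "\<And>k. norm (X (r (Suc k)) x - X (r k) x) \<le> sqrt K * (1 / sqrt 2) ^ k" .
    have sg: "summable (\<lambda>k. sqrt K * (1 / sqrt 2) ^ k)" by (intro summable_mult summable_geometric) simp
    have "summable (\<lambda>k. X (r (Suc k)) x - X (r k) x)"
      by (rule summable_comparison_test'[OF sg, of 0]) (rule le)
    then have "convergent (\<lambda>n. \<Sum>k<n. X (r (Suc k)) x - X (r k) x)" by (simp add: summable_iff_convergent)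
    then have "convergent (\<lambda>n. X (r n) x - X (r 0) x)"
      by (simp only: sum_lessThan_telescope[of "\<lambda>k. X (r k) x"])
    then have "convergent (\<lambda>n. (X (r n) x - X (r 0) x) + X (r 0) x)" by (intro convergent_add convergent_const)
    then show "convergent (\<lambda>k. X (r k) x)" by simp
  qed
  define u where "u x = lim (\<lambda>k. X (r k) x)" for x
  have um: "u \<in> borel_measurable ?M" unfolding u_def by (intro borel_measurable_lim_metric Xm)
  \<comment> \<open>Fatou's lemma for fixed m along the subsequence. It yields at once that X m - u
    is square integrable and that its norm is small, so membership of u itself follows by
    subtraction.\<close>
  have key: "X m - u \<in> L2_space U \<and> L2.nrm U (X m - u) \<le> eps"
    if "eps > 0" "\<And>n. n \<ge> N \<Longrightarrow> L2.nrm U (X m - X n) < eps" for m N eps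
  proof -
    have "(\<integral>\<^sup>+x. ennreal ((norm ((X m - u) x))\<^sup>2) \<partial>?M) \<le> (\<integral>\<^sup>+x. liminf (\<lambda>k. ennreal ((norm (X m x - X (r k) x))\<^sup>2)) \<partial>?M)"
    proof (rule nn_integral_mono_AE)
      show "AE x in ?M. ennreal ((norm ((X m - u) x))\<^sup>2) \<le> liminf (\<lambda>k. ennreal ((norm (X m x - X (r k) x))\<^sup>2))"
        using conv
      proof eventually_elim
        fix x assume "convergent (\<lambda>k. X (r k) x)"
        then have "(\<lambda>k. X (r k) x) \<longlonglongrightarrow> u x" by (simp add: u_def convergent_LIMSEQ_iff)
        then have "(\<lambda>k. ennreal ((norm (X m x - X (r k) x))\<^sup>2)) \<longlonglongrightarrow> ennreal ((norm (X m x - u x))\<^sup>2)"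
          by (intro tendsto_ennrealI tendsto_power tendsto_norm tendsto_diff tendsto_const)
        then have "liminf (\<lambda>k. ennreal ((norm (X m x - X (r k) x))\<^sup>2)) = ennreal ((norm (X m x - u x))\<^sup>2)"
          by (rule lim_imp_Liminf[OF trivial_limit_sequentially])
        then show "ennreal ((norm ((X m - u) x))\<^sup>2) \<le> liminf (\<lambda>k. ennreal ((norm (X m x - X (r k) x))\<^sup>2))"
          by simp
      qed
    qed
    also have "... \<le> liminf (\<lambda>k. \<integral>\<^sup>+x. ennreal ((norm (X m x - X (r k) x))\<^sup>2) \<partial>?M)"
      by (intro nn_integral_liminf) measurable
    also have "... \<le> ennreal (eps\<^sup>2)"
    proof (rule Liminf_le)
      show "\<forall>\<^sub>F k in sequentially. (\<integral>\<^sup>+x. ennreal ((norm (X m x - X (r k) x))\<^sup>2) \<partial>?M) \<le> ennreal (eps\<^sup>2)"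
        using eventually_ge_at_top[of N]
      proof eventually_elim
        fix k assume "k \<ge> N"
        then have "L2.nrm U (X m - X (r k)) < eps" using that(2) seq_suble[OF r(1), of k] le_trans by blast
        then have "(L2.nrm U (X m - X (r k)))\<^sup>2 \<le> eps\<^sup>2" by (intro power_mono[OF less_imp_le] L2.nrm_nonneg[OF D])
        then show "(\<integral>\<^sup>+x. ennreal ((norm (X m x - X (r k) x))\<^sup>2) \<partial>?M) \<le> ennreal (eps\<^sup>2)"
          using L2_nn_integral[OF D, of m "r k"] by (simp add: L2.nrm_sq[OF D] ennreal_leI)
      qed
    qed simp
    finally have b: "(\<integral>\<^sup>+x. ennreal ((norm ((X m - u) x))\<^sup>2) \<partial>?M) \<le> ennreal (eps\<^sup>2)" .
    have m: "X m - u \<in> borel_measurable ?M" using borel_measurable_diff[OF Xm um] by (simp add: fun_diff_def)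
    note L2 = L2_memI[OF m b zero_le_power2]
    have "L2.nrm U (X m - u) \<le> eps"
      unfolding L2.nrm_def by (rule real_le_lsqrt[OF less_imp_le[OF that(1)] L2(2)])
    then show ?thesis using L2(1) by (simp add: fun_diff_def)
  qed
  have ex: "\<exists>N. \<forall>m\<ge>N. X m - u \<in> L2_space U \<and> L2.nrm U (X m - u) \<le> eps" if "eps > 0" for eps
    using cau that key[OF that] unfolding L2.Cauchy_seq_def by meson
  obtain m where "X m - u \<in> L2_space U" using ex[of 1] by auto
  then have u: "u \<in> L2_space U" using L2.mem_diff[OF X, of "X m - u" m] by simp
  have "(\<lambda>n. L2.nrm U (X n - u)) \<longlonglongrightarrow> 0"
  proof (rule LIMSEQ_I)
    fix eps :: real assume "eps > 0"
    then obtain N where "\<forall>m\<ge>N. L2.nrm U (X m - u) \<le> eps / 2" using ex[of "eps / 2"] by auto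
    then have "\<forall>m\<ge>N. norm (L2.nrm U (X m - u) - 0) < eps"
      using \<open>eps > 0\<close> L2.nrm_nonneg[OF L2.mem_diff[OF X u]] by fastforce
    then show "\<exists>N. \<forall>m\<ge>N. norm (L2.nrm U (X m - u) - 0) < eps" by blast
  qed
  with u show ?thesis by blast
qed

section \<open>Weak gradients\<close>

locale bounded_open =
  fixes U :: "(real^'n::finite) set"
  assumes open_dom: "open U" and bounded_dom: "bounded U"
begin

abbreviation M :: "(real^'n) measure" where "M \<equiv> lebesgue_on U"

lemma dom_lebesgue: "U \<in> sets lebesgue" using open_dom by simp

lemma finite_M: "finite_measure M"
proof
  have "U \<in> lmeasurable" using open_dom bounded_dom by (simp add: lmeasurable_open)
  then have "emeasure lebesgue U \<noteq> \<infinity>" using fmeasurableD2 by fastforce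
  then show "emeasure M (space M) \<noteq> \<infinity>" using dom_lebesgue by (simp add: emeasure_restrict_space del: emeasure_completion)
qed

lemma L2_integrable:
  fixes u :: "real^'n \<Rightarrow> 'b::euclidean_space"
  assumes "u \<in> L2_space U" shows "integrable M u"
proof (rule Bochner_Integration.integrable_bound)
  interpret finite_measure M by (rule finite_M)
  show "integrable M (\<lambda>x. 1 + (norm (u x))\<^sup>2)"
    using assms by (intro Bochner_Integration.integrable_add integrable_const) (auto simp: L2_space_def)
  show "u \<in> borel_measurable M" using assms by (simp add: L2_space_def)
  show "AE x in M. norm (u x) \<le> norm (1 + (norm (u x))\<^sup>2)"
  proof (intro AE_I2)
    fix x
    have "2 * norm (u x) * 1 \<le> (norm (u x))\<^sup>2 + 1\<^sup>2" by (rule sum_squares_bound)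
    moreover have "norm (u x) \<ge> 0" by simp
    ultimately have "norm (u x) \<le> 1 + (norm (u x))\<^sup>2" unfolding one_power2 mult_1_right by linarith
    then show "norm (u x) \<le> norm (1 + (norm (u x))\<^sup>2)" by simp
  qed
qed

lemma C1c_bounded:
  assumes "C1c \<phi>" shows "\<exists>B. \<forall>x. \<bar>\<phi> x\<bar> \<le> B"
proof -
  have "compact (closure {x. \<phi> x \<noteq> 0})" using assms by (simp add: C1c_def)
  then have "compact (\<phi> ` closure {x. \<phi> x \<noteq> 0})"
    by (rule compact_continuous_image[OF continuous_on_subset[OF C1c_continuous[OF assms] subset_UNIV]])
  then obtain B where B: "\<forall>y \<in> \<phi> ` closure {x. \<phi> x \<noteq> 0}. \<bar>y\<bar> \<le> B"
    using compact_imp_bounded[of "\<phi> ` closure {x. \<phi> x \<noteq> 0}"] unfolding bounded_iff real_norm_def by blast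
  have "\<bar>\<phi> x\<bar> \<le> max B 0" for x
  proof (cases "\<phi> x = 0")
    case False
    then have "x \<in> closure {x. \<phi> x \<noteq> 0}" by (intro subsetD[OF closure_subset]) simp
    then have "\<bar>\<phi> x\<bar> \<le> B" by (rule B[rule_format, OF imageI])
    then show ?thesis by linarith
  qed simp
  then show ?thesis by blast
qed

lemma partial_eq_dd: "partial j \<phi> x = dd \<phi> (axis j 1) x" by (simp add: partial_def dd_def)

lemma integrable_test:
  fixes \<phi> :: "real^'n \<Rightarrow> real"
  assumes "integrable M g" "\<phi> \<in> test_functions U"
  shows "integrable M (\<lambda>x. g x * \<phi> x)" "integrable M (\<lambda>x. g x * partial j \<phi> x)"
proof -
  note C = test_function_C1c[OF assms(2)]
  obtain B where "\<And>x. \<bar>\<phi> x\<bar> \<le> B" using C1c_bounded[OF C] by blast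
  then show "integrable M (\<lambda>x. g x * \<phi> x)"
    using C1c_continuous[OF C] by (intro integrable_mult_bounded[OF assms(1)] continuous_imp_lebesgue_on)
  obtain B where "\<And>x. \<bar>dd \<phi> (axis j 1) x\<bar> \<le> B" using C1c_dd_bounded[OF C] by blast
  then show "integrable M (\<lambda>x. g x * partial j \<phi> x)" unfolding partial_eq_dd
    using C1c_dd_continuous[OF C] by (intro integrable_mult_bounded[OF assms(1)] continuous_imp_lebesgue_on)
qed

lemma integrable_component: "u \<in> L2_space U \<Longrightarrow> integrable M (\<lambda>x. u x $ i)" for u :: "real^'n \<Rightarrow> real^'m::finite"
  using integrable_bounded_linear[OF bounded_linear_vec_nth L2_integrable] .

lemma integrable_component2:
  fixes G :: "real^'n \<Rightarrow> real^'n^'n"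
  assumes "G \<in> L2_space U" shows "integrable M (\<lambda>x. G x $ i $ j)"
  using integrable_bounded_linear[OF bounded_linear_vec_nth
      integrable_bounded_linear[OF bounded_linear_vec_nth L2_integrable[OF assms]]] .

lemma weak_gradientD:
  "is_weak_gradient U u G \<Longrightarrow> \<phi> \<in> test_functions U \<Longrightarrow>
    (LINT x|M. u x $ i * partial j \<phi> x) = - (LINT x|M. G x $ i $ j * \<phi> x)" by (simp add: is_weak_gradient_def)

text \<open>The fundamental lemma, entry by entry. It is what makes the arbitrary choice in
  \<open>weak_grad\<close> harmless.\<close>

lemma weak_gradient_unique:
  assumes "G \<in> L2_space U" "H \<in> L2_space U" "is_weak_gradient U u G" "is_weak_gradient U u H"
  shows "AE x in M. G x = H x"
proof -
  have "AE x in M. G x $ i $ j = H x $ i $ j" for i j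
  proof -
    have int: "integrable M (\<lambda>x. G x $ i $ j - H x $ i $ j)"
      using assms by (intro Bochner_Integration.integrable_diff integrable_component2)
    have "AE x in M. G x $ i $ j - H x $ i $ j = 0"
    proof (rule fundamental_lemma[OF open_dom int])
      fix \<phi> :: "real^'n \<Rightarrow> real" assume \<phi>: "\<phi> \<in> test_functions U"
      have "(LINT x|M. G x $ i $ j * \<phi> x) = (LINT x|M. H x $ i $ j * \<phi> x)"
        using weak_gradientD[OF assms(3) \<phi>, of i j] weak_gradientD[OF assms(4) \<phi>, of i j] by simp
      then show "(LINT x|M. (G x $ i $ j - H x $ i $ j) * \<phi> x) = 0"
        using assms(1,2) \<phi> by (simp add: left_diff_distrib integrable_test integrable_component2)
    qed
    then show ?thesis by simp
  qed
  then have "AE x in M. \<forall>ij\<in>UNIV. G x $ fst ij $ snd ij = H x $ fst ij $ snd ij"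
    by (intro AE_finite_allI) auto
  then show ?thesis by eventually_elim (auto simp: vec_eq_iff)
qed

lemma weak_gradient_add:
  assumes "u \<in> L2_space U" "v \<in> L2_space U" "G \<in> L2_space U" "H \<in> L2_space U"
    "is_weak_gradient U u G" "is_weak_gradient U v H"
  shows "is_weak_gradient U (u + v) (G + H)" using assms unfolding is_weak_gradient_def
  by (simp add: distrib_right integrable_test integrable_component integrable_component2)

lemma weak_gradient_scale:
  assumes "is_weak_gradient U u G"
  shows "is_weak_gradient U (c *\<^sub>R u) (c *\<^sub>R G)"
  using assms unfolding is_weak_gradient_def by (simp add: mult.assoc)

lemma weak_grad:
  assumes "u \<in> H1_space U"
  shows "weak_grad U u \<in> L2_space U" "is_weak_gradient U u (weak_grad U u)"
proof -
  have "\<exists>G. G \<in> L2_space U \<and> is_weak_gradient U u G" using assms by (auto simp: H1_space_def)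
  from someI_ex[OF this] show "weak_grad U u \<in> L2_space U" "is_weak_gradient U u (weak_grad U u)"
    unfolding weak_grad_def by auto
qed

lemma H1_L2: "u \<in> H1_space U \<Longrightarrow> u \<in> L2_space U" by (simp add: H1_space_def)

lemma H1_I: "u \<in> L2_space U \<Longrightarrow> G \<in> L2_space U \<Longrightarrow> is_weak_gradient U u G \<Longrightarrow> u \<in> H1_space U"
  by (auto simp: H1_space_def)

lemma weak_grad_AE:
  assumes "u \<in> L2_space U" "G \<in> L2_space U" "is_weak_gradient U u G"
  shows "AE x in M. weak_grad U u x = G x"
  using weak_gradient_unique[OF weak_grad(1) assms(2) weak_grad(2) assms(3)] H1_I[OF assms] by simp

lemma H1_subspace: "subspace (H1_space U)" unfolding subspace_def
proof (intro conjI ballI allI)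
  show "0 \<in> H1_space U" by (rule H1_I[OF L2_zero L2_zero]) (simp add: is_weak_gradient_def)
  show "u + v \<in> H1_space U" if "u \<in> H1_space U" "v \<in> H1_space U" for u v
    by (rule H1_I[OF L2_add[OF H1_L2 H1_L2] L2_add[OF weak_grad(1) weak_grad(1)]
          weak_gradient_add[OF H1_L2 H1_L2 weak_grad(1) weak_grad(1) weak_grad(2) weak_grad(2)]]) (fact that)+
  show "c *\<^sub>R u \<in> H1_space U" if "u \<in> H1_space U" for u c
    by (rule H1_I[OF L2_scale[OF H1_L2] L2_scale[OF weak_grad(1)] weak_gradient_scale[OF weak_grad(2)]]) (fact that)+
qed

lemma inner_V_eq:
  assumes "u \<in> L2_space U" "G \<in> L2_space U" "is_weak_gradient U u G" "v \<in> H1_space U"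
  shows "inner_V U u v = inner_L2 U G (weak_grad U v)" unfolding inner_V_def
  by (rule L2_inner_cong_AE[OF weak_grad_AE[OF assms(1-3)] weak_grad(1)[OF H1_I[OF assms(1-3)]] assms(2) weak_grad(1)[OF assms(4)]])

text \<open>Every computation with \<open>inner_V\<close> passes through this: the chosen gradients
  may be replaced by whichever weak gradients are at hand.\<close>

lemma inner_V_eq2:
  assumes "u \<in> L2_space U" "G \<in> L2_space U" "is_weak_gradient U u G"
    "v \<in> L2_space U" "H \<in> L2_space U" "is_weak_gradient U v H"
  shows "inner_V U u v = inner_L2 U G H"
proof -
  have "inner_V U u v = inner_L2 U G (weak_grad U v)" by (rule inner_V_eq[OF assms(1-3) H1_I[OF assms(4-6)]])
  also have "... = inner_L2 U (weak_grad U v) G"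
    by (rule L2.sym[OF assms(2) weak_grad(1)[OF H1_I[OF assms(4-6)]]])
  also have "... = inner_L2 U H G"
    by (rule L2_inner_cong_AE[OF weak_grad_AE[OF assms(4-6)] weak_grad(1)[OF H1_I[OF assms(4-6)]] assms(5,2)])
  also have "... = inner_L2 U G H" using assms by (intro L2.sym)
  finally show ?thesis .
qed

lemma H1_semi_inner_V: "semi_inner (H1_space U) (inner_V U)"
proof
  show "subspace (H1_space U)" by (rule H1_subspace)
next
  fix u v w assume H: "u \<in> H1_space U" "v \<in> H1_space U" "w \<in> H1_space U"
  note g = weak_grad[OF H(1)] weak_grad[OF H(2)] weak_grad[OF H(3)] and l = H[THEN H1_L2]
  show "inner_V U (u + v) w = inner_V U u w + inner_V U v w"
    using inner_V_eq[OF L2_add[OF l(1,2)] L2_add[OF g(1,3)] weak_gradient_add[OF l(1,2) g(1,3) g(2,4)] H(3)]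
    unfolding inner_V_def using L2.add_left[OF g(1,3,5)] by simp
next
  fix u w c assume H: "u \<in> H1_space U" "w \<in> H1_space U"
  note g = weak_grad[OF H(1)] weak_grad[OF H(2)] and l = H[THEN H1_L2]
  show "inner_V U (c *\<^sub>R u) w = c * inner_V U u w"
    using inner_V_eq[OF L2_scale[OF l(1)] L2_scale[OF g(1)] weak_gradient_scale[OF g(2)] H(2)]
    unfolding inner_V_def using L2.scale_left[OF g(1,3)] by simp
next
  fix u v assume H: "u \<in> H1_space U" "v \<in> H1_space U"
  then show "inner_V U u v = inner_V U v u" unfolding inner_V_def by (intro L2.sym weak_grad)
next
  fix u assume "u \<in> H1_space U"
  then show "0 \<le> inner_V U u u" unfolding inner_V_def by (intro L2.nonneg weak_grad)
qed

definition inner_H1 :: "(real^'n \<Rightarrow> real^'n) \<Rightarrow> (real^'n \<Rightarrow> real^'n) \<Rightarrow> real" where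
  "inner_H1 u v = inner_L2 U u v + inner_V U u v"

sublocale HV: semi_inner "H1_space U" "inner_V U" by (rule H1_semi_inner_V)

sublocale H1: semi_inner "H1_space U" inner_H1
proof
  show "subspace (H1_space U)" by (rule H1_subspace)
qed (auto simp: inner_H1_def H1_L2 HV.add_left L2.add_left HV.scale_left L2.scale_left algebra_simps
    HV.nonneg L2.nonneg intro!: arg_cong2[where f = "(+)"] HV.sym L2.sym)

lemma norm_H1_eq: "u \<in> H1_space U \<Longrightarrow> norm_H1 U u = H1.nrm u"
  by (simp add: norm_H1_def H1.nrm_def inner_H1_def norm_L2_def inner_V_def L2.nonneg weak_grad H1_L2)

lemma norm_V_eq: "norm_V U u = HV.nrm u" by (simp add: norm_V_def HV.nrm_def)

lemma norms_le_H1: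
  assumes "u \<in> H1_space U" shows "HV.nrm u \<le> H1.nrm u" "L2.nrm U u \<le> H1.nrm u"
  using assms by (simp_all add: HV.nrm_def H1.nrm_def L2.nrm_def inner_H1_def L2.nonneg HV.nonneg H1_L2)

lemma H1_nrm_le:
  assumes "u \<in> H1_space U" shows "H1.nrm u \<le> L2.nrm U u + HV.nrm u"
  using assms sqrt_add_le_add_sqrt[OF L2.nonneg[OF H1_L2[OF assms]] HV.nonneg[OF assms]]
  by (simp add: HV.nrm_def H1.nrm_def L2.nrm_def inner_H1_def)

end

section \<open>Solenoidal spaces\<close>

lemma test_functions_zero: "(0 :: 'a::euclidean_space \<Rightarrow> 'b::real_normed_vector) \<in> test_functions U"
  by (rule test_functions_subset_support[where K = "{}"]) (simp_all add: zero_fun_def)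

lemma test_functions_add:
  fixes u v :: "'a::euclidean_space \<Rightarrow> 'b::real_normed_vector"
  assumes "u \<in> test_functions U" "v \<in> test_functions U" shows "u + v \<in> test_functions U"
proof (rule test_functions_subset_support)
  show "Ck k (u + v)" for k unfolding plus_fun_def
    by (rule Ck_add[OF test_functionsD(1)[OF assms(1)] test_functionsD(1)[OF assms(2)]])
  show "{x. (u + v) x \<noteq> 0} \<subseteq> closure {x. u x \<noteq> 0} \<union> closure {x. v x \<noteq> 0}"
  proof
    fix x assume "x \<in> {x. (u + v) x \<noteq> 0}"
    then have "x \<in> {x. u x \<noteq> 0} \<or> x \<in> {x. v x \<noteq> 0}" by auto
    then show "x \<in> closure {x. u x \<noteq> 0} \<union> closure {x. v x \<noteq> 0}"
      by (elim disjE) (rule UnI1, erule subsetD[OF closure_subset], rule UnI2, erule subsetD[OF closure_subset])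
  qed
  show "compact (closure {x. u x \<noteq> 0} \<union> closure {x. v x \<noteq> 0})"
    by (intro compact_Un test_functionsD(2)[OF assms(1)] test_functionsD(2)[OF assms(2)])
  show "closure {x. u x \<noteq> 0} \<union> closure {x. v x \<noteq> 0} \<subseteq> U"
    by (intro Un_least test_functionsD(3)[OF assms(1)] test_functionsD(3)[OF assms(2)])
qed

lemma test_functions_linear:
  fixes u :: "'a::euclidean_space \<Rightarrow> 'b::real_normed_vector"
  assumes "bounded_linear L" "u \<in> test_functions U" shows "(\<lambda>x. L (u x)) \<in> test_functions U"
proof (rule test_functions_subset_support)
  show "Ck k (\<lambda>x. L (u x))" for k by (rule Ck_linear[OF assms(1) test_functionsD(1)[OF assms(2)]])
  show "{x. L (u x) \<noteq> 0} \<subseteq> closure {x. u x \<noteq> 0}"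
    using linear_simps(3)[OF assms(1)] by (intro order_trans[OF _ closure_subset]) auto
qed (rule test_functionsD[OF assms(2)])+

lemma test_functions_subspace: "subspace (test_functions U :: ('a::euclidean_space \<Rightarrow> 'b::real_normed_vector) set)"
  unfolding subspace_def
proof (intro conjI ballI allI test_functions_zero test_functions_add)
  show "c *\<^sub>R u \<in> test_functions U" if "u \<in> test_functions U" for c and u :: "'a \<Rightarrow> 'b"
    unfolding scaleR_fun_def by (rule test_functions_linear[OF bounded_linear_scaleR_right that])
qed

lemma test_functions_has_derivative:
  "u \<in> test_functions U \<Longrightarrow> (u has_derivative frechet_derivative u (at x)) (at x)"
  by (rule Ck_Suc_has_derivative[OF test_functionsD(1)])

lemma solenoidal_subspace: "subspace (solenoidal_test U :: (real^'n::finite \<Rightarrow> real^'n) set)"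
  unfolding subspace_def
proof (intro conjI ballI allI)
  show "(0 :: real^'n \<Rightarrow> real^'n) \<in> solenoidal_test U"
    using test_functions_zero[where 'a = "real^'n" and 'b = "real^'n"]
    by (simp add: solenoidal_test_def divergence_def partial_def zero_fun_def)
next
  fix u v :: "real^'n \<Rightarrow> real^'n" assume uv: "u \<in> solenoidal_test U" "v \<in> solenoidal_test U"
  have "partial j (u + v) x = partial j u x + partial j v x" for j x
    unfolding partial_def plus_fun_def using uv
    by (subst frechet_derivative_eqI[OF has_derivative_add[OF test_functions_has_derivative test_functions_has_derivative]])
      (auto simp: solenoidal_test_def)
  then show "u + v \<in> solenoidal_test U" using uv
    by (simp add: solenoidal_test_def test_functions_add divergence_def sum.distrib)
next
  fix c and u :: "real^'n \<Rightarrow> real^'n" assume u: "u \<in> solenoidal_test U"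
  have "partial j (c *\<^sub>R u) x = c *\<^sub>R partial j u x" for j x unfolding partial_def scaleR_fun_def using u
    by (subst frechet_derivative_eqI[OF has_derivative_scaleR_right[OF test_functions_has_derivative]])
      (auto simp: solenoidal_test_def)
  moreover have "c *\<^sub>R u \<in> test_functions U"
    using u by (intro subspace_mul[OF test_functions_subspace]) (simp add: solenoidal_test_def)
  ultimately show "c *\<^sub>R u \<in> solenoidal_test U" using u
    by (simp add: solenoidal_test_def divergence_def flip: sum_distrib_left)
qed

lemma Basis_vec_real: "(Basis :: (real^'n::finite) set) = range (\<lambda>i. axis i 1)" by (auto simp: Basis_vec_def)

lemma sum_Basis_vec: "(\<Sum>b\<in>(Basis :: (real^'n::finite) set). f b) = (\<Sum>i\<in>UNIV. f (axis i 1))"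
proof -
  have "inj (\<lambda>i::'n. axis i (1::real))" by (auto simp: inj_on_def axis_eq_axis)
  then show ?thesis unfolding Basis_vec_real by (simp add: sum.reindex)
qed

lemma matrix_norm_sq: "(norm (A :: real^'n::finite^'m::finite))\<^sup>2 = (\<Sum>i\<in>UNIV. \<Sum>j\<in>UNIV. (A $ i $ j)\<^sup>2)"
  unfolding power2_norm_eq_inner by (simp add: inner_vec_def power2_eq_square)

lemma vector_norm_sq: "(norm (a :: real^'n::finite))\<^sup>2 = (\<Sum>i\<in>UNIV. (a $ i)\<^sup>2)"
  unfolding power2_norm_eq_inner by (simp add: inner_vec_def power2_eq_square)

context bounded_open
begin

definition comp :: "(real^'n \<Rightarrow> real^'n) \<Rightarrow> 'n \<Rightarrow> real^'n \<Rightarrow> real" where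
  "comp u i x = u x $ i"

definition grad :: "(real^'n \<Rightarrow> real^'n) \<Rightarrow> real^'n \<Rightarrow> real^'n^'n" where
  "grad u x = (\<chi> i j. dd (comp u i) (axis j 1) x)"

lemma comp_test: "u \<in> test_functions U \<Longrightarrow> comp u i \<in> test_functions U"
  unfolding comp_def[abs_def] by (rule test_functions_linear[OF bounded_linear_vec_nth])

text \<open>The spaces are defined with Lebesgue measure on the domain, whereas the translation
  arguments need Borel measure on the whole space; for functions vanishing off the domain the two
  agree.\<close>

lemma integral_dom_eq:
  fixes f :: "real^'n \<Rightarrow> real"
  assumes "f \<in> borel_measurable borel" "\<And>x. f x \<noteq> 0 \<Longrightarrow> x \<in> U"
  shows "(LINT x|M. f x) = (LINT x|lborel. f x)" "integrable M f \<longleftrightarrow> integrable lborel f"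
proof -
  have eq: "(\<lambda>x. indicator U x *\<^sub>R f x) = f" using assms(2) by (auto simp: fun_eq_iff indicator_def)
  show "(LINT x|M. f x) = (LINT x|lborel. f x)"
  proof -
    have "(LINT x|M. f x) = (LINT x|lebesgue. indicator U x *\<^sub>R f x)"
      using dom_lebesgue by (intro integral_restrict_space) simp
    also have "... = (LINT x|lebesgue. f x)" by (simp only: eq)
    also have "... = (LINT x|lborel. f x)" by (rule integral_completion) (simp add: assms(1))
    finally show ?thesis .
  qed
  show "integrable M f \<longleftrightarrow> integrable lborel f"
  proof -
    have "integrable M f \<longleftrightarrow> integrable lebesgue (\<lambda>x. indicator U x *\<^sub>R f x)"
      using dom_lebesgue by (intro integrable_restrict_space) simp
    also have "... \<longleftrightarrow> integrable lebesgue f" by (simp only: eq)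
    also have "... \<longleftrightarrow> integrable lborel f" by (rule integrable_completion) (simp add: assms(1))
    finally show ?thesis .
  qed
qed

lemma dd_in_dom: "\<phi> \<in> test_functions U \<Longrightarrow> dd \<phi> z x \<noteq> 0 \<Longrightarrow> x \<in> U"
proof (rule ccontr)
  assume \<phi>: "\<phi> \<in> test_functions U" "dd \<phi> z x \<noteq> 0" "x \<notin> U"
  then have "x \<notin> closure {x. \<phi> x \<noteq> 0}" using subsetD[OF test_functionsD(3)[OF \<phi>(1)], of x] by argo
  then show False using C1c_dd_outside[OF test_function_C1c[OF \<phi>(1)]] \<phi>(2) by simp
qed

lemma borel_measurable_matrix:
  fixes G :: "real^'n \<Rightarrow> real^'n^'n"
  assumes "\<And>i j. (\<lambda>x. G x $ i $ j) \<in> borel_measurable N" shows "G \<in> borel_measurable N"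
proof (rule borel_measurable_euclidean_space[THEN iffD2], rule ballI)
  fix b :: "real^'n^'n" assume "b \<in> Basis"
  then obtain i v where "b = axis i v" "v \<in> Basis" unfolding Basis_vec_def by auto
  moreover from this obtain j where "v = axis j 1" unfolding Basis_vec_real by auto
  ultimately show "(\<lambda>x. G x \<bullet> b) \<in> borel_measurable N" using assms by (simp add: inner_axis)
qed

lemma test_L2:
  assumes "u \<in> test_functions U"
  shows "u \<in> L2_space U" "inner_L2 U u u = (\<Sum>i\<in>UNIV. LINT x|lborel. (comp u i x)\<^sup>2)"
proof -
  note C = test_function_C1c[OF comp_test[OF assms]]
  have cont: "continuous_on UNIV u" using test_functionsD(1)[OF assms, of 0] by simp
  have cm: "comp u i \<in> borel_measurable borel" for i using C1c_continuous[OF C] by (rule borel_measurable_continuous_onI)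
  have z: "x \<in> U" if "(comp u i x)\<^sup>2 \<noteq> 0" for i x
  proof -
    have "u x \<noteq> 0" using that by (auto simp: comp_def)
    then show ?thesis by (rule test_functionsD(4)[OF assms])
  qed
  have i: "integrable M (\<lambda>x. (comp u i x)\<^sup>2)" for i
    by (rule iffD2[OF integral_dom_eq(2)], rule borel_measurable_power[OF cm], erule z, rule C1c_sq_integrable[OF C])
  have n: "(norm (u x))\<^sup>2 = (\<Sum>i\<in>UNIV. (comp u i x)\<^sup>2)" for x by (simp add: vector_norm_sq comp_def)
  have "integrable M (\<lambda>x. (norm (u x))\<^sup>2)" unfolding n by (intro Bochner_Integration.integrable_sum i)
  then show "u \<in> L2_space U" using continuous_imp_lebesgue_on[OF cont] by (simp add: L2_space_def)
  have "inner_L2 U u u = (LINT x|M. (\<Sum>i\<in>UNIV. (comp u i x)\<^sup>2))"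
    by (simp add: inner_L2_def n flip: power2_norm_eq_inner)
  also have "... = (\<Sum>i\<in>UNIV. LINT x|M. (comp u i x)\<^sup>2)" by (intro Bochner_Integration.integral_sum i)
  also have "... = (\<Sum>i\<in>UNIV. LINT x|lborel. (comp u i x)\<^sup>2)"
    by (intro sum.cong refl integral_dom_eq(1) borel_measurable_power cm z)
  finally show "inner_L2 U u u = (\<Sum>i\<in>UNIV. LINT x|lborel. (comp u i x)\<^sup>2)" .
qed

lemma test_grad_L2:
  assumes "u \<in> test_functions U"
  shows "grad u \<in> L2_space U" "inner_L2 U (grad u) (grad u) = (\<Sum>i\<in>UNIV. energy (comp u i))"
proof -
  note C = test_function_C1c[OF comp_test[OF assms]]
  have cm: "dd (comp u i) z \<in> borel_measurable borel" for i z
    using C1c_dd_continuous[OF C] by (rule borel_measurable_continuous_onI)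
  have z: "x \<in> U" if "(dd (comp u i) (axis j 1) x)\<^sup>2 \<noteq> 0" for i j x
    using that dd_in_dom[OF comp_test[OF assms]] by simp
  have i: "integrable M (\<lambda>x. (dd (comp u i) (axis j 1) x)\<^sup>2)" for i j
    by (rule iffD2[OF integral_dom_eq(2)], rule borel_measurable_power[OF cm], erule z, rule C1c_dd_sq_integrable[OF C])
  have n: "(norm (grad u x))\<^sup>2 = (\<Sum>i\<in>UNIV. \<Sum>j\<in>UNIV. (dd (comp u i) (axis j 1) x)\<^sup>2)" for x
    by (simp add: matrix_norm_sq grad_def)
  have int: "integrable M (\<lambda>x. (norm (grad u x))\<^sup>2)"
    unfolding n by (intro Bochner_Integration.integrable_sum i)
  have "grad u \<in> borel_measurable M"
  proof (rule borel_measurable_matrix)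
    show "(\<lambda>x. grad u x $ i $ j) \<in> borel_measurable M" for i j
      using continuous_imp_lebesgue_on[OF C1c_dd_continuous[OF C]] by (simp add: grad_def)
  qed
  then show "grad u \<in> L2_space U" using int by (simp add: L2_space_def)
  have "inner_L2 U (grad u) (grad u) = (LINT x|M. (\<Sum>i\<in>UNIV. \<Sum>j\<in>UNIV. (dd (comp u i) (axis j 1) x)\<^sup>2))"
    by (simp add: inner_L2_def n flip: power2_norm_eq_inner)
  also have "... = (\<Sum>i\<in>UNIV. \<Sum>j\<in>UNIV. LINT x|M. (dd (comp u i) (axis j 1) x)\<^sup>2)"
    by (simp add: Bochner_Integration.integral_sum Bochner_Integration.integrable_sum i)
  also have "... = (\<Sum>i\<in>UNIV. \<Sum>j\<in>UNIV. LINT x|lborel. (dd (comp u i) (axis j 1) x)\<^sup>2)"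
    by (intro sum.cong refl integral_dom_eq(1) borel_measurable_power cm z)
  also have "... = (\<Sum>i\<in>UNIV. energy (comp u i))" by (simp add: energy_def[OF C] sum_Basis_vec)
  finally show "inner_L2 U (grad u) (grad u) = (\<Sum>i\<in>UNIV. energy (comp u i))" .
qed

lemma C1c_mult:
  fixes f g :: "real^'n \<Rightarrow> real"
  assumes "f \<in> test_functions U" "g \<in> test_functions U"
  shows "C1c (\<lambda>x. f x * g x)" "dd (\<lambda>x. f x * g x) z x = f x * dd g z x + dd f z x * g x"
proof -
  have "(\<lambda>x. f x * g x) \<in> test_functions U"
  proof (rule test_functions_subset_support)
    show "Ck k (\<lambda>x. f x * g x)" for k by (rule Ck_mult[OF test_functionsD(1)[OF assms(1)] test_functionsD(1)[OF assms(2)]])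
    show "{x. f x * g x \<noteq> 0} \<subseteq> closure {x. f x \<noteq> 0}" by (intro order_trans[OF _ closure_subset]) auto
  qed (rule test_functionsD[OF assms(1)])+
  then show C: "C1c (\<lambda>x. f x * g x)" by (rule test_function_C1c)
  show "dd (\<lambda>x. f x * g x) z x = f x * dd g z x + dd f z x * g x"
    using has_derivative_unique[OF C1c_has_derivative[OF C]
        has_derivative_mult[OF C1c_has_derivative[OF test_function_C1c[OF assms(1)]] C1c_has_derivative[OF test_function_C1c[OF assms(2)]]]]
    by (rule fun_cong)
qed

text \<open>The derivative of the product of a component with a test function has integral
  zero.\<close>

lemma test_weak_gradient:
  assumes "u \<in> test_functions U" shows "is_weak_gradient U u (grad u)" unfolding is_weak_gradient_def
proof (intro ballI allI)
  fix \<phi> :: "real^'n \<Rightarrow> real" and i j assume \<phi>: "\<phi> \<in> test_functions U"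
  let ?f = "comp u i" and ?z = "axis j 1 :: real^'n"
  note f = comp_test[OF assms, of i]
  have "f \<in> borel_measurable M" if "continuous_on UNIV f" for f :: "real^'n \<Rightarrow> real"
    using continuous_imp_lebesgue_on[OF that] .
  have int: "integrable M (\<lambda>x. ?f x * dd \<phi> ?z x)" "integrable M (\<lambda>x. dd ?f ?z x * \<phi> x)"
    using integrable_test(2)[OF integrable_component[OF test_L2(1)[OF assms]] \<phi>]
      integrable_test(1)[OF integrable_component2[OF test_grad_L2(1)[OF assms]] \<phi>, of i j]
    by (simp_all add: comp_def partial_eq_dd grad_def)
  have m: "(\<lambda>x. dd (\<lambda>x. ?f x * \<phi> x) ?z x) \<in> borel_measurable borel"
    using C1c_dd_continuous[OF C1c_mult(1)[OF f \<phi>]] by (rule borel_measurable_continuous_onI)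
  have z: "x \<in> U" if "dd (\<lambda>x. ?f x * \<phi> x) ?z x \<noteq> 0" for x
  proof -
    have "?f x \<noteq> 0 \<or> \<phi> x \<noteq> 0" using that unfolding C1c_mult(2)[OF f \<phi>] by auto
    then show ?thesis by (elim disjE) (erule test_functionsD(4)[OF f], erule test_functionsD(4)[OF \<phi>])
  qed
  have "0 = (LINT x|M. dd (\<lambda>x. ?f x * \<phi> x) ?z x)"
    using integral_dom_eq(1)[OF m z] integral_dd_zero[OF C1c_mult(1)[OF f \<phi>]] by simp
  also have "... = (LINT x|M. ?f x * dd \<phi> ?z x) + (LINT x|M. dd ?f ?z x * \<phi> x)"
    unfolding C1c_mult(2)[OF f \<phi>] by (rule Bochner_Integration.integral_add[OF int])
  finally show "(LINT x|M. u x $ i * partial j \<phi> x) = - (LINT x|M. grad u x $ i $ j * \<phi> x)"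
    by (simp add: partial_eq_dd grad_def comp_def[abs_def])
qed

lemma test_H1: "u \<in> test_functions U \<Longrightarrow> u \<in> H1_space U"
  by (rule H1_I[OF test_L2(1) test_grad_L2(1) test_weak_gradient])

lemma test_inner_V:
  "u \<in> test_functions U \<Longrightarrow> inner_V U u u = (\<Sum>i\<in>UNIV. energy (comp u i))"
  using inner_V_eq2[OF test_L2(1) test_grad_L2(1) test_weak_gradient test_L2(1) test_grad_L2(1) test_weak_gradient]
    test_grad_L2(2) by simp

end

section \<open>Closures with respect to a seminorm\<close>

definition (in semi_inner) nrm_closure :: "'v set \<Rightarrow> 'v set" where
  "nrm_closure S = {u \<in> V. \<forall>eps>0. \<exists>\<phi>\<in>S. nrm (u - \<phi>) < eps}"

lemma (in semi_inner) nrm_closureD: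
  "u \<in> nrm_closure S \<Longrightarrow> eps > 0 \<Longrightarrow> \<exists>\<phi>\<in>S. nrm (u - \<phi>) < eps" unfolding nrm_closure_def by blast

lemma (in semi_inner) nrm_closure_superset:
  assumes "S \<subseteq> V" shows "S \<subseteq> nrm_closure S"
proof
  fix u assume "u \<in> S"
  then have "u \<in> V" "nrm (u - u) = 0" using assms mem_zero by (auto simp: nrm_def)
  then show "u \<in> nrm_closure S" using \<open>u \<in> S\<close> unfolding nrm_closure_def by force
qed

lemma (in semi_inner) nrm_closure_subspace:
  assumes S: "subspace S" "S \<subseteq> V" shows "subspace (nrm_closure S)" unfolding subspace_def
proof (intro conjI ballI allI)
  show "0 \<in> nrm_closure S" using nrm_closure_superset[OF S(2)] subspace_0[OF S(1)] by blast
next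
  fix u v assume u: "u \<in> nrm_closure S" and v: "v \<in> nrm_closure S"
  have "\<exists>\<phi>\<in>S. nrm (u + v - \<phi>) < eps" if that': "eps > 0" for eps
  proof -
    obtain \<phi> where \<phi>: "\<phi> \<in> S" "nrm (u - \<phi>) < eps / 2" using nrm_closureD[OF u half_gt_zero[OF that']] by blast
    obtain \<psi> where \<psi>: "\<psi> \<in> S" "nrm (v - \<psi>) < eps / 2" using nrm_closureD[OF v half_gt_zero[OF that']] by blast
    have "nrm ((u - \<phi>) + (v - \<psi>)) \<le> nrm (u - \<phi>) + nrm (v - \<psi>)"
      using u v \<phi>(1) \<psi>(1) S(2) by (intro nrm_triangle mem_diff) (auto simp: nrm_closure_def)
    moreover have "(u - \<phi>) + (v - \<psi>) = u + v - (\<phi> + \<psi>)" by simp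
    ultimately have "nrm (u + v - (\<phi> + \<psi>)) < eps" using \<phi>(2) \<psi>(2) by simp
    then show ?thesis using subspace_add[OF S(1) \<phi>(1) \<psi>(1)] by blast
  qed
  then show "u + v \<in> nrm_closure S" using u v by (simp add: nrm_closure_def mem_add)
next
  fix c u assume u: "u \<in> nrm_closure S"
  have "\<exists>\<phi>\<in>S. nrm (c *\<^sub>R u - \<phi>) < eps" if "eps > 0" for eps
  proof -
    have "eps / (\<bar>c\<bar> + 1) > 0" using that by simp
    then obtain \<phi> where \<phi>: "\<phi> \<in> S" "nrm (u - \<phi>) < eps / (\<bar>c\<bar> + 1)" using u unfolding nrm_closure_def by blast
    have uV: "u - \<phi> \<in> V" using u \<phi>(1) S(2) by (intro mem_diff) (auto simp: nrm_closure_def)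
    have "nrm (c *\<^sub>R u - c *\<^sub>R \<phi>) = \<bar>c\<bar> * nrm (u - \<phi>)" using nrm_scale[OF uV] by (simp add: scaleR_diff_right)
    also have "... \<le> (\<bar>c\<bar> + 1) * nrm (u - \<phi>)" using nrm_nonneg[OF uV] by (simp add: mult_right_mono)
    also have "... < eps" using \<phi>(2) by (simp add: field_simps)
    finally show ?thesis using subspace_mul[OF S(1) \<phi>(1)] by blast
  qed
  then show "c *\<^sub>R u \<in> nrm_closure S" using u by (simp add: nrm_closure_def mem_scale)
qed

lemma (in semi_inner) nrm_closure_closed:
  assumes S: "S \<subseteq> V" and X: "\<And>n. X n \<in> nrm_closure S" "(\<lambda>n. nrm (X n - u)) \<longlonglongrightarrow> 0" "u \<in> V"
  shows "u \<in> nrm_closure S"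
proof -
  have "\<exists>\<phi>\<in>S. nrm (u - \<phi>) < eps" if that': "eps > 0" for eps
  proof -
    obtain n where "norm (nrm (X n - u) - 0) < eps / 2"
      using LIMSEQ_D[OF X(2) half_gt_zero[OF that']] by blast
    then have n: "nrm (X n - u) < eps / 2" by simp
    obtain \<phi> where \<phi>: "\<phi> \<in> S" "nrm (X n - \<phi>) < eps / 2" using nrm_closureD[OF X(1) half_gt_zero[OF that'], of n] by blast
    have V: "X n \<in> V" "\<phi> \<in> V" using X(1) \<phi>(1) S by (auto simp: nrm_closure_def)
    have "nrm (u - \<phi>) \<le> nrm (u - X n) + nrm (X n - \<phi>)" by (rule nrm_triangle_diff[OF X(3) V])
    then have "nrm (u - \<phi>) < eps" using n \<phi>(2) nrm_minus_commute[OF X(3) V(1)] by simp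
    then show ?thesis using \<phi>(1) by blast
  qed
  then show ?thesis using X(3) by (simp add: nrm_closure_def)
qed

lemma (in semi_inner) nrm_closure_seq:
  assumes "u \<in> nrm_closure S"
  shows "\<exists>\<phi>. (\<forall>n::nat. \<phi> n \<in> S \<and> nrm (u - \<phi> n) < inverse (real (Suc n)))"
proof (intro choice allI)
  fix n :: nat
  have "inverse (real (Suc n)) > 0" by simp
  from nrm_closureD[OF assms this] show "\<exists>\<phi>. \<phi> \<in> S \<and> nrm (u - \<phi>) < inverse (real (Suc n))" by blast
qed

lemma LIMSEQ_of_less_inverse:
  assumes "\<And>n. 0 \<le> x n" "\<And>n. x n < inverse (real (Suc n))" shows "x \<longlonglongrightarrow> 0"
proof (rule tendsto_sandwich[OF _ _ tendsto_const LIMSEQ_inverse_real_of_nat])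
  show "\<forall>\<^sub>F n in sequentially. x n \<le> inverse (real (Suc n))"
    using assms(2) by (intro always_eventually allI less_imp_le)
qed (use assms(1) in simp)

text \<open>With v a unit vector or unit matrix, the two sides of the definition of a weak gradient
  become L2 products with such a fixed function, and those are continuous.\<close>

lemma weak_gradient_limit_aux:
  assumes "finite_measure (lebesgue_on U)" "continuous_on UNIV \<psi>" "\<And>x. \<bar>\<psi> x\<bar> \<le> B"
  shows "(\<lambda>x. \<psi> x *\<^sub>R v) \<in> L2_space U"
proof -
  interpret finite_measure "lebesgue_on U" by (rule assms)
  have m: "(\<lambda>x. \<psi> x *\<^sub>R v) \<in> borel_measurable (lebesgue_on U)"
    by (intro continuous_imp_lebesgue_on continuous_intros assms)
  have b: "(norm (\<psi> x *\<^sub>R v))\<^sup>2 \<le> (B * norm v)\<^sup>2" for x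
    using assms(3)[of x] by (intro power_mono) (auto intro: mult_right_mono)
  have "integrable (lebesgue_on U) (\<lambda>x. (norm (\<psi> x *\<^sub>R v))\<^sup>2)"
  proof (rule integrable_const_bound[where B = "(B * norm v)\<^sup>2"])
    show "AE x in lebesgue_on U. norm ((norm (\<psi> x *\<^sub>R v))\<^sup>2) \<le> (B * norm v)\<^sup>2" using b by (intro AE_I2) simp
    show "(\<lambda>x. (norm (\<psi> x *\<^sub>R v))\<^sup>2) \<in> borel_measurable (lebesgue_on U)"
      by (intro borel_measurable_power measurable_compose[OF m borel_measurable_norm])
  qed
  with m show ?thesis by (simp add: L2_space_def)
qed

section \<open>The spaces V and H: Poincare inequality and completeness of V\<close>

context bounded_open
begin

abbreviation "VV \<equiv> V_space U"
abbreviation "HH \<equiv> H_space U"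

lemma solenoidal_H1: "solenoidal_test U \<subseteq> H1_space U" using test_H1 by (auto simp: solenoidal_test_def)

text \<open>Solenoidal test fields are test functions, so whatever they approximate in H1 lies in
  \<open>H01_space\<close> automatically, and the closure may be taken in H1.\<close>

lemma V_eq: "VV = H1.nrm_closure (solenoidal_test U)"
proof -
  have d: "norm_H1 U (u - \<phi>) = H1.nrm (u - \<phi>)" if "u \<in> H1_space U" "\<phi> \<in> test_functions U" for u \<phi>
    by (rule norm_H1_eq[OF H1.mem_diff[OF that(1) test_H1[OF that(2)]]])
  have "\<phi> \<in> test_functions U" if "\<phi> \<in> solenoidal_test U" for \<phi> using that by (simp add: solenoidal_test_def)
  then show ?thesis
    unfolding V_space_def H01_space_def closure_in_def H1.nrm_closure_def using d by (auto; metis)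
qed

lemma H_eq: "HH = L2.nrm_closure U (solenoidal_test U)"
  unfolding H_space_def closure_in_def L2.nrm_closure_def norm_L2_eq_nrm ..

lemma solenoidal_L2: "solenoidal_test U \<subseteq> L2_space U" using solenoidal_H1 H1_L2 by blast

lemma V_subspace: "subspace VV"
  unfolding V_eq by (rule H1.nrm_closure_subspace[OF solenoidal_subspace solenoidal_H1])

lemma H_subspace: "subspace HH"
  unfolding H_eq by (rule L2.nrm_closure_subspace[OF solenoidal_subspace solenoidal_L2])

lemma V_H1: "u \<in> VV \<Longrightarrow> u \<in> H1_space U" unfolding V_eq H1.nrm_closure_def by simp

lemma H_L2: "u \<in> HH \<Longrightarrow> u \<in> L2_space U" unfolding H_eq L2.nrm_closure_def by simp

lemma V_H: "u \<in> VV \<Longrightarrow> u \<in> HH" unfolding V_eq H_eq H1.nrm_closure_def L2.nrm_closure_def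
proof (safe intro!: H1_L2)
  fix eps :: real assume u: "u \<in> H1_space U" "\<forall>eps>0. \<exists>\<phi>\<in>solenoidal_test U. H1.nrm (u - \<phi>) < eps" "eps > 0"
  then obtain \<phi> where \<phi>: "\<phi> \<in> solenoidal_test U" "H1.nrm (u - \<phi>) < eps" by blast
  then have "L2.nrm U (u - \<phi>) < eps"
    using norms_le_H1(2)[of "u - \<phi>"] H1.mem_diff[OF u(1), of \<phi>] solenoidal_H1 by fastforce
  then show "\<exists>\<phi>\<in>solenoidal_test U. L2.nrm U (u - \<phi>) < eps" using \<phi>(1) by blast
qed

lemma solenoidal_V: "u \<in> solenoidal_test U \<Longrightarrow> u \<in> VV"
  unfolding V_eq using H1.nrm_closure_superset[OF solenoidal_H1] by blast

sublocale VA: semi_inner VV "inner_V U"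
  by unfold_locales (auto simp: V_subspace V_H1 HV.add_left HV.scale_left HV.nonneg intro: HV.sym)

sublocale VB: semi_inner VV "inner_L2 U"
  by unfold_locales (auto simp: V_subspace V_H1 H1_L2 L2.add_left L2.scale_left L2.nonneg intro: L2.sym)

sublocale HB: semi_inner HH "inner_L2 U"
  by unfold_locales (auto simp: H_subspace H_L2 L2.add_left L2.scale_left L2.nonneg intro: L2.sym)

lemma radius_ex: "\<exists>R>0. \<forall>x\<in>U. norm x < R"
  using bounded_dom unfolding bounded_pos by (metis add_strict_increasing le_less_trans less_add_one zero_less_one add_pos_pos)

definition radius :: real where "radius = (SOME R. R > 0 \<and> (\<forall>x\<in>U. norm x < R))"

lemma radius: "radius > 0" "x \<in> U \<Longrightarrow> norm x < radius" using someI_ex[OF radius_ex] unfolding radius_def by auto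

text \<open>The constant of \<open>poincare\<close> for a ball about the origin that contains the
  domain.\<close>

definition pc :: real where "pc = 2 * radius\<^sup>2"

lemma pc_pos: "pc > 0" using radius(1) by (simp add: pc_def)

lemma poincare_test:
  assumes "u \<in> test_functions U" shows "inner_L2 U u u \<le> pc * inner_V U u u"
proof -
  have "(LINT x|lborel. (comp u i x)\<^sup>2) \<le> pc * energy (comp u i)" for i
    unfolding pc_def using radius(2)[OF test_functionsD(4)[OF comp_test[OF assms]]]
    by (rule poincare[OF test_function_C1c[OF comp_test[OF assms]] radius(1)])
  then show ?thesis unfolding test_L2(2)[OF assms] test_inner_V[OF assms] sum_distrib_left by (rule sum_mono)
qed

lemma V_seq:
  assumes "u \<in> VV"
  shows "\<exists>\<phi>. (\<forall>n. \<phi> n \<in> solenoidal_test U \<and> H1.nrm (u - \<phi> n) < inverse (real (Suc n)))"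
  using H1.nrm_closure_seq assms unfolding V_eq .

text \<open>The inequality for test fields passes to the limit, since both sides are continuous in
  the H1 seminorm.\<close>

lemma poincare_V:
  assumes u: "u \<in> VV" shows "inner_L2 U u u \<le> pc * inner_V U u u"
proof -
  obtain \<phi> where \<phi>: "\<And>n. \<phi> n \<in> solenoidal_test U" "\<And>n. H1.nrm (u - \<phi> n) < inverse (real (Suc n))"
    using V_seq[OF u] by blast
  have \<phi>H: "\<phi> n \<in> H1_space U" for n using \<phi>(1) solenoidal_H1 by blast
  have d: "u - \<phi> n \<in> H1_space U" for n by (rule H1.mem_diff[OF V_H1[OF u] \<phi>H])
  have l1: "(\<lambda>n. HV.nrm (\<phi> n - u)) \<longlonglongrightarrow> 0"
    using HV.nrm_minus_commute[OF V_H1[OF u] \<phi>H] norms_le_H1(1)[OF d] \<phi>(2) HV.nrm_nonneg[OF d]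
    by (intro LIMSEQ_of_less_inverse) (auto intro: le_less_trans)
  have l2: "(\<lambda>n. L2.nrm U (\<phi> n - u)) \<longlonglongrightarrow> 0"
    using L2.nrm_minus_commute[OF H1_L2[OF V_H1[OF u]] H1_L2[OF \<phi>H]] norms_le_H1(2)[OF d] \<phi>(2) L2.nrm_nonneg[OF H1_L2[OF d]]
    by (intro LIMSEQ_of_less_inverse) (auto intro: le_less_trans)
  have "(\<lambda>n. (HV.nrm (\<phi> n))\<^sup>2) \<longlonglongrightarrow> (HV.nrm u)\<^sup>2" by (intro tendsto_power HV.tendsto_nrm[OF l1 \<phi>H V_H1[OF u]])
  then have 1: "(\<lambda>n. pc * inner_V U (\<phi> n) (\<phi> n)) \<longlonglongrightarrow> pc * inner_V U u u"
    by (intro tendsto_mult_left) (simp add: HV.nrm_sq \<phi>H V_H1[OF u])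
  have "(\<lambda>n. (L2.nrm U (\<phi> n))\<^sup>2) \<longlonglongrightarrow> (L2.nrm U u)\<^sup>2"
    by (intro tendsto_power L2.tendsto_nrm[OF l2 H1_L2[OF \<phi>H] H1_L2[OF V_H1[OF u]]])
  then have 2: "(\<lambda>n. inner_L2 U (\<phi> n) (\<phi> n)) \<longlonglongrightarrow> inner_L2 U u u" by (simp add: L2.nrm_sq H1_L2 \<phi>H V_H1[OF u])
  show ?thesis using poincare_test \<phi>(1) by (intro LIMSEQ_le[OF 2 1]) (auto simp: solenoidal_test_def)
qed

lemma weak_gradient_diff:
  assumes "u \<in> H1_space U" "v \<in> H1_space U"
  shows "is_weak_gradient U (u - v) (weak_grad U u - weak_grad U v)"
proof -
  have "is_weak_gradient U (u + (-1) *\<^sub>R v) (weak_grad U u + (-1) *\<^sub>R weak_grad U v)"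
    using assms by (intro weak_gradient_add weak_gradient_scale L2_scale weak_grad H1_L2)
  then show ?thesis by simp
qed

lemma test_multiple_L2:
  assumes "\<phi> \<in> test_functions U"
  shows "(\<lambda>x. \<phi> x *\<^sub>R v) \<in> L2_space U" "(\<lambda>x. partial j \<phi> x *\<^sub>R v) \<in> L2_space U"
proof -
  note C = test_function_C1c[OF assms]
  obtain B where B: "\<And>x. \<bar>\<phi> x\<bar> \<le> B" using C1c_bounded[OF C] by blast
  show "(\<lambda>x. \<phi> x *\<^sub>R v) \<in> L2_space U" by (rule weak_gradient_limit_aux[OF finite_M C1c_continuous[OF C] B])
  obtain B where B: "\<And>x. \<bar>dd \<phi> (axis j 1) x\<bar> \<le> B" using C1c_dd_bounded[OF C] by blast
  show "(\<lambda>x. partial j \<phi> x *\<^sub>R v) \<in> L2_space U" unfolding partial_eq_dd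
    by (rule weak_gradient_limit_aux[OF finite_M C1c_dd_continuous[OF C] B])
qed

text \<open>Both sides of the defining identity are L2 products with a fixed function, so L2
  convergence of the functions and of their gradients suffices.\<close>

lemma weak_gradient_limit:
  assumes X: "\<And>n. X n \<in> H1_space U" and u: "u \<in> L2_space U" and G: "G \<in> L2_space U"
    and lim: "(\<lambda>n. L2.nrm U (X n - u)) \<longlonglongrightarrow> 0" "(\<lambda>n. L2.nrm U (weak_grad U (X n) - G)) \<longlonglongrightarrow> 0"
  shows "is_weak_gradient U u G" unfolding is_weak_gradient_def
proof (intro ballI allI)
  fix \<phi> :: "real^'n \<Rightarrow> real" and i j :: 'n assume \<phi>: "\<phi> \<in> test_functions U"
  have "(\<lambda>n. inner_L2 U (X n) (\<lambda>x. partial j \<phi> x *\<^sub>R axis i 1)) \<longlonglongrightarrow> inner_L2 U u (\<lambda>x. partial j \<phi> x *\<^sub>R axis i 1)"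
    by (rule L2.tendsto_inner[OF lim(1) H1_L2[OF X] u test_multiple_L2(2)[OF \<phi>]])
  then have 1: "(\<lambda>n. LINT x|M. X n x $ i * partial j \<phi> x) \<longlonglongrightarrow> (LINT x|M. u x $ i * partial j \<phi> x)"
    by (simp add: inner_L2_def inner_axis mult.commute)
  have "(\<lambda>n. inner_L2 U (weak_grad U (X n)) (\<lambda>x. \<phi> x *\<^sub>R axis i (axis j 1))) \<longlonglongrightarrow> inner_L2 U G (\<lambda>x. \<phi> x *\<^sub>R axis i (axis j 1))"
    by (rule L2.tendsto_inner[OF lim(2) weak_grad(1)[OF X] G test_multiple_L2(1)[OF \<phi>]])
  then have 2: "(\<lambda>n. - (LINT x|M. weak_grad U (X n) x $ i $ j * \<phi> x)) \<longlonglongrightarrow> - (LINT x|M. G x $ i $ j * \<phi> x)"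
    by (intro tendsto_minus) (simp add: inner_L2_def inner_axis mult.commute)
  show "(LINT x|M. u x $ i * partial j \<phi> x) = - (LINT x|M. G x $ i $ j * \<phi> x)"
    using LIMSEQ_unique[OF 1] 2 weak_gradientD[OF weak_grad(2)[OF X] \<phi>] by simp
qed

lemma HV_nrm_diff:
  assumes "u \<in> H1_space U" "v \<in> H1_space U"
  shows "HV.nrm (u - v) = L2.nrm U (weak_grad U u - weak_grad U v)" unfolding HV.nrm_def L2.nrm_def
  using inner_V_eq2[OF H1_L2[OF H1.mem_diff[OF assms]] L2.mem_diff[OF weak_grad(1)[OF assms(1)] weak_grad(1)[OF assms(2)]] weak_gradient_diff[OF assms]
    H1_L2[OF H1.mem_diff[OF assms]] L2.mem_diff[OF weak_grad(1)[OF assms(1)] weak_grad(1)[OF assms(2)]] weak_gradient_diff[OF assms]]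
  by simp

lemma L2_nrm_le_V: "u \<in> VV \<Longrightarrow> L2.nrm U u \<le> sqrt pc * HV.nrm u"
  unfolding HV.nrm_def L2.nrm_def using poincare_V[of u] by (simp flip: real_sqrt_mult)

text \<open>A sequence that is Cauchy for \<open>inner_V\<close> is Cauchy in L2 by Poincare, and
  its gradients are Cauchy in L2 as well. The two L2 limits are a function and its weak gradient, so
  the convergence holds in H1, where V is closed.\<close>

lemma V_complete: "VA.complete" unfolding VA.complete_def
proof (intro allI impI)
  fix X assume X: "\<forall>n. X n \<in> VV" and cau: "VA.Cauchy_seq X"
  have XV: "X n \<in> VV" "X n \<in> H1_space U" "X n \<in> L2_space U" for n using X V_H1 H1_L2 by blast+
  have cau': "\<exists>N. \<forall>m\<ge>N. \<forall>n\<ge>N. HV.nrm (X m - X n) < eps" if "eps > 0" for eps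
    using cau that unfolding VA.Cauchy_seq_def by blast
  have "L2.Cauchy_seq U X" unfolding L2.Cauchy_seq_def
  proof (intro allI impI)
    fix eps :: real assume "eps > 0"
    then have "eps / sqrt pc > 0" using pc_pos by simp
    from cau'[OF this] obtain N where N: "\<forall>m\<ge>N. \<forall>n\<ge>N. HV.nrm (X m - X n) < eps / sqrt pc" by blast
    have "L2.nrm U (X m - X n) < eps" if "m \<ge> N" "n \<ge> N" for m n
    proof -
      have "L2.nrm U (X m - X n) \<le> sqrt pc * HV.nrm (X m - X n)" by (intro L2_nrm_le_V VA.mem_diff XV)
      also have "... < sqrt pc * (eps / sqrt pc)" using N that pc_pos by (intro mult_strict_left_mono) auto
      also have "... = eps" using pc_pos by simp
      finally show ?thesis .
    qed
    then show "\<exists>N. \<forall>m\<ge>N. \<forall>n\<ge>N. L2.nrm U (X m - X n) < eps" by blast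
  qed
  from L2_complete[OF XV(3) this] obtain u where u: "u \<in> L2_space U" "(\<lambda>n. L2.nrm U (X n - u)) \<longlonglongrightarrow> 0" by blast
  have "L2.Cauchy_seq U (\<lambda>n. weak_grad U (X n))" unfolding L2.Cauchy_seq_def
    using cau' HV_nrm_diff[OF XV(2) XV(2)] by simp
  from L2_complete[OF weak_grad(1)[OF XV(2)] this] obtain G where
    G: "G \<in> L2_space U" "(\<lambda>n. L2.nrm U (weak_grad U (X n) - G)) \<longlonglongrightarrow> 0" by blast
  have wg: "is_weak_gradient U u G" by (rule weak_gradient_limit[OF XV(2) u(1) G(1) u(2) G(2)])
  have uH: "u \<in> H1_space U" by (rule H1_I[OF u(1) G(1) wg])
  have "L2.nrm U (weak_grad U (X n) - weak_grad U u) = L2.nrm U (weak_grad U (X n) - G)" for n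
  proof -
    have w: "is_weak_gradient U (X n - u) (weak_grad U (X n) - G)"
    proof -
      have "is_weak_gradient U (X n + (-1) *\<^sub>R u) (weak_grad U (X n) + (-1) *\<^sub>R G)"
        by (intro weak_gradient_add weak_gradient_scale L2_scale weak_grad XV u G wg)
      then show ?thesis by simp
    qed
    note d = L2.mem_diff[OF XV(3) u(1), of n] L2.mem_diff[OF weak_grad(1)[OF XV(2)] G(1), of n]
    show ?thesis unfolding HV_nrm_diff[OF XV(2) uH, symmetric]
      unfolding HV.nrm_def L2.nrm_def using inner_V_eq2[OF d w d w] by simp
  qed
  then have lV: "(\<lambda>n. HV.nrm (X n - u)) \<longlonglongrightarrow> 0" using G(2) by (simp add: HV_nrm_diff[OF XV(2) uH])
  have lH: "(\<lambda>n. H1.nrm (X n - u)) \<longlonglongrightarrow> 0"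
  proof (rule tendsto_sandwich[OF _ _ tendsto_const])
    show "\<forall>\<^sub>F n in sequentially. 0 \<le> H1.nrm (X n - u)" by (intro always_eventually allI H1.nrm_nonneg H1.mem_diff XV uH)
    show "\<forall>\<^sub>F n in sequentially. H1.nrm (X n - u) \<le> L2.nrm U (X n - u) + HV.nrm (X n - u)"
      by (intro always_eventually allI H1_nrm_le H1.mem_diff XV uH)
    show "(\<lambda>n. L2.nrm U (X n - u) + HV.nrm (X n - u)) \<longlonglongrightarrow> 0" using tendsto_add[OF u(2) lV] by simp
  qed
  have "u \<in> VV" using XV(1) unfolding V_eq by (intro H1.nrm_closure_closed[OF solenoidal_H1 _ lH uH])
  then show "\<exists>u\<in>VV. (\<lambda>n. HV.nrm (X n - u)) \<longlonglongrightarrow> 0" using lV by blast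
qed

end

section \<open>Compactness of the embedding of V into H, and the eigenfunctions\<close>

context bounded_open
begin

lemma comp_diff: "comp (u - v) i = (\<lambda>x. comp u i x - comp v i x)" by (simp add: comp_def fun_eq_iff)

text \<open>The index packs mesh level, component and cube, with side 1/(m+1), so that the averages
  of all levels form one countable family for the diagonal argument.\<close>

definition cell_int :: "(real^'n \<Rightarrow> real^'n) \<Rightarrow> nat \<times> 'n \<times> (real^'n \<Rightarrow> int) \<Rightarrow> real" where
  "cell_int u = (\<lambda>(m, i, k). LINT x|lborel. indicator (cube (inverse (real (Suc m))) k) x * comp u i x)"

lemma cell_integrable:
  assumes "u \<in> test_functions U"
  shows "integrable lborel (\<lambda>x. indicator (cube h k) x * comp u i x)"
  using integrable_mult_indicator[of "cube h k" lborel "comp u i"]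
    integrable_continuous_support[OF C1c_continuous C1c_support, OF test_function_C1c test_function_C1c, OF comp_test comp_test, OF assms assms]
  by simp

lemma cell_int_diff:
  assumes "u \<in> test_functions U" "v \<in> test_functions U"
  shows "cell_int (u - v) q = cell_int u q - cell_int v q" unfolding cell_int_def comp_diff
  using cell_integrable[OF assms(1)] cell_integrable[OF assms(2)] by (cases q) (simp add: right_diff_distrib)

text \<open>The bound x \<le> 1 + x^2 is enough because all cubes have side, hence volume, at most
  1. What matters is that the estimate is uniform in the index.\<close>

lemma cell_int_bound:
  assumes "u \<in> test_functions U"
  shows "\<bar>cell_int u q\<bar> \<le> 1 + inner_L2 U u u"
proof -
  obtain m i k where q: "q = (m, i, k)" by (cases q)
  let ?Q = "cube (inverse (real (Suc m))) k :: (real^'n) set"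
  note C = test_function_C1c[OF comp_test[OF assms]]
  have em: "emeasure lborel ?Q = ennreal (inverse (real (Suc m)) ^ DIM(real^'n))" by (rule emeasure_cube) simp
  have i0: "integrable lborel (indicator ?Q :: real^'n \<Rightarrow> real)"
  proof (rule integrable_real_indicator)
    show "emeasure lborel ?Q < \<infinity>" unfolding em by simp
  qed simp
  have "\<bar>cell_int u q\<bar> \<le> (LINT x|lborel. norm (indicator ?Q x * comp u i x))"
    unfolding q cell_int_def by (simp add: integral_norm_bound[of _ "\<lambda>x. indicator ?Q x * comp u i x", simplified])
  also have "... \<le> (LINT x|lborel. indicator ?Q x + (comp u i x)\<^sup>2)"
  proof (rule integral_mono)
    show "integrable lborel (\<lambda>x. norm (indicator ?Q x * comp u i x))" using cell_integrable[OF assms] by (rule integrable_norm)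
    show "integrable lborel (\<lambda>x. indicator ?Q x + (comp u i x)\<^sup>2)"
      using i0 C1c_sq_integrable[OF C] by (rule Bochner_Integration.integrable_add)
    fix x
    have "2 * \<bar>comp u i x\<bar> * 1 \<le> \<bar>comp u i x\<bar>\<^sup>2 + 1\<^sup>2" by (rule sum_squares_bound)
    then have "\<bar>comp u i x\<bar> \<le> 1 + (comp u i x)\<^sup>2"
      unfolding power2_abs one_power2 mult_1_right using abs_ge_zero[of "comp u i x"] by linarith
    then show "norm (indicator ?Q x * comp u i x) \<le> indicator ?Q x + (comp u i x)\<^sup>2"
      by (cases "x \<in> ?Q") simp_all
  qed
  also have "... = (LINT x|lborel. indicator ?Q x) + (LINT x|lborel. (comp u i x)\<^sup>2)"
    using i0 C1c_sq_integrable[OF C] by (rule Bochner_Integration.integral_add)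
  also have "(LINT x|lborel. indicator ?Q x) \<le> (1 :: real)"
  proof -
    have "measure lborel ?Q = inverse (real (Suc m)) ^ DIM(real^'n)" by (simp only: measure_def em) simp
    also have "... \<le> 1" by (intro power_le_one) (auto simp: inverse_le_1_iff)
    finally show ?thesis by simp
  qed
  also have "(LINT x|lborel. (comp u i x)\<^sup>2) \<le> inner_L2 U u u"
    unfolding test_L2(2)[OF assms] by (rule member_le_sum[of i UNIV "\<lambda>i. LINT x|lborel. (comp u i x)\<^sup>2"]) auto
  finally show ?thesis by simp
qed

lemma ehrling_vector:
  assumes "u \<in> test_functions U" and h: "h = inverse (real (Suc m))"
  shows "inner_L2 U u u \<le> (\<Sum>i\<in>UNIV. \<Sum>k\<in>cubes radius h. (cell_int u (m, i, k))\<^sup>2 / h ^ DIM(real^'n))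
     + 2 ^ DIM(real^'n) * real DIM(real^'n) * h\<^sup>2 * inner_V U u u"
proof -
  have "(LINT x|lborel. (comp u i x)\<^sup>2) \<le> (\<Sum>k\<in>cubes radius h. (cell_int u (m, i, k))\<^sup>2 / h ^ DIM(real^'n))
     + 2 ^ DIM(real^'n) * real DIM(real^'n) * h\<^sup>2 * energy (comp u i)" for i
    unfolding cell_int_def h prod.case
    by (rule ehrling[OF test_function_C1c[OF comp_test[OF assms(1)]] less_imp_le[OF radius(2)[OF test_functionsD(4)[OF comp_test[OF assms(1)]]]]])
      simp_all
  then have "(\<Sum>i\<in>UNIV. LINT x|lborel. (comp u i x)\<^sup>2) \<le> (\<Sum>i\<in>UNIV. (\<Sum>k\<in>cubes radius h. (cell_int u (m, i, k))\<^sup>2 / h ^ DIM(real^'n))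
     + 2 ^ DIM(real^'n) * real DIM(real^'n) * h\<^sup>2 * energy (comp u i))" by (rule sum_mono)
  then show ?thesis unfolding test_L2(2)[OF assms(1)] test_inner_V[OF assms(1)] sum.distrib sum_distrib_left .
qed

definition cell_index :: "(nat \<times> 'n \<times> (real^'n \<Rightarrow> int)) set" where
  "cell_index = (\<Union>m. {m} \<times> UNIV \<times> cubes radius (inverse (real (Suc m))))"

lemma countable_cell_index: "countable cell_index" unfolding cell_index_def
  by (rule countable_UN[OF countableI_type countable_finite])
    (intro finite_cartesian_product finite_cubes finite.intros finite)

lemma Cauchy_convergent_pair:
  fixes x :: "nat \<Rightarrow> real"
  assumes "convergent x" "\<delta> > 0" shows "\<exists>N. \<forall>a\<ge>N. \<forall>b\<ge>N. (x a - x b)\<^sup>2 < \<delta>"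
proof -
  have "sqrt \<delta> > 0" using assms(2) by simp
  then obtain N where N: "\<And>a b. a \<ge> N \<Longrightarrow> b \<ge> N \<Longrightarrow> dist (x a) (x b) < sqrt \<delta>"
    using convergent_Cauchy[OF assms(1)] unfolding Cauchy_def by blast
  have "(x a - x b)\<^sup>2 < \<delta>" if "a \<ge> N" "b \<ge> N" for a b
  proof -
    have "\<bar>x a - x b\<bar>\<^sup>2 < (sqrt \<delta>)\<^sup>2" using N[OF that] by (intro power_strict_mono) (auto simp: dist_real_def)
    then show ?thesis using assms(2) by simp
  qed
  then show ?thesis by blast
qed

lemma uniform_index:
  assumes "finite S" "\<And>s. s \<in> S \<Longrightarrow> \<exists>N::nat. \<forall>a\<ge>N. \<forall>b\<ge>N. P s a b"
  shows "\<exists>N. \<forall>a\<ge>N. \<forall>b\<ge>N. \<forall>s\<in>S. P s a b" using assms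
proof (induction S rule: finite_induct)
  case (insert s S)
  obtain N where N: "\<forall>a\<ge>N. \<forall>b\<ge>N. \<forall>s\<in>S. P s a b" using insert by blast
  obtain N' where N': "\<forall>a\<ge>N'. \<forall>b\<ge>N'. P s a b" using insert.prems by blast
  have "\<forall>a\<ge>max N N'. \<forall>b\<ge>max N N'. \<forall>s\<in>insert s S. P s a b" using N N' by simp
  then show ?case by blast
qed simp

text \<open>Along a diagonal subsequence all cell integrals converge. For given eps the mesh is
  fixed first, so that the energy term of \<open>ehrling_vector\<close> is at most eps^2/2; then
  only finitely many cell integrals are left, and these are eventually close.\<close>

lemma rellich_test:
  assumes \<phi>: "\<And>n. \<phi> n \<in> test_functions U" and K: "\<And>n. inner_V U (\<phi> n) (\<phi> n) \<le> K"
  shows "\<exists>r :: nat \<Rightarrow> nat. strict_mono r \<and> L2.Cauchy_seq U (\<phi> \<circ> r)"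
proof -
  define F where "F q j = cell_int (\<phi> j) (from_nat_into cell_index q)" for q j
  have "\<bar>F q j\<bar> \<le> 1 + pc * K" for q j
  proof -
    have "inner_L2 U (\<phi> j) (\<phi> j) \<le> pc * K"
      using poincare_test[OF \<phi>, of j] mult_left_mono[OF K less_imp_le[OF pc_pos], of j] by linarith
    then show ?thesis unfolding F_def using cell_int_bound[OF \<phi>, of j "from_nat_into cell_index q"] by linarith
  qed
  from bounded_family_convergent_subseq[of F "\<lambda>q. 1 + pc * K", OF this]
  obtain r where r: "strict_mono r" "\<And>q. convergent (\<lambda>j. F q (r j))" by blast
  have conv: "convergent (\<lambda>j. cell_int (\<phi> (r j)) s)" if s: "s \<in> cell_index" for s
  proof -
    obtain q where "s = from_nat_into cell_index q" using from_nat_into_surj[OF countable_cell_index s] by metis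
    then show ?thesis using r(2)[of q] by (simp add: F_def)
  qed
  have K0: "K \<ge> 0" using K[of 0] HV.nonneg[OF test_H1[OF \<phi>[of 0]]] by linarith
  have "L2.Cauchy_seq U (\<phi> \<circ> r)" unfolding L2.Cauchy_seq_def
  proof (intro allI impI)
    fix eps :: real assume eps: "eps > 0"
    let ?d = "DIM(real^'n)"
    \<comment> \<open>The difference of two members has energy at most 4 K by the parallelogram
      identity; K + 1 keeps the constant positive.\<close>
    let ?c = "2 ^ ?d * real ?d * (4 * (K + 1))"
    have c: "?c > 0" using K0 by simp
    have "0 < eps\<^sup>2 / (2 * ?c)" using eps c by (intro divide_pos_pos) auto
    from reals_Archimedean[OF this] obtain m where m: "inverse (real (Suc m)) < eps\<^sup>2 / (2 * ?c)" by blast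
    define h where "h = inverse (real (Suc m))"
    have h: "h > 0" "h \<le> 1" by (auto simp: h_def inverse_le_1_iff)
    have hc: "?c * h\<^sup>2 \<le> eps\<^sup>2 / 2"
    proof -
      have "h\<^sup>2 \<le> h" using h by (simp add: power2_eq_square mult_left_le)
      then have "?c * h\<^sup>2 \<le> ?c * h" using c by (intro mult_left_mono) auto
      also have "... \<le> ?c * (eps\<^sup>2 / (2 * ?c))" using m c by (intro mult_left_mono) (auto simp: h_def)
      also have "... = eps\<^sup>2 / 2"
      proof -
        have "x * (eps\<^sup>2 / (2 * x)) = eps\<^sup>2 / 2" if "x > 0" for x :: real using that by simp
        from this[OF c] show ?thesis .
      qed
      finally show ?thesis .
    qed
    define S where "S = {m} \<times> (UNIV :: 'n set) \<times> (cubes radius h :: (real^'n \<Rightarrow> int) set)"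
    have S: "finite S" unfolding S_def by (intro finite_cartesian_product finite_cubes finite.intros finite)
    have S': "S \<subseteq> cell_index" unfolding S_def cell_index_def h_def by blast
    \<comment> \<open>Chosen so that \<open>card S\<close> terms of size at most \<delta> / h^d add
      up to less than eps^2/2; the 1 in the denominator makes this strict.\<close>
    define \<delta> where "\<delta> = eps\<^sup>2 * h ^ ?d / (2 * (real (card S) + 1))"
    have \<delta>: "\<delta> > 0" unfolding \<delta>_def using eps h by (intro divide_pos_pos mult_pos_pos) auto
    have "\<exists>N. \<forall>a\<ge>N. \<forall>b\<ge>N. \<forall>s\<in>S. (cell_int (\<phi> (r a)) s - cell_int (\<phi> (r b)) s)\<^sup>2 < \<delta>"
      by (rule uniform_index[OF S]) (rule Cauchy_convergent_pair[OF conv[OF subsetD[OF S']] \<delta>])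
    then obtain N where
      N: "\<And>a b s. a \<ge> N \<Longrightarrow> b \<ge> N \<Longrightarrow> s \<in> S \<Longrightarrow> (cell_int (\<phi> (r a)) s - cell_int (\<phi> (r b)) s)\<^sup>2 < \<delta>" by blast
    have "L2.nrm U ((\<phi> \<circ> r) a - (\<phi> \<circ> r) b) < eps" if ab: "a \<ge> N" "b \<ge> N" for a b
    proof -
      let ?w = "\<phi> (r a) - \<phi> (r b)"
      have w: "?w \<in> test_functions U" by (rule subspace_diff[OF test_functions_subspace \<phi> \<phi>])
      have "inner_V U ?w ?w \<le> 4 * K"
      proof -
        have V: "\<phi> n \<in> H1_space U" for n by (rule test_H1[OF \<phi>])
        have "0 \<le> inner_V U (\<phi> (r a) + \<phi> (r b)) (\<phi> (r a) + \<phi> (r b))" by (intro HV.nonneg HV.mem_add V)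
        then have "inner_V U ?w ?w \<le> 2 * inner_V U (\<phi> (r a)) (\<phi> (r a)) + 2 * inner_V U (\<phi> (r b)) (\<phi> (r b))"
          by (simp add: HV.sq_diff HV.sq_add V)
        then show ?thesis using K[of "r a"] K[of "r b"] by linarith
      qed
      then have V: "2 ^ ?d * real ?d * h\<^sup>2 * inner_V U ?w ?w \<le> eps\<^sup>2 / 2"
      proof -
        assume "inner_V U ?w ?w \<le> 4 * K"
        then have "2 ^ ?d * real ?d * h\<^sup>2 * inner_V U ?w ?w \<le> 2 ^ ?d * real ?d * h\<^sup>2 * (4 * (K + 1))"
          by (intro mult_left_mono) auto
        also have "... = ?c * h\<^sup>2" by (simp add: algebra_simps)
        finally show ?thesis using hc by linarith
      qed
      have "(\<Sum>i\<in>UNIV. \<Sum>k\<in>cubes radius h. (cell_int ?w (m, i, k))\<^sup>2 / h ^ ?d) = (\<Sum>s\<in>S. (cell_int ?w s)\<^sup>2 / h ^ ?d)"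
        unfolding S_def by (simp add: sum.cartesian_product')
      also have "... \<le> (\<Sum>s\<in>S. \<delta> / h ^ ?d)"
      proof (intro sum_mono divide_right_mono)
        fix s assume "s \<in> S"
        then show "(cell_int ?w s)\<^sup>2 \<le> \<delta>" using N[OF ab] by (simp add: cell_int_diff[OF \<phi> \<phi>] less_imp_le)
      qed (use h in simp)
      also have "... = real (card S) / (real (card S) + 1) * (eps\<^sup>2 / 2)"
      proof -
        have gen: "p \<noteq> 0 \<Longrightarrow> e * p / (2 * c) / p = e / (2 * c)" for p e c :: real by simp
        have "h ^ ?d \<noteq> 0" using h by simp
        then have "\<delta> / h ^ ?d = eps\<^sup>2 / (2 * (real (card S) + 1))" unfolding \<delta>_def by (rule gen)
        then show ?thesis by simp
      qed
      also have "... < 1 * (eps\<^sup>2 / 2)" using eps by (intro mult_strict_right_mono) auto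
      finally have "inner_L2 U ?w ?w < eps\<^sup>2" using ehrling_vector[OF w h_def] V by linarith
      then have "(L2.nrm U ?w)\<^sup>2 < eps\<^sup>2" using L2.nrm_sq[OF test_L2(1)[OF w]] by simp
      then show ?thesis using eps by (simp add: power2_less_imp_less)
    qed
    then show "\<exists>N. \<forall>a\<ge>N. \<forall>b\<ge>N. L2.nrm U ((\<phi> \<circ> r) a - (\<phi> \<circ> r) b) < eps" by blast
  qed
  then show ?thesis using r(1) by blast
qed

text \<open>Each X n is replaced by a solenoidal test field at H1 distance less than 1/(n+1). This
  keeps the energies bounded, and closeness in L2 carries the Cauchy property back to X.\<close>

lemma rellich_V:
  assumes X: "\<And>n. X n \<in> VV" and K: "\<And>n. inner_V U (X n) (X n) \<le> K"
  shows "\<exists>r :: nat \<Rightarrow> nat. strict_mono r \<and> VB.Cauchy_seq (X \<circ> r)"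
proof -
  have "\<forall>n. \<exists>\<phi>. \<phi> \<in> solenoidal_test U \<and> H1.nrm (X n - \<phi>) < inverse (real (Suc n))" using V_seq[OF X] by blast
  then obtain \<phi> where \<phi>: "\<And>n. \<phi> n \<in> solenoidal_test U" "\<And>n. H1.nrm (X n - \<phi> n) < inverse (real (Suc n))" by metis
  have t: "\<phi> n \<in> test_functions U" for n using \<phi>(1) by (simp add: solenoidal_test_def)
  have XH: "X n \<in> H1_space U" for n by (rule V_H1[OF X])
  have \<phi>H: "\<phi> n \<in> H1_space U" for n by (rule test_H1[OF t])
  have d: "X n - \<phi> n \<in> H1_space U" for n by (rule H1.mem_diff[OF XH \<phi>H])
  have "inner_V U (\<phi> n) (\<phi> n) \<le> (sqrt K + 1)\<^sup>2" for n
  proof -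
    have "HV.nrm (\<phi> n) \<le> HV.nrm (\<phi> n - X n) + HV.nrm (X n)" using HV.nrm_triangle[OF HV.mem_diff[OF \<phi>H XH] XH, of n n n] by simp
    also have "HV.nrm (\<phi> n - X n) \<le> 1"
    proof -
      have "inverse (real (Suc n)) \<le> 1" by (simp add: inverse_le_1_iff)
      then show ?thesis using \<phi>(2)[of n] norms_le_H1(1)[OF d, of n] HV.nrm_minus_commute[OF XH \<phi>H, of n n] by linarith
    qed
    also have "HV.nrm (X n) \<le> sqrt K" unfolding HV.nrm_def using K[of n] by simp
    finally have "HV.nrm (\<phi> n) \<le> sqrt K + 1" by simp
    then have "(HV.nrm (\<phi> n))\<^sup>2 \<le> (sqrt K + 1)\<^sup>2" using HV.nrm_nonneg[OF \<phi>H] by (intro power_mono)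
    then show ?thesis using HV.nrm_sq[OF \<phi>H] by simp
  qed
  from rellich_test[of \<phi> "(sqrt K + 1)\<^sup>2", OF t this]
  obtain r :: "nat \<Rightarrow> nat" where "strict_mono r \<and> L2.Cauchy_seq U (\<phi> \<circ> r)" ..
  then have r: "strict_mono r" "L2.Cauchy_seq U (\<phi> \<circ> r)" by simp_all
  have "L2.Cauchy_seq U (X \<circ> r)" unfolding L2.Cauchy_seq_def
  proof (intro allI impI)
    fix eps :: real assume "eps > 0"
    then have e3: "eps / 3 > 0" by simp
    from r(2)[unfolded L2.Cauchy_seq_def o_def, rule_format, OF e3] obtain N1
      where N1: "\<forall>a\<ge>N1. \<forall>b\<ge>N1. L2.nrm U (\<phi> (r a) - \<phi> (r b)) < eps / 3" ..
    obtain N2 where N2: "inverse (real (Suc N2)) < eps / 3" using reals_Archimedean[OF e3] by blast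
    have close: "L2.nrm U (X (r a) - \<phi> (r a)) < eps / 3" if "a \<ge> N2" for a
    proof -
      have "N2 \<le> r a" using seq_suble[OF r(1), of a] that by simp
      then have "inverse (real (Suc (r a))) \<le> inverse (real (Suc N2))" by (simp add: le_imp_inverse_le)
      then show ?thesis using norms_le_H1(2)[OF d, of "r a"] \<phi>(2)[of "r a"] N2 by linarith
    qed
    have "L2.nrm U (X (r a) - X (r b)) < eps" if "a \<ge> max N1 N2" "b \<ge> max N1 N2" for a b
    proof -
      note L = H1_L2[OF XH] H1_L2[OF \<phi>H]
      have "L2.nrm U (X (r a) - X (r b)) \<le> L2.nrm U (X (r a) - \<phi> (r a)) + L2.nrm U (\<phi> (r a) - X (r b))"
        by (rule L2.nrm_triangle_diff[OF L(1) L(2) L(1)])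
      moreover have "L2.nrm U (\<phi> (r a) - X (r b)) \<le> L2.nrm U (\<phi> (r a) - \<phi> (r b)) + L2.nrm U (\<phi> (r b) - X (r b))"
        by (rule L2.nrm_triangle_diff[OF L(2) L(2) L(1)])
      moreover have "L2.nrm U (\<phi> (r b) - X (r b)) = L2.nrm U (X (r b) - \<phi> (r b))"
        by (rule L2.nrm_minus_commute[OF L(2) L(1)])
      moreover have "L2.nrm U (\<phi> (r a) - \<phi> (r b)) < eps / 3" using N1 that by simp
      ultimately show ?thesis using close[of a] close[of b] that by simp
    qed
    then show "\<exists>N. \<forall>a\<ge>N. \<forall>b\<ge>N. L2.nrm U ((X \<circ> r) a - (X \<circ> r) b) < eps"
      unfolding o_def by (intro exI[of _ "max N1 N2"] allI impI)
  qed
  then show ?thesis using r(1) by blast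
qed

text \<open>A function that vanishes almost everywhere has the zero matrix field as a weak
  gradient.\<close>

lemma V_definite:
  assumes "u \<in> VV" "inner_L2 U u u = 0" shows "inner_V U u u = 0"
proof -
  have uL: "u \<in> L2_space U" by (rule H1_L2[OF V_H1[OF assms(1)]])
  have ae: "AE x in M. u x = 0" by (rule L2_zero_imp_AE[OF uL assms(2)])
  have "is_weak_gradient U u 0" unfolding is_weak_gradient_def
  proof (intro ballI allI)
    fix \<phi> :: "real^'n \<Rightarrow> real" and i j
    have "(LINT x|M. u x $ i * partial j \<phi> x) = (LINT x|M. 0)"
      by (rule Bochner_Integration.integral_eq_zero_AE[THEN trans[OF _ sym]]) (use ae in \<open>auto elim: eventually_mono\<close>)
    then show "(LINT x|M. u x $ i * partial j \<phi> x) = - (LINT x|M. 0 x $ i $ j * \<phi> x)" by simp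
  qed
  from inner_V_eq2[OF uL L2_zero this uL L2_zero this] show ?thesis by (simp add: L2_zero)
qed

text \<open>From here on \<open>SP.eig\<close> and \<open>SP.eigval\<close> are the eigenfunctions
  and eigenvalues of the Stokes operator.\<close>

sublocale SP: compact_pair VV "inner_V U" "inner_L2 U" pc
proof
  show "\<exists>r :: nat \<Rightarrow> nat. strict_mono r \<and> VB.Cauchy_seq (X \<circ> r)"
    if "\<And>n. X n \<in> VV" "\<And>n. inner_V U (X n) (X n) \<le> K" for X K by (rule rellich_V[OF that])
qed (simp_all add: pc_pos poincare_V V_definite V_complete)

sublocale onH: orthonormal HH "inner_L2 U" SP.eig
  by unfold_locales (auto simp: V_H SP.eig_mem SP.eig_orth_B SP.eig_unit)

text \<open>The spectral theorem yields convergence only for elements of V. Solenoidal test fields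
  are dense in H and taking residuals does not increase the norm, which extends it to H.\<close>

lemma H_expansion:
  assumes u: "u \<in> HH" shows "(\<lambda>n. HB.nrm (u - onH.psum n u)) \<longlonglongrightarrow> 0"
proof (rule LIMSEQ_I)
  fix eps :: real assume eps: "eps > 0"
  then have e3: "eps / 3 > 0" by simp
  obtain v where v: "v \<in> solenoidal_test U" "L2.nrm U (u - v) < eps / 3"
    using L2.nrm_closureD[OF u[unfolded H_eq] e3] by blast
  have vV: "v \<in> VV" by (rule solenoidal_V[OF v(1)])
  have vH: "v \<in> HH" by (rule V_H[OF vV])
  have "(\<lambda>n. HB.nrm (v - onH.psum n v)) \<longlonglongrightarrow> 0"
    using SP.eig_complete[OF vV] by (simp add: onH.psum_def SP.onB.psum_def)
  from LIMSEQ_D[OF this e3] obtain N where N: "\<And>n. n \<ge> N \<Longrightarrow> HB.nrm (v - onH.psum n v) < eps / 3"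
    by (metis abs_less_iff diff_zero real_norm_def)
  have "HB.nrm (u - onH.psum n u) < eps" if "n \<ge> N" for n
  proof -
    have d: "u - v \<in> HH" "v - onH.psum n v \<in> HH" "u - v - onH.psum n (u - v) \<in> HH"
      by (intro HB.mem_diff u vH onH.psum_mem)+
    have "onH.psum n (u - v) = onH.psum n u - onH.psum n v" unfolding onH.psum_def using u vH
      by (simp add: HB.diff_left onH.mem scaleR_left_diff_distrib sum_subtractf)
    then have eq: "u - onH.psum n u = (u - v - onH.psum n (u - v)) + (v - onH.psum n v)" by (simp add: algebra_simps)
    have "HB.nrm (u - onH.psum n u) \<le> HB.nrm (u - v - onH.psum n (u - v)) + HB.nrm (v - onH.psum n v)"
      unfolding eq by (rule HB.nrm_triangle[OF d(3,2)])
    also have "HB.nrm (u - v - onH.psum n (u - v)) \<le> HB.nrm (u - v)" by (rule onH.residual_nrm_le[OF d(1)])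
    finally show ?thesis using N[OF that] v(2) eps by linarith
  qed
  then show "\<exists>N. \<forall>n\<ge>N. norm (HB.nrm (u - onH.psum n u) - 0) < eps"
    using HB.nrm_nonneg[OF HB.mem_diff[OF u onH.psum_mem]] by fastforce
qed

end

section \<open>Convolutions on the half-line\<close>

text \<open>Integrals run over the whole line; the one-sided convolution arises because the
  functions vanish on the nonpositive half-line. The version in \<open>ennreal\<close> obeys Tonelli
  unconditionally and is used to certify finiteness for the real version \<open>conv\<close>, whose
  integral is 0 when it does not exist.\<close>

definition nconv :: "(real \<Rightarrow> ennreal) \<Rightarrow> (real \<Rightarrow> ennreal) \<Rightarrow> real \<Rightarrow> ennreal" where
  "nconv f g t = (\<integral>\<^sup>+s. f (t - s) * g s \<partial>lborel)"

definition conv :: "(real \<Rightarrow> real) \<Rightarrow> (real \<Rightarrow> real) \<Rightarrow> real \<Rightarrow> real" where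
  "conv f g t = (LINT s|lborel. f (t - s) * g s)"

abbreviation nabs :: "(real \<Rightarrow> real) \<Rightarrow> real \<Rightarrow> ennreal" where "nabs f \<equiv> \<lambda>s. ennreal \<bar>f s\<bar>"

lemma borel_measurable_nconv [measurable]:
  assumes [measurable]: "f \<in> borel_measurable borel" "g \<in> borel_measurable borel"
  shows "nconv f g \<in> borel_measurable borel" unfolding nconv_def by measurable

lemma borel_measurable_conv [measurable]:
  assumes [measurable]: "f \<in> borel_measurable borel" "g \<in> borel_measurable borel"
  shows "conv f g \<in> borel_measurable borel" unfolding conv_def by measurable

lemma nn_integral_reflect:
  assumes [measurable]: "(f :: real \<Rightarrow> ennreal) \<in> borel_measurable borel"
  shows "(\<integral>\<^sup>+s. f (t - s) \<partial>lborel) = (\<integral>\<^sup>+s. f s \<partial>lborel)" using nn_integral_real_affine[of f "-1" t] by simp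

lemma nn_integral_shift:
  assumes [measurable]: "(f :: real \<Rightarrow> ennreal) \<in> borel_measurable borel"
  shows "(\<integral>\<^sup>+s. f (s + t) \<partial>lborel) = (\<integral>\<^sup>+s. f s \<partial>lborel)"
  using nn_integral_real_affine[of f 1 t] by (simp add: add.commute)

lemma nconv_commute:
  assumes [measurable]: "f \<in> borel_measurable borel" "g \<in> borel_measurable borel"
  shows "nconv f g = nconv g f"
proof
  fix t
  have "nconv f g t = (\<integral>\<^sup>+s. f (t - (t - s)) * g (t - s) \<partial>lborel)"
    unfolding nconv_def by (rule nn_integral_reflect[symmetric]) measurable
  then show "nconv f g t = nconv g f t" by (simp add: nconv_def mult.commute)
qed

lemma nconv_assoc:
  assumes [measurable]: "f \<in> borel_measurable borel" "g \<in> borel_measurable borel" "h \<in> borel_measurable borel"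
  shows "nconv f (nconv g h) = nconv (nconv f g) h"
proof
  fix t
  have "nconv f (nconv g h) t = (\<integral>\<^sup>+s. \<integral>\<^sup>+r. f (t - s) * (g (s - r) * h r) \<partial>lborel \<partial>lborel)"
    unfolding nconv_def by (intro nn_integral_cong nn_integral_cmult[symmetric]) measurable
  also have "... = (\<integral>\<^sup>+r. \<integral>\<^sup>+s. f (t - s) * (g (s - r) * h r) \<partial>lborel \<partial>lborel)"
    by (rule lborel_pair.Fubini') measurable
  also have "... = (\<integral>\<^sup>+r. \<integral>\<^sup>+s. f (t - (s + r)) * (g ((s + r) - r) * h r) \<partial>lborel \<partial>lborel)"
    by (intro nn_integral_cong nn_integral_shift[symmetric]) measurable
  also have "... = (\<integral>\<^sup>+r. (\<integral>\<^sup>+s. f (t - r - s) * g s \<partial>lborel) * h r \<partial>lborel)"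
    by (intro nn_integral_cong) (simp add: nn_integral_multc[symmetric] mult.assoc diff_diff_eq add.commute)
  finally show "nconv f (nconv g h) t = nconv (nconv f g) h t" by (simp add: nconv_def)
qed

lemma nconv_mono: "(\<And>s. f s \<le> f' s) \<Longrightarrow> (\<And>s. g s \<le> g' s) \<Longrightarrow> nconv f g t \<le> nconv f' g' t"
  unfolding nconv_def by (intro nn_integral_mono mult_mono) auto

lemma nconv_add_right:
  assumes [measurable]: "f \<in> borel_measurable borel" "g \<in> borel_measurable borel" "h \<in> borel_measurable borel"
  shows "nconv f (\<lambda>s. g s + h s) t = nconv f g t + nconv f h t"
  unfolding nconv_def by (simp add: distrib_left nn_integral_add)

lemma nconv_cmult_right:
  assumes [measurable]: "f \<in> borel_measurable borel" "g \<in> borel_measurable borel"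
  shows "nconv f (\<lambda>s. c * g s) t = c * nconv f g t"
  unfolding nconv_def by (simp add: mult.left_commute[of _ c] nn_integral_cmult)

lemma conv_integrable:
  assumes [measurable]: "f \<in> borel_measurable borel" "g \<in> borel_measurable borel"
    and "nconv (nabs f) (nabs g) t < \<infinity>"
  shows "integrable lborel (\<lambda>s. f (t - s) * g s)" unfolding integrable_iff_bounded using assms(3)
  by (simp add: nconv_def abs_mult ennreal_mult)

lemma ennreal_conv:
  assumes [measurable]: "f \<in> borel_measurable borel" "g \<in> borel_measurable borel"
    and pos: "\<And>s. 0 \<le> f s" "\<And>s. 0 \<le> g s" and fin: "nconv (\<lambda>s. ennreal (f s)) (\<lambda>s. ennreal (g s)) t < \<infinity>"
  shows "ennreal (conv f g t) = nconv (\<lambda>s. ennreal (f s)) (\<lambda>s. ennreal (g s)) t"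
proof -
  have "integrable lborel (\<lambda>s. f (t - s) * g s)" using conv_integrable[of f g t] pos fin by simp
  then show ?thesis unfolding conv_def nconv_def using pos
    by (subst nn_integral_eq_integral[symmetric]) (auto simp: ennreal_mult)
qed

lemma conv_abs_le:
  assumes "nconv (nabs f) (nabs g) t \<le> ennreal B" "B \<ge> 0"
    and [measurable]: "f \<in> borel_measurable borel" "g \<in> borel_measurable borel"
  shows "\<bar>conv f g t\<bar> \<le> B"
proof -
  have "ennreal \<bar>conv f g t\<bar> \<le> (\<integral>\<^sup>+s. ennreal (norm (f (t - s) * g s)) \<partial>lborel)"
    unfolding conv_def real_norm_def[symmetric]
    using assms(1) by (intro integral_norm_bound_ennreal conv_integrable le_less_trans[OF assms(1)]) auto
  also have "... \<le> ennreal B" using assms(1) by (simp add: nconv_def abs_mult ennreal_mult)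
  finally show ?thesis using assms(2) by simp
qed

lemma conv_commute:
  assumes [measurable]: "f \<in> borel_measurable borel" "g \<in> borel_measurable borel"
  shows "conv f g t = conv g f t"
proof -
  have "(LINT s|lborel. f (t - s) * g s) = (LINT s|lborel. f (t - (t - s)) * g (t - s))"
    using lborel_integral_real_affine[of "-1" "\<lambda>s. f (t - s) * g s" t] by simp
  then show ?thesis by (simp add: conv_def mult.commute)
qed

text \<open>Fubini and a shift; \<open>fin\<close> is the absolute integrability of the double
  integrand.\<close>

lemma conv_assoc:
  assumes [measurable]: "f \<in> borel_measurable borel" "g \<in> borel_measurable borel" "h \<in> borel_measurable borel"
    and fin: "nconv (nabs f) (nconv (nabs g) (nabs h)) t < \<infinity>"
  shows "conv f (conv g h) t = conv (conv f g) h t"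
proof -
  let ?F = "\<lambda>s r. f (t - s) * (g (s - r) * h r)"
  have "(\<integral>\<^sup>+s. \<integral>\<^sup>+r. ennreal (norm (?F s r)) \<partial>lborel \<partial>lborel) =
      nconv (nabs f) (nconv (nabs g) (nabs h)) t"
    unfolding nconv_def by (intro nn_integral_cong) (simp add: abs_mult ennreal_mult nn_integral_cmult)
  then have int: "integrable (lborel \<Otimes>\<^sub>M lborel) (\<lambda>(s, r). ?F s r)" unfolding integrable_iff_bounded using fin
    by (subst lborel.nn_integral_fst[symmetric]) (auto simp: case_prod_beta')
  have "conv f (conv g h) t = (LINT s|lborel. LINT r|lborel. ?F s r)"
    unfolding conv_def by (simp flip: integral_mult_right_zero)
  also have "... = (LINT r|lborel. LINT s|lborel. ?F s r)"
    by (rule lborel_pair.Fubini_integral[symmetric, OF int])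
  also have "... = (LINT r|lborel. LINT s|lborel. f (t - r - s) * g s * h r)"
  proof (rule Bochner_Integration.integral_cong[OF refl])
    fix r
    have "(LINT s|lborel. ?F s r) = (LINT s|lborel. ?F (r + 1 * s) r)"
      by (subst lborel_integral_real_affine[of 1 _ r]) simp_all
    then show "(LINT s|lborel. ?F s r) = (LINT s|lborel. f (t - r - s) * g s * h r)"
      by (simp add: mult.assoc diff_diff_eq)
  qed
  also have "... = conv (conv f g) h t" unfolding conv_def by simp
  finally show ?thesis .
qed

section \<open>The Riemann--Liouville kernels\<close>

text \<open>The kernel of the Riemann-Liouville integral: convolution with
  \<open>kern \<beta>\<close> is J^\<beta>, and \<open>kern 1\<close> is the indicator of the
  positive half-line, which also serves as a cut-off in many integrands below.\<close>

definition kern :: "real \<Rightarrow> real \<Rightarrow> real" where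
  "kern \<beta> t = (if t > 0 then t powr (\<beta> - 1) / Gamma \<beta> else 0)"

abbreviation nkern :: "real \<Rightarrow> real \<Rightarrow> ennreal" where "nkern \<beta> \<equiv> \<lambda>t. ennreal (kern \<beta> t)"

lemma kern_measurable [measurable]: "kern \<beta> \<in> borel_measurable borel" unfolding kern_def by measurable

lemma kern_nonneg: "\<beta> > 0 \<Longrightarrow> 0 \<le> kern \<beta> t" by (simp add: kern_def Gamma_real_nonneg)

lemma kern_pos: "\<beta> > 0 \<Longrightarrow> t > 0 \<Longrightarrow> 0 < kern \<beta> t" by (simp add: kern_def Gamma_real_pos)

lemma kern_zero [simp]: "t \<le> 0 \<Longrightarrow> kern \<beta> t = 0" by (simp add: kern_def)

lemma kern_1: "kern 1 t = indicator {0<..} t" by (simp add: kern_def indicator_def)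

text \<open>The semigroup law of fractional integration. The substitution s = t u turns the
  convolution into a Beta integral.\<close>

lemma nconv_kern:
  assumes "a > 0" "b > 0" shows "nconv (nkern a) (nkern b) t = nkern (a + b) t"
proof (cases "t > 0")
  case False
  then have "(\<lambda>s. nkern a (t - s) * nkern b s) = (\<lambda>s. 0)" by (auto simp: kern_def fun_eq_iff)
  then show ?thesis using False by (simp add: nconv_def)
next
  case t: True
  let ?C = "t powr (a + b - 1) / (Gamma a * Gamma b)"
  have G: "Gamma a > 0" "Gamma b > 0" "Gamma (a + b) > 0" using assms by (auto intro: Gamma_real_pos)
  have "nconv (nkern a) (nkern b) t = ennreal t * (\<integral>\<^sup>+u. nkern a (t - t * u) * nkern b (t * u) \<partial>lborel)"
    unfolding nconv_def using nn_integral_real_affine[of "\<lambda>s. nkern a (t - s) * nkern b s" t 0] t by simp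
  also have "... = ennreal t * (\<integral>\<^sup>+u. ennreal (?C / t * (u powr (b - 1) * (1 - u) powr (a - 1))) * indicator {0..1} u \<partial>lborel)"
  proof -
    have "AE u in lborel. nkern a (t - t * u) * nkern b (t * u) = ennreal (?C / t * (u powr (b - 1) * (1 - u) powr (a - 1))) * indicator {0..1} u"
    proof -
      have "AE u in lborel. u \<noteq> (0::real)" "AE u in lborel. u \<noteq> (1::real)" by (rule AE_lborel_singleton)+
      then show ?thesis
      proof eventually_elim
        fix u :: real assume u: "u \<noteq> 0" "u \<noteq> 1"
        show "nkern a (t - t * u) * nkern b (t * u) = ennreal (?C / t * (u powr (b - 1) * (1 - u) powr (a - 1))) * indicator {0..1} u"
        proof (cases "0 < u \<and> u < 1")
          case True
          have e: "t - t * u = t * (1 - u)" by (simp add: algebra_simps)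
          have p: "t powr (a - 1) * t powr (b - 1) = t powr (a + b - 1) / t"
          proof -
            have "t powr (a - 1) * t powr (b - 1) = t powr ((a + b - 1) - 1)" by (simp add: powr_add[symmetric] algebra_simps)
            then show ?thesis using t by (simp add: powr_diff power2_eq_square)
          qed
          have "kern a (t - t * u) * kern b (t * u) = (t powr (a - 1) * t powr (b - 1)) * (u powr (b - 1) * (1 - u) powr (a - 1)) / (Gamma a * Gamma b)"
            unfolding e using True t by (simp add: kern_def powr_mult)
          also have "... = ?C / t * (u powr (b - 1) * (1 - u) powr (a - 1))" unfolding p by simp
          finally have "kern a (t - t * u) * kern b (t * u) = ?C / t * (u powr (b - 1) * (1 - u) powr (a - 1))" .
          then show ?thesis using True kern_nonneg[OF assms(1)] kern_nonneg[OF assms(2)]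
            by (simp flip: ennreal_mult)
        next
          case False
          then have "t * (1 - u) \<le> 0 \<or> t * u \<le> 0" "u \<notin> {0..1}" using u t by (auto simp: mult_le_0_iff)
          then have "kern a (t - t * u) * kern b (t * u) = 0" by (auto simp: algebra_simps kern_def)
          then show ?thesis using \<open>u \<notin> {0..1}\<close> by (simp flip: ennreal_mult' add: kern_nonneg assms)
        qed
      qed
    qed
    then show ?thesis by (intro arg_cong2[where f = "(*)"] refl nn_integral_cong_AE)
  qed
  also have "(\<integral>\<^sup>+u. ennreal (?C / t * (u powr (b - 1) * (1 - u) powr (a - 1))) * indicator {0..1} u \<partial>lborel) = ennreal (?C / t * Beta b a)"
  proof (rule nn_integral_has_integral_lebesgue')
    show "((\<lambda>u. ?C / t * (u powr (b - 1) * (1 - u) powr (a - 1))) has_integral ?C / t * Beta b a) {0..1}"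
      by (intro has_integral_mult_right has_integral_Beta_real assms)
    show "0 \<le> ?C / t * (x powr (b - 1) * (1 - x) powr (a - 1))" for x using t G by simp
  qed
  also have "ennreal t * ennreal (?C / t * Beta b a) = nkern (a + b) t"
  proof -
    have "t * (?C / t * Beta b a) = kern (a + b) t" using t G by (simp add: kern_def Beta_def add.commute)
    moreover have "0 \<le> ?C / t * Beta b a" using t G by (simp add: Beta_def add.commute)
    ultimately show ?thesis using t by (simp only: ennreal_mult[symmetric] less_imp_le)
  qed
  finally show ?thesis .
qed

text \<open>In the Gamma integral only s \<ge> m t is kept, where the power of s is at least that of
  m t because \<beta> \<ge> 1. The free parameter m is the point: its power 1 - \<beta> makes the
  resolvent series geometric once m is large.\<close>

lemma kern_le_exp:
  assumes "\<beta> \<ge> 1" "m > 0" "t > 0" shows "kern \<beta> t \<le> exp (m * t) * m powr (1 - \<beta>)"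
proof -
  have "(m * t) powr (\<beta> - 1) * exp (- (m * t)) \<le> Gamma \<beta>"
  proof (rule has_integral_le)
    let ?x = "m * t"
    have x: "?x > 0" using assms by simp
    show "((\<lambda>s. if s \<in> {?x..} then ?x powr (\<beta> - 1) * exp (- 1 * s) else 0) has_integral ?x powr (\<beta> - 1) * exp (- ?x)) {0..}"
    proof -
      have "((\<lambda>s. ?x powr (\<beta> - 1) * exp (- 1 * s)) has_integral ?x powr (\<beta> - 1) * (exp (- 1 * ?x) / 1)) {?x..}"
        by (intro has_integral_mult_right has_integral_exp_minus_to_infinity) simp
      then show ?thesis using x by (subst has_integral_restrict) auto
    qed
    show "((\<lambda>s. s powr (\<beta> - 1) / exp s) has_integral Gamma \<beta>) {0..}"
      using assms by (intro Gamma_integral_real) simp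
    show "(if s \<in> {?x..} then ?x powr (\<beta> - 1) * exp (- 1 * s) else 0) \<le> s powr (\<beta> - 1) / exp s" for s
      using assms x by (auto simp: exp_minus divide_inverse intro!: mult_right_mono powr_mono2)
  qed
  then have "(m * t) powr (\<beta> - 1) \<le> Gamma \<beta> * exp (m * t)" by (simp add: exp_minus field_simps)
  moreover have "Gamma \<beta> > 0" using assms by (intro Gamma_real_pos) simp
  ultimately have "(m * t) powr (\<beta> - 1) / Gamma \<beta> \<le> exp (m * t)" by (simp add: pos_divide_le_eq mult.commute)
  then have "m powr (1 - \<beta>) * ((m * t) powr (\<beta> - 1) / Gamma \<beta>) \<le> m powr (1 - \<beta>) * exp (m * t)"
    by (intro mult_left_mono) auto
  moreover have "m powr (1 - \<beta>) * (m * t) powr (\<beta> - 1) = t powr (\<beta> - 1)"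
    using assms by (simp add: powr_mult mult.assoc[symmetric] powr_add[symmetric])
  ultimately show ?thesis using assms by (simp add: kern_def mult.commute)
qed

section \<open>The resolvent of the kernel\<close>

lemma conv_kern:
  assumes "a > 0" "b > 0" shows "conv (kern a) (kern b) t = kern (a + b) t"
proof -
  have "ennreal (conv (kern a) (kern b) t) = ennreal (kern (a + b) t)"
    using ennreal_conv[of "kern a" "kern b" t] nconv_kern[OF assms, of t] assms by (simp add: kern_nonneg)
  moreover have "0 \<le> conv (kern a) (kern b) t"
    unfolding conv_def using assms by (intro integral_nonneg_AE) (auto simp: kern_nonneg)
  ultimately show ?thesis using assms by (simp add: kern_nonneg)
qed

lemma kern_continuous: "continuous_on {0<..} (kern \<beta>)"
proof -
  have "continuous_on {0<..} (\<lambda>t. t powr (\<beta> - 1) * inverse (Gamma \<beta>))"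
    by (intro continuous_on_mult continuous_on_powr continuous_on_const continuous_on_id) auto
  then show ?thesis by (rule continuous_on_eq) (simp add: kern_def divide_inverse)
qed

text \<open>A shift by t reduces this to the semigroup law with \<open>kern 1\<close>.\<close>

lemma kern_integral_tail:
  assumes "\<beta> > 0"
  shows "integrable lborel (\<lambda>s. kern \<beta> (t' - s) * kern 1 (s - t))"
    and "(LINT s|lborel. kern \<beta> (t' - s) * kern 1 (s - t)) = kern (\<beta> + 1) (t' - t)"
proof -
  let ?f = "\<lambda>s. kern \<beta> (t' - s) * kern 1 (s - t)"
  have eq: "?f (t + 1 * r) = kern \<beta> ((t' - t) - r) * kern 1 r" for r by (simp add: algebra_simps)
  have "integrable lborel (\<lambda>r. kern \<beta> ((t' - t) - r) * kern 1 r)"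
    using assms by (intro conv_integrable) (simp_all add: kern_nonneg nconv_kern)
  then have "integrable lborel (\<lambda>r. ?f (t + 1 * r))" unfolding eq .
  then show "integrable lborel ?f" by (rule lborel_integrable_real_affine_iff[THEN iffD1, rotated]) simp
  have "(LINT s|lborel. ?f s) = \<bar>1\<bar> *\<^sub>R (LINT r|lborel. ?f (t + 1 * r))"
    by (rule lborel_integral_real_affine) simp
  also have "... = conv (kern \<beta>) (kern 1) (t' - t)" unfolding eq conv_def by simp
  also have "... = kern (\<beta> + 1) (t' - t)" using assms by (intro conv_kern) auto
  finally show "(LINT s|lborel. ?f s) = kern (\<beta> + 1) (t' - t)" .
qed

locale frac =
  fixes al \<mu> :: real
  assumes al: "1 / 2 < al" "al < 1" and \<mu>: "\<mu> > 0"
begin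

lemma al_pos: "al > 0" "1 - al > 0" using al by auto

text \<open>The growth parameter for which the majorant of the resolvent series has ratio
  1/2.\<close>

definition rate :: real where "rate = (2 * \<mu>) powr (1 / al)"

lemma rate: "rate > 0" "\<mu> * rate powr (- al) = 1 / 2"
  using \<mu> al by (simp_all add: rate_def powr_powr powr_minus)

text \<open>The Neumann series of the resolvent: by the semigroup law the (j+1)-fold convolution
  power of \<open>kern al\<close> is the kernel of order (j+1) * al.\<close>

definition rterm :: "nat \<Rightarrow> real \<Rightarrow> real" where
  "rterm j t = (- \<mu>) ^ j * kern (real (Suc j) * al) t"

text \<open>In terms of the Mittag-Leffler function, res t = t^(al-1) E_{al,al}(-\<mu> t^al) for t >
  0.\<close>

definition res :: "real \<Rightarrow> real" where "res t = (\<Sum>j. rterm j t)"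

lemma rterm_abs: "\<bar>rterm j t\<bar> = \<mu> ^ j * kern (real (Suc j) * al) t"
  using kern_nonneg[of "real (Suc j) * al" t] \<mu> al by (simp add: rterm_def abs_mult power_abs)

text \<open>The bound starts at the second term, whose order 2 * al exceeds 1; the first term is
  singular at 0 and is always treated separately.\<close>

lemma rterm_bound:
  assumes "t > 0" shows "\<bar>rterm (Suc j) t\<bar> \<le> exp (rate * t) * rate powr (1 - al) * (1 / 2) ^ Suc j"
proof -
  let ?n = "Suc j"
  have "real (Suc ?n) * al \<ge> 1"
  proof -
    have "2 * al \<le> real (Suc ?n) * al" using al by (intro mult_right_mono) auto
    then show ?thesis using al by linarith
  qed
  then have "kern (real (Suc ?n) * al) t \<le> exp (rate * t) * rate powr (1 - real (Suc ?n) * al)"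
    using assms rate(1) by (intro kern_le_exp)
  also have "rate powr (1 - real (Suc ?n) * al) = rate powr (1 - al) * (rate powr (- al)) ^ ?n"
  proof -
    have "(rate powr (- al)) ^ ?n = rate powr (- al * real ?n)"
      using rate(1) by (simp only: powr_realpow[symmetric] powr_powr powr_gt_zero)
    then show ?thesis by (simp add: powr_add[symmetric] algebra_simps)
  qed
  finally have "\<mu> ^ ?n * kern (real (Suc ?n) * al) t \<le> \<mu> ^ ?n * (exp (rate * t) * (rate powr (1 - al) * (rate powr (- al)) ^ ?n))"
    using \<mu> by (intro mult_left_mono) auto
  also have "... = exp (rate * t) * rate powr (1 - al) * (\<mu> * rate powr (- al)) ^ ?n"
    by (simp only: power_mult_distrib mult_ac)
  finally show ?thesis unfolding rterm_abs rate(2) .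
qed

lemma rterm_summable: "summable (\<lambda>j. \<bar>rterm j t\<bar>)"
proof (cases "t > 0")
  case True
  have "summable (\<lambda>j. \<bar>rterm (Suc j) t\<bar>)"
  proof (rule summable_comparison_test')
    show "summable (\<lambda>j. exp (rate * t) * rate powr (1 - al) * (1 / 2) ^ Suc j)"
      by (intro summable_mult summable_Suc_iff[THEN iffD2] summable_geometric) simp
    show "norm \<bar>rterm (Suc j) t\<bar> \<le> exp (rate * t) * rate powr (1 - al) * (1 / 2) ^ Suc j" if "j \<ge> 0" for j
      using rterm_bound[OF True, of j] by simp
  qed
  then show ?thesis by (rule summable_Suc_iff[of "\<lambda>j. \<bar>rterm j t\<bar>", THEN iffD1])
qed (simp add: rterm_def)

lemma rterm_measurable [measurable]: "rterm j \<in> borel_measurable borel" unfolding rterm_def by measurable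

lemma res_measurable [measurable]: "res \<in> borel_measurable borel" unfolding res_def by measurable

lemma res_zero [simp]: "t \<le> 0 \<Longrightarrow> res t = 0" by (simp add: res_def rterm_def)

lemma conv_kern_multiple: "conv (kern al) (kern (real (Suc j) * al)) t = kern (real (j + 2) * al) t"
proof -
  have "al + real (Suc j) * al = real (j + 2) * al" by (simp add: algebra_simps)
  then show ?thesis using conv_kern[of al "real (Suc j) * al" t] al by simp
qed

lemma conv_kern_rterm: "conv (kern al) (rterm j) t = (- \<mu>) ^ j * kern (real (j + 2) * al) t"
proof -
  have "conv (kern al) (rterm j) t = (- \<mu>) ^ j * conv (kern al) (kern (real (Suc j) * al)) t"
    unfolding conv_def rterm_def by (simp add: mult.left_commute flip: integral_mult_right_zero)
  then show ?thesis unfolding conv_kern_multiple .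
qed

lemma integrable_kern_rterm: "integrable lborel (\<lambda>s. kern al (t - s) * rterm j s)"
proof -
  have "integrable lborel (\<lambda>s. kern al (t - s) * kern (real (Suc j) * al) s)"
    using al by (intro conv_integrable) (simp_all add: kern_nonneg nconv_kern)
  then have "integrable lborel (\<lambda>s. (- \<mu>) ^ j * (kern al (t - s) * kern (real (Suc j) * al) s))"
    by (rule integrable_mult_right)
  then show ?thesis by (simp add: rterm_def mult.left_commute)
qed

text \<open>Convolution with \<open>kern al\<close>, multiplied by -\<mu>, moves each term of the
  series to the next one. Absolute convergence of the integrated series justifies the exchange of
  sum and integral.\<close>

lemma res_equation: "res t + \<mu> * conv (kern al) res t = kern al t" (is ?eq)
  and integrable_kern_res: "integrable lborel (\<lambda>s. kern al (t - s) * res s)" (is ?int)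
proof -
  let ?g = "\<lambda>j. (- \<mu>) ^ j * kern (real (j + 2) * al) t"
  have g: "rterm (Suc j) t = - \<mu> * ?g j" for j by (simp add: rterm_def algebra_simps)
  have nrm: "(LINT s|lborel. norm (kern al (t - s) * rterm j s)) = \<mu> ^ j * kern (real (j + 2) * al) t" for j
  proof -
    have "(LINT s|lborel. norm (kern al (t - s) * rterm j s)) = (LINT s|lborel. \<mu> ^ j * (kern al (t - s) * kern (real (Suc j) * al) s))"
      using al by (intro Bochner_Integration.integral_cong refl)
        (simp add: abs_mult rterm_abs kern_nonneg al_pos)
    also have "... = \<mu> ^ j * conv (kern al) (kern (real (Suc j) * al)) t" unfolding conv_def by simp
    finally show ?thesis unfolding conv_kern_multiple .
  qed
  have "summable (\<lambda>j. \<bar>rterm (Suc j) t\<bar> / \<mu>)"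
    by (intro summable_divide summable_Suc_iff[THEN iffD2] rterm_summable)
  moreover have "\<bar>rterm (Suc j) t\<bar> / \<mu> = \<mu> ^ j * kern (real (j + 2) * al) t" for j
    unfolding rterm_abs using \<mu> by simp
  ultimately have sn: "summable (\<lambda>j. \<mu> ^ j * kern (real (j + 2) * al) t)" by simp
  have fac: "kern al (t - s) * res s = (\<Sum>j. kern al (t - s) * rterm j s)" for s
    unfolding res_def using summable_rabs_cancel[OF rterm_summable] by (simp add: suminf_mult)
  have a: "AE s in lborel. summable (\<lambda>j. norm (kern al (t - s) * rterm j s))"
    using rterm_summable by (intro AE_I2) (simp add: abs_mult summable_mult)
  have b: "summable (\<lambda>j. LINT s|lborel. norm (kern al (t - s) * rterm j s))" unfolding nrm by (rule sn)
  show ?int unfolding fac by (rule integrable_suminf[OF integrable_kern_rterm a b])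
  have "conv (kern al) res t = (\<Sum>j. LINT s|lborel. kern al (t - s) * rterm j s)"
    unfolding conv_def fac by (rule integral_suminf[OF integrable_kern_rterm a b])
  also have "... = (\<Sum>j. ?g j)" using conv_kern_rterm by (simp add: conv_def)
  finally have c: "conv (kern al) res t = (\<Sum>j. ?g j)" .
  have "summable ?g"
  proof (rule summable_rabs_cancel)
    have "\<bar>?g j\<bar> = \<mu> ^ j * kern (real (j + 2) * al) t" for j
      using \<mu> kern_nonneg[of "real (j + 2) * al" t] al by (simp add: abs_mult power_abs)
    then show "summable (\<lambda>j. \<bar>?g j\<bar>)" using sn by simp
  qed
  then have "(\<Sum>j. rterm (Suc j) t) = - \<mu> * (\<Sum>j. ?g j)" unfolding g by (rule suminf_mult)
  moreover have "(\<Sum>j. rterm (Suc j) t) = res t - rterm 0 t"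
    unfolding res_def by (rule suminf_split_head[OF summable_rabs_cancel[OF rterm_summable]])
  moreover have "rterm 0 t = kern al t" by (simp add: rterm_def)
  ultimately show ?eq unfolding c by linarith
qed

lemma res_split: "res t = kern al t + (\<Sum>j. rterm (Suc j) t)"
  unfolding res_def using suminf_split_head[OF summable_rabs_cancel[OF rterm_summable], of t] by (simp add: rterm_def)

lemma res_continuous: "continuous_on {0<..} res"
proof -
  have "continuous_on {0<..<T} res" for T
  proof -
    let ?M = "\<lambda>j. exp (rate * \<bar>T\<bar>) * rate powr (1 - al) * (1 / 2) ^ Suc j"
    have "uniform_limit {0<..<T} (\<lambda>n t. \<Sum>j<n. rterm (Suc j) t) (\<lambda>t. \<Sum>j. rterm (Suc j) t) sequentially"
    proof (rule Weierstrass_m_test)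
      show "norm (rterm (Suc j) t) \<le> ?M j" if "t \<in> {0<..<T}" for j t
      proof -
        have "exp (rate * t) \<le> exp (rate * \<bar>T\<bar>)" using rate(1) that by auto
        then have "exp (rate * t) * rate powr (1 - al) * (1 / 2) ^ Suc j \<le> ?M j"
          by (intro mult_right_mono) auto
        then show ?thesis using rterm_bound[of t j] that by simp
      qed
      show "summable ?M" by (intro summable_mult summable_Suc_iff[THEN iffD2] summable_geometric) simp
    qed
    then have "continuous_on {0<..<T} (\<lambda>t. \<Sum>j. rterm (Suc j) t)"
    proof (rule uniform_limit_theorem[rotated])
      show "\<forall>\<^sub>F n in sequentially. continuous_on {0<..<T} (\<lambda>t. \<Sum>j<n. rterm (Suc j) t)" unfolding rterm_def
        by (intro always_eventually allI continuous_intros continuous_on_subset[OF kern_continuous]) auto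
    qed simp
    then show ?thesis unfolding res_split[abs_def]
      by (intro continuous_on_add continuous_on_subset[OF kern_continuous]) auto
  qed
  then have "continuous (at t) res" if "t > 0" for t
    using that by (intro continuous_on_interior[of "{0<..<t + 1}"]) auto
  then show ?thesis by (intro continuous_at_imp_continuous_on) auto
qed

text \<open>The first term is unbounded at 0, while the remaining series stays below the constant
  \<open>C\<close>.\<close>

lemma res_pos_near_zero: "\<exists>\<delta>>0. \<forall>t. 0 < t \<and> t < \<delta> \<longrightarrow> res t > 0"
proof -
  define C where "C = exp rate * rate powr (1 - al)"
  have C: "C > 0" unfolding C_def using rate(1) by simp
  have tail: "\<bar>\<Sum>j. rterm (Suc j) t\<bar> \<le> C" if t: "0 < t" "t < 1" for t
  proof -
    have "exp (rate * t) \<le> exp rate" using rate(1) t by simp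
    then have "exp (rate * t) * rate powr (1 - al) * (1 / 2) ^ Suc j \<le> C * (1 / 2) ^ Suc j" for j
      unfolding C_def by (intro mult_right_mono) auto
    then have b: "norm (rterm (Suc j) t) \<le> C * (1 / 2) ^ Suc j" for j
      unfolding real_norm_def by (rule order_trans[OF rterm_bound[OF t(1)]])
    have s: "(\<lambda>j. C * (1 / 2) ^ Suc j) sums (C * 1)" by (rule sums_mult[OF power_half_series])
    have "norm (\<Sum>j. rterm (Suc j) t) \<le> (\<Sum>j. C * (1 / 2) ^ Suc j)"
      by (rule norm_suminf_le[OF b sums_summable[OF s]])
    then show ?thesis using sums_unique[OF s] by simp
  qed
  define K where "K = (C + 1) * Gamma al"
  have G: "Gamma al > 0" by (rule Gamma_real_pos[OF al_pos(1)])
  have K: "K > 0" unfolding K_def using C G by simp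
  \<comment> \<open>The second entry is the time at which \<open>kern al\<close> equals C + 1;
    before it the kernel is larger.\<close>
  define \<delta> where "\<delta> = min 1 (K powr (1 / (al - 1)))"
  have "res t > 0" if t: "0 < t" "t < \<delta>" for t
  proof -
    have "K = (K powr (1 / (al - 1))) powr (al - 1)" using K al by (simp add: powr_powr)
    also have "... < t powr (al - 1)" using t al unfolding \<delta>_def by (intro powr_less_mono2_neg) auto
    finally have "kern al t > C + 1" using t(1) G by (simp add: kern_def K_def pos_less_divide_eq)
    moreover have "t < 1" using t(2) unfolding \<delta>_def by simp
    ultimately show ?thesis using tail[OF t(1)] unfolding res_split by linarith
  qed
  moreover have "\<delta> > 0" unfolding \<delta>_def using K by simp
  ultimately show ?thesis by blast
qed

text \<open>For a logarithmically convex kernel the quotient of its values at t' - s and t - s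
  decreases in s; it is compared here with its value at s = 0.\<close>

lemma kern_ratio:
  assumes "0 < t" "t < t'" "0 < s" "s < t"
  shows "kern al (t' - s) \<le> kern al t' / kern al t * kern al (t - s)"
proof -
  have G: "Gamma al > 0" by (rule Gamma_real_pos[OF al_pos(1)])
  have "t * (t' - s) \<ge> t' * (t - s)" using assms by (simp add: algebra_simps)
  then have "(t * (t' - s)) powr (al - 1) \<le> (t' * (t - s)) powr (al - 1)"
    using assms al by (intro powr_mono2') auto
  then have "t powr (al - 1) * (t' - s) powr (al - 1) \<le> t' powr (al - 1) * (t - s) powr (al - 1)"
    using assms by (simp add: powr_mult)
  then show ?thesis using assms G by (simp add: kern_def field_simps)
qed

text \<open>Let t0 be the first time with a nonpositive value, and r a maximum point of
  \<open>res\<close> on a short interval ending at t0. In the convolution at t0 the part over (0,r)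
  is at most \<rho> times the convolution at r by \<open>kern_ratio\<close>, and the part over
  (r,t0) involves only values up to res r. Inserting the resolvent equation at t0 and at r cancels
  the kernels, since \<rho> * kern al r = kern al t0, and leaves \<rho> \<le> 1/3. But r \<ge> t0/2
  forces \<rho> \<ge> 1/2.\<close>

lemma res_nonneg: "0 \<le> res t"
proof (rule ccontr)
  assume neg: "\<not> 0 \<le> res t"
  obtain \<delta> where \<delta>: "\<delta> > 0" "\<And>s. 0 < s \<Longrightarrow> s < \<delta> \<Longrightarrow> res s > 0" using res_pos_near_zero by blast
  define S where "S = {s \<in> {\<delta>..}. res s \<le> 0}"
  define t0 where "t0 = Inf S"
  have "t > 0" using neg res_zero[of t] by (cases "t > 0") auto
  then have "t \<in> S" using neg \<delta>(2)[of t] unfolding S_def by fastforce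
  have "closed S" unfolding S_def
    using \<delta>(1) by (intro continuous_closed_preimage_constant[THEN closed_subset[rotated]]
        continuous_on_closed_Collect_le continuous_on_subset[OF res_continuous] continuous_on_const) auto
  have bdd: "bdd_below S" by (rule bdd_belowI[of _ \<delta>]) (simp add: S_def)
  then have "t0 \<in> S" unfolding t0_def using \<open>t \<in> S\<close> \<open>closed S\<close> by (intro closed_contains_Inf) auto
  then have t0: "t0 \<ge> \<delta>" "res t0 \<le> 0" by (auto simp: S_def)
  have pos: "res s > 0" if "0 < s" "s < t0" for s
  proof (rule ccontr)
    assume "\<not> res s > 0"
    then have "s \<in> S" using \<delta>(2)[of s] that unfolding S_def by fastforce
    then have "t0 \<le> s" unfolding t0_def using bdd by (rule cInf_lower)
    then show False using that by simp
  qed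
  have G: "Gamma (al + 1) > 0" using al_pos by (intro Gamma_real_pos) simp
  \<comment> \<open>The bound t0/2 keeps r in the right half of (0,t0); the other entry makes the
    integral of \<mu> * \<open>kern al\<close> over any length up to d at most 1/3.\<close>
  define d where "d = min (t0 / 2) ((Gamma (al + 1) / (3 * \<mu>)) powr (1 / al))"
  have d: "0 < d" "d \<le> t0 / 2" unfolding d_def using \<mu> G \<delta>(1) t0(1) by auto
  have small: "\<mu> * kern (al + 1) r \<le> 1 / 3" if "r \<le> d" for r
  proof (cases "r > 0")
    case True
    have "r powr al \<le> ((Gamma (al + 1) / (3 * \<mu>)) powr (1 / al)) powr al"
      using that True al unfolding d_def by (intro powr_mono2) auto
    also have "... = Gamma (al + 1) / (3 * \<mu>)" using al \<mu> G by (simp add: powr_powr)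
    finally show ?thesis using True G \<mu> by (simp add: kern_def field_simps)
  qed simp
  define t1 where "t1 = t0 - d"
  have t1: "0 < t1" "t1 < t0" "t0 / 2 \<le> t1" unfolding t1_def using d t0(1) \<delta>(1) by auto
  \<comment> \<open>The maximum is positive because it is attained against \<open>t1\<close> < t0,
    so r lies strictly before t0.\<close>
  obtain r where r: "r \<in> {t1..t0}" "\<And>s. s \<in> {t1..t0} \<Longrightarrow> res s \<le> res r"
    using continuous_attains_sup[of "{t1..t0}" res] t1 continuous_on_subset[OF res_continuous, of "{t1..t0}"] by fastforce
  have "res r \<ge> res t1" using r(2)[of t1] t1 by simp
  then have rr: "res r > 0" using pos[OF t1(1,2)] by simp
  then have "r < t0" using r(1) t0(2) by (cases "r = t0") auto
  have "r > 0" using r(1) t1 by simp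
  define \<rho> where "\<rho> = kern al t0 / kern al r"
  have "AE s in lborel. kern al (t0 - s) * res s
      \<le> \<rho> * (kern al (r - s) * res s) + res r * (kern al (t0 - s) * kern 1 (s - r))"
    using AE_lborel_singleton[of r]
  proof eventually_elim
    fix s assume "s \<noteq> r"
    have k: "kern al x \<ge> 0" for x using al_pos kern_nonneg by simp
    show "kern al (t0 - s) * res s \<le> \<rho> * (kern al (r - s) * res s) + res r * (kern al (t0 - s) * kern 1 (s - r))"
    proof -
      consider "s \<le> 0" | "0 < s" "s < r" | "r < s" "s < t0" | "s \<ge> t0" using \<open>s \<noteq> r\<close> by linarith
      then show ?thesis
      proof cases
        case 2
        have "kern al (t0 - s) * res s \<le> \<rho> * kern al (r - s) * res s"
          using kern_ratio[OF \<open>r > 0\<close> \<open>r < t0\<close> 2] pos[of s] 2 \<open>r < t0\<close> unfolding \<rho>_def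
          by (intro mult_right_mono) auto
        then show ?thesis using 2 by simp
      next
        case 3
        then have "kern al (t0 - s) * res s \<le> kern al (t0 - s) * res r" using r by (intro mult_left_mono k) auto
        then show ?thesis using 3 by (simp add: kern_1 mult.commute)
      qed (use \<open>r > 0\<close> \<open>r < t0\<close> in auto)
    qed
  qed
  then have "(LINT s|lborel. kern al (t0 - s) * res s)
      \<le> (LINT s|lborel. \<rho> * (kern al (r - s) * res s) + res r * (kern al (t0 - s) * kern 1 (s - r)))"
    by (intro integral_mono_AE Bochner_Integration.integrable_add integrable_mult_right
        integrable_kern_res kern_integral_tail al_pos)
  also have "... = \<rho> * conv (kern al) res r + res r * kern (al + 1) (t0 - r)"
    by (simp add: integrable_kern_res kern_integral_tail al_pos conv_def)
  finally have "conv (kern al) res t0 \<le> \<rho> * conv (kern al) res r + res r * kern (al + 1) (t0 - r)"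
    by (simp add: conv_def)
  then have "\<mu> * conv (kern al) res t0 \<le> \<mu> * (\<rho> * conv (kern al) res r + res r * kern (al + 1) (t0 - r))"
    using \<mu> by (intro mult_left_mono) auto
  also have "... = \<rho> * (\<mu> * conv (kern al) res r) + res r * (\<mu> * kern (al + 1) (t0 - r))"
    by (simp add: algebra_simps)
  also have "\<mu> * conv (kern al) res r = kern al r - res r" using res_equation[of r] by simp
  finally have "kern al t0 - res t0 \<le> \<rho> * (kern al r - res r) + res r * (\<mu> * kern (al + 1) (t0 - r))"
    using res_equation[of t0] by linarith
  moreover have "\<rho> * kern al r = kern al t0" unfolding \<rho>_def using kern_pos[of al r] al_pos \<open>r > 0\<close> by simp
  ultimately have "\<rho> * res r \<le> res r * (\<mu> * kern (al + 1) (t0 - r))" using t0(2) by (simp add: algebra_simps)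
  also have "... \<le> res r * (1 / 3)" using small[of "t0 - r"] r(1) rr unfolding t1_def by (intro mult_left_mono) auto
  finally have "\<rho> \<le> 1 / 3" using rr by simp
  moreover have "\<rho> \<ge> 1 / 2"
  proof -
    have "\<rho> = (r / t0) powr (1 - al)" unfolding \<rho>_def using \<open>r > 0\<close> \<open>r < t0\<close> Gamma_real_pos[OF al_pos(1)]
      by (simp add: kern_def powr_divide powr_diff)
    moreover have "r / t0 \<ge> 1 / 2" using r(1) t1 \<open>r > 0\<close> \<open>r < t0\<close> by (simp add: field_simps)
    moreover have "r / t0 \<le> (r / t0) powr (1 - al)"
      using powr_mono'[of "1 - al" 1 "r / t0"] \<open>r > 0\<close> \<open>r < t0\<close> al by simp
    ultimately show ?thesis by linarith
  qed
  ultimately show False by simp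
qed

end

lemma nn_integral_kern_tail:
  assumes "\<beta> > 0"
  shows "(\<integral>\<^sup>+s. ennreal (kern \<beta> (t' - s) * kern 1 (s - t)) \<partial>lborel) = nkern (\<beta> + 1) (t' - t)"
  using kern_integral_tail[OF assms, of t' t] assms
  by (subst nn_integral_eq_integral) (auto simp: kern_nonneg)

lemma kern_mono: "\<beta> \<ge> 1 \<Longrightarrow> s \<le> t \<Longrightarrow> kern \<beta> s \<le> kern \<beta> t"
  using Gamma_real_pos[of \<beta>] by (auto simp: kern_def intro!: divide_right_mono powr_mono2)

lemma kern_antimono: "\<beta> > 0 \<Longrightarrow> \<beta> \<le> 1 \<Longrightarrow> 0 < s \<Longrightarrow> s \<le> t \<Longrightarrow> kern \<beta> t \<le> kern \<beta> s"
  using Gamma_real_pos[of \<beta>] by (auto simp: kern_def intro!: divide_right_mono powr_mono2')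

text \<open>The integral of a non-integrable function has the value 0, so the bound holds for every
  measurable function and estimates can precede integrability.\<close>

lemma abs_lint_le: "f \<in> borel_measurable M \<Longrightarrow> ennreal \<bar>LINT x|M. f x\<bar> \<le> (\<integral>\<^sup>+x. ennreal \<bar>f x\<bar> \<partial>M)"
proof (cases "integrable M f")
  case True then show ?thesis using integral_norm_bound_ennreal[OF True] by simp
qed (simp add: not_integrable_integral_eq)

section \<open>Square integrability of the kernel for orders above one half\<close>

context
  fixes al :: real
  assumes al: "1 / 2 < al" "al < 1"
begin

text \<open>The factor by which the square of \<open>kern al\<close> is a kernel again, of order 2 *
  al - 1. That order is positive exactly because al > 1/2.\<close>

definition kern_sq_const :: real where "kern_sq_const = Gamma (2 * al - 1) / (Gamma al)\<^sup>2"

lemma kern_sq_const_pos: "kern_sq_const > 0"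
  unfolding kern_sq_const_def using al by (intro divide_pos_pos Gamma_real_pos zero_less_power) auto

lemma kern_sq: "(kern al s)\<^sup>2 = kern_sq_const * kern (2 * al - 1) s"
proof (cases "s > 0")
  case True
  have "(s powr (al - 1))\<^sup>2 = s powr (2 * al - 1 - 1)" using True
    by (simp add: power2_eq_square powr_add[symmetric])
  moreover have "Gamma (2 * al - 1) > 0" using al by (intro Gamma_real_pos) simp
  ultimately show ?thesis using True by (simp add: kern_def kern_sq_const_def power_divide)
qed simp

text \<open>Cauchy-Schwarz after inserting the cut-off \<open>kern 1 s\<close>, without which the
  squared kernel would be integrated over all of s < t.\<close>

lemma nconv_kern_sq_le:
  assumes [measurable]: "g \<in> borel_measurable borel" and g0: "\<And>s. s \<le> 0 \<Longrightarrow> g s = 0"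
  shows "(nconv (nkern al) g t)\<^sup>2 \<le> ennreal (kern_sq_const * kern (2 * al) t) * (\<integral>\<^sup>+s. (g s)\<^sup>2 \<partial>lborel)"
proof -
  have "nconv (nkern al) g t = (\<integral>\<^sup>+s. (ennreal (kern al (t - s) * kern 1 s)) * g s \<partial>lborel)"
    unfolding nconv_def
  proof (intro nn_integral_cong)
    fix s show "nkern al (t - s) * g s = ennreal (kern al (t - s) * kern 1 s) * g s"
      using g0[of s] by (cases "s > 0") (auto simp: kern_1)
  qed
  then have "(nconv (nkern al) g t)\<^sup>2 \<le>
      (\<integral>\<^sup>+s. (ennreal (kern al (t - s) * kern 1 s))\<^sup>2 \<partial>lborel) * (\<integral>\<^sup>+s. (g s)\<^sup>2 \<partial>lborel)"
    by (simp only:) (rule Cauchy_Schwarz_nn_integral, auto)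
  also have "(\<integral>\<^sup>+s. (ennreal (kern al (t - s) * kern 1 s))\<^sup>2 \<partial>lborel)
      = (\<integral>\<^sup>+s. ennreal kern_sq_const * ennreal (kern (2 * al - 1) (t - s) * kern 1 (s - 0)) \<partial>lborel)"
  proof (intro nn_integral_cong)
    fix s
    have "(kern al (t - s) * kern 1 s)\<^sup>2 = kern_sq_const * (kern (2 * al - 1) (t - s) * kern 1 (s - 0))"
      using kern_sq[of "t - s"] by (auto simp: power_mult_distrib kern_1 indicator_def)
    then show "(ennreal (kern al (t - s) * kern 1 s))\<^sup>2
      = ennreal kern_sq_const * ennreal (kern (2 * al - 1) (t - s) * kern 1 (s - 0))"
      using al kern_sq_const_pos
      by (subst ennreal_power) (simp_all add: kern_nonneg ennreal_mult[symmetric] del: ennreal_mult')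
  qed
  also have "... = ennreal kern_sq_const * nkern (2 * al - 1 + 1) (t - 0)"
    using al by (subst nn_integral_cmult) (simp, subst nn_integral_kern_tail, simp_all)
  also have "... = ennreal (kern_sq_const * kern (2 * al) t)"
    using al kern_sq_const_pos by (simp add: ennreal_mult kern_nonneg)
  finally show ?thesis .
qed

lemma nconv_kern_finite:
  assumes "g \<in> borel_measurable borel" "\<And>s. s \<le> 0 \<Longrightarrow> g s = 0" "(\<integral>\<^sup>+s. (g s)\<^sup>2 \<partial>lborel) < \<infinity>"
  shows "nconv (nkern al) g t < \<infinity>"
proof -
  have "(nconv (nkern al) g t)\<^sup>2 < \<infinity>"
  proof (rule order.strict_trans1)
    show "(nconv (nkern al) g t)\<^sup>2 \<le> ennreal (kern_sq_const * kern (2 * al) t) * (\<integral>\<^sup>+s. (g s)\<^sup>2 \<partial>lborel)"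
      by (rule nconv_kern_sq_le) (use assms in auto)
  qed (use assms(3) in \<open>simp add: ennreal_mult_less_top\<close>)
  then show ?thesis by (simp add: power_less_top_ennreal)
qed

text \<open>For r < s the kernel values satisfy 0 \<le> a \<le> b, so (a - b)^2 \<le> b^2 - a^2; for
  r > s the second value is 0. The right-hand side consists of kernels of order 2 * al - 1 with
  known integrals.\<close>

lemma kern_diff_sq_le:
  assumes "r \<noteq> s" "s \<le> t"
  shows "(kern al (t - r) - kern al (s - r))\<^sup>2
    \<le> kern_sq_const * (kern (2 * al - 1) (s - r) - kern (2 * al - 1) (t - r) + 2 * (kern (2 * al - 1) (t - r) * kern 1 (r - s)))"
proof -
  let ?a = "kern al (t - r)" and ?b = "kern al (s - r)"
  have "kern_sq_const * (kern (2 * al - 1) (s - r) - kern (2 * al - 1) (t - r) + 2 * (kern (2 * al - 1) (t - r) * kern 1 (r - s)))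
      = ?b\<^sup>2 - ?a\<^sup>2 + 2 * (?a\<^sup>2 * kern 1 (r - s))" unfolding kern_sq by (simp add: algebra_simps)
  moreover have "(?a - ?b)\<^sup>2 \<le> ?b\<^sup>2 - ?a\<^sup>2 + 2 * (?a\<^sup>2 * kern 1 (r - s))"
  proof (cases "r < s")
    case True
    then have "?a \<le> ?b" using assms al by (intro kern_antimono) auto
    moreover have "0 \<le> ?a" using al by (intro kern_nonneg) auto
    ultimately have "0 \<le> 2 * (?a * (?b - ?a))" by simp
    then have "(?a - ?b)\<^sup>2 \<le> ?b\<^sup>2 - ?a\<^sup>2" by (simp add: power2_eq_square algebra_simps)
    then show ?thesis using True by simp
  next
    case False
    then show ?thesis using assms(1) by (simp add: kern_1)
  qed
  ultimately show ?thesis by simp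
qed

text \<open>J^al maps L2 into functions that are Hoelder continuous of exponent al - 1/2:
  Cauchy-Schwarz against the difference of two shifted kernels, whose squared norm is bounded by
  \<open>kern_diff_sq_le\<close>.\<close>

lemma conv_kern_holder:
  assumes [measurable]: "h \<in> borel_measurable borel" and h0: "\<And>s. s \<le> 0 \<Longrightarrow> h s = 0"
    and hi: "integrable lborel (\<lambda>s. (h s)\<^sup>2)" and st: "0 \<le> s" "s \<le> t"
  shows "(conv (kern al) h t - conv (kern al) h s)\<^sup>2 \<le> 2 * kern_sq_const * kern (2 * al) (t - s) * (LINT r|lborel. (h r)\<^sup>2)"
proof -
  have hn: "(\<integral>\<^sup>+r. ennreal ((h r)\<^sup>2) \<partial>lborel) = ennreal (LINT r|lborel. (h r)\<^sup>2)"
    by (rule nn_integral_eq_integral[OF hi]) simp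
  have hsq: "(\<integral>\<^sup>+r. (ennreal \<bar>h r\<bar>)\<^sup>2 \<partial>lborel) = ennreal (LINT r|lborel. (h r)\<^sup>2)"
    unfolding hn[symmetric] by (intro nn_integral_cong) (simp add: ennreal_power)
  have int: "integrable lborel (\<lambda>r. kern al (x - r) * h r)" for x
  proof (rule conv_integrable)
    show "nconv (\<lambda>s. ennreal \<bar>kern al s\<bar>) (nabs h) x < \<infinity>"
      using nconv_kern_finite[of "\<lambda>s. ennreal \<bar>h s\<bar>" x] h0 hsq al by (simp add: kern_nonneg)
  qed auto
  let ?D = "\<lambda>r. \<bar>kern al (t - r) - kern al (s - r)\<bar> * kern 1 r"
  let ?G = "\<lambda>r. kern_sq_const * (kern (2 * al - 1) (s - r) * kern 1 (r - 0) - kern (2 * al - 1) (t - r) * kern 1 (r - 0)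
      + 2 * (kern (2 * al - 1) (t - r) * kern 1 (r - s)))"
  have pos: "2 * al - 1 > 0" using al by simp
  have D: "AE r in lborel. (?D r)\<^sup>2 \<le> ?G r" using AE_lborel_singleton[of s]
  proof eventually_elim
    fix r assume "r \<noteq> s"
    show "(?D r)\<^sup>2 \<le> ?G r"
    proof (cases "r > 0")
      case True
      then show ?thesis using kern_diff_sq_le[OF \<open>r \<noteq> s\<close> st(2)] by (simp add: kern_1)
    next
      case False
      then show ?thesis using st by (simp add: kern_1)
    qed
  qed
  have Gi: "integrable lborel ?G"
    by (intro integrable_mult_right Bochner_Integration.integrable_add Bochner_Integration.integrable_diff
        kern_integral_tail pos)
  have tail0: "integrable lborel (\<lambda>r. kern (2 * al - 1) (x - r) * kern 1 r)"
    "(LINT r|lborel. kern (2 * al - 1) (x - r) * kern 1 r) = kern (2 * al) x" for x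
    using kern_integral_tail[OF pos, of x 0] by simp_all
  have tails: "integrable lborel (\<lambda>r. kern (2 * al - 1) (t - r) * kern 1 (r - s))"
    "(LINT r|lborel. kern (2 * al - 1) (t - r) * kern 1 (r - s)) = kern (2 * al) (t - s)"
    using kern_integral_tail[OF pos, of t s] by simp_all
  have "(LINT r|lborel. ?G r) = kern_sq_const * (kern (2 * al) s - kern (2 * al) t + 2 * kern (2 * al) (t - s))"
    by (simp add: tail0 tails)
  also have "... \<le> kern_sq_const * (2 * kern (2 * al) (t - s))"
    using kern_mono[of "2 * al" s t] al st kern_sq_const_pos by (intro mult_left_mono) auto
  finally have G: "(LINT r|lborel. ?G r) \<le> 2 * kern_sq_const * kern (2 * al) (t - s)" by simp
  have "ennreal \<bar>conv (kern al) h t - conv (kern al) h s\<bar>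
      = ennreal \<bar>LINT r|lborel. kern al (t - r) * h r - kern al (s - r) * h r\<bar>"
    unfolding conv_def using int by simp
  also have "... \<le> (\<integral>\<^sup>+r. ennreal \<bar>kern al (t - r) * h r - kern al (s - r) * h r\<bar> \<partial>lborel)"
    by (rule abs_lint_le) measurable
  also have "... = (\<integral>\<^sup>+r. ennreal (?D r) * ennreal \<bar>h r\<bar> \<partial>lborel)"
  proof (intro nn_integral_cong)
    fix r
    show "ennreal \<bar>kern al (t - r) * h r - kern al (s - r) * h r\<bar> = ennreal (?D r) * ennreal \<bar>h r\<bar>"
      using h0[of r] by (cases "r > 0")
        (auto simp: kern_1 left_diff_distrib[symmetric] abs_mult ennreal_mult)
  qed
  finally have "(ennreal \<bar>conv (kern al) h t - conv (kern al) h s\<bar>)\<^sup>2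
      \<le> (\<integral>\<^sup>+r. ennreal (?D r) * ennreal \<bar>h r\<bar> \<partial>lborel)\<^sup>2" by (rule power_mono) simp
  also have "... \<le> (\<integral>\<^sup>+r. (ennreal (?D r))\<^sup>2 \<partial>lborel) * (\<integral>\<^sup>+r. (ennreal \<bar>h r\<bar>)\<^sup>2 \<partial>lborel)"
    by (rule Cauchy_Schwarz_nn_integral) auto
  also have "(\<integral>\<^sup>+r. (ennreal (?D r))\<^sup>2 \<partial>lborel) \<le> (\<integral>\<^sup>+r. ennreal (?G r) \<partial>lborel)"
    by (rule nn_integral_mono_AE)
      (use D in eventually_elim, simp add: ennreal_power kern_nonneg ennreal_leI)
  also have "(\<integral>\<^sup>+r. ennreal (?G r) \<partial>lborel) = ennreal (LINT r|lborel. ?G r)"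
    by (rule nn_integral_eq_integral[OF Gi]) (use D in eventually_elim, meson order_trans zero_le_power2)
  also have "... \<le> ennreal (2 * kern_sq_const * kern (2 * al) (t - s))" using G by (rule ennreal_leI)
  finally have "ennreal ((conv (kern al) h t - conv (kern al) h s)\<^sup>2)
      \<le> ennreal (2 * kern_sq_const * kern (2 * al) (t - s)) * ennreal (LINT r|lborel. (h r)\<^sup>2)"
    unfolding hsq by (simp add: ennreal_power mult_right_mono)
  also have "... = ennreal (2 * kern_sq_const * kern (2 * al) (t - s) * (LINT r|lborel. (h r)\<^sup>2))"
    by (rule ennreal_mult[symmetric]) (use al kern_sq_const_pos in \<open>auto intro!: kern_nonneg mult_nonneg_nonneg\<close>)
  finally show ?thesis
    using al kern_sq_const_pos by (subst (asm) ennreal_le_iff) (auto intro!: kern_nonneg mult_nonneg_nonneg)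
qed

end

lemma nkern_1_le: "nkern 1 t \<le> 1" by (simp add: kern_1 indicator_def)

section \<open>Mass of the resolvent and the relaxation function\<close>

context frac
begin

abbreviation nres :: "real \<Rightarrow> ennreal" where "nres \<equiv> \<lambda>t. ennreal (res t)"

lemma nconv_kern_res: "nres t + ennreal \<mu> * nconv (nkern al) nres t = nkern al t"
proof -
  have n: "0 \<le> kern al (t - s) * res s" for s using al_pos by (intro mult_nonneg_nonneg kern_nonneg res_nonneg)
  have "nconv (nkern al) nres t = (\<integral>\<^sup>+s. ennreal (kern al (t - s) * res s) \<partial>lborel)"
    unfolding nconv_def using al_pos by (intro nn_integral_cong) (simp add: ennreal_mult kern_nonneg res_nonneg)
  also have "... = ennreal (conv (kern al) res t)"
    unfolding conv_def by (rule nn_integral_eq_integral[OF integrable_kern_res]) (use n in simp)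
  finally have e: "nconv (nkern al) nres t = ennreal (conv (kern al) res t)" .
  have "0 \<le> conv (kern al) res t" unfolding conv_def using n by (intro integral_nonneg_AE) simp
  then have "nres t + ennreal \<mu> * nconv (nkern al) nres t = ennreal (res t + \<mu> * conv (kern al) res t)"
    unfolding e using \<mu> by (simp add: ennreal_mult res_nonneg)
  then show ?thesis by (simp add: res_equation)
qed

lemma nres_le_kern: "nres t \<le> nkern al t" unfolding nconv_kern_res[of t, symmetric] by simp

lemma nconv_kern_res_le: "\<beta> > 0 \<Longrightarrow> nconv (nkern \<beta>) nres t \<le> nkern (\<beta> + al) t"
  using nconv_mono[of "nkern \<beta>" "nkern \<beta>" nres "nkern al" t] nres_le_kern nconv_kern[of \<beta> al t] al_pos by simp

text \<open>J^\<beta> applied to the resolvent equation.\<close>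

lemma nconv_kern_res_shift:
  assumes "\<beta> > 0"
  shows "nconv (nkern \<beta>) nres t + ennreal \<mu> * nconv (nkern (\<beta> + al)) nres t = nkern (\<beta> + al) t"
proof -
  have "nconv (nkern \<beta>) (nconv (nkern al) nres) t = nconv (nconv (nkern \<beta>) (nkern al)) nres t"
    by (subst nconv_assoc) auto
  also have "nconv (nkern \<beta>) (nkern al) = nkern (\<beta> + al)" using nconv_kern[OF assms al_pos(1)] by (rule ext)
  finally have a: "nconv (nkern \<beta>) (nconv (nkern al) nres) t = nconv (nkern (\<beta> + al)) nres t" .
  have "nkern (\<beta> + al) t = nconv (nkern \<beta>) (nkern al) t" using nconv_kern[OF assms al_pos(1)] by simp
  also have "nkern al = (\<lambda>s. nres s + ennreal \<mu> * nconv (nkern al) nres s)" using nconv_kern_res by simp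
  also have "nconv (nkern \<beta>) ... t = nconv (nkern \<beta>) nres t + ennreal \<mu> * nconv (nkern \<beta>) (nconv (nkern al) nres) t"
    by (subst nconv_add_right) (auto simp: nconv_cmult_right)
  finally show ?thesis unfolding a by simp
qed

text \<open>The preceding identity with \<beta> = 1 - al after dropping a nonnegative summand. The
  resolvent therefore has total mass at most 1/\<mu>, the first place where its nonnegativity pays
  off.\<close>

lemma nconv_1_res_le: "ennreal \<mu> * nconv (nkern 1) nres t \<le> nkern 1 t"
  using nconv_kern_res_shift[of "1 - al" t] al_pos by (metis add.commute add_diff_cancel_left' diff_add_cancel le_iff_add)

lemma nconv_1_res_le': "nconv (nkern 1) nres t \<le> ennreal (1 / \<mu>)"
proof -
  have "nconv (nkern 1) nres t = ennreal (1 / \<mu>) * (ennreal \<mu> * nconv (nkern 1) nres t)"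
    using \<mu> by (simp add: mult.assoc[symmetric] ennreal_mult[symmetric])
  also have "... \<le> ennreal (1 / \<mu>) * 1"
    by (intro mult_left_mono order_trans[OF nconv_1_res_le] nkern_1_le) auto
  finally show ?thesis by simp
qed

text \<open>The solution of the homogeneous equation with initial value 1, known as E_al(-\<mu>
  t^al); at t \<le> 0 it is 0 here.\<close>

definition relax :: "real \<Rightarrow> real" where "relax = conv (kern (1 - al)) res"

lemma relax_measurable [measurable]: "relax \<in> borel_measurable borel" unfolding relax_def by measurable

lemma ennreal_relax: "ennreal (relax t) = nconv (nkern (1 - al)) nres t" unfolding relax_def
proof (rule ennreal_conv)
  show "nconv (nkern (1 - al)) nres t < \<infinity>"
    using nconv_kern_res_le[of "1 - al" t] al_pos by (simp add: order.strict_trans1)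
qed (use al_pos kern_nonneg res_nonneg in auto)

lemma relax_nonneg: "0 \<le> relax t" unfolding relax_def conv_def using al_pos
  by (intro integral_nonneg_AE AE_I2 mult_nonneg_nonneg kern_nonneg res_nonneg)

lemma ennreal_conv_1_res: "ennreal (conv (kern 1) res t) = nconv (nkern 1) nres t"
proof (rule ennreal_conv)
  show "nconv (nkern 1) nres t < \<infinity>" using nconv_1_res_le'[of t] by (simp add: order.strict_trans1)
qed (auto intro: kern_nonneg res_nonneg)

lemma conv_1_res_nonneg: "0 \<le> conv (kern 1) res t"
  unfolding conv_def by (intro integral_nonneg_AE AE_I2 mult_nonneg_nonneg kern_nonneg res_nonneg) simp

lemma relax_eq: "relax t + \<mu> * conv (kern 1) res t = kern 1 t"
proof -
  have "ennreal (relax t + \<mu> * conv (kern 1) res t) = nkern 1 t"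
    using nconv_kern_res_shift[of "1 - al" t] al_pos \<mu> conv_1_res_nonneg
    by (simp add: ennreal_mult relax_nonneg ennreal_relax ennreal_conv_1_res)
  then show ?thesis using \<mu> conv_1_res_nonneg[of t] relax_nonneg[of t] kern_nonneg[of 1 t] by (subst (asm) ennreal_inj) auto
qed

lemma relax_le: "relax t \<le> kern 1 t"
proof -
  have "0 \<le> \<mu> * conv (kern 1) res t" using \<mu> conv_1_res_nonneg[of t] by simp
  then show ?thesis using relax_eq[of t] by linarith
qed

text \<open>Interchanging the integrals, \<mu> J^1 relax = J^{1-al} (\<mu> J^1 res), which is at
  most J^{1-al} 1. The gain of a factor 1/\<mu> is what puts the response to initial data from H
  into V.\<close>

lemma relax_integral: "ennreal \<mu> * nconv (nkern 1) (\<lambda>s. ennreal (relax s)) t \<le> nkern (2 - al) t"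
proof -
  have "nconv (nkern 1) (\<lambda>s. ennreal (relax s)) t = nconv (nconv (nkern 1) (nkern (1 - al))) nres t"
    unfolding ennreal_relax by (subst nconv_assoc) auto
  also have "... = nconv (nkern (1 - al)) (nconv (nkern 1) nres) t"
    by (subst nconv_commute[of "nkern 1"]) (auto simp: nconv_assoc)
  finally have "ennreal \<mu> * nconv (nkern 1) (\<lambda>s. ennreal (relax s)) t
      = nconv (nkern (1 - al)) (\<lambda>s. ennreal \<mu> * nconv (nkern 1) nres s) t" by (simp add: nconv_cmult_right)
  also have "... \<le> nconv (nkern (1 - al)) (nkern 1) t" by (intro nconv_mono nconv_1_res_le) simp
  also have "... = nkern (2 - al) t" using al_pos by (simp add: nconv_kern)
  finally show ?thesis .
qed

text \<open>Cauchy-Schwarz with the weight \<open>res\<close>, whose mass is at most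
  1/\<mu>.\<close>

lemma nconv_res_sq:
  assumes [measurable]: "g \<in> borel_measurable borel" and g0: "\<And>s. s \<le> 0 \<Longrightarrow> g s = 0"
  shows "(nconv nres g t)\<^sup>2 \<le> ennreal (1 / \<mu>) * nconv nres (\<lambda>s. (g s)\<^sup>2) t"
proof -
  let ?r = "\<lambda>s. ennreal (sqrt (res (t - s)))"
  have sq: "?r s * ?r s = nres (t - s)" for s using res_nonneg[of "t - s"] by (simp add: ennreal_mult[symmetric])
  have "nconv nres g t = (\<integral>\<^sup>+s. (?r s * nkern 1 s) * (?r s * g s) \<partial>lborel)" unfolding nconv_def
  proof (intro nn_integral_cong)
    fix s
    have "?r s * nkern 1 s * (?r s * g s) = (?r s * ?r s) * (nkern 1 s * g s)" by (simp only: mult_ac)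
    then show "nres (t - s) * g s = ?r s * nkern 1 s * (?r s * g s)"
      unfolding sq using g0[of s] by (cases "s > 0") (auto simp: kern_1)
  qed
  then have "(nconv nres g t)\<^sup>2 \<le> (\<integral>\<^sup>+s. (?r s * nkern 1 s)\<^sup>2 \<partial>lborel) * (\<integral>\<^sup>+s. (?r s * g s)\<^sup>2 \<partial>lborel)"
    by (simp only:) (rule Cauchy_Schwarz_nn_integral, auto)
  also have "(\<integral>\<^sup>+s. (?r s * nkern 1 s)\<^sup>2 \<partial>lborel) = nconv nres (nkern 1) t" unfolding nconv_def
  proof (intro nn_integral_cong)
    fix s
    have "(?r s * nkern 1 s)\<^sup>2 = (?r s * ?r s) * (nkern 1 s * nkern 1 s)" by (simp only: power2_eq_square mult_ac)
    then show "(?r s * nkern 1 s)\<^sup>2 = nres (t - s) * nkern 1 s" unfolding sq by (simp add: kern_1 indicator_def)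
  qed
  also have "... \<le> ennreal (1 / \<mu>)" using nconv_1_res_le'[of t] nconv_commute[of nres "nkern 1"] by simp
  also have "(\<integral>\<^sup>+s. (?r s * g s)\<^sup>2 \<partial>lborel) = nconv nres (\<lambda>s. (g s)\<^sup>2) t" unfolding nconv_def
  proof (intro nn_integral_cong)
    fix s
    have "(?r s * g s)\<^sup>2 = (?r s * ?r s) * (g s)\<^sup>2" by (simp only: power2_eq_square mult_ac)
    then show "(?r s * g s)\<^sup>2 = nres (t - s) * (g s)\<^sup>2" unfolding sq .
  qed
  finally show ?thesis by (simp add: mult_right_mono)
qed

end

lemma square_sum_le: "(a + b)\<^sup>2 \<le> 2 * a\<^sup>2 + 2 * (b :: real)\<^sup>2"
  using zero_le_power2[of "a - b"] by (simp add: power2_eq_square algebra_simps)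

lemma conv_cong_upto:
  assumes "\<And>s. s < t \<Longrightarrow> f (t - s) * g s = f (t - s) * g' s" "\<And>s. s \<le> 0 \<Longrightarrow> f s = 0"
  shows "conv f g t = conv f g' t" unfolding conv_def
proof (rule Bochner_Integration.integral_cong[OF refl])
  fix s show "f (t - s) * g s = f (t - s) * g' s" using assms by (cases "s < t") auto
qed

lemma ennreal_lincomb:
  "\<lbrakk>0 \<le> a; 0 \<le> b; 0 \<le> x; 0 \<le> y\<rbrakk> \<Longrightarrow> ennreal a * ennreal x + ennreal b * ennreal y = ennreal (a * x + b * y)"
  by (simp add: ennreal_mult)

lemma (in frac) relax_le_1: "relax s \<le> 1"
proof -
  have "kern 1 s \<le> 1" by (simp add: kern_1 indicator_def)
  then show ?thesis using relax_le[of s] by linarith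
qed

text \<open>The resolvent equation convolved with g; it serves both to verify the solution formula
  and to prove uniqueness.\<close>

lemma (in frac) mult_conv_kern_res:
  assumes [measurable]: "g \<in> borel_measurable borel" and g: "nconv (nkern al) (nabs g) t < \<infinity>"
  shows "\<mu> * conv (conv (kern al) res) g t = conv (kern al) g t - conv res g t"
proof -
  have "nconv nres (nabs g) t < \<infinity>"
    using g nres_le_kern by (intro order.strict_trans1[OF nconv_mono[of nres "nkern al"]]) auto
  then have i: "integrable lborel (\<lambda>s. kern al (t - s) * g s)" "integrable lborel (\<lambda>s. res (t - s) * g s)"
    using g al_pos by (auto intro!: conv_integrable simp: kern_nonneg res_nonneg)
  have "\<mu> * conv (conv (kern al) res) g t = (LINT s|lborel. kern al (t - s) * g s - res (t - s) * g s)"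
    unfolding conv_def[of "conv _ _"]
  proof (subst integral_mult_right_zero[symmetric], rule Bochner_Integration.integral_cong[OF refl])
    fix s
    have "\<mu> * conv (kern al) res (t - s) = kern al (t - s) - res (t - s)" using res_equation[of "t - s"] by simp
    then show "\<mu> * (conv (kern al) res (t - s) * g s) = kern al (t - s) * g s - res (t - s) * g s"
      by (simp add: mult.assoc[symmetric] left_diff_distrib)
  qed
  then show ?thesis using i by (simp add: conv_def)
qed

lemma nn_abs_finite_of_sq:
  fixes g :: "real \<Rightarrow> real"
  assumes [measurable]: "g \<in> borel_measurable borel" and g0: "\<And>s. s \<notin> {0<..T} \<Longrightarrow> g s = 0"
    and g2: "(\<integral>\<^sup>+s. ennreal ((g s)\<^sup>2) \<partial>lborel) < \<infinity>"
  shows "(\<integral>\<^sup>+s. ennreal \<bar>g s\<bar> \<partial>lborel) < \<infinity>"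
proof -
  have "(\<integral>\<^sup>+s. ennreal \<bar>g s\<bar> \<partial>lborel) \<le> (\<integral>\<^sup>+s. indicator {0..T} s + ennreal ((g s)\<^sup>2) \<partial>lborel)"
  proof (rule nn_integral_mono)
    fix s
    have "\<bar>g s\<bar> \<le> indicator {0..T} s + (g s)\<^sup>2"
    proof (cases "s \<in> {0<..T}")
      case True
      have "0 \<le> (\<bar>g s\<bar> - 1)\<^sup>2 + \<bar>g s\<bar>\<^sup>2 + 1" by simp
      then show ?thesis using True by (simp add: power2_eq_square algebra_simps)
    qed (use g0[of s] in auto)
    then have "ennreal \<bar>g s\<bar> \<le> ennreal (indicator {0..T} s + (g s)\<^sup>2)" by (rule ennreal_leI)
    also have "ennreal (indicator {0..T} s + (g s)\<^sup>2) = indicator {0..T} s + ennreal ((g s)\<^sup>2)"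
      by (subst ennreal_plus) (auto simp: indicator_def)
    finally show "ennreal \<bar>g s\<bar> \<le> indicator {0..T} s + ennreal ((g s)\<^sup>2)" .
  qed
  also have "... = emeasure lborel {0..T} + (\<integral>\<^sup>+s. ennreal ((g s)\<^sup>2) \<partial>lborel)" by (subst nn_integral_add) auto
  also have "... < \<infinity>" using g2 by (simp add: emeasure_lborel_Icc_eq)
  finally show ?thesis .
qed

section \<open>The scalar fractional equation and its estimates\<close>

locale frac_data = frac +
  fixes T u0 :: real and F :: "real \<Rightarrow> real"
  assumes F_measurable [measurable]: "F \<in> borel_measurable borel"
    and F_zero: "s \<notin> {0<..T} \<Longrightarrow> F s = 0"
    and F_sq: "integrable lborel (\<lambda>s. (F s)\<^sup>2)"
begin

abbreviation Q :: real where "Q \<equiv> LINT s|lborel. (F s)\<^sup>2"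

lemma F_nonpos: "s \<le> 0 \<Longrightarrow> F s = 0" using F_zero[of s] by simp

lemma nn_F_sq: "(\<integral>\<^sup>+s. ennreal ((F s)\<^sup>2) \<partial>lborel) = ennreal Q" by (rule nn_integral_eq_integral[OF F_sq]) simp

lemma nconv_kern_F: "nconv (nkern al) (nabs F) t < \<infinity>"
proof (rule nconv_kern_finite[OF al])
  show "(\<integral>\<^sup>+s. (ennreal \<bar>F s\<bar>)\<^sup>2 \<partial>lborel) < \<infinity>" using nn_F_sq by (simp add: ennreal_power)
qed (auto simp: F_nonpos)

lemma nconv_kern_res_F_finite: "nconv (nkern al) (nconv nres (nabs F)) t < \<infinity>"
proof -
  have le: "nconv (nkern al) nres s \<le> ennreal (1 / \<mu>) * nkern al s" for s
  proof -
    have "nconv (nkern al) nres s = ennreal (1 / \<mu>) * (ennreal \<mu> * nconv (nkern al) nres s)"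
      using \<mu> by (simp add: mult.assoc[symmetric] ennreal_mult[symmetric])
    also have "... \<le> ennreal (1 / \<mu>) * nkern al s"
      unfolding nconv_kern_res[of s, symmetric] by (intro mult_left_mono) auto
    finally show ?thesis .
  qed
  have "nconv (nkern al) (nconv nres (nabs F)) t = nconv (nconv (nkern al) nres) (nabs F) t"
    by (subst nconv_assoc) auto
  also have "... \<le> (\<integral>\<^sup>+s. ennreal (1 / \<mu>) * (nkern al (t - s) * ennreal \<bar>F s\<bar>) \<partial>lborel)"
    unfolding nconv_def[of "nconv _ _"] mult.assoc[symmetric] using le by (intro nn_integral_mono mult_right_mono) auto
  also have "... = ennreal (1 / \<mu>) * nconv (nkern al) (nabs F) t"
    unfolding nconv_def by (rule nn_integral_cmult) measurable
  also have "... < \<infinity>" using nconv_kern_F[of t] by (simp add: ennreal_mult_less_top)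
  finally show ?thesis .
qed

text \<open>The variation of constants formula. It has the wrong value 0 at time 0, so
  \<open>sol\<close> below is defined instead as initial value plus J^al of the derivative
  \<open>rhs\<close>: it agrees with \<open>relsol\<close> on (0,T], starts at \<open>u0\<close> and
  is Hoelder continuous.\<close>

definition relsol :: "real \<Rightarrow> real" where "relsol t = u0 * relax t + conv res F t"

definition rhs :: "real \<Rightarrow> real" where "rhs t = (if t \<in> {0<..T} then F t - \<mu> * relsol t else 0)"

definition sol :: "real \<Rightarrow> real" where "sol t = u0 + conv (kern al) rhs t"

lemma relsol_measurable [measurable]: "relsol \<in> borel_measurable borel" unfolding relsol_def by measurable

lemma rhs_measurable [measurable]: "rhs \<in> borel_measurable borel" unfolding rhs_def by measurable

lemma sol_measurable [measurable]: "sol \<in> borel_measurable borel" unfolding sol_def by measurable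

lemma rhs_nonpos: "s \<le> 0 \<Longrightarrow> rhs s = 0" by (simp add: rhs_def)

lemma conv_res_sq: "ennreal ((conv res F t)\<^sup>2) \<le> ennreal (1 / \<mu>) * nconv nres (\<lambda>s. ennreal ((F s)\<^sup>2)) t"
proof -
  have "ennreal \<bar>conv res F t\<bar> \<le> nconv nres (nabs F) t" unfolding conv_def nconv_def
    by (rule order_trans[OF abs_lint_le]) (auto simp: abs_mult res_nonneg ennreal_mult)
  then have "(ennreal \<bar>conv res F t\<bar>)\<^sup>2 \<le> (nconv nres (nabs F) t)\<^sup>2" by (rule power_mono) simp
  also have "... \<le> ennreal (1 / \<mu>) * nconv nres (\<lambda>s. (ennreal \<bar>F s\<bar>)\<^sup>2) t"
    by (rule nconv_res_sq) (auto simp: F_nonpos)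
  finally show ?thesis by (simp add: ennreal_power)
qed

text \<open>Order 1 gives the L2 estimate of the solution, order 1 - al the weighted one.\<close>

lemma nconv_conv_res_sq:
  assumes "\<beta> > 0" and le: "\<And>s. nconv (nkern \<beta>) nres s \<le> ennreal b"
  shows "nconv (nkern \<beta>) (\<lambda>s. ennreal ((conv res F s)\<^sup>2)) t \<le> ennreal (1 / \<mu>) * (ennreal b * ennreal Q)"
proof -
  have "nconv (nkern \<beta>) (\<lambda>s. ennreal ((conv res F s)\<^sup>2)) t
      \<le> nconv (nkern \<beta>) (\<lambda>s. ennreal (1 / \<mu>) * nconv nres (\<lambda>s. ennreal ((F s)\<^sup>2)) s) t"
    by (intro nconv_mono conv_res_sq) simp
  also have "... = ennreal (1 / \<mu>) * nconv (nkern \<beta>) (nconv nres (\<lambda>s. ennreal ((F s)\<^sup>2))) t"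
    by (simp add: nconv_cmult_right)
  also have "nconv (nkern \<beta>) (nconv nres (\<lambda>s. ennreal ((F s)\<^sup>2))) t = nconv (nconv (nkern \<beta>) nres) (\<lambda>s. ennreal ((F s)\<^sup>2)) t"
    by (simp add: nconv_assoc)
  also have "... \<le> (\<integral>\<^sup>+s. ennreal b * ennreal ((F s)\<^sup>2) \<partial>lborel)"
    unfolding nconv_def[of "nconv _ _"] using le by (intro nn_integral_mono mult_right_mono) auto
  also have "... = ennreal b * ennreal Q" by (simp add: nn_integral_cmult nn_F_sq)
  finally show ?thesis by (simp add: mult_left_mono)
qed

lemma nconv_conv_res_sq_1: "nconv (nkern 1) (\<lambda>s. ennreal ((conv res F s)\<^sup>2)) t \<le> ennreal (Q / \<mu>\<^sup>2)"
proof -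
  have "nconv (nkern 1) (\<lambda>s. ennreal ((conv res F s)\<^sup>2)) t \<le> ennreal (1 / \<mu>) * (ennreal (1 / \<mu>) * ennreal Q)"
    by (rule nconv_conv_res_sq) (auto simp: nconv_1_res_le')
  also have "... = ennreal (1 / \<mu> * (1 / \<mu> * Q))" using \<mu> by (subst ennreal_mult, simp, simp, subst ennreal_mult, simp_all)
  finally show ?thesis by (simp add: power2_eq_square)
qed

lemma nconv_conv_res_sq_relax: "nconv (nkern (1 - al)) (\<lambda>s. ennreal ((conv res F s)\<^sup>2)) t \<le> ennreal (Q / \<mu>)"
proof -
  have "nconv (nkern (1 - al)) nres s \<le> ennreal 1" for s
  proof -
    have "relax s \<le> 1" by (rule relax_le_1)
    then show ?thesis unfolding ennreal_relax[symmetric] by (rule ennreal_leI)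
  qed
  then have "nconv (nkern (1 - al)) (\<lambda>s. ennreal ((conv res F s)\<^sup>2)) t \<le> ennreal (1 / \<mu>) * (ennreal 1 * ennreal Q)"
    using al_pos by (intro nconv_conv_res_sq) auto
  also have "... = ennreal (1 / \<mu> * Q)" using \<mu> by (simp only: ennreal_1 mult_1) (simp add: ennreal_mult[symmetric] del: ennreal_mult')
  finally show ?thesis by simp
qed

text \<open>Since \<open>relax\<close> takes values in [0,1], its square is at most
  \<open>relax\<close>, whose integral is known.\<close>

lemma relsol_sq_le: "(relsol s)\<^sup>2 \<le> 2 * u0\<^sup>2 * relax s + 2 * (conv res F s)\<^sup>2"
proof -
  have "relax s \<le> 1" by (rule relax_le_1)
  then have "relax s * relax s \<le> relax s" using relax_nonneg[of s] by (simp add: mult_left_le)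
  then have "u0\<^sup>2 * (relax s)\<^sup>2 \<le> u0\<^sup>2 * relax s" unfolding power2_eq_square by (intro mult_left_mono) auto
  then show ?thesis using square_sum_le[of "u0 * relax s" "conv res F s"] by (simp add: relsol_def power_mult_distrib)
qed

text \<open>With \<mu> = \<nu> * \<open>lam k\<close>, the product of this bound with
  \<open>lam k\<close> is a combination of u0^2 and Q / \<open>lam k\<close> whose factors do not
  depend on k; hence it is summable.\<close>

definition bound_sq :: real where "bound_sq = 2 * u0\<^sup>2 * kern (2 - al) T / \<mu> + 2 * Q / \<mu>\<^sup>2"

lemma bound_sq_nonneg: "0 \<le> bound_sq"
  unfolding bound_sq_def using \<mu> al by (intro add_nonneg_nonneg divide_nonneg_nonneg mult_nonneg_nonneg kern_nonneg integral_nonneg_AE) auto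

lemma relsol_sq_integral: "(\<integral>\<^sup>+s. ennreal ((relsol s)\<^sup>2) * indicator {0<..T} s \<partial>lborel) \<le> ennreal bound_sq"
proof -
  have r: "nconv (nkern 1) (\<lambda>s. ennreal (relax s)) T \<le> ennreal (kern (2 - al) T / \<mu>)"
  proof -
    have "nconv (nkern 1) (\<lambda>s. ennreal (relax s)) T = ennreal (1 / \<mu>) * (ennreal \<mu> * nconv (nkern 1) (\<lambda>s. ennreal (relax s)) T)"
      using \<mu> by (simp add: mult.assoc[symmetric] ennreal_mult[symmetric])
    also have "... \<le> ennreal (1 / \<mu>) * nkern (2 - al) T" by (intro mult_left_mono relax_integral) simp
    also have "... = ennreal (1 / \<mu> * kern (2 - al) T)" using \<mu> al by (subst ennreal_mult) (auto simp: kern_nonneg)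
    finally show ?thesis by simp
  qed
  have T: "AE s in lborel. s \<noteq> T" by (rule AE_lborel_singleton)
  have "(\<integral>\<^sup>+s. ennreal ((relsol s)\<^sup>2) * indicator {0<..T} s \<partial>lborel)
      \<le> nconv (nkern 1) (\<lambda>s. ennreal (2 * u0\<^sup>2) * ennreal (relax s) + ennreal 2 * ennreal ((conv res F s)\<^sup>2)) T"
    unfolding nconv_def
  proof (rule nn_integral_mono_AE, use T in eventually_elim)
    fix s assume "s \<noteq> T"
    have "ennreal ((relsol s)\<^sup>2) \<le> ennreal (2 * u0\<^sup>2 * relax s + 2 * (conv res F s)\<^sup>2)"
      by (rule ennreal_leI[OF relsol_sq_le])
    also have "... = ennreal (2 * u0\<^sup>2) * ennreal (relax s) + ennreal 2 * ennreal ((conv res F s)\<^sup>2)"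
      using relax_nonneg by (simp add: ennreal_mult)
    finally show "ennreal ((relsol s)\<^sup>2) * indicator {0<..T} s
        \<le> nkern 1 (T - s) * (ennreal (2 * u0\<^sup>2) * ennreal (relax s) + ennreal 2 * ennreal ((conv res F s)\<^sup>2))"
      using \<open>s \<noteq> T\<close> by (auto simp: kern_1 indicator_def)
  qed
  also have "... = ennreal (2 * u0\<^sup>2) * nconv (nkern 1) (\<lambda>s. ennreal (relax s)) T
      + ennreal 2 * nconv (nkern 1) (\<lambda>s. ennreal ((conv res F s)\<^sup>2)) T"
    by (subst nconv_add_right) (auto simp del: ennreal_numeral simp: nconv_cmult_right)
  also have "... \<le> ennreal (2 * u0\<^sup>2) * ennreal (kern (2 - al) T / \<mu>) + ennreal 2 * ennreal (Q / \<mu>\<^sup>2)"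
    by (intro add_mono mult_left_mono r nconv_conv_res_sq_1) auto
  also have "... = ennreal (2 * u0\<^sup>2 * (kern (2 - al) T / \<mu>) + 2 * (Q / \<mu>\<^sup>2))"
    using \<mu> al by (intro ennreal_lincomb) (auto simp: kern_nonneg)
  finally show ?thesis by (simp add: bound_sq_def)
qed

lemma relax_dev_sq:
  assumes "s > 0" shows "(relsol s - u0)\<^sup>2 \<le> 2 * u0\<^sup>2 + 2 * (conv res F s)\<^sup>2"
proof -
  have "relax s \<le> 1" by (rule relax_le_1)
  then have "\<bar>relax s - 1\<bar> \<le> 1" using relax_nonneg[of s] by simp
  then have "(relax s - 1)\<^sup>2 \<le> 1" by (simp add: abs_square_le_1)
  then have "u0\<^sup>2 * (relax s - 1)\<^sup>2 \<le> u0\<^sup>2 * 1" by (rule mult_left_mono) simp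
  moreover have "relsol s - u0 = u0 * (relax s - 1) + conv res F s" by (simp add: relsol_def algebra_simps)
  moreover note square_sum_le[of "u0 * (relax s - 1)" "conv res F s"]
  ultimately show ?thesis by (simp add: power_mult_distrib)
qed

lemma rhs_sq_le: "(rhs s)\<^sup>2 \<le> 2 * (F s)\<^sup>2 + 2 * \<mu>\<^sup>2 * ((relsol s)\<^sup>2 * indicator {0<..T} s)"
  using square_sum_le[of "F s" "- \<mu> * relsol s"] by (simp add: rhs_def power_mult_distrib)

definition bound_rhs :: real where "bound_rhs = 2 * Q + 2 * \<mu>\<^sup>2 * bound_sq"

lemma nn_rhs_sq: "(\<integral>\<^sup>+s. ennreal ((rhs s)\<^sup>2) \<partial>lborel) \<le> ennreal bound_rhs"
proof -
  have "(\<integral>\<^sup>+s. ennreal ((rhs s)\<^sup>2) \<partial>lborel)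
      \<le> (\<integral>\<^sup>+s. ennreal 2 * ennreal ((F s)\<^sup>2) + ennreal (2 * \<mu>\<^sup>2) * (ennreal ((relsol s)\<^sup>2) * indicator {0<..T} s) \<partial>lborel)"
  proof (rule nn_integral_mono)
    fix s
    have "ennreal ((rhs s)\<^sup>2) \<le> ennreal (2 * (F s)\<^sup>2 + 2 * \<mu>\<^sup>2 * ((relsol s)\<^sup>2 * indicator {0<..T} s))"
      by (rule ennreal_leI[OF rhs_sq_le])
    also have "... = ennreal 2 * ennreal ((F s)\<^sup>2) + ennreal (2 * \<mu>\<^sup>2) * (ennreal ((relsol s)\<^sup>2) * indicator {0<..T} s)"
      by (cases "s \<in> {0<..T}") (simp_all add: ennreal_mult del: ennreal_numeral)
    finally show "ennreal ((rhs s)\<^sup>2) \<le> ..." .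
  qed
  also have "... = ennreal 2 * ennreal Q + ennreal (2 * \<mu>\<^sup>2) * (\<integral>\<^sup>+s. ennreal ((relsol s)\<^sup>2) * indicator {0<..T} s \<partial>lborel)"
    by (subst nn_integral_add) (auto simp: nn_integral_cmult nn_F_sq simp del: ennreal_numeral)
  also have "... \<le> ennreal 2 * ennreal Q + ennreal (2 * \<mu>\<^sup>2) * ennreal bound_sq"
    by (intro add_mono mult_left_mono relsol_sq_integral) auto
  also have "... = ennreal bound_rhs"
    using bound_sq_nonneg by (simp add: bound_rhs_def ennreal_mult del: ennreal_numeral)
  finally show ?thesis .
qed

lemma bound_rhs_nonneg: "0 \<le> bound_rhs" unfolding bound_rhs_def using bound_sq_nonneg by simp

lemma rhs_sq_integrable: "integrable lborel (\<lambda>s. (rhs s)\<^sup>2)"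
  using nn_rhs_sq by (intro integrableI_bounded) (auto intro: order.strict_trans1)

lemma rhs_sq_integral_le: "(LINT s|lborel. (rhs s)\<^sup>2) \<le> bound_rhs"
  using nn_rhs_sq nn_integral_eq_integral[OF rhs_sq_integrable] bound_rhs_nonneg by simp

text \<open>Three applications of associativity and the resolvent equation: J^al relax = J^1 res,
  \<mu> J^1 res = 1 - relax, and \<mu> J^al (res * F) = J^al F - res * F, where the star denotes
  convolution.\<close>

lemma conv_kern_rhs:
  assumes t: "0 < t" "t \<le> T" shows "conv (kern al) rhs t = relsol t - u0"
proof -
  have "conv (kern al) rhs t = conv (kern al) (\<lambda>s. F s - \<mu> * relsol s) t"
  proof (rule conv_cong_upto)
    fix s assume "s < t"
    \<comment> \<open>The cut-off in \<open>rhs\<close> at time 0 changes nothing, because the uncut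
      expression vanishes there too.\<close>
    have "relsol s = 0" if "s \<le> 0"
    proof -
      have "relax s = 0" using relax_le[of s] relax_nonneg[of s] that by simp
      moreover have "conv res F s = 0" unfolding conv_def
      proof (rule integral_eq_zero_AE, rule AE_I2)
        fix r show "res (s - r) * F r = 0" using that by (cases "r \<le> 0") (auto simp: F_nonpos)
      qed
      ultimately show ?thesis by (simp add: relsol_def)
    qed
    then show "kern al (t - s) * rhs s = kern al (t - s) * (F s - \<mu> * relsol s)"
      using \<open>s < t\<close> t by (auto simp: rhs_def F_nonpos)
  qed simp
  also have "... = (LINT s|lborel. kern al (t - s) * F s - \<mu> * u0 * (kern al (t - s) * relax s) - \<mu> * (kern al (t - s) * conv res F s))"
    unfolding conv_def[of "kern al"] relsol_def by (simp add: algebra_simps)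
  also have "... = conv (kern al) F t - \<mu> * u0 * conv (kern al) relax t - \<mu> * conv (kern al) (conv res F) t"
  proof -
    have i1: "integrable lborel (\<lambda>s. kern al (t - s) * F s)"
      using nconv_kern_F[of t] al_pos by (intro conv_integrable) (auto simp: kern_nonneg)
    have i2: "integrable lborel (\<lambda>s. kern al (t - s) * relax s)"
    proof (rule conv_integrable)
      have "nconv (nkern al) (\<lambda>s. ennreal (relax s)) t \<le> nconv (nkern al) (nkern 1) t"
        using relax_le by (intro nconv_mono ennreal_leI) auto
      then show "nconv (\<lambda>s. ennreal \<bar>kern al s\<bar>) (nabs relax) t < \<infinity>"
        using al_pos by (simp add: kern_nonneg relax_nonneg nconv_kern order.strict_trans1)
    qed auto
    have i3: "integrable lborel (\<lambda>s. kern al (t - s) * conv res F s)"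
    proof (rule conv_integrable)
      have "nconv (nkern al) (\<lambda>s. ennreal \<bar>conv res F s\<bar>) t \<le> nconv (nkern al) (nconv nres (nabs F)) t"
        unfolding conv_def nconv_def[of nres]
        by (intro nconv_mono order_trans[OF abs_lint_le]) (auto simp: abs_mult res_nonneg ennreal_mult)
      also have "... < \<infinity>" by (rule nconv_kern_res_F_finite)
      finally show "nconv (\<lambda>s. ennreal \<bar>kern al s\<bar>) (\<lambda>s. ennreal \<bar>conv res F s\<bar>) t < \<infinity>"
        using al_pos by (simp add: kern_nonneg)
    qed auto
    show ?thesis using i1 i2 i3 by (simp add: conv_def[of "kern al"])
  qed
  also have "conv (kern al) relax t = conv (kern 1) res t"
  proof -
    have "conv (kern al) relax t = conv (conv (kern al) (kern (1 - al))) res t" unfolding relax_def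
    proof (rule conv_assoc)
      have "nconv (nkern al) (nconv (nkern (1 - al)) nres) t = nconv (nkern 1) nres t"
        by (subst nconv_assoc) (auto simp: nconv_kern[OF al_pos, abs_def])
      also have "... < \<infinity>" using nconv_1_res_le'[of t] by (simp add: order.strict_trans1)
      finally show "nconv (\<lambda>s. ennreal \<bar>kern al s\<bar>) (nconv (\<lambda>s. ennreal \<bar>kern (1 - al) s\<bar>) (nabs res)) t < \<infinity>"
        using al_pos by (simp add: kern_nonneg res_nonneg)
    qed auto
    also have "conv (kern al) (kern (1 - al)) = kern 1" using conv_kern[OF al_pos] by auto
    finally show ?thesis .
  qed
  also have "conv (kern al) (conv res F) t = conv (conv (kern al) res) F t"
    using nconv_kern_res_F_finite[of t] al_pos by (intro conv_assoc) (auto simp: kern_nonneg res_nonneg)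
  also have "\<mu> * conv (conv (kern al) res) F t = conv (kern al) F t - conv res F t"
    by (rule mult_conv_kern_res[OF F_measurable nconv_kern_F])
  finally have e: "conv (kern al) rhs t = conv (kern al) F t - \<mu> * u0 * conv (kern 1) res t - (conv (kern al) F t - conv res F t)" .
  have "\<mu> * u0 * conv (kern 1) res t = u0 * (1 - relax t)"
  proof -
    have "\<mu> * conv (kern 1) res t = 1 - relax t" using relax_eq[of t] t by (simp add: kern_1[of t])
    then show ?thesis by (simp add: mult.left_commute[of \<mu>] mult.assoc)
  qed
  then show ?thesis unfolding e by (simp add: relsol_def algebra_simps)
qed

lemma sol_eq_relsol: "0 < t \<Longrightarrow> t \<le> T \<Longrightarrow> sol t = relsol t" by (simp add: sol_def conv_kern_rhs)

lemma rhs_eq: "0 < t \<Longrightarrow> t \<le> T \<Longrightarrow> rhs t = F t - \<mu> * sol t" by (simp add: rhs_def sol_eq_relsol)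

lemma sol_0: "sol 0 = u0"
proof -
  have "conv (kern al) rhs 0 = 0" unfolding conv_def
  proof (rule integral_eq_zero_AE, rule AE_I2)
    fix r show "kern al (0 - r) * rhs r = 0" by (cases "r \<le> 0") (auto simp: rhs_nonpos)
  qed
  then show ?thesis by (simp add: sol_def)
qed

lemma sol_holder:
  assumes "0 \<le> s" "s \<le> t"
  shows "(sol t - sol s)\<^sup>2 \<le> 2 * kern_sq_const al * kern (2 * al) (t - s) * (LINT r|lborel. (rhs r)\<^sup>2)"
  using conv_kern_holder[OF al rhs_measurable _ rhs_sq_integrable assms] rhs_nonpos by (simp add: sol_def)

lemma sol_sq_integral: "(\<integral>\<^sup>+s. ennreal ((sol s)\<^sup>2) * indicator {0..T} s \<partial>lborel) \<le> ennreal bound_sq"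
proof -
  have "(\<integral>\<^sup>+s. ennreal ((sol s)\<^sup>2) * indicator {0..T} s \<partial>lborel) = (\<integral>\<^sup>+s. ennreal ((relsol s)\<^sup>2) * indicator {0<..T} s \<partial>lborel)"
  proof (rule nn_integral_cong_AE)
    have "AE s in lborel. s \<noteq> (0::real)" by (rule AE_lborel_singleton)
    then show "AE s in lborel. ennreal ((sol s)\<^sup>2) * indicator {0..T} s = ennreal ((relsol s)\<^sup>2) * indicator {0<..T} s"
      by eventually_elim (auto simp: indicator_def sol_eq_relsol)
  qed
  then show ?thesis using relsol_sq_integral by simp
qed

text \<open>Summed over the eigenfunctions, this gives both the weighted Bochner norm and the
  boundedness of J^{1-al} of the squared deviation.\<close>

lemma sol_dev_sq:
  assumes "t \<le> T"
  shows "nconv (nkern (1 - al)) (\<lambda>s. ennreal ((sol s - u0)\<^sup>2) * indicator {0..T} s) t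
    \<le> ennreal (2 * u0\<^sup>2 * kern (2 - al) T + 2 * Q / \<mu>)"
proof -
  have "nconv (nkern (1 - al)) (\<lambda>s. ennreal ((sol s - u0)\<^sup>2) * indicator {0..T} s) t
      \<le> nconv (nkern (1 - al)) (\<lambda>s. ennreal (2 * u0\<^sup>2) * nkern 1 s + ennreal 2 * ennreal ((conv res F s)\<^sup>2)) t"
  proof (rule nconv_mono)
    fix s
    show "ennreal ((sol s - u0)\<^sup>2) * indicator {0..T} s \<le> ennreal (2 * u0\<^sup>2) * nkern 1 s + ennreal 2 * ennreal ((conv res F s)\<^sup>2)"
    proof (cases "0 < s \<and> s \<le> T")
      case True
      have "ennreal ((sol s - u0)\<^sup>2) \<le> ennreal (2 * u0\<^sup>2 + 2 * (conv res F s)\<^sup>2)"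
        using relax_dev_sq[of s] True by (intro ennreal_leI) (simp add: sol_eq_relsol)
      also have "... = ennreal (2 * u0\<^sup>2) * nkern 1 s + ennreal 2 * ennreal ((conv res F s)\<^sup>2)"
        using True by (simp add: kern_1 ennreal_mult)
      finally show ?thesis using True by simp
    next
      case False
      then show ?thesis by (cases "s = 0") (auto simp: sol_0 indicator_def)
    qed
  qed simp
  also have "... = ennreal (2 * u0\<^sup>2) * nconv (nkern (1 - al)) (nkern 1) t
      + ennreal 2 * nconv (nkern (1 - al)) (\<lambda>s. ennreal ((conv res F s)\<^sup>2)) t"
    by (subst nconv_add_right) (auto simp del: ennreal_numeral simp: nconv_cmult_right)
  also have "... \<le> ennreal (2 * u0\<^sup>2) * nkern (2 - al) T + ennreal 2 * ennreal (Q / \<mu>)"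
  proof (intro add_mono mult_left_mono nconv_conv_res_sq_relax)
    have "nconv (nkern (1 - al)) (nkern 1) t = nkern (2 - al) t" using al_pos by (simp add: nconv_kern)
    also have "... \<le> nkern (2 - al) T" using assms al by (intro ennreal_leI kern_mono) auto
    finally show "nconv (nkern (1 - al)) (nkern 1) t \<le> nkern (2 - al) T" .
  qed auto
  also have "... = ennreal (2 * u0\<^sup>2 * kern (2 - al) T + 2 * (Q / \<mu>))"
    using \<mu> al by (intro ennreal_lincomb) (auto simp: kern_nonneg)
  finally show ?thesis by simp
qed

lemma nconv_1_rhs_finite: "nconv (nkern 1) (nabs rhs) t < \<infinity>"
proof -
  have "nconv (nkern 1) (nabs rhs) t \<le> (\<integral>\<^sup>+s. 1 * ennreal \<bar>rhs s\<bar> \<partial>lborel)"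
    unfolding nconv_def by (intro nn_integral_mono mult_right_mono nkern_1_le) simp
  moreover have "(\<integral>\<^sup>+s. ennreal \<bar>rhs s\<bar> \<partial>lborel) < \<infinity>"
  proof (rule nn_abs_finite_of_sq[of _ T])
    show "(\<integral>\<^sup>+s. ennreal ((rhs s)\<^sup>2) \<partial>lborel) < \<infinity>" by (rule order.strict_trans1[OF nn_rhs_sq]) simp
  qed (auto simp: rhs_def)
  ultimately show ?thesis by (simp add: order.strict_trans1)
qed

text \<open>J^{1-al} J^al = J^1, so the Riemann-Liouville derivative of the deviation is
  \<open>rhs\<close>.\<close>

lemma conv_sol_dev:
  assumes "t \<le> T"
  shows "conv (kern (1 - al)) (\<lambda>s. (sol s - u0) * indicator {0..T} s) t = conv (kern 1) rhs t"
proof -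
  have "conv (kern (1 - al)) (\<lambda>s. (sol s - u0) * indicator {0..T} s) t = conv (kern (1 - al)) (conv (kern al) rhs) t"
  proof (rule conv_cong_upto)
    fix s assume "s < t"
    have "conv (kern al) rhs s = 0" if "s < 0" unfolding conv_def
    proof (rule integral_eq_zero_AE, rule AE_I2)
      fix r show "kern al (s - r) * rhs r = 0" using that by (cases "r \<le> 0") (auto simp: rhs_nonpos)
    qed
    then show "kern (1 - al) (t - s) * ((sol s - u0) * indicator {0..T} s) = kern (1 - al) (t - s) * conv (kern al) rhs s"
      using \<open>s < t\<close> assms by (auto simp: sol_def indicator_def)
  qed simp
  also have "... = conv (conv (kern (1 - al)) (kern al)) rhs t"
  proof (rule conv_assoc)
    have "nconv (nkern (1 - al)) (nconv (nkern al) (nabs rhs)) t = nconv (nconv (nkern al) (nkern (1 - al))) (nabs rhs) t"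
      by (subst nconv_assoc) (auto simp: nconv_commute[of "nkern al"])
    also have "nconv (nkern al) (nkern (1 - al)) = nkern 1" using nconv_kern[OF al_pos] by auto
    also have "nconv (nkern 1) (nabs rhs) t < \<infinity>" by (rule nconv_1_rhs_finite)
    finally show "nconv (\<lambda>s. ennreal \<bar>kern (1 - al) s\<bar>) (nconv (\<lambda>s. ennreal \<bar>kern al s\<bar>) (nabs rhs)) t < \<infinity>"
      using al_pos by (simp add: kern_nonneg)
  qed auto
  also have "conv (kern (1 - al)) (kern al) = kern 1" using conv_kern[of "1 - al" al] al_pos by auto
  finally show ?thesis .
qed

end

section \<open>Functions on the time interval\<close>

lemma AE_lebesgue_on_iff: "S \<in> sets borel \<Longrightarrow> (AE t in lebesgue_on S. P t) \<longleftrightarrow> (AE t in lborel. t \<in> S \<longrightarrow> P t)"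
  by (subst AE_restrict_space_iff) (auto simp: AE_completion_iff)

lemma nn_integral_lebesgue_on:
  "S \<in> sets borel \<Longrightarrow> (\<integral>\<^sup>+t. f t \<partial>lebesgue_on S) = (\<integral>\<^sup>+t. f t * indicator S t \<partial>lborel)"
  by (subst nn_integral_restrict_space) (auto simp: nn_integral_completion)

lemma borel_measurable_lebesgue_AE:
  assumes [measurable]: "g \<in> borel_measurable borel" and ae: "AE t in lborel. f t = (g t :: real)"
  shows "f \<in> borel_measurable lebesgue" unfolding borel_measurable_iff_less
proof
  fix a
  have "{w. g w < a} \<in> sets lborel" by measurable
  then have "{w. g w < a} \<in> sets lebesgue" using sets_completionI_sets by blast
  moreover have "AE t in lebesgue. t \<in> {w. g w < a} \<longleftrightarrow> t \<in> {w. f w < a}"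
    unfolding AE_completion_iff using ae by eventually_elim auto
  ultimately show "{w \<in> space lebesgue. f w < a} \<in> sets lebesgue"
    using completion.in_sets_AE[of "{w. g w < a}" "{w. f w < a}" lborel] by simp
qed

text \<open>The bridge between the two settings: the solution concept speaks of Lebesgue measurable
  functions on [0,T] up to null sets, the convolution calculus of Borel functions on the line that
  vanish on the nonpositive half-line.\<close>

definition borel_rep :: "real \<Rightarrow> (real \<Rightarrow> real) \<Rightarrow> (real \<Rightarrow> real) \<Rightarrow> bool" where
  "borel_rep T v g \<longleftrightarrow> g \<in> borel_measurable borel \<and> (\<forall>t. t \<notin> {0<..T} \<longrightarrow> g t = 0) \<and>
     (AE t\<in>{0..T} in lborel. v t = g t)"

lemma borel_repD:
  assumes "borel_rep T v g"
  shows "g \<in> borel_measurable borel" "\<And>t. t \<notin> {0<..T} \<Longrightarrow> g t = 0" "AE t\<in>{0..T} in lborel. v t = g t"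
    "AE t in lborel. indicator {0..T} t * v t = g t"
proof -
  show "g \<in> borel_measurable borel" "\<And>t. t \<notin> {0<..T} \<Longrightarrow> g t = 0"
    and *: "AE t\<in>{0..T} in lborel. v t = g t" using assms unfolding borel_rep_def by auto
  show "AE t in lborel. indicator {0..T} t * v t = g t"
    using * assms unfolding borel_rep_def by (auto elim!: eventually_mono simp: indicator_def)
qed

lemma borel_rep_ex:
  assumes "v \<in> borel_measurable (lebesgue_on {0..T})"
  shows "\<exists>g. borel_rep T v g"
proof -
  have "(\<lambda>t. indicator {0..T} t *\<^sub>R v t) \<in> borel_measurable lebesgue"
    using assms by (subst (asm) borel_measurable_restrict_space_iff) simp_all
  then obtain g where [measurable]: "g \<in> borel_measurable lborel" and g: "AE t in lborel. indicator {0..T} t *\<^sub>R v t = g t"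
    using completion_ex_borel_measurable_real by blast
  have "AE t\<in>{0..T} in lborel. v t = indicator {0<..T} t * g t"
    using g AE_lborel_singleton[of "0::real"] by eventually_elim (auto simp: indicator_def)
  moreover have "(\<lambda>t. indicator {0<..T} t * g t) \<in> borel_measurable borel" by measurable
  ultimately have "borel_rep T v (\<lambda>t. indicator {0<..T} t * g t)" unfolding borel_rep_def by simp
  then show ?thesis by blast
qed

lemma borel_rep_lint:
  assumes r: "borel_rep T v g" and p: "p \<in> borel_measurable borel"
  shows "(LINT t|lebesgue_on {0..T}. v t * p t) = (LINT t|lborel. g t * p t)" (is ?eq)
    and "integrable (lebesgue_on {0..T}) (\<lambda>t. v t * p t) \<longleftrightarrow> integrable lborel (\<lambda>t. g t * p t)" (is ?int)
proof -
  note g = borel_repD[OF r]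
  have gp: "(\<lambda>t. g t * p t) \<in> borel_measurable lborel" using g(1) p by simp
  have ae: "AE t in lborel. indicator {0..T} t *\<^sub>R (v t * p t) = g t * p t"
    using g(4) by eventually_elim (simp add: mult.assoc[symmetric])
  have m: "(\<lambda>t. indicator {0..T} t *\<^sub>R (v t * p t)) \<in> borel_measurable lebesgue"
    using gp ae by (intro borel_measurable_lebesgue_AE) auto
  have "(LINT t|lebesgue_on {0..T}. v t * p t) = (LINT t|lebesgue. indicator {0..T} t *\<^sub>R (v t * p t))"
    by (rule integral_restrict_space) simp
  also have "... = (LINT t|lebesgue. g t * p t)"
    using m gp ae by (intro integral_cong_AE) (auto simp: AE_completion_iff intro: measurable_completion)
  also have "... = (LINT t|lborel. g t * p t)" by (rule integral_completion[OF gp])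
  finally show ?eq .
  have "integrable (lebesgue_on {0..T}) (\<lambda>t. v t * p t) \<longleftrightarrow> integrable lebesgue (\<lambda>t. indicator {0..T} t *\<^sub>R (v t * p t))"
    by (rule integrable_restrict_space) simp
  also have "... \<longleftrightarrow> integrable lebesgue (\<lambda>t. g t * p t)"
    using m gp ae by (intro integrable_cong_AE) (auto simp: AE_completion_iff intro: measurable_completion)
  also have "... \<longleftrightarrow> integrable lborel (\<lambda>t. g t * p t)" by (rule integrable_completion[OF gp])
  finally show ?int .
qed

lemma borel_rep_integrable:
  "borel_rep T v g \<Longrightarrow> integrable (lebesgue_on {0..T}) v \<longleftrightarrow> integrable lborel g"
  using borel_rep_lint(2)[of T v g "\<lambda>t. 1"] by simp

text \<open>Valid for each t in [0,T], not just almost every one, because changing the integrand on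
  a null set changes no integral. The point s = t, where the kernel is singular, is such a null
  set.\<close>

lemma borel_rep_RL_integral:
  assumes r: "borel_rep T v g" and t: "0 \<le> t" "t \<le> T"
  shows "RL_integral \<beta> v t = conv (kern \<beta>) g t"
proof -
  note g = borel_repD[OF r]
  have [measurable]: "g \<in> borel_measurable borel" by (rule g(1))
  have ae: "AE s in lborel. indicator {0..t} s *\<^sub>R ((t - s) powr (\<beta> - 1) * v s) = indicator {..<t} s * (t - s) powr (\<beta> - 1) * g s"
    using g(3) AE_lborel_singleton[of t] by eventually_elim (use t g(2) in \<open>auto simp: indicator_def\<close>)
  have gm: "(\<lambda>s. indicator {..<t} s * (t - s) powr (\<beta> - 1) * g s) \<in> borel_measurable lborel" by measurable
  have "(LINT s|lebesgue_on {0..t}. (t - s) powr (\<beta> - 1) * v s)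
      = (LINT s|lebesgue. indicator {0..t} s *\<^sub>R ((t - s) powr (\<beta> - 1) * v s))"
    by (rule integral_restrict_space) simp
  also have "... = (LINT s|lebesgue. indicator {..<t} s * (t - s) powr (\<beta> - 1) * g s)"
    using gm ae by (intro integral_cong_AE borel_measurable_lebesgue_AE[OF _ ae] measurable_completion)
      (simp_all add: AE_completion_iff)
  also have "... = (LINT s|lborel. indicator {..<t} s * (t - s) powr (\<beta> - 1) * g s)"
    by (rule integral_completion[OF gm])
  finally have "RL_integral \<beta> v t = (LINT s|lborel. 1 / Gamma \<beta> * (indicator {..<t} s * (t - s) powr (\<beta> - 1) * g s))"
    unfolding RL_integral_def by simp
  also have "... = conv (kern \<beta>) g t"
    unfolding conv_def by (intro Bochner_Integration.integral_cong refl) (auto simp: kern_def indicator_def)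
  finally show ?thesis .
qed

subsection \<open>Weak derivatives\<close>

lemma test_function_deriv:
  fixes \<phi> :: "real \<Rightarrow> real"
  assumes "\<phi> \<in> test_functions S"
  shows "(\<phi> has_real_derivative deriv \<phi> t) (at t)" "continuous_on UNIV (deriv \<phi>)"
proof -
  have "Ck (Suc 0) \<phi>" by (rule test_functionsD(1)[OF assms])
  then have d: "\<phi> differentiable (at x)" and c: "continuous_on UNIV (\<lambda>x. frechet_derivative \<phi> (at x) 1)" for x by auto
  have D: "(\<phi> has_real_derivative deriv \<phi> x) (at x)" for x
    using d[of x] by (simp add: DERIV_deriv_iff_real_differentiable)
  then show "(\<phi> has_real_derivative deriv \<phi> t) (at t)" .
  have "frechet_derivative \<phi> (at x) 1 = deriv \<phi> x" for x
    using D[of x] unfolding has_field_derivative_def by (simp add: frechet_derivative_eqI)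
  then show "continuous_on UNIV (deriv \<phi>)" using c by simp
qed

lemma test_function_measurable:
  fixes \<phi> :: "real \<Rightarrow> real"
  assumes "\<phi> \<in> test_functions S"
  shows "\<phi> \<in> borel_measurable borel" "deriv \<phi> \<in> borel_measurable borel"
  using test_functionsD(1)[OF assms, of 0] test_function_deriv(2)[OF assms]
  by (auto intro: borel_measurable_continuous_onI)

lemma test_function_bounded:
  fixes \<phi> :: "real \<Rightarrow> real"
  assumes \<phi>: "\<phi> \<in> test_functions {0<..<T}" shows "\<exists>B. \<forall>t. \<bar>\<phi> t\<bar> \<le> B"
proof -
  have "compact (\<phi> ` {0..T})"
    using test_functionsD(1)[OF \<phi>, of 0] by (intro compact_continuous_image) (auto intro: continuous_on_subset)
  then obtain B where B: "\<And>t. t \<in> {0..T} \<Longrightarrow> \<bar>\<phi> t\<bar> \<le> B"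
    using compact_imp_bounded bounded_iff by (metis image_eqI real_norm_def)
  have "\<bar>\<phi> t\<bar> \<le> \<bar>B\<bar>" for t using B[of t] test_functionsD(4)[OF \<phi>, of t] by (cases "\<phi> t = 0") auto
  then show ?thesis by blast
qed

lemma test_function_times_integrable:
  fixes \<phi> :: "real \<Rightarrow> real"
  assumes "integrable lborel g" and \<phi>: "\<phi> \<in> test_functions {0<..<T}"
  shows "integrable lborel (\<lambda>t. g t * \<phi> t)"
  using test_function_bounded[OF \<phi>] test_function_measurable(1)[OF \<phi>]
  by (auto intro: integrable_mult_bounded[OF assms(1)])

lemma test_function_deriv_bounded:
  fixes \<phi> :: "real \<Rightarrow> real"
  assumes "\<phi> \<in> test_functions {0<..<T}" shows "\<exists>B. \<forall>t\<in>{0..T}. \<bar>deriv \<phi> t\<bar> \<le> B"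
proof -
  have "compact (deriv \<phi> ` {0..T})"
    by (intro compact_continuous_image continuous_on_subset[OF test_function_deriv(2)[OF assms]]) auto
  then show ?thesis using compact_imp_bounded bounded_iff by (metis image_eqI real_norm_def)
qed

lemma lint_zero_imp_AE_zero:
  fixes g :: "real \<Rightarrow> real"
  assumes gi: "integrable lborel g" and g0: "\<And>t. t \<notin> {0<..T} \<Longrightarrow> g t = 0"
    and zero: "\<And>\<phi>. \<phi> \<in> test_functions {0<..<T} \<Longrightarrow> (LINT t|lborel. g t * \<phi> t) = 0"
  shows "AE t in lborel. g t = 0"
proof -
  have [measurable]: "g \<in> borel_measurable borel" using gi by auto
  have "AE t in lebesgue_on {0<..<T}. g t = 0"
  proof (rule fundamental_lemma)
    show "integrable (lebesgue_on {0<..<T}) g" using integrable_mult_indicator[OF _ gi, of "{0<..<T}"]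
      by (subst integrable_restrict_space) (simp_all add: integrable_completion)
    fix \<phi> :: "real \<Rightarrow> real" assume \<phi>: "\<phi> \<in> test_functions {0<..<T}"
    have [measurable]: "\<phi> \<in> borel_measurable borel" by (rule test_function_measurable[OF \<phi>])
    have "(LINT t|lebesgue_on {0<..<T}. g t * \<phi> t) = (LINT t|lebesgue. indicator {0<..<T} t *\<^sub>R (g t * \<phi> t))"
      by (rule integral_restrict_space) simp
    also have "... = (LINT t|lebesgue. g t * \<phi> t)"
      using test_functionsD(4)[OF \<phi>] by (intro Bochner_Integration.integral_cong) (auto simp: indicator_def)
    also have "... = (LINT t|lborel. g t * \<phi> t)" by (rule integral_completion) measurable
    finally show "(LINT t|lebesgue_on {0<..<T}. g t * \<phi> t) = 0" using zero[OF \<phi>] by simp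
  qed simp
  then have "AE t\<in>{0<..<T} in lborel. g t = 0" by (subst (asm) AE_lebesgue_on_iff) auto
  then show ?thesis using AE_lborel_singleton[of T]
  proof eventually_elim
    fix t assume "t \<in> {0<..<T} \<longrightarrow> g t = 0" "t \<noteq> T"
    then show "g t = 0" using g0[of t] by (cases "t \<in> {0<..T}") auto
  qed
qed

text \<open>Fubini: for fixed s the inner integral of \<phi>' over (s,T) is -\<phi>(s).\<close>

lemma primitive_weak_deriv:
  fixes h :: "real \<Rightarrow> real"
  assumes hi: "integrable lborel h" and h0: "\<And>t. t \<notin> {0<..T} \<Longrightarrow> h t = 0" and \<phi>: "\<phi> \<in> test_functions {0<..<T}"
  shows "(LINT t|lborel. (indicator {0<..T} t * conv (kern 1) h t) * deriv \<phi> t) = - (LINT t|lborel. h t * \<phi> t)"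
proof -
  have [measurable]: "h \<in> borel_measurable borel" using hi by auto
  have [measurable]: "\<phi> \<in> borel_measurable borel" "deriv \<phi> \<in> borel_measurable borel"
    using test_function_measurable[OF \<phi>] by auto
  let ?F = "\<lambda>t s. (indicator {0<..T} t * deriv \<phi> t * kern 1 (t - s)) * h s"
  obtain B where B: "\<And>t. t \<in> {0..T} \<Longrightarrow> \<bar>deriv \<phi> t\<bar> \<le> B" using test_function_deriv_bounded[OF \<phi>] by blast
  have "(\<integral>\<^sup>+t. \<integral>\<^sup>+s. ennreal (norm (?F t s)) \<partial>lborel \<partial>lborel)
      \<le> (\<integral>\<^sup>+t. \<integral>\<^sup>+s. (ennreal \<bar>B\<bar> * indicator {0..T} t) * ennreal \<bar>h s\<bar> \<partial>lborel \<partial>lborel)"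
  proof (intro nn_integral_mono)
    fix t s
    have "norm (?F t s) \<le> (\<bar>B\<bar> * indicator {0..T} t) * \<bar>h s\<bar>"
      using B[of t] by (auto simp: abs_mult kern_1 indicator_def intro!: mult_right_mono)
    then have "ennreal (norm (?F t s)) \<le> ennreal ((\<bar>B\<bar> * indicator {0..T} t) * \<bar>h s\<bar>)" by (rule ennreal_leI)
    also have "... = (ennreal \<bar>B\<bar> * indicator {0..T} t) * ennreal \<bar>h s\<bar>"
      by (auto simp: indicator_def ennreal_mult)
    finally show "ennreal (norm (?F t s)) \<le> (ennreal \<bar>B\<bar> * indicator {0..T} t) * ennreal \<bar>h s\<bar>" .
  qed
  also have "... = (ennreal \<bar>B\<bar> * emeasure lborel {0..T}) * (\<integral>\<^sup>+s. ennreal \<bar>h s\<bar> \<partial>lborel)"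
    by (simp add: nn_integral_cmult nn_integral_multc)
  also have "... < \<infinity>" using hi unfolding integrable_iff_bounded
    by (simp add: ennreal_mult_less_top emeasure_lborel_Icc_eq)
  finally have int: "integrable (lborel \<Otimes>\<^sub>M lborel) (\<lambda>(t, s). ?F t s)" unfolding integrable_iff_bounded
    by (subst lborel.nn_integral_fst[symmetric]) (auto simp: case_prod_beta')
  have "(LINT t|lborel. (indicator {0<..T} t * conv (kern 1) h t) * deriv \<phi> t) = (LINT t|lborel. LINT s|lborel. ?F t s)"
    unfolding conv_def by (intro Bochner_Integration.integral_cong refl) (simp add: mult_ac flip: integral_mult_right_zero)
  also have "... = (LINT s|lborel. LINT t|lborel. ?F t s)"
    by (rule lborel_pair.Fubini_integral[symmetric, OF int])
  also have "... = (LINT s|lborel. - (h s * \<phi> s))"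
  proof (rule Bochner_Integration.integral_cong[OF refl])
    fix s
    show "(LINT t|lborel. ?F t s) = - (h s * \<phi> s)"
    proof (cases "s \<in> {0<..T}")
      case True
      have "(LINT t|lborel. ?F t s) = (LINT t|lborel. indicator {0<..T} t * deriv \<phi> t * kern 1 (t - s)) * h s"
        by simp
      also have "(LINT t|lborel. indicator {0<..T} t * deriv \<phi> t * kern 1 (t - s)) = (LINT t|lborel. deriv \<phi> t * indicator {s..T} t)"
      proof (rule integral_cong_AE)
        show "AE t in lborel. indicator {0<..T} t * deriv \<phi> t * kern 1 (t - s) = deriv \<phi> t * indicator {s..T} t"
          using AE_lborel_singleton[of s] by eventually_elim (use True in \<open>auto simp: kern_1 indicator_def\<close>)
      qed auto
      also have "... = \<phi> T - \<phi> s"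
        using True test_function_deriv[OF \<phi>] by (intro integral_FTC_Icc_real) (auto simp: continuous_on_eq_continuous_at)
      also have "\<phi> T = 0" using test_functionsD(4)[OF \<phi>, of T] by auto
      finally show ?thesis by (simp add: mult.commute)
    qed (simp add: h0)
  qed
  finally show ?thesis by simp
qed

lemma compact_subset_Ioo:
  fixes K :: "real set"
  assumes "compact K" "K \<subseteq> {0<..<T}" "T > 0"
  shows "\<exists>a b. 0 < a \<and> a \<le> b \<and> b < T \<and> K \<subseteq> {a..b}"
proof (cases "K = {}")
  case True then show ?thesis using assms(3) by (intro exI[of _ "T / 2"]) auto
next
  case False
  obtain a where "a \<in> K" "\<And>x. x \<in> K \<Longrightarrow> a \<le> x" using compact_attains_inf[OF assms(1) False] by blast
  moreover obtain b where "b \<in> K" "\<And>x. x \<in> K \<Longrightarrow> x \<le> b" using compact_attains_sup[OF assms(1) False] by blast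
  ultimately show ?thesis using assms(2) by (intro exI[of _ a] exI[of _ b]) auto
qed

text \<open>Mean zero makes the primitive vanish to the right of the support as well as to the
  left.\<close>

lemma test_function_primitive:
  assumes C: "\<And>k. Ck k (\<psi> :: real \<Rightarrow> real)" and ab: "0 < a" "a \<le> b" "b < T" and supp: "\<And>t. t \<notin> {a..b} \<Longrightarrow> \<psi> t = 0"
    and zero: "(LINT t|lborel. \<psi> t) = 0"
  shows "\<exists>\<Psi>\<in>test_functions {0<..<T}. deriv \<Psi> = \<psi>"
proof -
  have c: "isCont \<psi> x" for x using C[of 0] by (auto simp: continuous_on_eq_continuous_at)
  obtain F where F: "\<And>x. (F has_vector_derivative \<psi> x) (at x)"
    using einterval_antiderivative[of "-\<infinity>" "\<infinity>" \<psi>] c by auto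
  define \<Psi> where "\<Psi> t = F t - F 0" for t
  have D: "(\<Psi> has_real_derivative \<psi> x) (at x)" for x
    unfolding \<Psi>_def using F[of x] by (auto simp: has_real_derivative_iff_has_vector_derivative[symmetric] intro!: derivative_eq_intros)
  have FTC: "(LINT t|lborel. \<psi> t * indicator {x..y} t) = \<Psi> y - \<Psi> x" if "x \<le> y" for x y
    using that D c by (intro integral_FTC_Icc_real) auto
  have "\<Psi> 0 = 0" by (simp add: \<Psi>_def)
  have supp': "\<Psi> t = 0" if "t \<notin> {a..b}" for t
  proof -
    consider "t \<le> 0" | "0 < t" "t < a" | "b < t" using \<open>t \<notin> {a..b}\<close> by fastforce
    then show ?thesis
    proof cases
      case 1
      then have "(\<lambda>r. \<psi> r * indicator {t..0} r) = (\<lambda>r. 0)" using supp ab by (auto simp: indicator_def fun_eq_iff)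
      then show ?thesis using FTC[OF 1] \<open>\<Psi> 0 = 0\<close> by simp
    next
      case 2
      then have "(\<lambda>r. \<psi> r * indicator {0..t} r) = (\<lambda>r. 0)" using supp ab by (auto simp: indicator_def fun_eq_iff)
      then show ?thesis using FTC[of 0 t] 2 \<open>\<Psi> 0 = 0\<close> by simp
    next
      case 3
      have "(\<lambda>r. \<psi> r * indicator {0..t} r) = \<psi>"
      proof
        fix r show "\<psi> r * indicator {0..t} r = \<psi> r" using supp[of r] ab 3 by (cases "r \<in> {a..b}") (auto simp: indicator_def)
      qed
      then show ?thesis using FTC[of 0 t] 3 ab \<open>\<Psi> 0 = 0\<close> zero by simp
    qed
  qed
  have "Ck k \<Psi>" for k
  proof (rule Ck_Suc_imp_Ck, rule Ck_SucI)
    show "(\<Psi> has_derivative (*) (\<psi> x)) (at x)" for x using D[of x] by (simp add: has_field_derivative_def)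
    show "Ck k (\<lambda>x. \<psi> x * r)" if "r \<in> Basis" for r using that C[of k] by simp
  qed
  then have "\<Psi> \<in> test_functions {0<..<T}"
    by (rule test_functions_subset_support[of _ "{a..b}"]) (use supp' ab in \<open>auto simp del: atLeastAtMost_iff\<close>, auto)
  moreover have "deriv \<Psi> = \<psi>" using D by (intro ext DERIV_imp_deriv)
  ultimately show ?thesis by blast
qed

text \<open>The du Bois-Reymond lemma. Subtracting from \<phi> a multiple of a fixed bump
  \<open>p\<close> leaves a function of mean zero, which is the derivative of a test function; so
  integrals against \<phi> see g only through the constant \<open>c\<close>, the mean of g weighted
  by \<open>p\<close>.\<close>

lemma weak_deriv_zero_imp_const:
  fixes g :: "real \<Rightarrow> real"
  assumes T: "T > 0" and gi: "integrable lborel g" and g0: "\<And>t. t \<notin> {0<..T} \<Longrightarrow> g t = 0"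
    and zero: "\<And>\<phi>. \<phi> \<in> test_functions {0<..<T} \<Longrightarrow> (LINT t|lborel. g t * deriv \<phi> t) = 0"
  shows "\<exists>c. AE t\<in>{0..T} in lborel. g t = c"
proof -
  have ti: "integrable lborel \<phi>" if "\<phi> \<in> test_functions {0<..<T}" for \<phi> :: "real \<Rightarrow> real"
  proof -
    have "integrable lborel (\<lambda>x. indicator {0..T} x *\<^sub>R \<phi> x)"
      using test_functionsD(1)[OF that, of 0] by (intro borel_integrable_compact) (auto intro: continuous_on_subset)
    moreover have "(\<lambda>x. indicator {0..T} x *\<^sub>R \<phi> x) = \<phi>"
    proof
      fix x show "indicator {0..T} x *\<^sub>R \<phi> x = \<phi> x"
        using test_functionsD(4)[OF that, of x] by (cases "\<phi> x = 0") auto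
    qed
    ultimately show ?thesis by simp
  qed
  note gti = test_function_times_integrable[OF gi]
  obtain \<beta> where \<beta>: "bump_seq {0<..<T} (T / 3) (2 * T / 3) \<beta>"
    using bump_seq_ex[of "T / 3" "2 * T / 3" "{0<..<T}"] T by (auto simp: subset_eq)
  define p where "p = \<beta> 0"
  have p: "p \<in> test_functions {0<..<T}" "\<And>x. 0 \<le> p x" "\<And>x. x \<in> {T / 3<..<2 * T / 3} \<Longrightarrow> 0 < p x"
    using \<beta> unfolding bump_seq_def p_def by (auto simp: box_real)
  have [measurable]: "p \<in> borel_measurable borel" by (rule test_function_measurable[OF p(1)])
  have "(LINT t|lborel. p t) \<noteq> 0"
  proof
    assume "(LINT t|lborel. p t) = 0"
    then have "AE t in lborel. p t = 0" using integral_nonneg_eq_0_iff_AE[OF ti[OF p(1)]] p(2) by simp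
    then have "AE t in lborel. t \<notin> {T / 3<..<2 * T / 3}"
    proof eventually_elim
      fix t assume "p t = 0" then show "t \<notin> {T / 3<..<2 * T / 3}" using p(3)[of t] by auto
    qed
    then have "emeasure lborel {T / 3<..<2 * T / 3} = 0" by (subst (asm) AE_iff_measurable[of "{T / 3<..<2 * T / 3}"]) auto
    then show False using T by simp
  qed
  then obtain m where m: "m \<noteq> 0" "(LINT t|lborel. p t) = m" by blast
  define c where "c = (LINT t|lborel. g t * p t) / m"
  have "AE t in lborel. g t - c * indicator {0<..T} t = 0"
  proof (rule lint_zero_imp_AE_zero[of _ T])
    show ii: "integrable lborel (\<lambda>t. g t - c * indicator {0<..T} t)"
      using gi by (intro Bochner_Integration.integrable_diff integrable_mult_right integrable_real_indicator) (use T in auto)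
    fix \<phi> :: "real \<Rightarrow> real" assume \<phi>: "\<phi> \<in> test_functions {0<..<T}"
    define q where "q = (LINT t|lborel. \<phi> t) / m"
    define \<psi> where "\<psi> t = \<phi> t + - q * p t" for t
    let ?K = "closure {x. \<phi> x \<noteq> 0} \<union> closure {x. p x \<noteq> 0}"
    obtain a b where ab: "0 < a" "a \<le> b" "b < T" "?K \<subseteq> {a..b}"
      using compact_subset_Ioo[OF compact_Un[OF test_functionsD(2)[OF \<phi>] test_functionsD(2)[OF p(1)]]
          Un_least[OF test_functionsD(3)[OF \<phi>] test_functionsD(3)[OF p(1)]] T] by blast
    have "\<exists>\<Psi>\<in>test_functions {0<..<T}. deriv \<Psi> = \<psi>"
    proof (rule test_function_primitive[OF _ ab(1-3)])
      show "Ck k \<psi>" for k unfolding \<psi>_def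
        by (intro Ck_add Ck_mult Ck_const test_functionsD(1)[OF \<phi>] test_functionsD(1)[OF p(1)])
      show "\<psi> t = 0" if "t \<notin> {a..b}" for t
      proof -
        have "t \<notin> closure {x. \<phi> x \<noteq> 0}" "t \<notin> closure {x. p x \<noteq> 0}" using that ab(4) by auto
        then have "\<phi> t = 0" "p t = 0"
          using subsetD[OF closure_subset, of t "{x. \<phi> x \<noteq> 0}"] subsetD[OF closure_subset, of t "{x. p x \<noteq> 0}"] by auto
        then show ?thesis by (simp add: \<psi>_def)
      qed
      show "(LINT t|lborel. \<psi> t) = 0" unfolding \<psi>_def using ti[OF \<phi>] ti[OF p(1)] m by (simp add: q_def)
    qed
    then have "(LINT t|lborel. g t * \<psi> t) = 0" using zero by auto
    then have "(LINT t|lborel. g t * \<phi> t - q * (g t * p t)) = 0" unfolding \<psi>_def by (simp add: algebra_simps)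
    then have "(LINT t|lborel. g t * \<phi> t) = q * (LINT t|lborel. g t * p t)"
      using gti[OF \<phi>] gti[OF p(1)] by simp
    then have e: "(LINT t|lborel. g t * \<phi> t) = c * (LINT t|lborel. \<phi> t)" using m by (simp add: c_def q_def)
    have "(LINT t|lborel. (g t - c * indicator {0<..T} t) * \<phi> t) = (LINT t|lborel. g t * \<phi> t - c * \<phi> t)"
      by (intro Bochner_Integration.integral_cong refl)
        (use test_functionsD(4)[OF \<phi>] in \<open>force simp: indicator_def algebra_simps\<close>)
    then show "(LINT t|lborel. (g t - c * indicator {0<..T} t) * \<phi> t) = 0" using e gti[OF \<phi>] ti[OF \<phi>] by simp
  qed (simp add: g0)
  then have "AE t\<in>{0..T} in lborel. g t = c"
    using AE_lborel_singleton[of "0::real"] by eventually_elim (auto simp: indicator_def)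
  then show ?thesis by blast
qed

section \<open>Fractional integrals of integrable functions and uniqueness for the scalar
  equation\<close>

lemma abs_conv_le:
  assumes [measurable]: "f \<in> borel_measurable borel" "g \<in> borel_measurable borel"
  shows "ennreal \<bar>conv f g t\<bar> \<le> nconv (nabs f) (nabs g) t" unfolding conv_def nconv_def
  by (rule order_trans[OF abs_lint_le]) (auto simp: abs_mult ennreal_mult)

lemma conv_add_scale:
  assumes "f \<in> borel_measurable borel" "g \<in> borel_measurable borel" "h \<in> borel_measurable borel"
    and "nconv (nabs f) (nabs g) t < \<infinity>" "nconv (nabs f) (nabs h) t < \<infinity>"
  shows "conv f (\<lambda>s. g s + c * h s) t = conv f g t + c * conv f h t"
proof -
  have "(\<lambda>s. f (t - s) * (g s + c * h s)) = (\<lambda>s. f (t - s) * g s + c * (f (t - s) * h s))"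
    by (simp add: algebra_simps)
  then show ?thesis
    using conv_integrable[OF assms(1,2,4)] conv_integrable[OF assms(1,3,5)] by (simp add: conv_def)
qed

lemma conv_AE_zero_upto:
  assumes "\<And>s. s \<le> 0 \<Longrightarrow> f s = 0" "AE s in lborel. s < t \<longrightarrow> g s = 0"
  shows "conv f g t = 0" unfolding conv_def
proof (rule integral_eq_zero_AE)
  show "AE s in lborel. f (t - s) * g s = 0" using assms(2)
  proof eventually_elim
    fix s assume "s < t \<longrightarrow> g s = 0" then show "f (t - s) * g s = 0" using assms(1)[of "t - s"] by (cases "s < t") auto
  qed
qed

lemma AE_interval_ex:
  assumes "AE t\<in>{a<..<b} in lborel. P t" "a < (b :: real)"
  shows "\<exists>t. a < t \<and> t < b \<and> P t"
proof (rule ccontr)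
  assume n: "\<not> ?thesis"
  have "AE t in lborel. t \<notin> {a<..<b}" using assms(1) by eventually_elim (use n in auto)
  then have "emeasure lborel {a<..<b} = 0" by (subst (asm) AE_iff_measurable[of "{a<..<b}"]) auto
  then show False using assms(2) by simp
qed

lemma nconv_kern_finite_L1:
  fixes z :: "real \<Rightarrow> real"
  assumes \<beta>: "\<beta> \<ge> 1" and [measurable]: "z \<in> borel_measurable borel" and z0: "\<And>t. t \<le> 0 \<Longrightarrow> z t = 0"
    and zi: "integrable lborel z"
  shows "nconv (nkern \<beta>) (nabs z) t < \<infinity>"
proof -
  have "nconv (nkern \<beta>) (nabs z) t \<le> (\<integral>\<^sup>+s. ennreal (kern \<beta> t) * ennreal \<bar>z s\<bar> \<partial>lborel)" unfolding nconv_def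
  proof (rule nn_integral_mono)
    fix s show "nkern \<beta> (t - s) * ennreal \<bar>z s\<bar> \<le> ennreal (kern \<beta> t) * ennreal \<bar>z s\<bar>"
      using z0[of s] by (cases "s > 0") (auto intro!: mult_right_mono ennreal_leI kern_mono \<beta>)
  qed
  also have "... = ennreal (kern \<beta> t) * (\<integral>\<^sup>+s. ennreal \<bar>z s\<bar> \<partial>lborel)" by (rule nn_integral_cmult) measurable
  also have "... < \<infinity>" using zi unfolding integrable_iff_bounded by (simp add: ennreal_mult_less_top)
  finally show ?thesis .
qed

lemma nconv_kern_comb:
  assumes "a > 0" "b > 0" and [measurable]: "z \<in> borel_measurable borel"
  shows "nconv (nkern a) (nconv (nkern b) (nabs z)) t = nconv (nkern (a + b)) (nabs z) t"
proof -
  have "nconv (nkern a) (nconv (nkern b) (nabs z)) t = nconv (nconv (nkern a) (nkern b)) (nabs z) t"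
    by (subst nconv_assoc) auto
  also have "nconv (nkern a) (nkern b) = nkern (a + b)" using nconv_kern[OF assms(1,2)] by auto
  finally show ?thesis .
qed

text \<open>The integral over (0,T] is J^1 at time T, and J^1 J^\<beta> has a kernel of order at
  least 1, which is bounded on bounded intervals.\<close>

lemma indicator_nconv_finite:
  fixes z :: "real \<Rightarrow> real"
  assumes \<beta>: "\<beta> > 0" and [measurable]: "z \<in> borel_measurable borel" and z0: "\<And>t. t \<le> 0 \<Longrightarrow> z t = 0"
    and zi: "integrable lborel z"
  shows "(\<integral>\<^sup>+t. indicator {0<..T} t * nconv (nkern \<beta>) (nabs z) t \<partial>lborel) < \<infinity>"
proof -
  have "(\<integral>\<^sup>+t. indicator {0<..T} t * nconv (nkern \<beta>) (nabs z) t \<partial>lborel)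
      \<le> nconv (nkern 1) (nconv (nkern \<beta>) (nabs z)) T" unfolding nconv_def[of "nkern 1"]
    by (rule nn_integral_mono_AE, use AE_lborel_singleton[of T] in eventually_elim) (auto simp: kern_1 indicator_def)
  also have "... < \<infinity>" using nconv_kern_comb[of 1 \<beta> z T] nconv_kern_finite_L1[of "1 + \<beta>" z T] \<beta> z0 zi by simp
  finally show ?thesis .
qed

lemma indicator_conv_integrable:
  fixes z :: "real \<Rightarrow> real"
  assumes \<beta>: "\<beta> > 0" and [measurable]: "z \<in> borel_measurable borel" and z0: "\<And>t. t \<le> 0 \<Longrightarrow> z t = 0"
    and zi: "integrable lborel z"
  shows "integrable lborel (\<lambda>t. indicator {0<..T} t * conv (kern \<beta>) z t)" unfolding integrable_iff_bounded
proof
  have "(\<integral>\<^sup>+t. ennreal (norm (indicator {0<..T} t * conv (kern \<beta>) z t)) \<partial>lborel)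
      \<le> (\<integral>\<^sup>+t. indicator {0<..T} t * nconv (nkern \<beta>) (nabs z) t \<partial>lborel)"
    using abs_conv_le[of "kern \<beta>" z] \<beta> by (intro nn_integral_mono) (auto simp: indicator_def kern_nonneg)
  also have "... < \<infinity>" by (rule indicator_nconv_finite[OF assms])
  finally show "(\<integral>\<^sup>+t. ennreal (norm (indicator {0<..T} t * conv (kern \<beta>) z t)) \<partial>lborel) < \<infinity>" .
qed measurable

lemma indicator_conv_deriv_integrable:
  fixes z :: "real \<Rightarrow> real"
  assumes "\<beta> > 0" "z \<in> borel_measurable borel" "\<And>t. t \<le> 0 \<Longrightarrow> z t = 0" "integrable lborel z"
    and \<phi>: "\<phi> \<in> test_functions {0<..<T}"
  shows "integrable lborel (\<lambda>t. (indicator {0<..T} t * conv (kern \<beta>) z t) * deriv \<phi> t)"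
proof -
  note [measurable] = test_function_measurable[OF \<phi>]
  obtain B where B: "\<And>t. t \<in> {0..T} \<Longrightarrow> \<bar>deriv \<phi> t\<bar> \<le> B" using test_function_deriv_bounded[OF \<phi>] by blast
  have "integrable lborel (\<lambda>t. (indicator {0<..T} t * conv (kern \<beta>) z t) * (indicator {0<..T} t * deriv \<phi> t))"
  proof (rule integrable_mult_bounded[OF indicator_conv_integrable[OF assms(1-4)]])
    show "\<bar>indicator {0<..T} t * deriv \<phi> t\<bar> \<le> \<bar>B\<bar>" for t using B[of t] by (auto simp: indicator_def)
  qed auto
  then show ?thesis by (rule back_subst[where P = "integrable lborel"]) (auto simp: indicator_def)
qed

lemma kern_tendsto_0:
  assumes "\<beta> > 1" "(f \<longlongrightarrow> 0) F" "eventually (\<lambda>x. 0 \<le> f x) F"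
  shows "((\<lambda>x. kern \<beta> (f x)) \<longlongrightarrow> 0) F"
proof -
  have G: "Gamma \<beta> > 0" by (rule Gamma_real_pos) (use assms in simp)
  have "((\<lambda>x. f x powr (\<beta> - 1) / Gamma \<beta>) \<longlongrightarrow> 0 / Gamma \<beta>) F"
    using assms less_imp_neq[OF G] by (intro tendsto_divide tendsto_zero_powrI[of f F "\<lambda>_. \<beta> - 1" "\<beta> - 1"] tendsto_const) auto
  moreover have "eventually (\<lambda>x. f x powr (\<beta> - 1) / Gamma \<beta> = kern \<beta> (f x)) F"
    using assms(3) by eventually_elim (auto simp: kern_def)
  ultimately show ?thesis by (simp add: tendsto_cong)
qed

context frac
begin

text \<open>The tested equation says that J^{1-al} z + \<mu> J^1 z has weak derivative zero, hence
  is a constant c, and c = 0 by the initial condition. Applying J^al gives p + \<mu> J^al p = 0 for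
  p = J^1 z. Convolving this with \<open>res\<close> and using the resolvent equation leaves J^al p
  = 0, so p = 0, and z is zero because its primitive is.\<close>

lemma fractional_uniqueness:
  fixes z \<zeta> :: "real \<Rightarrow> real"
  assumes T: "T > 0" and [measurable]: "z \<in> borel_measurable borel"
    and z0: "\<And>t. t \<notin> {0<..T} \<Longrightarrow> z t = 0" and zi: "integrable lborel z"
    and eq: "\<And>\<phi>. \<phi> \<in> test_functions {0<..<T} \<Longrightarrow>
      (LINT t|lborel. (indicator {0<..T} t * conv (kern (1 - al)) z t) * deriv \<phi> t) = \<mu> * (LINT t|lborel. z t * \<phi> t)"
    and \<zeta>: "AE t\<in>{0..T} in lborel. z t = \<zeta> t" "(\<zeta> \<longlongrightarrow> 0) (at 0 within {0..T})"
  shows "AE t in lborel. z t = 0"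
proof -
  have kn: "nabs (kern \<beta>) = nkern \<beta>" if "\<beta> > 0" for \<beta> using kern_nonneg[OF that] by simp
  have rn: "nabs res = nres" using res_nonneg by simp
  have z0': "\<And>t. t \<le> 0 \<Longrightarrow> z t = 0" using z0 by simp
  have fin: "nconv (nkern a) (nconv (nkern b) (nabs z)) t < \<infinity>" if "a > 0" "b > 0" "a + b \<ge> 1" for a b t
    using nconv_kern_finite_L1[OF that(3) \<open>z \<in> borel_measurable borel\<close> z0' zi] nconv_kern_comb[OF that(1,2)] by simp
  have fin_abs: "nconv (nkern a) (nabs (conv (kern b) z)) t < \<infinity>" if "a > 0" "b > 0" "a + b \<ge> 1" for a b t
    by (rule order.strict_trans1[OF nconv_mono fin[OF that]]) (use abs_conv_le[of "kern b" z] kn[OF that(2)] in auto)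
  define g where "g t = indicator {0<..T} t * (conv (kern (1 - al)) z t + \<mu> * conv (kern 1) z t)" for t
  note Ji = indicator_conv_integrable[OF _ \<open>z \<in> borel_measurable borel\<close> z0' zi]
  have gsplit: "g = (\<lambda>t. indicator {0<..T} t * conv (kern (1 - al)) z t + \<mu> * (indicator {0<..T} t * conv (kern 1) z t))"
    by (auto simp: g_def algebra_simps)
  have "\<exists>c. AE t\<in>{0..T} in lborel. g t = c"
  proof (rule weak_deriv_zero_imp_const[OF T])
    show "integrable lborel g" unfolding gsplit
      using Ji[of "1 - al"] Ji[of 1] al_pos by (intro Bochner_Integration.integrable_add integrable_mult_right) auto
    show "g t = 0" if "t \<notin> {0<..T}" for t using that by (simp add: g_def)
    fix \<phi> :: "real \<Rightarrow> real" assume \<phi>: "\<phi> \<in> test_functions {0<..<T}"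
    note [measurable] = test_function_measurable[OF \<phi>]
    have i: "integrable lborel (\<lambda>t. (indicator {0<..T} t * conv (kern \<beta>) z t) * deriv \<phi> t)" if "\<beta> > 0" for \<beta>
      by (rule indicator_conv_deriv_integrable[OF that _ _ zi \<phi>]) (use z0 in auto)
    have "(LINT t|lborel. g t * deriv \<phi> t) = (LINT t|lborel. (indicator {0<..T} t * conv (kern (1 - al)) z t) * deriv \<phi> t
        + \<mu> * ((indicator {0<..T} t * conv (kern 1) z t) * deriv \<phi> t))"
      unfolding gsplit by (simp add: algebra_simps)
    also have "... = \<mu> * (LINT t|lborel. z t * \<phi> t) + \<mu> * - (LINT t|lborel. z t * \<phi> t)"
      using i[of "1 - al"] i[of 1] al_pos eq[OF \<phi>] primitive_weak_deriv[OF zi z0 \<phi>] by simp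
    finally show "(LINT t|lborel. g t * deriv \<phi> t) = 0" by simp
  qed
  then obtain c where c: "AE t\<in>{0..T} in lborel. g t = c" by blast
  \<comment> \<open>Near 0 the values of z are at most 1 in modulus, so both fractional integrals
    are bounded by kernels that tend to 0, while their combination equals c at almost every
    time.\<close>
  have "c = 0"
  proof (rule ccontr)
    assume "c \<noteq> 0"
    have "((\<lambda>t. kern (2 - al) t + \<mu> * kern 2 t) \<longlongrightarrow> 0 + \<mu> * 0) (at_right 0)"
      using al by (intro tendsto_add tendsto_mult kern_tendsto_0 tendsto_const tendsto_ident_at) (auto simp: eventually_at_right_less eventually_at_filter)
    then have e1: "eventually (\<lambda>t. kern (2 - al) t + \<mu> * kern 2 t < \<bar>c\<bar>) (at_right 0)"
      using \<open>c \<noteq> 0\<close> by (intro order_tendstoD(2)[where y = 0]) auto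
    have "eventually (\<lambda>t. \<bar>\<zeta> t\<bar> < 1) (at_right 0)"
      using tendstoD[OF \<zeta>(2), of 1] T by (simp add: at_within_Icc_at_right)
    with e1 have "eventually (\<lambda>t. kern (2 - al) t + \<mu> * kern 2 t < \<bar>c\<bar> \<and> \<bar>\<zeta> t\<bar> < 1) (at_right 0)" by (rule eventually_conj)
    then obtain d where d: "d > 0" "\<And>t. 0 < t \<Longrightarrow> t < d \<Longrightarrow> kern (2 - al) t + \<mu> * kern 2 t < \<bar>c\<bar> \<and> \<bar>\<zeta> t\<bar> < 1"
      unfolding eventually_at_right_field by blast
    have "AE t\<in>{0<..<min d T} in lborel. g t = c" using c by eventually_elim auto
    then obtain t where t: "0 < t" "t < min d T" "g t = c" using AE_interval_ex[of 0 "min d T" "\<lambda>t. g t = c"] d T by auto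
    have zk: "AE s in lborel. s < t \<longrightarrow> \<bar>z s\<bar> \<le> kern 1 s" using \<zeta>(1)
    proof eventually_elim
      fix s assume "s \<in> {0..T} \<longrightarrow> z s = \<zeta> s"
      then show "s < t \<longrightarrow> \<bar>z s\<bar> \<le> kern 1 s" using d(2)[of s] t z0[of s] by (cases "s > 0") (auto simp: kern_1)
    qed
    have bd: "\<bar>conv (kern \<beta>) z t\<bar> \<le> kern (\<beta> + 1) t" if "\<beta> > 0" for \<beta>
    proof (rule conv_abs_le)
      have "nconv (nkern \<beta>) (nabs z) t \<le> nconv (nkern \<beta>) (nkern 1) t" unfolding nconv_def
      proof (rule nn_integral_mono_AE, use zk in eventually_elim)
        fix s assume "s < t \<longrightarrow> \<bar>z s\<bar> \<le> kern 1 s"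
        then show "nkern \<beta> (t - s) * nabs z s \<le> nkern \<beta> (t - s) * nkern 1 s"
          by (cases "s < t") (auto intro!: mult_left_mono ennreal_leI)
      qed
      then show "nconv (nabs (kern \<beta>)) (nabs z) t \<le> ennreal (kern (\<beta> + 1) t)"
        unfolding kn[OF that] using that by (simp add: nconv_kern)
    qed (use that in \<open>auto intro: kern_nonneg\<close>)
    have "\<bar>c\<bar> \<le> \<bar>conv (kern (1 - al)) z t\<bar> + \<mu> * \<bar>conv (kern 1) z t\<bar>"
      using t \<mu> abs_triangle_ineq[of "conv (kern (1 - al)) z t" "\<mu> * conv (kern 1) z t"] by (auto simp: g_def abs_mult)
    also have "... \<le> kern (2 - al) t + \<mu> * kern 2 t"
      using bd[of "1 - al"] bd[of 1] al_pos \<mu> by (intro add_mono mult_left_mono) auto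
    also have "... < \<bar>c\<bar>" using d(2)[of t] t by auto
    finally show False by simp
  qed
  have cz: "conv f z s = 0" if "s \<le> 0" "\<And>s. s \<le> 0 \<Longrightarrow> f s = 0" for f s
    by (rule conv_AE_zero_upto[OF that(2)]) (use that(1) z0 in auto)
  \<comment> \<open>Fractional integrals of p of any positive order are finite at every t; for z
    itself an order below 1 would give this only almost everywhere.\<close>
  define p where "p = conv (kern 1) z"
  have p[measurable]: "p \<in> borel_measurable borel" unfolding p_def by measurable
  have fp: "nconv (nkern a) (nabs p) t < \<infinity>" if "a > 0" for a t
    unfolding p_def using that by (intro fin_abs) auto
  have e: "p t + \<mu> * conv (kern al) p t = 0" if "t \<le> T" for t
  proof -
    have "conv (kern al) (\<lambda>s. conv (kern (1 - al)) z s + \<mu> * p s) t = 0"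
    proof (rule conv_AE_zero_upto)
      show "AE s in lborel. s < t \<longrightarrow> conv (kern (1 - al)) z s + \<mu> * p s = 0" using c
      proof eventually_elim
        fix s assume "s \<in> {0..T} \<longrightarrow> g s = c"
        then show "s < t \<longrightarrow> conv (kern (1 - al)) z s + \<mu> * p s = 0"
          using \<open>c = 0\<close> that cz[of s "kern 1"] cz[of s "kern (1 - al)"] by (cases "s > 0") (auto simp: g_def p_def)
      qed
    qed simp
    moreover have "conv (kern al) (\<lambda>s. conv (kern (1 - al)) z s + \<mu> * p s) t
        = conv (kern al) (conv (kern (1 - al)) z) t + \<mu> * conv (kern al) p t"
      by (rule conv_add_scale) (use al_pos fin_abs[of al "1 - al" t] fp[of al t] kn[of al] in auto)
    moreover have "conv (kern al) (conv (kern (1 - al)) z) t = conv (conv (kern al) (kern (1 - al))) z t"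
      by (rule conv_assoc) (use al_pos fin[of al "1 - al" t] kn[of al] kn[of "1 - al"] in auto)
    moreover have "conv (kern al) (kern (1 - al)) = kern 1" using conv_kern[OF al_pos] by auto
    ultimately show ?thesis by (simp add: p_def)
  qed
  have le: "nconv nres q t \<le> nconv (nkern al) q t" for q t by (intro nconv_mono nres_le_kern order_refl)
  have fin2: "nconv nres (nconv (nkern al) (nabs p)) t < \<infinity>" for t
    using nconv_kern_comb[OF al_pos(1) al_pos(1) p] fp[of "al + al"] al_pos by (intro order.strict_trans1[OF le]) simp
  have p0: "p t = 0" if "t \<le> T" for t
  proof -
    have "conv res (\<lambda>s. p s + \<mu> * conv (kern al) p s) t = 0" by (rule conv_AE_zero_upto) (use e that in auto)
    moreover have "conv res (\<lambda>s. p s + \<mu> * conv (kern al) p s) t = conv res p t + \<mu> * conv res (conv (kern al) p) t"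
    proof (rule conv_add_scale)
      show "nconv (nabs res) (nabs p) t < \<infinity>" unfolding rn using fp[OF al_pos(1)] by (rule order.strict_trans1[OF le])
      have "nconv nres (nabs (conv (kern al) p)) t \<le> nconv nres (nconv (nkern al) (nabs p)) t"
        by (rule nconv_mono) (use abs_conv_le[of "kern al" p] kn[OF al_pos(1)] in auto)
      then show "nconv (nabs res) (nabs (conv (kern al) p)) t < \<infinity>"
        unfolding rn using fin2 by (rule order.strict_trans1)
    qed auto
    moreover have "conv res (conv (kern al) p) t = conv (conv res (kern al)) p t"
      by (rule conv_assoc) (use fin2[of t] kn[OF al_pos(1)] rn in auto)
    moreover have "conv res (kern al) = conv (kern al) res" using conv_commute[of res "kern al"] by auto
    moreover have "\<mu> * conv (conv (kern al) res) p t = conv (kern al) p t - conv res p t"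
      by (rule mult_conv_kern_res[OF p fp[OF al_pos(1)]])
    ultimately show ?thesis using e[OF that] by simp
  qed
  show ?thesis
  proof (rule lint_zero_imp_AE_zero[OF zi z0])
    fix \<phi> :: "real \<Rightarrow> real" assume \<phi>: "\<phi> \<in> test_functions {0<..<T}"
    have "(\<lambda>t. (indicator {0<..T} t * p t) * deriv \<phi> t) = (\<lambda>t. 0)"
      using p0 by (auto simp: indicator_def fun_eq_iff)
    then show "(LINT t|lborel. z t * \<phi> t) = 0" using primitive_weak_deriv[OF zi z0 \<phi>] by (simp add: p_def)
  qed
qed

end

section \<open>Expansions in the Stokes eigenfunctions\<close>

lemma summable_product:
  fixes x y :: "nat \<Rightarrow> real"
  assumes "summable (\<lambda>k. (x k)\<^sup>2)" "summable (\<lambda>k. (y k)\<^sup>2)"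
  shows "summable (\<lambda>k. \<bar>x k * y k\<bar>)"
proof (rule summable_comparison_test')
  show "summable (\<lambda>k. (x k)\<^sup>2 + (y k)\<^sup>2)" using assms by (rule summable_add)
  show "norm \<bar>x k * y k\<bar> \<le> (x k)\<^sup>2 + (y k)\<^sup>2" if "k \<ge> 0" for k
  proof -
    have "0 \<le> (\<bar>x k\<bar> - \<bar>y k\<bar>)\<^sup>2" by simp
    then have "2 * (\<bar>x k\<bar> * \<bar>y k\<bar>) \<le> (x k)\<^sup>2 + (y k)\<^sup>2" by (simp add: power2_eq_square algebra_simps)
    moreover have "0 \<le> \<bar>x k\<bar> * \<bar>y k\<bar>" by simp
    ultimately show ?thesis unfolding real_norm_def abs_mult abs_idempotent by linarith
  qed
qed

lemma suminf_product_le: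
  fixes x y :: "nat \<Rightarrow> real"
  assumes "summable (\<lambda>k. (x k)\<^sup>2)" "summable (\<lambda>k. (y k)\<^sup>2)"
  shows "\<bar>\<Sum>k. x k * y k\<bar> \<le> sqrt (\<Sum>k. (x k)\<^sup>2) * sqrt (\<Sum>k. (y k)\<^sup>2)"
proof (rule LIMSEQ_le_const2)
  show "(\<lambda>n. \<bar>\<Sum>k<n. x k * y k\<bar>) \<longlonglongrightarrow> \<bar>\<Sum>k. x k * y k\<bar>"
    by (intro tendsto_rabs summable_LIMSEQ summable_rabs_cancel[OF summable_product[OF assms]])
  show "\<exists>N. \<forall>n\<ge>N. \<bar>\<Sum>k<n. x k * y k\<bar> \<le> sqrt (\<Sum>k. (x k)\<^sup>2) * sqrt (\<Sum>k. (y k)\<^sup>2)"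
  proof (intro exI allI impI)
    fix n
    have "\<bar>\<Sum>k<n. x k * y k\<bar> \<le> (\<Sum>k<n. \<bar>x k\<bar> * \<bar>y k\<bar>)" unfolding abs_mult[symmetric] by (rule sum_abs)
    also have "... \<le> L2_set x {..<n} * L2_set y {..<n}" by (rule L2_set_mult_ineq)
    also have "... \<le> sqrt (\<Sum>k. (x k)\<^sup>2) * sqrt (\<Sum>k. (y k)\<^sup>2)"
      unfolding L2_set_def by (intro mult_mono real_sqrt_le_mono sum_le_suminf assms) (auto simp: sum_nonneg suminf_nonneg assms)
    finally show "\<bar>\<Sum>k<n. x k * y k\<bar> \<le> sqrt (\<Sum>k. (x k)\<^sup>2) * sqrt (\<Sum>k. (y k)\<^sup>2)" .
  qed
qed

section \<open>Functionals on V and their coefficients\<close>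

context bounded_open
begin

abbreviation ip :: "(real^'n \<Rightarrow> real^'n) \<Rightarrow> (real^'n \<Rightarrow> real^'n) \<Rightarrow> real" where "ip \<equiv> inner_L2 U"
abbreviation "ei \<equiv> SP.eig"
abbreviation "lam \<equiv> SP.eigval"

lemma dual_linear:
  assumes "F \<in> V_dual U" "u \<in> VV" "v \<in> VV"
  shows "F (p *\<^sub>R u + q *\<^sub>R v) = p * F u + q * F v"
proof -
  have "p *\<^sub>R u + q *\<^sub>R v = (\<lambda>x. p *\<^sub>R u x + q *\<^sub>R v x)" by (simp add: fun_eq_iff)
  then show ?thesis using assms by (simp add: V_dual_def)
qed

lemma dual_zero: "F \<in> V_dual U \<Longrightarrow> F 0 = 0" using dual_linear[of F 0 0 0 0] VA.mem_zero by simp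

lemma dual_scale: "F \<in> V_dual U \<Longrightarrow> u \<in> VV \<Longrightarrow> F (p *\<^sub>R u) = p * F u" using dual_linear[of F u u p 0] by simp

lemma dual_add: "F \<in> V_dual U \<Longrightarrow> u \<in> VV \<Longrightarrow> v \<in> VV \<Longrightarrow> F (u + v) = F u + F v"
  using dual_linear[of F u v 1 1] by simp

lemma dual_sub: "F \<in> V_dual U \<Longrightarrow> u \<in> VV \<Longrightarrow> v \<in> VV \<Longrightarrow> F (u - v) = F u - F v"
  using dual_linear[of F u v 1 "-1"] by simp

lemma dual_sum:
  "F \<in> V_dual U \<Longrightarrow> (\<And>k. k < n \<Longrightarrow> g k \<in> VV) \<Longrightarrow> F (\<Sum>k<n. g k) = (\<Sum>k<(n::nat). F (g k))"
proof (induct n)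
  case (Suc n)
  then show ?case using dual_add[of F "sum g {..<n}" "g n"] VA.mem_sum[of "{..<n}" g] by (simp add: plus_fun_def)
qed (simp add: dual_zero)

lemma dual_bound: "F \<in> V_dual U \<Longrightarrow> \<exists>C. \<forall>v\<in>VV. \<bar>F v\<bar> \<le> C * norm_V U v" by (simp add: V_dual_def)

lemma dual_bdd:
  assumes "F \<in> V_dual U"
  shows "bdd_above {\<bar>F v\<bar> | v. v \<in> VV \<and> norm_V U v \<le> 1}"
proof -
  obtain C where C: "\<forall>v\<in>VV. \<bar>F v\<bar> \<le> C * norm_V U v" using dual_bound[OF assms] ..
  have "\<bar>F v\<bar> \<le> \<bar>C\<bar>" if "v \<in> VV" "norm_V U v \<le> 1" for v
  proof -
    have n: "0 \<le> norm_V U v" using that(1) by (simp add: norm_V_eq)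
    have "C * norm_V U v \<le> \<bar>C\<bar> * norm_V U v" using n by (intro mult_right_mono) auto
    also have "... \<le> \<bar>C\<bar> * 1" using that(2) by (intro mult_left_mono) auto
    finally show ?thesis using bspec[OF C that(1)] by simp
  qed
  then show ?thesis by (intro bdd_aboveI[of _ "\<bar>C\<bar>"]) auto
qed

lemma dual_nonneg:
  assumes "F \<in> V_dual U" shows "0 \<le> norm_V_dual U F"
proof -
  have "\<bar>F 0\<bar> \<in> {\<bar>F v\<bar> | v. v \<in> VV \<and> norm_V U v \<le> 1}"
    using VA.mem_zero by (auto intro!: exI[of _ 0] simp: norm_V_eq HV.nrm_def)
  then show ?thesis unfolding norm_V_dual_def
    using cSup_upper[OF _ dual_bdd[OF assms]] abs_ge_zero order_trans by blast
qed

lemma dual_le: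
  assumes F: "F \<in> V_dual U" and v: "v \<in> VV"
  shows "\<bar>F v\<bar> \<le> norm_V_dual U F * norm_V U v"
proof (cases "norm_V U v = 0")
  case True
  obtain C where C: "\<forall>v\<in>VV. \<bar>F v\<bar> \<le> C * norm_V U v" using dual_bound[OF F] ..
  show ?thesis using bspec[OF C v] True by simp
next
  case False
  then have p: "norm_V U v > 0" using VA.nrm_nonneg[OF v] by (simp add: norm_V_eq)
  let ?w = "(1 / norm_V U v) *\<^sub>R v"
  have w: "?w \<in> VV" by (rule VA.mem_scale[OF v])
  have "norm_V U ?w = 1" using p VA.nrm_scale[OF v] by (simp add: norm_V_eq)
  then have "\<bar>F ?w\<bar> \<le> norm_V_dual U F"
    unfolding norm_V_dual_def using w by (intro cSup_upper dual_bdd[OF F]) auto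
  then show ?thesis using p by (simp add: dual_scale[OF F v] abs_mult field_simps)
qed

lemma norm_V_dual_le:
  assumes "\<And>v. v \<in> VV \<Longrightarrow> \<bar>F v\<bar> \<le> B * norm_V U v" "B \<ge> 0"
  shows "norm_V_dual U F \<le> B" unfolding norm_V_dual_def
proof (rule cSup_least)
  show "{\<bar>F v\<bar> | v. v \<in> VV \<and> norm_V U v \<le> 1} \<noteq> {}"
    using VA.mem_zero by (auto intro!: exI[of _ 0] simp: norm_V_eq HV.nrm_def)
  fix x assume "x \<in> {\<bar>F v\<bar> | v. v \<in> VV \<and> norm_V U v \<le> 1}"
  then obtain v where v: "v \<in> VV" "norm_V U v \<le> 1" "x = \<bar>F v\<bar>" by blast
  have "B * norm_V U v \<le> B * 1" using assms(2) v(2) by (rule mult_left_mono[rotated])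
  then show "x \<le> B" using assms(1)[OF v(1)] v(3) by simp
qed

lemma dual_diff:
  assumes "F \<in> V_dual U" "G \<in> V_dual U" shows "F - G \<in> V_dual U"
proof -
  obtain C where C: "\<forall>v\<in>VV. \<bar>F v\<bar> \<le> C * norm_V U v" using dual_bound[OF assms(1)] ..
  obtain D where D: "\<forall>v\<in>VV. \<bar>G v\<bar> \<le> D * norm_V U v" using dual_bound[OF assms(2)] ..
  have "\<bar>(F - G) v\<bar> \<le> (C + D) * norm_V U v" if "v \<in> VV" for v
    using bspec[OF C that] bspec[OF D that] abs_triangle_ineq4[of "F v" "G v"] by (simp add: distrib_right)
  then have "\<exists>C. \<forall>v\<in>VV. \<bar>(F - G) v\<bar> \<le> C * norm_V U v" by blast
  then show ?thesis using assms unfolding V_dual_def by (auto simp: algebra_simps)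
qed

lemma coeff_summable: "\<eta> \<in> VV \<Longrightarrow> summable (\<lambda>k. lam k * (ip \<eta> (ei k))\<^sup>2)"
  using SP.onA.bessel[of \<eta>] SP.eigval_pos by (simp add: SP.coeff_A power_mult_distrib less_imp_le)

lemma coeff_suminf_le:
  assumes "\<eta> \<in> VV" shows "(\<Sum>k. lam k * (ip \<eta> (ei k))\<^sup>2) \<le> (norm_V U \<eta>)\<^sup>2"
proof (rule suminf_le_const[OF coeff_summable[OF assms]])
  fix n show "(\<Sum>k<n. lam k * (ip \<eta> (ei k))\<^sup>2) \<le> (norm_V U \<eta>)\<^sup>2"
    using SP.onA.bessel_partial[OF assms, of n] SP.eigval_pos assms
    by (simp add: SP.coeff_A power_mult_distrib less_imp_le norm_V_eq VA.nrm_sq)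
qed

lemma psum_nrm_tendsto:
  assumes "\<eta> \<in> VV" shows "(\<lambda>n. norm_V U (\<eta> - SP.onB.psum n \<eta>)) \<longlonglongrightarrow> 0"
  using SP.eig_complete_A[OF assms] by (simp add: norm_V_eq SP.psum_A_eq[OF assms])

text \<open>A functional on V is continuous in the V norm, and the partial sums of \<eta> converge
  in that norm.\<close>

lemma dual_expansion:
  assumes F: "F \<in> V_dual U" and \<eta>: "\<eta> \<in> VV"
  shows "(\<lambda>k. ip \<eta> (ei k) * F (ei k)) sums F \<eta>" unfolding sums_def
proof -
  have "(\<lambda>n. F \<eta> - (\<Sum>k<n. ip \<eta> (ei k) * F (ei k))) \<longlonglongrightarrow> 0"
  proof (rule Lim_null_comparison)
    show "\<forall>\<^sub>F n in sequentially. norm (F \<eta> - (\<Sum>k<n. ip \<eta> (ei k) * F (ei k))) \<le> norm_V_dual U F * norm_V U (\<eta> - SP.onB.psum n \<eta>)"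
    proof (intro always_eventually allI)
      fix n
      have "F (\<eta> - SP.onB.psum n \<eta>) = F \<eta> - (\<Sum>k<n. ip \<eta> (ei k) * F (ei k))"
        using F \<eta> by (simp add: dual_sub SP.onB.psum_mem) (simp add: SP.onB.psum_def dual_sum dual_scale VA.mem_scale SP.eig_mem)
      then show "norm (F \<eta> - (\<Sum>k<n. ip \<eta> (ei k) * F (ei k))) \<le> norm_V_dual U F * norm_V U (\<eta> - SP.onB.psum n \<eta>)"
        using dual_le[OF F VA.mem_diff[OF \<eta> SP.onB.psum_mem]] by (metis real_norm_def)
    qed
    show "(\<lambda>n. norm_V_dual U F * norm_V U (\<eta> - SP.onB.psum n \<eta>)) \<longlonglongrightarrow> 0"
      by (rule tendsto_mult_right_zero[OF psum_nrm_tendsto[OF \<eta>]])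
  qed
  then show "(\<lambda>n. \<Sum>k<n. ip \<eta> (ei k) * F (ei k)) \<longlonglongrightarrow> F \<eta>"
    using tendsto_diff[OF tendsto_const[of "F \<eta>"]] by fastforce
qed

text \<open>The functional is tested with its own truncated Riesz representative \<open>v\<close>:
  both F v and the bound for the squared norm of \<open>v\<close> equal the sum S, so S^2 is at most
  the squared dual norm times S.\<close>

lemma dual_bessel:
  assumes F: "F \<in> V_dual U"
  shows "(\<Sum>k<n. (F (ei k))\<^sup>2 / lam k) \<le> (norm_V_dual U F)\<^sup>2"
proof -
  let ?S = "\<Sum>k<n. (F (ei k))\<^sup>2 / lam k"
  define v where "v = (\<Sum>k<n. (F (ei k) / sqrt (lam k)) *\<^sub>R SP.sc_eig k)"
  have v: "v \<in> VV" unfolding v_def by (intro VA.mem_sum VA.mem_scale SP.onA.mem)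
  have sc: "F (SP.sc_eig k) = F (ei k) / sqrt (lam k)" for k
    unfolding SP.sc_eig_def using F by (simp add: dual_scale SP.eig_mem divide_inverse mult.commute)
  have sq: "sqrt (lam k) * sqrt (lam k) = lam k" for k using SP.eigval_pos[of k] by simp
  have "F v = (\<Sum>k<n. (F (ei k) / sqrt (lam k)) * F (SP.sc_eig k))"
    unfolding v_def using F by (simp add: dual_sum dual_scale VA.mem_scale SP.onA.mem)
  also have "... = ?S" unfolding sc times_divide_times_eq sq power2_eq_square ..
  finally have Fv: "F v = ?S" .
  have "inner_V U v v \<le> (\<Sum>k<n. (F (ei k) / sqrt (lam k))\<^sup>2)"
    unfolding v_def by (rule SP.onA.combination_sq_le) simp
  also have "... = ?S" using SP.eigval_pos by (simp add: power_divide less_imp_le)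
  finally have nv: "(norm_V U v)\<^sup>2 \<le> ?S" using v by (simp add: norm_V_eq VA.nrm_sq)
  have S0: "?S \<ge> 0" using SP.eigval_pos by (intro sum_nonneg divide_nonneg_nonneg) (auto simp: less_imp_le)
  have "?S \<le> norm_V_dual U F * norm_V U v" using dual_le[OF F v] Fv S0 by simp
  then have "?S\<^sup>2 \<le> (norm_V_dual U F * norm_V U v)\<^sup>2" using S0 by (rule power_mono)
  also have "... \<le> (norm_V_dual U F)\<^sup>2 * ?S" unfolding power_mult_distrib using nv by (intro mult_left_mono) auto
  finally have "?S * ?S \<le> (norm_V_dual U F)\<^sup>2 * ?S" by (simp add: power2_eq_square)
  then show ?thesis using S0 by (cases "?S = 0") (auto simp: mult_le_cancel_right)
qed

end

text \<open>Truncating at level \<open>N\<close> keeps the range of the quantised coefficient finite.\<close>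

definition quantise :: "nat \<Rightarrow> real \<Rightarrow> real" where
  "quantise N x = (if \<bar>x\<bar> \<le> real N then real_of_int \<lfloor>x * (real N)\<^sup>2\<rfloor> / (real N)\<^sup>2 else 0)"

lemma quantise_error:
  assumes "\<bar>x\<bar> \<le> real N" "N > 0" shows "\<bar>x - quantise N x\<bar> \<le> 1 / (real N)\<^sup>2"
proof -
  have "x - quantise N x = (x * (real N)\<^sup>2 - real_of_int \<lfloor>x * (real N)\<^sup>2\<rfloor>) / (real N)\<^sup>2"
    using assms by (simp add: quantise_def diff_divide_distrib)
  moreover have "0 \<le> x * (real N)\<^sup>2 - real_of_int \<lfloor>x * (real N)\<^sup>2\<rfloor>" "x * (real N)\<^sup>2 - real_of_int \<lfloor>x * (real N)\<^sup>2\<rfloor> \<le> 1"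
    by linarith+
  ultimately show ?thesis by (simp add: divide_right_mono)
qed

lemma quantise_finite_range: "finite (range (quantise N))"
proof (rule finite_subset)
  show "range (quantise N) \<subseteq> insert 0 ((\<lambda>i. real_of_int i / (real N)\<^sup>2) ` {- (int N * int N * int N) .. int N * int N * int N})"
  proof
    fix y assume "y \<in> range (quantise N)"
    then obtain x where x: "y = quantise N x" by blast
    show "y \<in> insert 0 ((\<lambda>i. real_of_int i / (real N)\<^sup>2) ` {- (int N * int N * int N) .. int N * int N * int N})"
    proof (cases "\<bar>x\<bar> \<le> real N")
      case True
      have "\<bar>x * (real N)\<^sup>2\<bar> \<le> real N * (real N)\<^sup>2" unfolding abs_mult using True by (intro mult_mono) auto
      then have "x * (real N)\<^sup>2 \<le> real_of_int (int N * int N * int N)" "real_of_int (- (int N * int N * int N)) \<le> x * (real N)\<^sup>2"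
        by (simp_all add: power2_eq_square mult.assoc)
      then have "\<lfloor>x * (real N)\<^sup>2\<rfloor> \<in> {- (int N * int N * int N) .. int N * int N * int N}"
        unfolding atLeastAtMost_iff le_floor_iff floor_le_iff by linarith
      then show ?thesis using True x by (auto simp: quantise_def)
    qed (simp add: x quantise_def)
  qed
qed simp

lemma quantise_measurable [measurable]: "quantise N \<in> borel_measurable borel"
  unfolding quantise_def by measurable

lemma simple_function_sum_scaled:
  fixes e :: "nat \<Rightarrow> 'v::real_vector"
  assumes "\<And>k. simple_function M (q k)"
  shows "simple_function M (\<lambda>t. \<Sum>k<(n::nat). q k t *\<^sub>R e k)"
proof (induction n)
  case (Suc n)
  then show ?case using simple_function_compose2[OF Suc assms[of n], of "\<lambda>x r. x + r *\<^sub>R e n"] by simp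
qed simp

text \<open>The n-th simple function truncates the expansion after n terms and rounds each
  coefficient to a grid of width 1/n^2, so the total rounding error is at most n / n^2. The bound B,
  which may depend on t, ensures that the cut-off of \<open>quantise\<close> is inactive for large
  n.\<close>

lemma (in orthonormal) bochner_measurable_expansion:
  assumes c: "\<And>k. c k \<in> borel_measurable borel"
    and v: "AE t in lebesgue_on {0..T}. v t \<in> V \<and> (\<forall>k. a (v t) (e k) = c k t * a (e k) (e k)) \<and> (\<lambda>n. nrm (v t - psum n (v t))) \<longlonglongrightarrow> 0
      \<and> (\<exists>B. \<forall>k. \<bar>c k t\<bar> \<le> B)"
  shows "bochner_measurable V nrm T v" unfolding bochner_measurable_def
proof (intro conjI exI allI)
  let ?s = "\<lambda>n t. \<Sum>k<n. quantise n (c k t) *\<^sub>R e k"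
  show "AE t in lebesgue_on {0..T}. v t \<in> V" using v by eventually_elim simp
  fix n
  show "simple_function (lebesgue_on {0..T}) (?s n)"
  proof (rule simple_function_sum_scaled, rule simple_function_borel_measurable)
    fix k
    have "(\<lambda>t. quantise n (c k t)) \<in> borel_measurable borel" using c[of k] by measurable
    then show "(\<lambda>t. quantise n (c k t)) \<in> borel_measurable (lebesgue_on {0..T})"
      by (intro measurable_restrict_space1 measurable_completion) simp
    show "finite ((\<lambda>t. quantise n (c k t)) ` space (lebesgue_on {0..T}))"
      by (rule finite_subset[OF _ quantise_finite_range[of n]]) auto
  qed
  show "?s n ` {0..T} \<subseteq> V" by (auto intro!: mem_sum mem_scale mem)
next
  let ?s = "\<lambda>n t. \<Sum>k<n. quantise n (c k t) *\<^sub>R e k"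
  show "AE t in lebesgue_on {0..T}. (\<lambda>n. nrm (v t - ?s n t)) \<longlonglongrightarrow> 0" using v
  proof eventually_elim
    case (elim t)
    then obtain B where vt: "v t \<in> V" "\<And>k. a (v t) (e k) = c k t * a (e k) (e k)"
      "(\<lambda>n. nrm (v t - psum n (v t))) \<longlonglongrightarrow> 0" and B: "\<And>k. \<bar>c k t\<bar> \<le> B" by blast
    have ps: "psum n (v t) = (\<Sum>k<n. c k t *\<^sub>R e k)" for n
      unfolding psum_def vt(2) using unit by (intro sum.cong refl) (auto dest: spec)
    have e1: "nrm (e k) \<le> 1" for k using unit[of k] mem_zero by (auto simp: nrm_def)
    have s: "?s n t \<in> V" for n by (intro mem_sum mem_scale mem)
    show ?case
    proof (rule Lim_null_comparison)
      show "\<forall>\<^sub>F n in sequentially. norm (nrm (v t - ?s n t)) \<le> nrm (v t - psum n (v t)) + 1 / real n"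
        using eventually_ge_at_top[of "Suc (nat \<lceil>B\<rceil>)"]
      proof eventually_elim
        fix n assume n: "Suc (nat \<lceil>B\<rceil>) \<le> n"
        then have nB: "B \<le> real n" "n > 0" by linarith+
        have "psum n (v t) - ?s n t = (\<Sum>k<n. (c k t - quantise n (c k t)) *\<^sub>R e k)"
          unfolding ps by (simp add: sum_subtractf scaleR_left_diff_distrib)
        then have "nrm (psum n (v t) - ?s n t) \<le> (\<Sum>k<n. nrm ((c k t - quantise n (c k t)) *\<^sub>R e k))"
          by (simp only:) (intro nrm_sum_le mem_scale mem)
        also have "... \<le> (\<Sum>k<n. 1 / (real n)\<^sup>2 * 1)"
        proof (rule sum_mono)
          fix k
          have "\<bar>c k t\<bar> \<le> real n" using B[of k] nB by linarith
          then show "nrm ((c k t - quantise n (c k t)) *\<^sub>R e k) \<le> 1 / (real n)\<^sup>2 * 1"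
            unfolding nrm_scale[OF mem] using e1[of k] nB(2) by (intro mult_mono quantise_error) (auto simp: mem)
        qed
        also have "... = 1 / real n" using nB(2) by (simp add: power2_eq_square)
        finally show "norm (nrm (v t - ?s n t)) \<le> nrm (v t - psum n (v t)) + 1 / real n"
          using nrm_triangle_diff[OF vt(1) psum_mem[of n "v t"] s[of n]] nrm_nonneg[OF mem_diff[OF vt(1) s[of n]]] by simp
      qed
      show "(\<lambda>n. nrm (v t - psum n (v t)) + 1 / real n) \<longlonglongrightarrow> 0" using tendsto_add[OF vt(3) lim_1_over_n] by simp
    qed
  qed
qed

lemma nn_integral_series_le:
  assumes "\<And>k. g k \<in> borel_measurable M" "\<And>k. (\<integral>\<^sup>+t. ennreal (g k t) \<partial>M) \<le> ennreal (b k)" "summable b" "\<And>k. 0 \<le> b k"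
  shows "(\<integral>\<^sup>+t. (\<Sum>k. ennreal (g k t)) \<partial>M) \<le> ennreal (\<Sum>k. b k)"
proof -
  have "(\<integral>\<^sup>+t. (\<Sum>k. ennreal (g k t)) \<partial>M) = (\<Sum>k. \<integral>\<^sup>+t. ennreal (g k t) \<partial>M)"
    using assms(1) by (intro nn_integral_suminf) simp
  also have "... \<le> (\<Sum>k. ennreal (b k))" by (intro suminf_le assms(2)) auto
  also have "... = ennreal (\<Sum>k. b k)" by (rule suminf_ennreal2[OF assms(4,3)])
  finally show ?thesis .
qed

lemma AE_summable:
  assumes "\<And>k. g k \<in> borel_measurable M" "\<And>k. (\<integral>\<^sup>+t. ennreal (g k t) \<partial>M) \<le> ennreal (b k)" "summable b" "\<And>k. 0 \<le> b k"
    and pos: "\<And>k t. 0 \<le> g k t"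
  shows "AE t in M. summable (\<lambda>k. g k t)"
proof -
  have "(\<integral>\<^sup>+t. (\<Sum>k. ennreal (g k t)) \<partial>M) \<noteq> \<infinity>"
    using nn_integral_series_le[OF assms(1-4)] by (auto simp: top_unique)
  then have "AE t in M. (\<Sum>k. ennreal (g k t)) \<noteq> \<infinity>" using assms(1) by (intro nn_integral_PInf_AE) auto
  then show ?thesis
  proof eventually_elim
    fix t assume "(\<Sum>k. ennreal (g k t)) \<noteq> \<infinity>"
    then show "summable (\<lambda>k. g k t)" using pos by (intro summable_suminf_not_top) auto
  qed
qed

lemma borel_rep_cong: "borel_rep T v g \<Longrightarrow> AE t\<in>{0..T} in lborel. v' t = v t \<Longrightarrow> borel_rep T v' g"
  unfolding borel_rep_def by (auto elim: eventually_elim2)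

text \<open>Along the approximating simple functions G takes finitely many values, and these
  converge to G (v t) almost everywhere. It turns Bochner measurability into measurability of
  coefficients and of norms.\<close>

lemma lipschitz_functional_rep:
  fixes G :: "'v::minus \<Rightarrow> real"
  assumes v: "bochner_measurable X N T v"
    and G: "\<And>p q. p \<in> X \<Longrightarrow> q \<in> X \<Longrightarrow> \<bar>G p - G q\<bar> \<le> K * N (p - q)"
  shows "\<exists>g. borel_rep T (\<lambda>t. G (v t)) g"
proof -
  obtain s :: "nat \<Rightarrow> real \<Rightarrow> 'v" where s: "\<And>k. simple_function (lebesgue_on {0..T}) (s k)" "\<And>k. s k ` {0..T} \<subseteq> X"
    and lim: "AE t\<in>{0..T} in lborel. (\<lambda>k. N (v t - s k t)) \<longlonglongrightarrow> 0" and vX: "AE t\<in>{0..T} in lborel. v t \<in> X"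
    using v unfolding bochner_measurable_def AE_lebesgue_on_iff[OF borel_closed[OF closed_atLeastAtMost]] by blast
  have "(\<lambda>t. G (s k t)) \<in> borel_measurable (lebesgue_on {0..T})" for k
    using simple_function_compose1[OF s(1), of G] by (rule borel_measurable_simple_function)
  then have "(\<lambda>t. lim (\<lambda>k. G (s k t))) \<in> borel_measurable (lebesgue_on {0..T})"
    by (rule borel_measurable_lim_metric)
  then obtain g where g: "borel_rep T (\<lambda>t. lim (\<lambda>k. G (s k t))) g" using borel_rep_ex by blast
  have "AE t\<in>{0..T} in lborel. G (v t) = lim (\<lambda>k. G (s k t))" using lim vX
  proof (eventually_elim, intro impI)
    fix t assume l: "t \<in> {0..T} \<longrightarrow> (\<lambda>k. N (v t - s k t)) \<longlonglongrightarrow> 0" and x: "t \<in> {0..T} \<longrightarrow> v t \<in> X" and t: "t \<in> {0..T}"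
    have st: "s k t \<in> X" for k using t s(2)[of k] by (rule subsetD[OF _ imageI, rotated])
    have "(\<lambda>k. G (v t) - G (s k t)) \<longlonglongrightarrow> 0"
    proof (rule Lim_null_comparison)
      show "(\<lambda>k. K * N (v t - s k t)) \<longlonglongrightarrow> 0" using l t by (intro tendsto_mult_right_zero) auto
      show "\<forall>\<^sub>F k in sequentially. norm (G (v t) - G (s k t)) \<le> K * N (v t - s k t)"
        using G[OF _ st] x t by (intro always_eventually) simp
    qed
    then have "(\<lambda>k. G (s k t)) \<longlonglongrightarrow> G (v t)" using tendsto_diff[OF tendsto_const[of "G (v t)"]] by fastforce
    then show "G (v t) = lim (\<lambda>k. G (s k t))" by (simp add: limI)
  qed
  from borel_rep_cong[OF g this] show "\<exists>g. borel_rep T (\<lambda>t. G (v t)) g" by (intro exI)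
qed

section \<open>Data of the problem and the series solution\<close>

locale stokes_data = bounded_open U for U :: "(real^'n::finite) set" +
  fixes T \<nu> al :: real and f :: "real \<Rightarrow> (real^'n \<Rightarrow> real^'n) \<Rightarrow> real" and u0 :: "real^'n \<Rightarrow> real^'n"
  assumes T: "T > 0" and nu: "\<nu> > 0" and alpha: "1 / 2 < al" "al < 1"
    and f: "f \<in> Lp_bochner 2 (V_dual U) (norm_V_dual U) T" and u0: "u0 \<in> HH"
begin

lemma AE_time: "(AE t in lebesgue_on {0..T}. P t) \<longleftrightarrow> (AE t\<in>{0..T} in lborel. P t)"
  by (rule AE_lebesgue_on_iff) simp

lemma f_dual: "AE t\<in>{0..T} in lborel. f t \<in> V_dual U"
  using f unfolding Lp_bochner_def bochner_measurable_def by (simp add: AE_time)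

lemma f_rep:
  assumes e: "e \<in> VV" shows "\<exists>g. borel_rep T (\<lambda>t. f t e) g"
proof (rule lipschitz_functional_rep[where G = "\<lambda>F. F e"])
  show "bochner_measurable (V_dual U) (norm_V_dual U) T f" using f by (simp add: Lp_bochner_def)
  show "\<bar>F e - F' e\<bar> \<le> norm_V U e * norm_V_dual U (F - F')" if "F \<in> V_dual U" "F' \<in> V_dual U" for F F'
    using dual_le[OF dual_diff[OF that] e] by (simp add: mult.commute)
qed

definition Fm :: "nat \<Rightarrow> real \<Rightarrow> real" where "Fm k = (SOME g. borel_rep T (\<lambda>t. f t (ei k)) g)"

lemma Fm_rep: "borel_rep T (\<lambda>t. f t (ei k)) (Fm k)"
  unfolding Fm_def by (rule someI_ex[OF f_rep[OF SP.eig_mem]])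

lemmas Fm_measurable [measurable] = borel_repD(1)[OF Fm_rep]
lemmas Fm_zero = borel_repD(2)[OF Fm_rep]

lemma Fm_eq: "AE t\<in>{0..T} in lborel. (\<forall>k. Fm k t = f t (ei k))"
proof -
  have "AE t in lborel. \<forall>k. t \<in> {0..T} \<longrightarrow> Fm k t = f t (ei k)" unfolding AE_all_countable
  proof
    fix k show "AE t\<in>{0..T} in lborel. Fm k t = f t (ei k)"
      using borel_repD(3)[OF Fm_rep[of k]] by eventually_elim simp
  qed
  then show ?thesis by eventually_elim auto
qed

lemma lam_pos [simp]: "0 < lam k" by (rule SP.eigval_pos)

lemma lam_nonneg [simp]: "0 \<le> lam k" using lam_pos[of k] by linarith

lemma lam_neq0 [simp]: "lam k \<noteq> 0" using lam_pos[of k] by linarith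

text \<open>\<open>dual_bessel\<close> at almost every time, integrated: the bound is the squared
  norm of f in L2 with values in V'.\<close>

lemma f_bound: "\<exists>G\<ge>0. \<forall>n. (\<Sum>k<n. \<integral>\<^sup>+s. ennreal ((Fm k s)\<^sup>2 / lam k) \<partial>lborel) \<le> ennreal G"
proof -
  let ?I = "\<integral>\<^sup>+t. ennreal (norm_V_dual U (f t) powr 2) * indicator {0..T} t \<partial>lborel"
  have I: "?I < \<infinity>" using f unfolding Lp_bochner_def by (simp add: nn_integral_lebesgue_on)
  have "(\<Sum>k<n. \<integral>\<^sup>+s. ennreal ((Fm k s)\<^sup>2 / lam k) \<partial>lborel) \<le> ?I" for n
  proof -
    have "(\<Sum>k<n. \<integral>\<^sup>+s. ennreal ((Fm k s)\<^sup>2 / lam k) \<partial>lborel) = (\<integral>\<^sup>+s. (\<Sum>k<n. ennreal ((Fm k s)\<^sup>2 / lam k)) \<partial>lborel)"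
      by (rule nn_integral_sum[symmetric]) simp
    also have "... \<le> ?I"
    proof (rule nn_integral_mono_AE, use Fm_eq f_dual in eventually_elim)
      fix t assume e: "t \<in> {0..T} \<longrightarrow> (\<forall>k. Fm k t = f t (ei k))" and d: "t \<in> {0..T} \<longrightarrow> f t \<in> V_dual U"
      show "(\<Sum>k<n. ennreal ((Fm k t)\<^sup>2 / lam k)) \<le> ennreal (norm_V_dual U (f t) powr 2) * indicator {0..T} t"
      proof (cases "t \<in> {0..T}")
        case True
        have "(\<Sum>k<n. ennreal ((Fm k t)\<^sup>2 / lam k)) = ennreal (\<Sum>k<n. (f t (ei k))\<^sup>2 / lam k)"
          using e True by (subst sum_ennreal) auto
        also have "... \<le> ennreal ((norm_V_dual U (f t))\<^sup>2)" using d True by (intro ennreal_leI dual_bessel) simp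
        finally show ?thesis using True d dual_nonneg[of "f t"] by simp
      next
        case False then show ?thesis using Fm_zero[of t] by auto
      qed
    qed
    finally show ?thesis .
  qed
  moreover have "?I = ennreal (enn2real ?I)" using I by simp
  ultimately show ?thesis by (intro exI[of _ "enn2real ?I"]) auto
qed

lemma Fm_sq_integrable: "integrable lborel (\<lambda>s. (Fm k s)\<^sup>2)"
proof -
  obtain G where G: "\<And>n. (\<Sum>k<n. \<integral>\<^sup>+s. ennreal ((Fm k s)\<^sup>2 / lam k) \<partial>lborel) \<le> ennreal G" using f_bound by blast
  have "(\<integral>\<^sup>+s. ennreal ((Fm k s)\<^sup>2 / lam k) \<partial>lborel) \<le> (\<Sum>k<Suc k. \<integral>\<^sup>+s. ennreal ((Fm k s)\<^sup>2 / lam k) \<partial>lborel)"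
    by (rule member_le_sum) auto
  also note G
  finally have "integrable lborel (\<lambda>s. (Fm k s)\<^sup>2 / lam k)"
    by (intro integrableI_bounded) (auto intro: order.strict_trans1 simp: less_imp_le)
  then have "integrable lborel (\<lambda>s. lam k * ((Fm k s)\<^sup>2 / lam k))" by (rule integrable_mult_right)
  then show ?thesis by simp
qed

definition c0 :: "nat \<Rightarrow> real" where "c0 k = ip u0 (ei k)"

text \<open>One scalar problem for each eigenfunction; the index k remains a parameter, so that
  \<open>FD.sol\<close>, \<open>FD.rhs\<close> and the bounds become sequences.\<close>

sublocale FD: frac_data al "\<nu> * lam k" T "c0 k" "Fm k" for k
  by unfold_locales (use alpha nu Fm_zero Fm_sq_integrable in auto)

abbreviation "Qf k \<equiv> LINT s|lborel. (Fm k s)\<^sup>2"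
abbreviation "C \<equiv> FD.sol"
abbreviation "h \<equiv> FD.rhs"

lemma Qf_summable: "summable (\<lambda>k. Qf k / lam k)"
proof -
  obtain G where G: "G \<ge> 0" "\<And>n. (\<Sum>k<n. \<integral>\<^sup>+s. ennreal ((Fm k s)\<^sup>2 / lam k) \<partial>lborel) \<le> ennreal G" using f_bound by blast
  have e: "(\<integral>\<^sup>+s. ennreal ((Fm k s)\<^sup>2 / lam k) \<partial>lborel) = ennreal (Qf k / lam k)" for k
    by (subst nn_integral_eq_integral) (auto simp: Fm_sq_integrable)
  show ?thesis
  proof (rule summableI_nonneg_bounded)
    fix n
    show "0 \<le> Qf n / lam n" by simp
    have "ennreal (\<Sum>k<n. Qf k / lam k) \<le> ennreal G" using G(2)[of n] unfolding e by (subst (asm) sum_ennreal) auto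
    then show "(\<Sum>k<n. Qf k / lam k) \<le> G" using G(1) by simp
  qed
qed

lemma c0_summable: "summable (\<lambda>k. (c0 k)\<^sup>2)" unfolding c0_def by (rule onH.bessel[OF u0])

lemma bound_sq_summable: "summable (\<lambda>k. lam k * FD.bound_sq k)"
proof -
  have e: "lam k * FD.bound_sq k = (2 * kern (2 - al) T / \<nu>) * (c0 k)\<^sup>2 + (2 / \<nu>\<^sup>2) * (Qf k / lam k)" for k
    using nu lam_pos[of k] by (simp add: FD.bound_sq_def field_simps power2_eq_square)
  show ?thesis unfolding e by (intro summable_add summable_mult c0_summable Qf_summable)
qed

lemma bound_rhs_summable: "summable (\<lambda>k. FD.bound_rhs k / lam k)"
proof -
  have e: "FD.bound_rhs k / lam k = 2 * (Qf k / lam k) + 2 * \<nu>\<^sup>2 * (lam k * FD.bound_sq k)" for k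
    by (simp add: FD.bound_rhs_def add_divide_distrib power_mult_distrib power2_eq_square)
  show ?thesis unfolding e by (intro summable_add summable_mult bound_sq_summable Qf_summable)
qed

definition bound_dev :: "nat \<Rightarrow> real" where
  "bound_dev k = 2 * (c0 k)\<^sup>2 * kern (2 - al) T + 2 * Qf k / (\<nu> * lam k)"

lemma bound_dev_summable: "summable bound_dev"
proof -
  have e: "bound_dev k = (2 * kern (2 - al) T) * (c0 k)\<^sup>2 + (2 / \<nu>) * (Qf k / lam k)" for k
    by (simp add: bound_dev_def)
  show ?thesis unfolding e[abs_def] by (intro summable_add summable_mult c0_summable Qf_summable)
qed

lemma bound_dev_nonneg: "0 \<le> bound_dev k"
  unfolding bound_dev_def using nu alpha by (intro add_nonneg_nonneg mult_nonneg_nonneg divide_nonneg_nonneg kern_nonneg) auto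

text \<open>The times at which the coefficients belong to an element of V; by \<open>AE_good\<close>
  they fill [0,T] up to a null set.\<close>

definition good :: "real \<Rightarrow> bool" where "good t \<longleftrightarrow> summable (\<lambda>k. lam k * (C k t)\<^sup>2)"

lemma C_sq_integral: "(\<integral>\<^sup>+t. ennreal (lam k * (C k t)\<^sup>2 * indicator {0..T} t) \<partial>lborel) \<le> ennreal (lam k * FD.bound_sq k)"
proof -
  have "(\<integral>\<^sup>+t. ennreal (lam k * (C k t)\<^sup>2 * indicator {0..T} t) \<partial>lborel)
      = ennreal (lam k) * (\<integral>\<^sup>+t. ennreal ((C k t)\<^sup>2) * indicator {0..T} t \<partial>lborel)"
    by (subst nn_integral_cmult[symmetric]) (auto intro!: nn_integral_cong simp: ennreal_mult indicator_def)
  also have "... \<le> ennreal (lam k) * ennreal (FD.bound_sq k)" by (intro mult_left_mono FD.sol_sq_integral) simp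
  finally show ?thesis by (simp add: ennreal_mult FD.bound_sq_nonneg)
qed

lemma AE_good: "AE t\<in>{0..T} in lborel. good t"
proof -
  have "AE t in lborel. summable (\<lambda>k. lam k * (C k t)\<^sup>2 * indicator {0..T} t)"
    by (rule AE_summable[OF _ C_sq_integral bound_sq_summable]) (auto simp: FD.bound_sq_nonneg)
  then show ?thesis
  proof eventually_elim
    fix t assume "summable (\<lambda>k. lam k * (C k t)\<^sup>2 * indicator {0..T} t)"
    then show "t \<in> {0..T} \<longrightarrow> good t" by (cases "t \<in> {0..T}") (simp_all add: good_def del: atLeastAtMost_iff)
  qed
qed

lemma sc_eig_sq: "inner_V U (SP.sc_eig k) (SP.sc_eig k) = ip (ei k) (ei k)"
  using SP.eig_sq[of k] lam_pos[of k] by (simp add: SP.sc_eig_def VA.scale_left VA.scale_right SP.eig_mem VA.mem_scale field_simps)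

lemma good_ex:
  assumes "good t"
  shows "\<exists>u. u \<in> VV \<and> (\<forall>k. ip u (ei k) = C k t * ip (ei k) (ei k))"
proof -
  have "summable (\<lambda>k. (sqrt (lam k) * C k t)\<^sup>2)" using assms by (simp add: good_def power_mult_distrib)
  from SP.onA.riesz_fischer[OF V_complete this] obtain u where u: "u \<in> VV"
    "\<And>k. inner_V U u (SP.sc_eig k) = sqrt (lam k) * C k t * inner_V U (SP.sc_eig k) (SP.sc_eig k)" by blast
  have "ip u (ei k) = C k t * ip (ei k) (ei k)" for k
  proof -
    note sc_eig_sq[of k]
    then show ?thesis using u(2)[of k] SP.coeff_A[OF u(1), of k] less_imp_neq[OF lam_pos[of k]] by simp
  qed
  then show ?thesis using u(1) by blast
qed

text \<open>The value is arbitrary at times that are not \<open>good\<close>. The factor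
  \<open>ip (ei k) (ei k)\<close> discards the coefficient of a zero eigenvector.\<close>

definition sol :: "real \<Rightarrow> real^'n \<Rightarrow> real^'n" where
  "sol t = (SOME u. u \<in> VV \<and> (\<forall>k. ip u (ei k) = C k t * ip (ei k) (ei k)))"

lemma sol_V: "good t \<Longrightarrow> sol t \<in> VV"
  and sol_coeff: "good t \<Longrightarrow> ip (sol t) (ei k) = C k t * ip (ei k) (ei k)"
  using someI_ex[OF good_ex[of t]] unfolding sol_def by auto

definition kap :: real where "kap = 2 * kern_sq_const al * kern (2 * al) T"

lemma kap_nonneg: "0 \<le> kap"
  unfolding kap_def using kern_sq_const_pos[OF alpha] kern_nonneg[of "2 * al" T] alpha by simp

lemma C_diff_sq:
  assumes "s \<in> {0..T}" "t \<in> {0..T}"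
  shows "(C k s - C k t)\<^sup>2 / lam k \<le> 2 * kern_sq_const al * kern (2 * al) \<bar>s - t\<bar> * (FD.bound_rhs k / lam k)"
proof -
  have *: "(C k t - C k s)\<^sup>2 / lam k \<le> 2 * kern_sq_const al * kern (2 * al) \<bar>s - t\<bar> * (FD.bound_rhs k / lam k)"
    if "s \<le> t" "0 \<le> s" for s t
  proof -
    have "(C k t - C k s)\<^sup>2 \<le> 2 * kern_sq_const al * kern (2 * al) (t - s) * (LINT r|lborel. (h k r)\<^sup>2)"
      using that by (intro FD.sol_holder)
    also have "... \<le> 2 * kern_sq_const al * kern (2 * al) (t - s) * FD.bound_rhs k"
      using kern_sq_const_pos[OF alpha] kern_nonneg[of "2 * al" "t - s"] alpha by (intro mult_left_mono FD.rhs_sq_integral_le) auto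
    finally show ?thesis using that lam_pos[of k] by (simp add: divide_right_mono)
  qed
  show ?thesis using *[of s t] *[of t s] assms by (cases "s \<le> t") (auto simp: power2_commute abs_minus_commute)
qed

lemma C_dev_sq:
  assumes "t \<in> {0..T}" shows "(C k t - c0 k)\<^sup>2 / lam k \<le> kap * (FD.bound_rhs k / lam k)"
proof -
  have "(C k t - c0 k)\<^sup>2 / lam k \<le> 2 * kern_sq_const al * kern (2 * al) t * (FD.bound_rhs k / lam k)"
    using C_diff_sq[of t 0 k] assms by (simp add: FD.sol_0)
  also have "... \<le> kap * (FD.bound_rhs k / lam k)"
    unfolding kap_def using kern_sq_const_pos[OF alpha] alpha assms kern_mono[of "2 * al" t T] FD.bound_rhs_nonneg[of k]
    by (intro mult_right_mono mult_left_mono) auto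
  finally show ?thesis .
qed

end

text \<open>The numbers \<open>b k\<close> dominate the integrals of the moduli of the terms, which
  allows the exchange of sum and integral.\<close>

lemma conv_suminf:
  fixes g :: "nat \<Rightarrow> real \<Rightarrow> real"
  assumes [measurable]: "p \<in> borel_measurable borel" "\<And>k. g k \<in> borel_measurable borel" and p: "\<And>s. 0 \<le> p s"
    and s: "AE s in lborel. summable (\<lambda>k. \<bar>g k s\<bar>)"
    and b: "\<And>k. nconv (\<lambda>s. ennreal (p s)) (\<lambda>s. ennreal \<bar>g k s\<bar>) t \<le> ennreal (b k)" "summable b" "\<And>k. 0 \<le> b k"
  shows "conv p (\<lambda>s. \<Sum>k. g k s) t = (\<Sum>k. conv p (g k) t)"
proof -
  have fin: "nconv (nabs p) (\<lambda>s. ennreal \<bar>g k s\<bar>) t < \<infinity>" for k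
    using b(1)[of k] p by (simp add: order.strict_trans1)
  have i: "integrable lborel (\<lambda>s. p (t - s) * g k s)" for k by (rule conv_integrable) (use fin in auto)
  have "conv p (\<lambda>s. \<Sum>k. g k s) t = (LINT s|lborel. (\<Sum>k. p (t - s) * g k s))" unfolding conv_def
  proof (rule integral_cong_AE)
    show "AE s in lborel. p (t - s) * (\<Sum>k. g k s) = (\<Sum>k. p (t - s) * g k s)"
      using s by eventually_elim (simp add: suminf_mult summable_rabs_cancel)
  qed auto
  also have "... = (\<Sum>k. LINT s|lborel. p (t - s) * g k s)"
  proof (rule integral_suminf[OF i])
    show "AE s in lborel. summable (\<lambda>k. norm (p (t - s) * g k s))"
      using s by eventually_elim (simp add: abs_mult summable_mult)
    have "(LINT s|lborel. norm (p (t - s) * g k s)) \<le> b k" for k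
    proof -
      have "ennreal (LINT s|lborel. norm (p (t - s) * g k s)) = (\<integral>\<^sup>+s. ennreal (norm (p (t - s) * g k s)) \<partial>lborel)"
        using i[of k] by (intro nn_integral_eq_integral[symmetric]) auto
      also have "... = nconv (\<lambda>s. ennreal (p s)) (\<lambda>s. ennreal \<bar>g k s\<bar>) t"
        unfolding nconv_def using p by (intro nn_integral_cong) (simp add: abs_mult ennreal_mult)
      finally have "ennreal (LINT s|lborel. norm (p (t - s) * g k s)) \<le> ennreal (b k)" using b(1)[of k] by simp
      then show ?thesis by (subst (asm) ennreal_le_iff) (rule b(3))
    qed
    then show "summable (\<lambda>k. LINT s|lborel. norm (p (t - s) * g k s))"
      by (intro summable_comparison_test'[OF b(2), of 0]) auto
  qed
  finally show ?thesis by (simp add: conv_def)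
qed

lemma is_weak_deriv_iff:
  assumes "borel_rep T v g" "borel_rep T w h"
  shows "is_weak_deriv T v w \<longleftrightarrow>
    (\<forall>\<phi>\<in>test_functions {0<..<T}. (LINT t|lborel. g t * deriv \<phi> t) = - (LINT t|lborel. h t * \<phi> t))"
  unfolding is_weak_deriv_def
  using borel_rep_lint(1)[OF assms(1) test_function_measurable(2)] borel_rep_lint(1)[OF assms(2) test_function_measurable(1)]
  by auto

text \<open>Two weak derivatives have the same integrals against test functions; hence the arbitrary
  choice in \<open>weak_deriv\<close> may be replaced by an explicit one.\<close>

lemma weak_deriv_AE_eq:
  assumes T: "T > 0" and w: "integrable (lebesgue_on {0..T}) w" "is_weak_deriv T v w"
    and v: "borel_rep T v g"
  shows "AE t\<in>{0..T} in lborel. weak_deriv T v t = w t"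
proof -
  have d: "integrable (lebesgue_on {0..T}) (weak_deriv T v)" "is_weak_deriv T v (weak_deriv T v)"
    using someI[of "\<lambda>g. integrable (lebesgue_on {0..T}) g \<and> is_weak_deriv T v g" w] w unfolding weak_deriv_def by auto
  obtain h where h: "borel_rep T w h" using borel_rep_ex[of w T] w(1) by auto
  obtain k where k: "borel_rep T (weak_deriv T v) k" using borel_rep_ex[of _ T] d(1) by blast
  note hk = borel_rep_integrable[OF h, THEN iffD1, OF w(1)] borel_rep_integrable[OF k, THEN iffD1, OF d(1)]
  have "AE t in lborel. k t - h t = 0"
  proof (rule lint_zero_imp_AE_zero[of _ T])
    show "integrable lborel (\<lambda>t. k t - h t)" using hk by simp
    show "k t - h t = 0" if "t \<notin> {0<..T}" for t using that borel_repD(2)[OF h] borel_repD(2)[OF k] by simp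
    fix \<phi> :: "real \<Rightarrow> real" assume \<phi>: "\<phi> \<in> test_functions {0<..<T}"
    have bd: "integrable lborel (\<lambda>t. q t * \<phi> t)" if "integrable lborel q" for q
      using test_function_times_integrable[OF that \<phi>] .
    have "(LINT t|lborel. h t * \<phi> t) = (LINT t|lborel. k t * \<phi> t)"
      using w(2) d(2) \<phi> unfolding is_weak_deriv_iff[OF v h] is_weak_deriv_iff[OF v k] by simp
    then show "(LINT t|lborel. (k t - h t) * \<phi> t) = 0" using bd[OF hk(1)] bd[OF hk(2)] by (simp add: left_diff_distrib)
  qed
  then show ?thesis using borel_repD(3)[OF h] borel_repD(3)[OF k] by eventually_elim auto
qed

section \<open>Membership of the series solution in the Bochner spaces\<close>

context stokes_data
begin

abbreviation "unit_sq k \<equiv> ip (ei k) (ei k)"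

lemma unit_sq: "unit_sq k = 0 \<or> unit_sq k = 1" using SP.onB.unit[of k] VB.mem_zero by auto

lemma unit_sq_le: "x\<^sup>2 * (unit_sq k)\<^sup>2 \<le> x\<^sup>2" "\<bar>unit_sq k\<bar> \<le> 1" using unit_sq[of k] by auto

lemma sol_H: "good t \<Longrightarrow> sol t \<in> HH" by (rule V_H[OF sol_V])

lemma dev_H: "good t \<Longrightarrow> sol t - u0 \<in> HH" by (rule HB.mem_diff[OF sol_H u0])

lemma ei_H: "ei k \<in> HH" by (rule V_H[OF SP.eig_mem])

lemma dev_coeff: "good t \<Longrightarrow> ip (sol t - u0) (ei k) = (C k t - c0 k) * unit_sq k"
  using onH.coeff_unit[OF u0, of k]
  by (simp add: HB.diff_left[OF sol_H u0 ei_H] sol_coeff left_diff_distrib c0_def)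

lemma dev_sq_sums:
  assumes g: "good t"
  shows "(\<lambda>k. ((C k t - c0 k) * unit_sq k)\<^sup>2) sums (norm_L2 U (sol t - u0))\<^sup>2"
  using onH.parseval[OF dev_H[OF g] dev_H[OF g] H_expansion[OF dev_H[OF g]]]
  unfolding dev_coeff[OF g] norm_L2_eq_nrm HB.nrm_sq[OF dev_H[OF g]] unfolding power2_eq_square .

lemma sol_V_sums:
  assumes g: "good t"
  shows "(\<lambda>k. lam k * (C k t * unit_sq k)\<^sup>2) sums (norm_V U (sol t))\<^sup>2"
proof -
  have e: "sqrt (lam k) * x * (sqrt (lam k) * x) = lam k * x\<^sup>2" for k x
    using real_sqrt_mult_self[of "lam k"] by (simp add: power2_eq_square mult.assoc mult.left_commute[of _ x])
  show ?thesis using SP.onA.parseval[OF sol_V[OF g] sol_V[OF g] SP.eig_complete_A[OF sol_V[OF g]]]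
    unfolding SP.coeff_A[OF sol_V[OF g]] sol_coeff[OF g] norm_V_eq VA.nrm_sq[OF sol_V[OF g]] e .
qed

lemma sol_norm_V: "good t \<Longrightarrow> (norm_V U (sol t))\<^sup>2 \<le> (\<Sum>k. lam k * (C k t)\<^sup>2)"
  unfolding sums_unique[OF sol_V_sums]
proof (rule suminf_le)
  assume "good t"
  then show "summable (\<lambda>k. lam k * (C k t)\<^sup>2)" "summable (\<lambda>k. lam k * (C k t * unit_sq k)\<^sup>2)"
    using sums_summable[OF sol_V_sums] by (auto simp: good_def)
  show "lam k * (C k t * unit_sq k)\<^sup>2 \<le> lam k * (C k t)\<^sup>2" for k
    unfolding power_mult_distrib by (intro mult_left_mono unit_sq_le) simp
qed

lemma sol_nn_V: "(\<integral>\<^sup>+ t. ennreal (norm_V U (sol t) powr 2) \<partial>lebesgue_on {0..T}) < \<infinity>"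
proof -
  have "(\<integral>\<^sup>+ t. ennreal (norm_V U (sol t) powr 2) \<partial>lebesgue_on {0..T})
      \<le> (\<integral>\<^sup>+t. (\<Sum>k. ennreal (lam k * (C k t)\<^sup>2 * indicator {0..T} t)) \<partial>lborel)"
    unfolding nn_integral_lebesgue_on[OF borel_closed[OF closed_atLeastAtMost]]
  proof (rule nn_integral_mono_AE, use AE_good in eventually_elim)
    fix t assume g: "t \<in> {0..T} \<longrightarrow> good t"
    show "ennreal (norm_V U (sol t) powr 2) * indicator {0..T} t \<le> (\<Sum>k. ennreal (lam k * (C k t)\<^sup>2 * indicator {0..T} t))"
    proof (cases "t \<in> {0..T}")
      case True
      then have gt: "good t" using g by simp
      have "norm_V U (sol t) powr 2 = (norm_V U (sol t))\<^sup>2"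
        using VA.nrm_nonneg[OF sol_V[OF gt]] by (simp add: norm_V_eq)
      then have "ennreal (norm_V U (sol t) powr 2) \<le> ennreal (\<Sum>k. lam k * (C k t)\<^sup>2)"
        using sol_norm_V[OF gt] by (simp add: ennreal_leI)
      also have "... = (\<Sum>k. ennreal (lam k * (C k t)\<^sup>2))"
        using gt by (intro suminf_ennreal2[symmetric]) (auto simp: good_def)
      finally show ?thesis using True by simp
    qed simp
  qed
  also have "... \<le> ennreal (\<Sum>k. lam k * FD.bound_sq k)"
    by (rule nn_integral_series_le[OF _ C_sq_integral bound_sq_summable]) (auto simp: FD.bound_sq_nonneg)
  finally show ?thesis by (rule order.strict_trans1) simp
qed

lemma sol_Lp_V: "sol \<in> Lp_bochner 2 VV (norm_V U) T"
proof -
  have "bochner_measurable VV VA.nrm T sol"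
  proof (rule SP.onA.bochner_measurable_expansion[where c = "\<lambda>k t. sqrt (lam k) * C k t"])
    show "AE t in lebesgue_on {0..T}. sol t \<in> VV \<and>
       (\<forall>k. inner_V U (sol t) (SP.sc_eig k) = sqrt (lam k) * C k t * inner_V U (SP.sc_eig k) (SP.sc_eig k)) \<and>
       (\<lambda>n. VA.nrm (sol t - SP.onA.psum n (sol t))) \<longlonglongrightarrow> 0 \<and> (\<exists>B. \<forall>k. \<bar>sqrt (lam k) * C k t\<bar> \<le> B)"
      unfolding AE_time using AE_good
    proof (eventually_elim, intro impI conjI allI)
      fix t assume "t \<in> {0..T} \<longrightarrow> good t" "t \<in> {0..T}"
      then have g: "good t" by simp
      show "sol t \<in> VV" by (rule sol_V[OF g])
      show "(\<lambda>n. VA.nrm (sol t - SP.onA.psum n (sol t))) \<longlonglongrightarrow> 0" by (rule SP.eig_complete_A[OF sol_V[OF g]])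
      show "inner_V U (sol t) (SP.sc_eig k) = sqrt (lam k) * C k t * inner_V U (SP.sc_eig k) (SP.sc_eig k)" for k
        by (simp add: SP.coeff_A sol_V[OF g] sol_coeff[OF g] sc_eig_sq)
      have "bounded (range (\<lambda>k. lam k * (C k t)\<^sup>2))"
        using g summable_LIMSEQ_zero convergent_imp_bounded unfolding good_def by blast
      then obtain B where "\<And>k. lam k * (C k t)\<^sup>2 \<le> B" unfolding bounded_iff by fastforce
      then have "\<bar>sqrt (lam k) * C k t\<bar> \<le> sqrt B" for k
        using real_sqrt_le_mono[of "lam k * (C k t)\<^sup>2" B] by (simp add: real_sqrt_mult abs_mult)
      then show "\<exists>B. \<forall>k. \<bar>sqrt (lam k) * C k t\<bar> \<le> B" by blast
    qed
  qed measurable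
  then show ?thesis using sol_nn_V by (simp add: Lp_bochner_def norm_V_eq[abs_def])
qed

text \<open>Monotone convergence moves the convolution inside the sum, where the scalar bounds are
  summable. Both the weighted norm and the L-infinity condition rest on this.\<close>

lemma dev_nn:
  assumes "t \<le> T"
  shows "nconv (nkern (1 - al)) (\<lambda>s. \<Sum>k. ennreal ((C k s - c0 k)\<^sup>2) * indicator {0..T} s) t \<le> ennreal (\<Sum>k. bound_dev k)"
proof -
  have "nconv (nkern (1 - al)) (\<lambda>s. \<Sum>k. ennreal ((C k s - c0 k)\<^sup>2) * indicator {0..T} s) t
      = (\<Sum>k. nconv (nkern (1 - al)) (\<lambda>s. ennreal ((C k s - c0 k)\<^sup>2) * indicator {0..T} s) t)"
    unfolding nconv_def ennreal_suminf_cmult[symmetric] by (rule nn_integral_suminf) measurable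
  also have "... \<le> (\<Sum>k. ennreal (bound_dev k))"
    unfolding bound_dev_def by (intro suminf_le FD.sol_dev_sq assms) auto
  also have "... = ennreal (\<Sum>k. bound_dev k)" by (rule suminf_ennreal2[OF bound_dev_nonneg bound_dev_summable])
  finally show ?thesis .
qed

lemma dev_norm_le: "good t \<Longrightarrow> ennreal ((norm_L2 U (sol t - u0))\<^sup>2) \<le> (\<Sum>k. ennreal ((C k t - c0 k)\<^sup>2))"
proof -
  assume g: "good t"
  have "ennreal ((norm_L2 U (sol t - u0))\<^sup>2) = (\<Sum>k. ennreal (((C k t - c0 k) * unit_sq k)\<^sup>2))"
    using dev_sq_sums[OF g] by (simp add: suminf_ennreal2 sums_iff)
  also have "... \<le> (\<Sum>k. ennreal ((C k t - c0 k)\<^sup>2))"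
    by (intro suminf_le ennreal_leI) (auto simp: power_mult_distrib unit_sq_le)
  finally show ?thesis .
qed

text \<open>The weight is the kernel of J^{1-al} evaluated at T - s. The solution is split into its
  deviation from u0, covered by \<open>dev_nn\<close> at time T, and the constant u0, for which the
  kernel itself is integrable.\<close>

lemma sol_Lp_weighted: "sol \<in> Lp_bochner_weighted 2 (1 - al) HH (norm_L2 U) T"
proof -
  have "bochner_measurable HH HB.nrm T sol"
  proof (rule onH.bochner_measurable_expansion[where c = "\<lambda>k t. C k t * unit_sq k"])
    show "AE t in lebesgue_on {0..T}. sol t \<in> HH \<and> (\<forall>k. ip (sol t) (ei k) = C k t * unit_sq k * unit_sq k) \<and>
       (\<lambda>n. HB.nrm (sol t - onH.psum n (sol t))) \<longlonglongrightarrow> 0 \<and> (\<exists>B. \<forall>k. \<bar>C k t * unit_sq k\<bar> \<le> B)"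
      unfolding AE_time using AE_good
    proof (eventually_elim, intro impI conjI allI)
      fix t assume "t \<in> {0..T} \<longrightarrow> good t" "t \<in> {0..T}"
      then have g: "good t" by simp
      show "sol t \<in> HH" by (rule sol_H[OF g])
      show "(\<lambda>n. HB.nrm (sol t - onH.psum n (sol t))) \<longlonglongrightarrow> 0" by (rule H_expansion[OF sol_H[OF g]])
      show "ip (sol t) (ei k) = C k t * unit_sq k * unit_sq k" for k
        using sol_coeff[OF g, of k] unit_sq[of k] by auto
      have "\<bar>C k t * unit_sq k\<bar> \<le> HB.nrm (sol t)" for k
      proof -
        have "HB.nrm (ei k) \<le> 1" using unit_sq[of k] by (auto simp: HB.nrm_def)
        then have "HB.nrm (sol t) * HB.nrm (ei k) \<le> HB.nrm (sol t) * 1" by (intro mult_left_mono HB.nrm_nonneg sol_H[OF g])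
        then show ?thesis using HB.cauchy_schwarz[OF sol_H[OF g] ei_H, of k] by (simp add: sol_coeff[OF g])
      qed
      then show "\<exists>B. \<forall>k. \<bar>C k t * unit_sq k\<bar> \<le> B" by blast
    qed
  qed measurable
  moreover have "(\<integral>\<^sup>+ s. ennreal ((T - s) powr (1 - al - 1) / Gamma (1 - al) * norm_L2 U (sol s) powr 2) \<partial>lebesgue_on {0..T}) < \<infinity>"
  proof -
    let ?S = "\<lambda>s. \<Sum>k. ennreal ((C k s - c0 k)\<^sup>2) * indicator {0..T} s"
    have "(\<integral>\<^sup>+ s. ennreal ((T - s) powr (1 - al - 1) / Gamma (1 - al) * norm_L2 U (sol s) powr 2) \<partial>lebesgue_on {0..T})
        \<le> nconv (nkern (1 - al)) (\<lambda>s. ennreal 2 * ?S s + ennreal (2 * (norm_L2 U u0)\<^sup>2) * nkern 1 s) T"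
      unfolding nn_integral_lebesgue_on[OF borel_closed[OF closed_atLeastAtMost]] nconv_def
    proof (rule nn_integral_mono_AE, use AE_good AE_lborel_singleton[of 0] AE_lborel_singleton[of T] in eventually_elim)
      fix s assume g: "s \<in> {0..T} \<longrightarrow> good s" "s \<noteq> 0" "s \<noteq> T"
      show "ennreal ((T - s) powr (1 - al - 1) / Gamma (1 - al) * norm_L2 U (sol s) powr 2) * indicator {0..T} s
          \<le> nkern (1 - al) (T - s) * (ennreal 2 * ?S s + ennreal (2 * (norm_L2 U u0)\<^sup>2) * nkern 1 s)"
      proof (cases "s \<in> {0..T}")
        case True
        then have gs: "good s" using g by simp
        have n: "0 \<le> norm_L2 U (sol s)" "0 \<le> norm_L2 U (sol s - u0)" using HB.nrm_nonneg[OF sol_H[OF gs]] HB.nrm_nonneg[OF dev_H[OF gs]] by (simp_all add: norm_L2_eq_nrm)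
        have "norm_L2 U (sol s) \<le> norm_L2 U (sol s - u0) + norm_L2 U u0"
          using HB.nrm_triangle[OF dev_H[OF gs] u0] by (simp add: norm_L2_eq_nrm)
        then have "(norm_L2 U (sol s))\<^sup>2 \<le> (norm_L2 U (sol s - u0) + norm_L2 U u0)\<^sup>2" using n(1) by (rule power_mono)
        also have "... \<le> 2 * (norm_L2 U (sol s - u0))\<^sup>2 + 2 * (norm_L2 U u0)\<^sup>2" by (rule square_sum_le)
        finally have "ennreal (norm_L2 U (sol s) powr 2) \<le> ennreal (2 * (norm_L2 U (sol s - u0))\<^sup>2 + 2 * (norm_L2 U u0)\<^sup>2)"
          using n by (intro ennreal_leI) simp
        also have "... = ennreal 2 * ennreal ((norm_L2 U (sol s - u0))\<^sup>2) + ennreal (2 * (norm_L2 U u0)\<^sup>2)"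
          by (simp add: ennreal_mult)
        also have "... \<le> ennreal 2 * ?S s + ennreal (2 * (norm_L2 U u0)\<^sup>2) * nkern 1 s"
          using True g(2) dev_norm_le[OF gs] by (intro add_mono mult_left_mono) (auto simp: kern_1)
        finally have "nkern (1 - al) (T - s) * ennreal (norm_L2 U (sol s) powr 2) \<le> nkern (1 - al) (T - s) * (ennreal 2 * ?S s + ennreal (2 * (norm_L2 U u0)\<^sup>2) * nkern 1 s)"
          by (rule mult_left_mono) simp
        moreover have "ennreal ((T - s) powr (1 - al - 1) / Gamma (1 - al) * norm_L2 U (sol s) powr 2) = nkern (1 - al) (T - s) * ennreal (norm_L2 U (sol s) powr 2)"
          using True g alpha by (subst ennreal_mult[symmetric]) (auto simp: kern_nonneg, simp add: kern_def)
        ultimately show ?thesis using True by simp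
      qed simp
    qed
    also have "... = ennreal 2 * nconv (nkern (1 - al)) ?S T + ennreal (2 * (norm_L2 U u0)\<^sup>2) * nconv (nkern (1 - al)) (nkern 1) T"
    proof -
      have k: "nkern (1 - al) \<in> borel_measurable borel" "nkern 1 \<in> borel_measurable borel" by measurable
      have S: "?S \<in> borel_measurable borel" by measurable
      show ?thesis
        by (simp only: nconv_add_right[OF k(1) borel_measurable_times_ennreal[OF borel_measurable_const S]
              borel_measurable_times_ennreal[OF borel_measurable_const k(2)]] nconv_cmult_right[OF k(1) S] nconv_cmult_right[OF k])
    qed
    also have "... < \<infinity>"
    proof -
      have "nconv (nkern (1 - al)) ?S T < \<infinity>" by (rule order.strict_trans1[OF dev_nn[OF order_refl]]) simp
      moreover have "nconv (nkern (1 - al)) (nkern 1) T < \<infinity>" using nconv_kern[of "1 - al" 1 T] alpha by simp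
      ultimately show ?thesis by (simp only: infinity_ennreal_def ennreal_add_less_top ennreal_mult_less_top ennreal_less_top) simp
    qed
    finally show ?thesis .
  qed
  ultimately show ?thesis by (simp add: Lp_bochner_weighted_def norm_L2_eq_nrm[abs_def])
qed

lemma sol_Linfty: "RL_integral (1 - al) (\<lambda>t. (norm_L2 U (sol t - u0))\<^sup>2) \<in> Linfty T"
proof -
  define g where "g t = indicator {0<..T} t * (\<Sum>k. ((C k t - c0 k) * unit_sq k)\<^sup>2)" for t
  have [measurable]: "g \<in> borel_measurable borel" unfolding g_def by measurable
  have rep: "borel_rep T (\<lambda>t. (norm_L2 U (sol t - u0))\<^sup>2) g" unfolding borel_rep_def
  proof (intro conjI allI impI)
    show "AE t\<in>{0..T} in lborel. (norm_L2 U (sol t - u0))\<^sup>2 = g t" using AE_good AE_lborel_singleton[of 0]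
      by eventually_elim (auto simp: g_def sums_unique[OF dev_sq_sums])
  qed (auto simp: g_def)
  let ?R = "RL_integral (1 - al) (\<lambda>t. (norm_L2 U (sol t - u0))\<^sup>2)"
  have R: "?R t = conv (kern (1 - al)) g t" if "t \<in> {0..T}" for t
    using that by (intro borel_rep_RL_integral[OF rep]) auto
  have "(\<lambda>t. conv (kern (1 - al)) g t) \<in> borel_measurable borel" by measurable
  then have "(\<lambda>t. conv (kern (1 - al)) g t) \<in> borel_measurable (lebesgue_on {0..T})"
    by (intro measurable_restrict_space1 measurable_completion) simp
  then have m: "?R \<in> borel_measurable (lebesgue_on {0..T})"
    by (rule measurable_cong[THEN iffD1, rotated]) (simp add: R)
  have gle: "AE s in lborel. ennreal \<bar>g s\<bar> \<le> (\<Sum>k. ennreal ((C k s - c0 k)\<^sup>2) * indicator {0..T} s)"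
    using AE_good
  proof eventually_elim
    fix s assume gd: "s \<in> {0..T} \<longrightarrow> good s"
    show "ennreal \<bar>g s\<bar> \<le> (\<Sum>k. ennreal ((C k s - c0 k)\<^sup>2) * indicator {0..T} s)"
    proof (cases "s \<in> {0<..T}")
      case True
      then have gs: "good s" using gd by simp
      have "g s = (norm_L2 U (sol s - u0))\<^sup>2"
        using True unfolding g_def sums_unique[OF dev_sq_sums[OF gs]] by simp
      then have "ennreal \<bar>g s\<bar> \<le> (\<Sum>k. ennreal ((C k s - c0 k)\<^sup>2))" using dev_norm_le[OF gs] by (simp only:) simp
      then show ?thesis using True by simp
    qed (simp add: g_def)
  qed
  have "\<bar>?R t\<bar> \<le> (\<Sum>k. bound_dev k)" if "t \<in> {0..T}" for t unfolding R[OF that]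
  proof (rule conv_abs_le)
    have "nconv (\<lambda>s. ennreal \<bar>kern (1 - al) s\<bar>) (nabs g) t
        \<le> nconv (nkern (1 - al)) (\<lambda>s. \<Sum>k. ennreal ((C k s - c0 k)\<^sup>2) * indicator {0..T} s) t"
      unfolding nconv_def
      by (rule nn_integral_mono_AE, use gle in eventually_elim) (use alpha in \<open>auto simp: kern_nonneg intro: mult_left_mono\<close>)
    also have "... \<le> ennreal (\<Sum>k. bound_dev k)" using that by (intro dev_nn) auto
    finally show "nconv (\<lambda>s. ennreal \<bar>kern (1 - al) s\<bar>) (nabs g) t \<le> ennreal (\<Sum>k. bound_dev k)" .
  qed (auto intro: suminf_nonneg bound_dev_summable bound_dev_nonneg)
  then have "AE t in lebesgue_on {0..T}. \<bar>?R t\<bar> \<le> (\<Sum>k. bound_dev k)" by (intro AE_I2) simp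
  then show ?thesis using m unfolding Linfty_def by blast
qed

end

text \<open>The weight l will be an eigenvalue, so that one square is measured in V and the other in
  V'.\<close>

lemma young_scaled: "0 < l \<Longrightarrow> \<bar>x * y\<bar> \<le> l * x\<^sup>2 + (y :: real)\<^sup>2 / l"
proof -
  assume l: "0 < l"
  have "0 \<le> (l * \<bar>x\<bar> - \<bar>y\<bar>)\<^sup>2 / l" using l by simp
  also have "... = l * x\<^sup>2 + y\<^sup>2 / l - 2 * \<bar>x * y\<bar>"
    using l by (simp add: power2_diff power_mult_distrib abs_mult diff_divide_distrib add_divide_distrib) (simp add: power2_eq_square)
  finally show ?thesis using abs_ge_zero[of "x * y"] by linarith
qed

section \<open>The equation tested with a fixed element of V\<close>

context stokes_data
begin

context
  fixes \<eta> assumes \<eta>: "\<eta> \<in> VV"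
begin

abbreviation (input) "et k \<equiv> ip \<eta> (ei k)"

lemma et_unit: "unit_sq k * et k = et k" using SP.onB.coeff_unit[OF \<eta>, of k] by (simp add: mult.commute)

lemma et_unit': "x * unit_sq k * et k = et k * x" unfolding mult.assoc et_unit by (rule mult.commute)

text \<open>This series and \<open>rhs_ser\<close> below are the Borel representatives of the two
  tested functions: the deviation from u0 paired with \<eta>, and the right-hand side minus the
  viscous term.\<close>

definition dev_ser :: "real \<Rightarrow> real" where
  "dev_ser t = (\<Sum>k. et k * ((C k t - c0 k) * indicator {0..T} t))"

definition rhs_ser :: "real \<Rightarrow> real" where "rhs_ser t = (\<Sum>k. et k * h k t)"

lemma dev_ser_measurable [measurable]: "dev_ser \<in> borel_measurable borel" unfolding dev_ser_def by measurable

lemma rhs_ser_measurable [measurable]: "rhs_ser \<in> borel_measurable borel" unfolding rhs_ser_def by measurable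

lemma dev_ser_rep: "borel_rep T (\<lambda>t. ip (sol t - u0) \<eta>) dev_ser" unfolding borel_rep_def
proof (intro conjI allI impI)
  show "dev_ser t = 0" if "t \<notin> {0<..T}" for t using that by (cases "t = 0") (auto simp: dev_ser_def FD.sol_0)
  show "AE t\<in>{0..T} in lborel. ip (sol t - u0) \<eta> = dev_ser t" using AE_good
  proof (eventually_elim, intro impI)
    fix t assume "t \<in> {0..T} \<longrightarrow> good t" and t: "t \<in> {0..T}"
    then have g: "good t" by simp
    have "(\<lambda>k. et k * (C k t - c0 k)) sums ip (sol t - u0) \<eta>"
      using onH.parseval[OF dev_H[OF g] V_H[OF \<eta>] H_expansion[OF dev_H[OF g]]] unfolding dev_coeff[OF g] et_unit' .
    then show "ip (sol t - u0) \<eta> = dev_ser t" using t by (simp add: dev_ser_def sums_unique)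
  qed
qed measurable

text \<open>Young's inequality with weight \<open>lam k\<close> separates the squared V-coefficients
  of \<eta> from the squared derivatives divided by \<open>lam k\<close>; both are summable.\<close>

lemma abs_rhs_term: "(\<integral>\<^sup>+s. ennreal \<bar>et k * h k s\<bar> \<partial>lborel) \<le> ennreal (T * (lam k * (et k)\<^sup>2) + FD.bound_rhs k / lam k)"
proof -
  have "(\<integral>\<^sup>+s. ennreal \<bar>et k * h k s\<bar> \<partial>lborel)
      \<le> (\<integral>\<^sup>+s. ennreal (lam k * (et k)\<^sup>2) * indicator {0..T} s + ennreal (1 / lam k) * ennreal ((h k s)\<^sup>2) \<partial>lborel)"
  proof (rule nn_integral_mono)
    fix s
    show "ennreal \<bar>et k * h k s\<bar> \<le> ennreal (lam k * (et k)\<^sup>2) * indicator {0..T} s + ennreal (1 / lam k) * ennreal ((h k s)\<^sup>2)"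
    proof (cases "s \<in> {0..T}")
      case True
      have "ennreal \<bar>et k * h k s\<bar> \<le> ennreal (lam k * (et k)\<^sup>2 + (1 / lam k) * (h k s)\<^sup>2)"
        using young_scaled[OF lam_pos[of k], of "et k" "h k s"] by (intro ennreal_leI) simp
      also have "... = ennreal (lam k * (et k)\<^sup>2) + ennreal (1 / lam k) * ennreal ((h k s)\<^sup>2)"
        by (subst ennreal_mult[symmetric]) simp_all
      finally show ?thesis using True by simp
    qed (auto simp: FD.rhs_def)
  qed
  also have "... = ennreal (lam k * (et k)\<^sup>2) * emeasure lborel {0..T} + ennreal (1 / lam k) * (\<integral>\<^sup>+s. ennreal ((h k s)\<^sup>2) \<partial>lborel)"
    by (subst nn_integral_add) (simp_all add: nn_integral_cmult)
  also have "... \<le> ennreal (lam k * (et k)\<^sup>2) * ennreal T + ennreal (1 / lam k) * ennreal (FD.bound_rhs k)"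
    using T by (intro add_mono mult_left_mono FD.nn_rhs_sq) (auto simp: emeasure_lborel_Icc_eq)
  also have "... = ennreal (lam k * (et k)\<^sup>2 * T + 1 / lam k * FD.bound_rhs k)"
    using T FD.bound_rhs_nonneg[of k] by (intro ennreal_lincomb) auto
  finally show ?thesis by (simp add: mult.commute)
qed

lemma rhs_bound: "summable (\<lambda>k. T * (lam k * (et k)\<^sup>2) + FD.bound_rhs k / lam k)"
  "0 \<le> T * (lam k * (et k)\<^sup>2) + FD.bound_rhs k / lam k"
  using T FD.bound_rhs_nonneg[of k] by (auto intro!: summable_add summable_mult coeff_summable[OF \<eta>] bound_rhs_summable)

lemma AE_rhs_summable: "AE s in lborel. summable (\<lambda>k. \<bar>et k * h k s\<bar>)"
  by (rule AE_summable[OF _ abs_rhs_term rhs_bound]) auto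

lemma rhs_ser_rep: "borel_rep T (\<lambda>t. f t \<eta> - \<nu> * inner_V U (sol t) \<eta>) rhs_ser" unfolding borel_rep_def
proof (intro conjI allI impI)
  show "rhs_ser t = 0" if "t \<notin> {0<..T}" for t
  proof -
    have "h k t = 0" for k by (simp add: FD.rhs_def that del: greaterThanAtMost_iff)
    then show ?thesis by (simp add: rhs_ser_def)
  qed
  show "AE t\<in>{0..T} in lborel. f t \<eta> - \<nu> * inner_V U (sol t) \<eta> = rhs_ser t"
    using AE_good f_dual Fm_eq AE_lborel_singleton[of 0]
  proof (eventually_elim, intro impI)
    fix t assume a: "t \<in> {0..T} \<longrightarrow> good t" "t \<in> {0..T} \<longrightarrow> f t \<in> V_dual U" "t \<in> {0..T} \<longrightarrow> (\<forall>k. Fm k t = f t (ei k))" "t \<noteq> 0"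
      and t: "t \<in> {0..T}"
    then have g: "good t" and d: "f t \<in> V_dual U" and F: "\<And>k. Fm k t = f t (ei k)" by auto
    have r: "sqrt (lam k) * (C k t * unit_sq k) * (sqrt (lam k) * et k) = et k * (lam k * C k t)" for k
    proof -
      have "sqrt (lam k) * (C k t * unit_sq k) * (sqrt (lam k) * et k) = (sqrt (lam k) * sqrt (lam k)) * C k t * (unit_sq k * et k)"
        by (simp only: mult_ac)
      then show ?thesis unfolding et_unit by simp
    qed
    have "(\<lambda>k. et k * (lam k * C k t)) sums inner_V U (sol t) \<eta>"
      using SP.onA.parseval[OF sol_V[OF g] \<eta> SP.eig_complete_A[OF sol_V[OF g]]]
      unfolding SP.coeff_A[OF sol_V[OF g]] SP.coeff_A[OF \<eta>] sol_coeff[OF g] r .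
    from sums_diff[OF dual_expansion[OF d \<eta>] sums_mult[OF this, of \<nu>]]
    have "(\<lambda>k. et k * f t (ei k) - \<nu> * (et k * (lam k * C k t))) sums (f t \<eta> - \<nu> * inner_V U (sol t) \<eta>)" .
    moreover have "et k * f t (ei k) - \<nu> * (et k * (lam k * C k t)) = et k * h k t" for k
      using t \<open>t \<noteq> 0\<close> by (simp add: FD.rhs_eq F algebra_simps)
    ultimately show "f t \<eta> - \<nu> * inner_V U (sol t) \<eta> = rhs_ser t" by (simp add: rhs_ser_def sums_unique)
  qed
qed measurable

lemma rhs_term_integrable: "integrable lborel (\<lambda>s. et k * h k s)"
  using order.strict_trans1[OF abs_rhs_term[of k]] by (intro integrableI_bounded) auto

lemma rhs_ser_integrable: "integrable lborel rhs_ser" unfolding rhs_ser_def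
proof (rule integrable_suminf[OF rhs_term_integrable])
  show "AE s in lborel. summable (\<lambda>k. norm (et k * h k s))" using AE_rhs_summable by simp
  have "(LINT s|lborel. norm (et k * h k s)) \<le> T * (lam k * (et k)\<^sup>2) + FD.bound_rhs k / lam k" for k
  proof -
    have "ennreal (LINT s|lborel. norm (et k * h k s)) = (\<integral>\<^sup>+s. ennreal (norm (et k * h k s)) \<partial>lborel)"
      using rhs_term_integrable[of k] by (intro nn_integral_eq_integral[symmetric]) auto
    also have "... \<le> ennreal (T * (lam k * (et k)\<^sup>2) + FD.bound_rhs k / lam k)" using abs_rhs_term[of k] by simp
    finally show ?thesis by (subst (asm) ennreal_le_iff) (rule rhs_bound)
  qed
  then show "summable (\<lambda>k. LINT s|lborel. norm (et k * h k s))"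
    by (intro summable_comparison_test'[OF rhs_bound(1), of 0]) auto
qed

text \<open>Termwise this is \<open>FD.conv_sol_dev\<close>. Exchanging sum and convolution on the
  left uses a majorant constant in time, which the Hoelder estimate of the deviation provides, and
  on the right the integrals bounded in \<open>abs_rhs_term\<close>.\<close>

lemma conv_dev_rhs:
  assumes t: "t \<le> T"
  shows "conv (kern (1 - al)) dev_ser t = conv (kern 1) rhs_ser t"
proof -
  let ?g = "\<lambda>k s. et k * ((C k s - c0 k) * indicator {0..T} s)"
  let ?m = "\<lambda>k. lam k * (et k)\<^sup>2 + kap * (FD.bound_rhs k / lam k)"
  have m: "summable ?m" by (intro summable_add summable_mult coeff_summable[OF \<eta>] bound_rhs_summable)
  have m0: "0 \<le> ?m k" for k using kap_nonneg FD.bound_rhs_nonneg[of k] by simp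
  have le: "\<bar>?g k s\<bar> \<le> ?m k * kern 1 s" for k s
  proof (cases "s \<in> {0<..T}")
    case True
    then show ?thesis
      using young_scaled[OF lam_pos[of k], of "et k" "C k s - c0 k"] C_dev_sq[of s k] by (simp add: kern_1)
  next
    case False
    then show ?thesis using m0[of k] by (cases "s = 0") (auto simp: FD.sol_0 indicator_def kern_1)
  qed
  have a0: "1 - al > 0" using alpha by simp
  have "conv (kern (1 - al)) dev_ser t = (\<Sum>k. conv (kern (1 - al)) (?g k) t)" unfolding dev_ser_def
  proof (rule conv_suminf)
    show "AE s in lborel. summable (\<lambda>k. \<bar>?g k s\<bar>)"
      using le by (intro AE_I2 summable_comparison_test'[OF summable_mult2[OF m], of 0]) (simp add: abs_mult)
    show "nconv (nkern (1 - al)) (\<lambda>s. ennreal \<bar>?g k s\<bar>) t \<le> ennreal (?m k * kern (2 - al) T)" for k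
    proof -
      have "nconv (nkern (1 - al)) (\<lambda>s. ennreal \<bar>?g k s\<bar>) t \<le> nconv (nkern (1 - al)) (\<lambda>s. ennreal (?m k) * nkern 1 s) t"
      proof (intro nconv_mono order_refl)
        fix s have "ennreal \<bar>?g k s\<bar> \<le> ennreal (?m k * kern 1 s)" by (rule ennreal_leI[OF le])
        then show "ennreal \<bar>?g k s\<bar> \<le> ennreal (?m k) * nkern 1 s" using m0[of k] by (simp only: ennreal_mult kern_nonneg zero_less_one)
      qed
      also have "... = ennreal (?m k) * nconv (nkern (1 - al)) (nkern 1) t" by (rule nconv_cmult_right) measurable
      also have "... = ennreal (?m k) * nkern (2 - al) t" using nconv_kern[OF a0 zero_less_one, of t] by simp
      also have "... \<le> ennreal (?m k) * nkern (2 - al) T" using t alpha by (intro mult_left_mono ennreal_leI kern_mono) auto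
      also have "... = ennreal (?m k * kern (2 - al) T)" using m0[of k] alpha by (simp only: ennreal_mult kern_nonneg)
      finally show ?thesis .
    qed
    show "summable (\<lambda>k. ?m k * kern (2 - al) T)" by (rule summable_mult2[OF m])
    show "0 \<le> ?m k * kern (2 - al) T" for k using m0[of k] alpha by (intro mult_nonneg_nonneg kern_nonneg) auto
    show "0 \<le> kern (1 - al) s" for s using a0 by (rule kern_nonneg)
  qed measurable
  also have "... = (\<Sum>k. conv (kern 1) (\<lambda>s. et k * h k s) t)"
  proof (rule suminf_cong)
    fix k
    have sc: "conv p (\<lambda>s. et k * q s) t = et k * conv p q t" for p q
      unfolding conv_def by (simp add: mult.left_commute flip: integral_mult_right_zero)
    show "conv (kern (1 - al)) (?g k) t = conv (kern 1) (\<lambda>s. et k * h k s) t"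
      unfolding sc FD.conv_sol_dev[OF t] ..
  qed
  also have "... = conv (kern 1) rhs_ser t" unfolding rhs_ser_def
  proof (rule conv_suminf[symmetric])
    show "nconv (nkern 1) (\<lambda>s. ennreal \<bar>et k * h k s\<bar>) t \<le> ennreal (T * (lam k * (et k)\<^sup>2) + FD.bound_rhs k / lam k)" for k
    proof -
      have "nconv (nkern 1) (\<lambda>s. ennreal \<bar>et k * h k s\<bar>) t \<le> (\<integral>\<^sup>+s. 1 * ennreal \<bar>et k * h k s\<bar> \<partial>lborel)"
        unfolding nconv_def by (intro nn_integral_mono mult_right_mono nkern_1_le) simp
      then show ?thesis using abs_rhs_term[of k] by simp
    qed
  qed (use AE_rhs_summable rhs_bound in \<open>auto intro: kern_nonneg\<close>)
  finally show ?thesis .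
qed

text \<open>J^{1-al} of the tested deviation is the primitive of \<open>rhs_ser\<close>, so its weak
  derivative is f \<eta> minus the viscous term, and both claims follow.\<close>

lemma sol_equation:
  "RL_integral (1 - al) (\<lambda>t. ip (sol t - u0) \<eta>) \<in> W11 T \<and>
   (AE t in lebesgue_on {0..T}.
      RL_deriv T al (\<lambda>t. ip (sol t - u0) \<eta>) t + \<nu> * inner_V U (sol t) \<eta> = f t \<eta>)"
proof -
  let ?R = "RL_integral (1 - al) (\<lambda>t. ip (sol t - u0) \<eta>)"
  let ?w = "\<lambda>t. f t \<eta> - \<nu> * inner_V U (sol t) \<eta>"
  let ?J = "\<lambda>t. indicator {0<..T} t * conv (kern 1) rhs_ser t"
  have rep: "borel_rep T ?R ?J" unfolding borel_rep_def
  proof (intro conjI allI impI)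
    have "?R t = ?J t" if "t \<in> {0..T}" "t \<noteq> 0" for t
      using that borel_rep_RL_integral[OF dev_ser_rep, of t "1 - al"] conv_dev_rhs[of t] by simp
    then show "AE t\<in>{0..T} in lborel. ?R t = ?J t"
      using AE_lborel_singleton[of 0] by (auto elim!: eventually_mono)
  qed auto
  have Ji: "integrable lborel ?J"
    by (rule indicator_conv_integrable) (use rhs_ser_integrable borel_repD(2)[OF rhs_ser_rep] in auto)
  have wi: "integrable (lebesgue_on {0..T}) ?w" by (rule borel_rep_integrable[OF rhs_ser_rep, THEN iffD2, OF rhs_ser_integrable])
  have wd: "is_weak_deriv T ?R ?w" unfolding is_weak_deriv_iff[OF rep rhs_ser_rep]
    using primitive_weak_deriv[OF rhs_ser_integrable borel_repD(2)[OF rhs_ser_rep]] by blast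
  have "?R \<in> W11 T" unfolding W11_def using borel_rep_integrable[OF rep, THEN iffD2, OF Ji] wi wd by blast
  moreover have "AE t\<in>{0..T} in lborel. weak_deriv T ?R t = ?w t" by (rule weak_deriv_AE_eq[OF T wi wd rep])
  then have "AE t in lebesgue_on {0..T}. RL_deriv T al (\<lambda>t. ip (sol t - u0) \<eta>) t + \<nu> * inner_V U (sol t) \<eta> = f t \<eta>"
    unfolding AE_time RL_deriv_def by eventually_elim simp
  ultimately show ?thesis ..
qed

end

section \<open>Continuity in the dual space and the initial value\<close>

lemma inner_L2_dual:
  assumes v: "v \<in> HH" shows "ip v \<in> V_dual U" unfolding V_dual_def
proof (intro CollectI conjI ballI allI exI)
  fix p q :: "real^'n \<Rightarrow> real^'n" and a b assume "p \<in> VV" "q \<in> VV"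
  then have "ip v (a *\<^sub>R p + b *\<^sub>R q) = a * ip v p + b * ip v q"
    using v by (simp add: HB.add_right HB.scale_right HB.mem_scale V_H)
  moreover have "a *\<^sub>R p + b *\<^sub>R q = (\<lambda>x. a *\<^sub>R p x + b *\<^sub>R q x)" by (simp add: fun_eq_iff)
  ultimately show "ip v (\<lambda>x. a *\<^sub>R p x + b *\<^sub>R q x) = a * ip v p + b * ip v q" by simp
next
  fix p assume p: "p \<in> VV"
  have "\<bar>ip v p\<bar> \<le> HB.nrm v * HB.nrm p" by (rule HB.cauchy_schwarz[OF v V_H[OF p]])
  also have "... \<le> HB.nrm v * (sqrt pc * norm_V U p)"
    using L2_nrm_le_V[OF p] v by (intro mult_left_mono) (auto simp: norm_V_eq)
  finally show "\<bar>ip v p\<bar> \<le> (HB.nrm v * sqrt pc) * norm_V U p" by (simp add: mult.assoc)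
qed

text \<open>Cauchy-Schwarz after distributing sqrt (\<open>lam k\<close>) to the coefficients of
  \<eta> and its inverse to \<open>d\<close>. The weighted l2 norm of \<open>d\<close> thus bounds
  the V' norm of the functional.\<close>

lemma series_abs_summable:
  assumes "summable (\<lambda>k. (d k)\<^sup>2 / lam k)" "\<eta> \<in> VV"
  shows "summable (\<lambda>k. ip \<eta> (ei k) * d k)"
    and "\<bar>\<Sum>k. ip \<eta> (ei k) * d k\<bar> \<le> sqrt (\<Sum>k. (d k)\<^sup>2 / lam k) * norm_V U \<eta>"
proof -
  let ?x = "\<lambda>k. sqrt (lam k) * ip \<eta> (ei k)" and ?y = "\<lambda>k. d k / sqrt (lam k)"
  have x2: "(?x k)\<^sup>2 = lam k * (ip \<eta> (ei k))\<^sup>2" for k by (simp add: power_mult_distrib)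
  have y2: "(?y k)\<^sup>2 = (d k)\<^sup>2 / lam k" for k by (simp add: power_divide)
  have xy: "?x k * ?y k = ip \<eta> (ei k) * d k" for k by simp
  have x: "summable (\<lambda>k. (?x k)\<^sup>2)" unfolding x2 by (rule coeff_summable[OF assms(2)])
  have y: "summable (\<lambda>k. (?y k)\<^sup>2)" unfolding y2 by (rule assms(1))
  show "summable (\<lambda>k. ip \<eta> (ei k) * d k)"
    using summable_rabs_cancel[OF summable_product[OF x y]] unfolding xy .
  have "\<bar>\<Sum>k. ip \<eta> (ei k) * d k\<bar> \<le> sqrt (\<Sum>k. lam k * (ip \<eta> (ei k))\<^sup>2) * sqrt (\<Sum>k. (d k)\<^sup>2 / lam k)"
    using suminf_product_le[OF x y] unfolding xy x2 y2 .
  also have "... \<le> norm_V U \<eta> * sqrt (\<Sum>k. (d k)\<^sup>2 / lam k)"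
    using coeff_suminf_le[OF assms(2)] VA.nrm_nonneg[OF assms(2)] assms(1)
    by (intro mult_right_mono real_le_lsqrt) (auto simp: norm_V_eq intro: suminf_nonneg)
  finally show "\<bar>\<Sum>k. ip \<eta> (ei k) * d k\<bar> \<le> sqrt (\<Sum>k. (d k)\<^sup>2 / lam k) * norm_V U \<eta>" by (simp add: mult.commute)
qed

lemma series_dual:
  assumes d: "summable (\<lambda>k. (d k)\<^sup>2 / lam k)"
  shows "(\<lambda>\<eta>. \<Sum>k. ip \<eta> (ei k) * d k) \<in> V_dual U" unfolding V_dual_def
proof (intro CollectI conjI ballI allI exI)
  fix p q :: "real^'n \<Rightarrow> real^'n" and a b assume p: "p \<in> VV" and q: "q \<in> VV"
  have "(\<lambda>x. a *\<^sub>R p x + b *\<^sub>R q x) = a *\<^sub>R p + b *\<^sub>R q" by (simp add: fun_eq_iff)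
  then have "ip (\<lambda>x. a *\<^sub>R p x + b *\<^sub>R q x) (ei k) * d k = a * (ip p (ei k) * d k) + b * (ip q (ei k) * d k)" for k
    using p q by (simp add: VB.add_left VB.scale_left VB.mem_scale SP.eig_mem algebra_simps)
  then show "(\<Sum>k. ip (\<lambda>x. a *\<^sub>R p x + b *\<^sub>R q x) (ei k) * d k)
      = a * (\<Sum>k. ip p (ei k) * d k) + b * (\<Sum>k. ip q (ei k) * d k)"
    using series_abs_summable(1)[OF d p] series_abs_summable(1)[OF d q]
    by (simp add: suminf_add[symmetric] suminf_mult summable_mult)
qed (rule series_abs_summable(2)[OF d])

text \<open>The continuous representative in V'. The series converges at every time of [0,T], since
  it needs only the squares of the coefficients divided by \<open>lam k\<close> to be summable,
  whereas \<open>sol\<close> is meaningful only at \<open>good\<close> times.\<close>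

definition wrep :: "real \<Rightarrow> (real^'n \<Rightarrow> real^'n) \<Rightarrow> real" where
  "wrep t \<eta> = (\<Sum>k. ip \<eta> (ei k) * C k t)"

lemma C_summable:
  assumes t: "t \<in> {0..T}" shows "summable (\<lambda>k. (C k t)\<^sup>2 / lam k)"
proof (rule summable_comparison_test')
  have "summable (\<lambda>k. (c0 k)\<^sup>2 / lam k)" unfolding c0_def using dual_bessel[OF inner_L2_dual[OF u0]]
    by (intro summableI_nonneg_bounded[where x = "(norm_V_dual U (ip u0))\<^sup>2"]) auto
  then show "summable (\<lambda>k. 2 * (kap * (FD.bound_rhs k / lam k)) + 2 * ((c0 k)\<^sup>2 / lam k))"
    by (intro summable_add summable_mult bound_rhs_summable)
  fix k :: nat
  have "(C k t)\<^sup>2 / lam k \<le> (2 * (C k t - c0 k)\<^sup>2 + 2 * (c0 k)\<^sup>2) / lam k"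
    using square_sum_le[of "C k t - c0 k" "c0 k"] by (intro divide_right_mono) auto
  then show "norm ((C k t)\<^sup>2 / lam k) \<le> 2 * (kap * (FD.bound_rhs k / lam k)) + 2 * ((c0 k)\<^sup>2 / lam k)"
    using C_dev_sq[OF t, of k] by (simp add: add_divide_distrib)
qed

lemma wrep_dual: "t \<in> {0..T} \<Longrightarrow> wrep t \<in> V_dual U"
  using series_dual[OF C_summable] unfolding wrep_def[abs_def] .

text \<open>The scalar Hoelder estimates divided by \<open>lam k\<close> and summed; the exponent al
  - 1/2 is the same for all k.\<close>

lemma wrep_diff:
  assumes s: "s \<in> {0..T}" and t: "t \<in> {0..T}"
  shows "norm_V_dual U (wrep s - wrep t) \<le> sqrt (2 * kern_sq_const al * kern (2 * al) \<bar>s - t\<bar> * (\<Sum>k. FD.bound_rhs k / lam k))"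
proof (rule norm_V_dual_le)
  let ?K = "2 * kern_sq_const al * kern (2 * al) \<bar>s - t\<bar>"
  have K: "?K \<ge> 0" using kern_sq_const_pos[OF alpha] kern_nonneg[of "2 * al" "\<bar>s - t\<bar>"] alpha by simp
  have S: "(\<Sum>k. FD.bound_rhs k / lam k) \<ge> 0" by (intro suminf_nonneg bound_rhs_summable) (simp add: FD.bound_rhs_nonneg)
  show "0 \<le> sqrt (?K * (\<Sum>k. FD.bound_rhs k / lam k))" using K S by simp
  fix \<eta> assume \<eta>: "\<eta> \<in> VV"
  have d: "summable (\<lambda>k. (C k s - C k t)\<^sup>2 / lam k)"
    by (rule summable_comparison_test'[OF summable_mult[OF bound_rhs_summable], of 0]) (use C_diff_sq[OF s t] in auto)
  have "(wrep s - wrep t) \<eta> = (\<Sum>k. ip \<eta> (ei k) * (C k s - C k t))"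
    using series_abs_summable(1)[OF C_summable[OF s] \<eta>] series_abs_summable(1)[OF C_summable[OF t] \<eta>]
    by (simp add: wrep_def suminf_diff right_diff_distrib)
  then have "\<bar>(wrep s - wrep t) \<eta>\<bar> \<le> sqrt (\<Sum>k. (C k s - C k t)\<^sup>2 / lam k) * norm_V U \<eta>"
    using series_abs_summable(2)[OF d \<eta>] by simp
  also have "(\<Sum>k. (C k s - C k t)\<^sup>2 / lam k) \<le> ?K * (\<Sum>k. FD.bound_rhs k / lam k)"
    unfolding suminf_mult[OF bound_rhs_summable, symmetric]
    by (intro suminf_le C_diff_sq s t d summable_mult bound_rhs_summable)
  finally show "\<bar>(wrep s - wrep t) \<eta>\<bar> \<le> sqrt (?K * (\<Sum>k. FD.bound_rhs k / lam k)) * norm_V U \<eta>"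
    using VA.nrm_nonneg[OF \<eta>] by (simp add: norm_V_eq mult_right_mono)
qed

lemma wrep_sums: "v \<in> HH \<Longrightarrow> \<eta> \<in> VV \<Longrightarrow> (\<And>k. ip v (ei k) = C k t * unit_sq k) \<Longrightarrow> wrep t \<eta> = ip v \<eta>"
proof -
  assume v: "v \<in> HH" and \<eta>: "\<eta> \<in> VV" and c: "\<And>k. ip v (ei k) = C k t * unit_sq k"
  have "ip v (ei k) * ip \<eta> (ei k) = ip \<eta> (ei k) * C k t" for k unfolding c by (rule et_unit'[OF \<eta>])
  then have "(\<lambda>k. ip \<eta> (ei k) * C k t) sums ip v \<eta>"
    using onH.parseval[OF v V_H[OF \<eta>] H_expansion[OF v]] by (simp only:)
  then show ?thesis unfolding wrep_def by (rule sums_unique[symmetric])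
qed

lemma sol_initial: "attains_initial_value U T sol u0" unfolding attains_initial_value_def
proof (intro exI[of _ wrep] conjI ballI)
  show "wrep t \<in> V_dual U" if "t \<in> {0..T}" for t using that by (rule wrep_dual)
  show "is_continuous_rep (norm_V_dual U) T wrep" unfolding is_continuous_rep_def
  proof
    fix t assume t: "t \<in> {0..T}"
    show "((\<lambda>s. norm_V_dual U (wrep s - wrep t)) \<longlongrightarrow> 0) (at t within {0..T})"
    proof (rule Lim_null_comparison)
      show "\<forall>\<^sub>F s in at t within {0..T}. norm (norm_V_dual U (wrep s - wrep t))
          \<le> sqrt (2 * kern_sq_const al * kern (2 * al) \<bar>s - t\<bar> * (\<Sum>k. FD.bound_rhs k / lam k))"
        unfolding eventually_at_filter
      proof (intro always_eventually allI impI)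
        fix s assume s: "s \<in> {0..T}"
        show "norm (norm_V_dual U (wrep s - wrep t)) \<le> sqrt (2 * kern_sq_const al * kern (2 * al) \<bar>s - t\<bar> * (\<Sum>k. FD.bound_rhs k / lam k))"
          using wrep_diff[OF s t] dual_nonneg[OF dual_diff[OF wrep_dual[OF s] wrep_dual[OF t]]] by simp
      qed
      have "((\<lambda>s. \<bar>s - t\<bar>) \<longlongrightarrow> \<bar>t - t\<bar>) (at t within {0..T})" by (intro tendsto_intros)
      then have "((\<lambda>s. kern (2 * al) \<bar>s - t\<bar>) \<longlongrightarrow> 0) (at t within {0..T})"
        using alpha by (intro kern_tendsto_0) auto
      then have "((\<lambda>s. sqrt (2 * kern_sq_const al * kern (2 * al) \<bar>s - t\<bar> * (\<Sum>k. FD.bound_rhs k / lam k)))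
          \<longlongrightarrow> sqrt (2 * kern_sq_const al * 0 * (\<Sum>k. FD.bound_rhs k / lam k))) (at t within {0..T})"
        by (intro tendsto_intros)
      then show "((\<lambda>s. sqrt (2 * kern_sq_const al * kern (2 * al) \<bar>s - t\<bar> * (\<Sum>k. FD.bound_rhs k / lam k))) \<longlongrightarrow> 0) (at t within {0..T})"
        by simp
    qed
  qed
  show "AE t in lebesgue_on {0..T}. \<forall>\<eta>\<in>VV. wrep t \<eta> = ip (sol t) \<eta>" unfolding AE_time using AE_good
    by eventually_elim (auto intro: wrep_sums sol_H sol_coeff)
  show "wrep 0 \<eta> = ip u0 \<eta>" if "\<eta> \<in> VV" for \<eta>
  proof (rule wrep_sums[OF u0 that])
    show "ip u0 (ei k) = C k 0 * unit_sq k" for k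
      unfolding FD.sol_0 unfolding c0_def by (rule onH.coeff_unit[OF u0, symmetric])
  qed
qed

lemma sol_weak_solution: "weak_solution U T \<nu> al f u0 sol" unfolding weak_solution_def
  using sol_Lp_weighted sol_Lp_V sol_Linfty sol_equation sol_initial by blast

end

section \<open>Uniqueness of weak solutions\<close>

context stokes_data
begin

lemma solution_V:
  assumes "weak_solution U T \<nu> al f u0 w"
  shows "AE t\<in>{0..T} in lborel. w t \<in> VV" "bochner_measurable VV (norm_V U) T w"
    "(\<integral>\<^sup>+t. ennreal (norm_V U (w t) powr 2) * indicator {0..T} t \<partial>lborel) < \<infinity>"
  using assms unfolding weak_solution_def Lp_bochner_def bochner_measurable_def
  by (simp_all add: AE_time nn_integral_lebesgue_on)

text \<open>Norm and coefficient are Lipschitz functionals on V and hence have Borel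
  representatives; the coefficient is dominated by a multiple of the norm, which is square
  integrable on a bounded interval.\<close>

lemma solution_coeff_rep:
  assumes w: "weak_solution U T \<nu> al f u0 w"
  shows "\<exists>g. borel_rep T (\<lambda>t. ip (w t - u0) (ei k)) g \<and> integrable lborel g"
proof -
  let ?F = "ip (ei k)"
  have F: "?F \<in> V_dual U" by (rule inner_L2_dual[OF ei_H])
  note wV = solution_V(1)[OF w]
  have "\<bar>norm_V U p - norm_V U q\<bar> \<le> 1 * norm_V U (p - q)" if "p \<in> VV" "q \<in> VV" for p q
    using VA.nrm_diff_abs[OF that] by (simp add: norm_V_eq)
  from lipschitz_functional_rep[where G = "norm_V U" and K = 1, OF solution_V(2)[OF w] this] obtain n where n: "borel_rep T (\<lambda>t. norm_V U (w t)) n" by blast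
  have "\<bar>?F p - ?F q\<bar> \<le> norm_V_dual U ?F * norm_V U (p - q)" if "p \<in> VV" "q \<in> VV" for p q
    using dual_le[OF F VA.mem_diff[OF that]] unfolding dual_sub[OF F that] .
  from lipschitz_functional_rep[where G = ?F and K = "norm_V_dual U ?F", OF solution_V(2)[OF w] this] obtain p where p: "borel_rep T (\<lambda>t. ?F (w t)) p" by blast
  note [measurable] = borel_repD(1)[OF n] borel_repD(1)[OF p]
  have "(\<integral>\<^sup>+t. ennreal ((n t)\<^sup>2) \<partial>lborel) < \<infinity>"
  proof -
    have "(\<integral>\<^sup>+t. ennreal ((n t)\<^sup>2) \<partial>lborel) = (\<integral>\<^sup>+t. ennreal (norm_V U (w t) powr 2) * indicator {0..T} t \<partial>lborel)"
    proof (rule nn_integral_cong_AE, use borel_repD(3)[OF n] wV in eventually_elim)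
      fix t assume e: "t \<in> {0..T} \<longrightarrow> norm_V U (w t) = n t" "t \<in> {0..T} \<longrightarrow> w t \<in> VV"
      show "ennreal ((n t)\<^sup>2) = ennreal (norm_V U (w t) powr 2) * indicator {0..T} t"
      proof (cases "t \<in> {0..T}")
        case True
        then have nt: "n t = norm_V U (w t)" and wt: "w t \<in> VV" using e by simp_all
        have "0 \<le> norm_V U (w t)" unfolding norm_V_eq by (rule VA.nrm_nonneg[OF wt])
        then show ?thesis using True nt by simp
      qed (use borel_repD(2)[OF n, of t] in auto)
    qed
    then show ?thesis using solution_V(3)[OF w] by simp
  qed
  from nn_abs_finite_of_sq[OF borel_repD(1,2)[OF n] this] have ni: "integrable lborel n"
    by (intro integrableI_bounded) auto
  have pi: "integrable lborel p"
  proof (rule Bochner_Integration.integrable_bound)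
    show "integrable lborel (\<lambda>t. norm_V_dual U ?F * n t)" using ni by simp
    show "AE t in lborel. norm (p t) \<le> norm (norm_V_dual U ?F * n t)"
      using wV borel_repD(3)[OF n] borel_repD(3)[OF p]
    proof eventually_elim
      fix t assume a: "t \<in> {0..T} \<longrightarrow> w t \<in> VV" "t \<in> {0..T} \<longrightarrow> norm_V U (w t) = n t" "t \<in> {0..T} \<longrightarrow> ?F (w t) = p t"
      show "norm (p t) \<le> norm (norm_V_dual U ?F * n t)"
      proof (cases "t \<in> {0..T}")
        case True
        then have wt: "w t \<in> VV" and nt: "norm_V U (w t) = n t" and pt: "?F (w t) = p t" using a by blast+
        show ?thesis using dual_le[OF F wt] unfolding nt pt real_norm_def by (rule order_trans[OF _ abs_ge_self])
      qed (use borel_repD(2)[OF p, of t] in auto)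
    qed
  qed measurable
  let ?g = "\<lambda>t. p t - c0 k * indicator {0<..T} t"
  have "borel_rep T (\<lambda>t. ip (w t - u0) (ei k)) ?g" unfolding borel_rep_def
  proof (intro conjI allI impI)
    show "AE t\<in>{0..T} in lborel. ip (w t - u0) (ei k) = ?g t"
      using wV borel_repD(3)[OF p] AE_lborel_singleton[of 0]
      by eventually_elim (auto simp: HB.diff_left V_H u0 ei_H c0_def HB.sym[of _ "ei k"])
  qed (auto simp: borel_repD(2)[OF p])
  moreover have "integrable lborel ?g"
    using pi T by (intro Bochner_Integration.integrable_diff integrable_mult_right integrable_real_indicator) auto
  ultimately show ?thesis by blast
qed

text \<open>Testing with an eigenfunction turns the V product into \<open>lam k\<close> times the L2
  product, so the equation for this coefficient is closed. The function \<open>q\<close> is the weak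
  derivative that the equation dictates.\<close>

lemma solution_coeff_equation:
  assumes w: "weak_solution U T \<nu> al f u0 w" and g: "borel_rep T (\<lambda>t. ip (w t - u0) (ei k)) g"
  defines "q \<equiv> \<lambda>t. indicator {0<..T} t * (Fm k t - \<nu> * lam k * (g t + c0 k))"
  shows "integrable lborel q"
    and "\<phi> \<in> test_functions {0<..<T} \<Longrightarrow>
      (LINT t|lborel. (indicator {0<..T} t * conv (kern (1 - al)) g t) * deriv \<phi> t) = - (LINT t|lborel. q t * \<phi> t)"
proof -
  let ?v = "\<lambda>t. ip (w t - u0) (ei k)"
  let ?R = "RL_integral (1 - al) ?v"
  note wV = solution_V(1)[OF w]
  have W: "?R \<in> W11 T" and eq: "AE t\<in>{0..T} in lborel. weak_deriv T ?R t + \<nu> * inner_V U (w t) (ei k) = f t (ei k)"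
    using w SP.eig_mem[of k] unfolding weak_solution_def RL_deriv_def by (auto simp: AE_time)
  have d: "integrable (lebesgue_on {0..T}) (weak_deriv T ?R)" "is_weak_deriv T ?R (weak_deriv T ?R)"
    using W someI_ex[of "\<lambda>g. integrable (lebesgue_on {0..T}) g \<and> is_weak_deriv T ?R g"] unfolding W11_def weak_deriv_def by auto
  note [measurable] = borel_repD(1)[OF g]
  have rq: "borel_rep T (weak_deriv T ?R) q" unfolding borel_rep_def
  proof (intro conjI allI impI)
    show "q \<in> borel_measurable borel" unfolding q_def by measurable
    show "AE t\<in>{0..T} in lborel. weak_deriv T ?R t = q t"
      using eq wV Fm_eq borel_repD(3)[OF g] AE_lborel_singleton[of 0]
    proof (eventually_elim, intro impI)
      fix t assume t: "t \<in> {0..T}" "t \<noteq> 0" and h: "t \<in> {0..T} \<longrightarrow> weak_deriv T ?R t + \<nu> * inner_V U (w t) (ei k) = f t (ei k)"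
        "t \<in> {0..T} \<longrightarrow> w t \<in> VV" "t \<in> {0..T} \<longrightarrow> (\<forall>k. Fm k t = f t (ei k))" "t \<in> {0..T} \<longrightarrow> ?v t = g t"
      then have wt: "w t \<in> VV" and vt: "?v t = g t" by blast+
      have "inner_V U (w t) (ei k) = lam k * ip (w t) (ei k)"
        using SP.eig_eq[OF wt, of k] VA.sym[OF wt SP.eig_mem] VB.sym[OF wt SP.eig_mem] by simp
      also have "ip (w t) (ei k) = g t + c0 k" using vt by (simp add: HB.diff_left V_H[OF wt] u0 ei_H c0_def)
      finally show "weak_deriv T ?R t = q t" using t h by (simp add: q_def algebra_simps)
    qed
  qed (simp add: q_def)
  have rR: "borel_rep T ?R (\<lambda>t. indicator {0<..T} t * conv (kern (1 - al)) g t)" unfolding borel_rep_def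
  proof (intro conjI allI impI)
    have "?R t = indicator {0<..T} t * conv (kern (1 - al)) g t" if "t \<in> {0..T}" "t \<noteq> 0" for t
      using that borel_rep_RL_integral[OF g, of t "1 - al"] by simp
    then show "AE t\<in>{0..T} in lborel. ?R t = indicator {0<..T} t * conv (kern (1 - al)) g t"
      using AE_lborel_singleton[of 0] by (auto elim!: eventually_mono)
  qed auto
  show "integrable lborel q" by (rule borel_rep_integrable[OF rq, THEN iffD1, OF d(1)])
  show "(LINT t|lborel. (indicator {0<..T} t * conv (kern (1 - al)) g t) * deriv \<phi> t) = - (LINT t|lborel. q t * \<phi> t)"
    if "\<phi> \<in> test_functions {0<..<T}" using d(2) that unfolding is_weak_deriv_iff[OF rR rq] by blast
qed

text \<open>The representative that is continuous in V' is evaluated at the eigenfunction, and its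
  value at 0 is subtracted.\<close>

lemma solution_coeff_initial:
  assumes w: "weak_solution U T \<nu> al f u0 w"
  shows "\<exists>\<zeta>. (AE t\<in>{0..T} in lborel. ip (w t - u0) (ei k) = \<zeta> t) \<and> (\<zeta> \<longlongrightarrow> 0) (at 0 within {0..T})"
proof -
  obtain W where W: "\<And>t. t \<in> {0..T} \<Longrightarrow> W t \<in> V_dual U" "is_continuous_rep (norm_V_dual U) T W"
    "AE t\<in>{0..T} in lborel. (\<forall>\<eta>\<in>VV. W t \<eta> = ip (w t) \<eta>)" "\<And>\<eta>. \<eta> \<in> VV \<Longrightarrow> W 0 \<eta> = ip u0 \<eta>"
    using w unfolding weak_solution_def attains_initial_value_def AE_time by blast
  note wV = solution_V(1)[OF w]
  have z: "0 \<in> {0..T}" using T by simp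
  have "((\<lambda>t. W t (ei k) - W 0 (ei k)) \<longlongrightarrow> 0) (at 0 within {0..T})"
  proof (rule Lim_null_comparison)
    show "((\<lambda>t. norm_V_dual U (W t - W 0) * norm_V U (ei k)) \<longlongrightarrow> 0) (at 0 within {0..T})"
      using W(2) z unfolding is_continuous_rep_def by (intro tendsto_mult_left_zero) auto
    show "\<forall>\<^sub>F t in at 0 within {0..T}. norm (W t (ei k) - W 0 (ei k)) \<le> norm_V_dual U (W t - W 0) * norm_V U (ei k)"
      unfolding eventually_at_filter
    proof (intro always_eventually allI impI)
      fix t assume "t \<in> {0..T}"
      from dual_le[OF dual_diff[OF W(1)[OF this] W(1)[OF z]] SP.eig_mem[of k]]
      show "norm (W t (ei k) - W 0 (ei k)) \<le> norm_V_dual U (W t - W 0) * norm_V U (ei k)" by simp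
    qed
  qed
  moreover have "AE t\<in>{0..T} in lborel. ip (w t - u0) (ei k) = W t (ei k) - W 0 (ei k)"
    using W(3) wV by eventually_elim (auto simp: HB.diff_left V_H u0 ei_H W(4)[OF SP.eig_mem] SP.eig_mem)
  ultimately show ?thesis by (intro exI conjI)
qed

text \<open>The forcing cancels in the difference of the two coefficient equations, which leaves the
  homogeneous equation of \<open>fractional_uniqueness\<close> with \<mu> = \<nu> *
  \<open>lam k\<close>.\<close>

lemma solution_coeff_unique:
  assumes v: "weak_solution U T \<nu> al f u0 v" and w: "weak_solution U T \<nu> al f u0 w"
  shows "AE t\<in>{0..T} in lborel. ip (v t - u0) (ei k) = ip (w t - u0) (ei k)"
proof -
  obtain g where g: "borel_rep T (\<lambda>t. ip (v t - u0) (ei k)) g" "integrable lborel g"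
    using solution_coeff_rep[OF v] by blast
  obtain h where h: "borel_rep T (\<lambda>t. ip (w t - u0) (ei k)) h" "integrable lborel h"
    using solution_coeff_rep[OF w] by blast
  obtain \<zeta> where \<zeta>: "AE t\<in>{0..T} in lborel. ip (v t - u0) (ei k) = \<zeta> t" "(\<zeta> \<longlongrightarrow> 0) (at 0 within {0..T})"
    using solution_coeff_initial[OF v] by blast
  obtain \<xi> where \<xi>: "AE t\<in>{0..T} in lborel. ip (w t - u0) (ei k) = \<xi> t" "(\<xi> \<longlongrightarrow> 0) (at 0 within {0..T})"
    using solution_coeff_initial[OF w] by blast
  note [measurable] = borel_repD(1)[OF g(1)] borel_repD(1)[OF h(1)]
  note g0 = borel_repD(2)[OF g(1)] and h0 = borel_repD(2)[OF h(1)]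
  note gi = g(2) and hi = h(2)
  let ?z = "\<lambda>t. g t - h t"
  have a0: "1 - al > 0" using alpha by simp
  have "AE t in lborel. ?z t = 0"
  proof (rule FD.fractional_uniqueness[where k = k and T = T and \<zeta> = "\<lambda>t. \<zeta> t - \<xi> t"])
    show "AE t\<in>{0..T} in lborel. g t - h t = \<zeta> t - \<xi> t"
      using \<zeta>(1) \<xi>(1) borel_repD(3)[OF g(1)] borel_repD(3)[OF h(1)] by eventually_elim auto
    show "((\<lambda>t. \<zeta> t - \<xi> t) \<longlongrightarrow> 0) (at 0 within {0..T})" using tendsto_diff[OF \<zeta>(2) \<xi>(2)] by simp
    fix \<phi> :: "real \<Rightarrow> real" assume \<phi>: "\<phi> \<in> test_functions {0<..<T}"
    let ?J = "\<lambda>g t. (indicator {0<..T} t * conv (kern (1 - al)) g t) * deriv \<phi> t"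
    let ?q = "\<lambda>g t. indicator {0<..T} t * (Fm k t - \<nu> * lam k * (g t + c0 k))"
    \<comment> \<open>The convolution of the difference splits only where both convolutions converge
      absolutely. The order 1 - al is less than 1, so this is available almost everywhere, which
      suffices under the integral.\<close>
    have fin: "AE t\<in>{0<..T} in lborel. nconv (nkern (1 - al)) (nabs p) t < \<infinity>"
      if [measurable]: "p \<in> borel_measurable borel" and "\<And>t. t \<notin> {0<..T} \<Longrightarrow> p t = 0" "integrable lborel p" for p
    proof -
      have "AE t in lborel. indicator {0<..T} t * nconv (nkern (1 - al)) (nabs p) t \<noteq> \<infinity>"
      proof (rule nn_integral_PInf_AE)
        show "(\<integral>\<^sup>+t. indicator {0<..T} t * nconv (nkern (1 - al)) (nabs p) t \<partial>lborel) \<noteq> \<infinity>"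
          using indicator_nconv_finite[OF a0 that(1) _ that(3), of T] that(2) by (simp add: less_top)
      qed measurable
      then show ?thesis by eventually_elim (auto simp: less_top)
    qed
    note [measurable] = test_function_measurable[OF \<phi>]
    have fin_g: "AE t\<in>{0<..T} in lborel. nconv (nkern (1 - al)) (nabs g) t < \<infinity>"
      and fin_h: "AE t\<in>{0<..T} in lborel. nconv (nkern (1 - al)) (nabs h) t < \<infinity>"
      by (rule fin; use g0 h0 gi hi in simp)+
    have "(LINT t|lborel. ?J ?z t) = (LINT t|lborel. ?J g t - ?J h t)"
    proof (rule integral_cong_AE)
      show "AE t in lborel. ?J ?z t = ?J g t - ?J h t" using fin_g fin_h
      proof eventually_elim
        fix t assume "t \<in> {0<..T} \<longrightarrow> nconv (nkern (1 - al)) (nabs g) t < \<infinity>"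
          "t \<in> {0<..T} \<longrightarrow> nconv (nkern (1 - al)) (nabs h) t < \<infinity>"
        then show "?J ?z t = ?J g t - ?J h t"
          using conv_add_scale[of "kern (1 - al)" g h t "-1"] a0 by (auto simp: indicator_def kern_nonneg left_diff_distrib)
      qed
    qed measurable
    also have "... = (LINT t|lborel. ?J g t) - (LINT t|lborel. ?J h t)"
      by (intro Bochner_Integration.integral_diff indicator_conv_deriv_integrable a0 gi hi \<phi>) (auto simp: g0 h0)
    also have "... = (LINT t|lborel. ?q h t * \<phi> t) - (LINT t|lborel. ?q g t * \<phi> t)"
      unfolding solution_coeff_equation(2)[OF v g(1) \<phi>] solution_coeff_equation(2)[OF w h(1) \<phi>] by simp
    also have "... = (LINT t|lborel. ?q h t * \<phi> t - ?q g t * \<phi> t)"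
      by (intro Bochner_Integration.integral_diff[symmetric] test_function_times_integrable[OF _ \<phi>]
          solution_coeff_equation(1)[OF v g(1)] solution_coeff_equation(1)[OF w h(1)])
    also have "(\<lambda>t. ?q h t * \<phi> t - ?q g t * \<phi> t) = (\<lambda>t. \<nu> * lam k * (?z t * \<phi> t))"
    proof
      fix t show "?q h t * \<phi> t - ?q g t * \<phi> t = \<nu> * lam k * (?z t * \<phi> t)"
        using g0[of t] h0[of t] by (cases "t \<in> {0<..T}") (simp_all add: algebra_simps)
    qed
    finally show "(LINT t|lborel. ?J ?z t) = \<nu> * lam k * (LINT t|lborel. ?z t * \<phi> t)" by simp
  qed (use T gi hi g0 h0 in auto)
  then show ?thesis using borel_repD(3)[OF g(1)] borel_repD(3)[OF h(1)] by eventually_elim auto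
qed

text \<open>The countably many exceptional sets are merged into one; outside of it the difference
  has only zero coefficients, and Parseval in H makes it vanish almost everywhere.\<close>

lemma solution_unique:
  assumes v: "weak_solution U T \<nu> al f u0 v" and w: "weak_solution U T \<nu> al f u0 w"
  shows "AE t in lebesgue_on {0..T}. AE x in lebesgue_on U. w t x = v t x" unfolding AE_time
proof -
  have "AE t in lborel. \<forall>k. t \<in> {0..T} \<longrightarrow> ip (v t - u0) (ei k) = ip (w t - u0) (ei k)"
    unfolding AE_all_countable using solution_coeff_unique[OF v w] by blast
  then show "AE t\<in>{0..T} in lborel. (AE x in lebesgue_on U. w t x = v t x)"
    using solution_V(1)[OF v] solution_V(1)[OF w]
  proof (eventually_elim, intro impI)
    fix t assume e: "\<forall>k. t \<in> {0..T} \<longrightarrow> ip (v t - u0) (ei k) = ip (w t - u0) (ei k)"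
      and "t \<in> {0..T} \<longrightarrow> v t \<in> VV" "t \<in> {0..T} \<longrightarrow> w t \<in> VV" and t: "t \<in> {0..T}"
    then have vt: "v t \<in> HH" and wt: "w t \<in> HH" using V_H by blast+
    let ?d = "w t - v t"
    have d: "?d \<in> HH" by (rule HB.mem_diff[OF wt vt])
    have "ip ?d (ei k) = 0" for k
    proof -
      have "ip (v t - u0) (ei k) = ip (w t - u0) (ei k)" using e t by blast
      then show ?thesis by (simp add: HB.diff_left vt wt u0 ei_H)
    qed
    then have "(\<lambda>k. 0) sums ip ?d ?d" using onH.parseval[OF d d H_expansion[OF d]] by simp
    then have "ip ?d ?d = 0" using sums_unique[of "\<lambda>k. 0::real"] by simp
    then show "AE x in lebesgue_on U. w t x = v t x"
      using L2_zero_imp_AE[OF H_L2[OF d]] by (simp add: fun_diff_def)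
  qed
qed

end

theorem mainTheorem1:
  fixes \<Omega> :: "(real^'n::finite) set" and T \<nu> \<alpha> :: real
    and f :: "real \<Rightarrow> (real^'n \<Rightarrow> real^'n) \<Rightarrow> real" and u0 :: "real^'n \<Rightarrow> real^'n"
  assumes "CARD('n) \<ge> 2"
    and "bounded_lipschitz_domain \<Omega>"
    and "T > 0" and "\<nu> > 0" and "1 / 2 < \<alpha>" and "\<alpha> < 1"
    and "f \<in> Lp_bochner 2 (V_dual \<Omega>) (norm_V_dual \<Omega>) T"
    and "u0 \<in> H_space \<Omega>"
  shows "\<exists>u. weak_solution \<Omega> T \<nu> \<alpha> f u0 u \<and>
    (\<forall>w. weak_solution \<Omega> T \<nu> \<alpha> f u0 w \<longrightarrow>
       (AE t in lebesgue_on {0..T}. AE x in lebesgue_on \<Omega>. w t x = u t x))"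
proof -
  interpret stokes_data \<Omega> T \<nu> \<alpha> f u0
    using assms by unfold_locales (auto simp: bounded_lipschitz_domain_def)
  show ?thesis
    using sol_weak_solution solution_unique by blast
qed

end
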